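(* Let $k$ be a field, and let $R$ be one of the following rings: (i) $R=k[X_1,\ldots,X_d]/(X_1,\ldots,X_d)^2$ with $d>1$; (ii) $R=k[X_1,X_2]/(X_1,X_2)^n$ with $n>1$ (in this case put $d=2$). Let $M$ be a finitely generated nonfree $R$-module. Then $\beta_{i+1}(M)-\beta_i(M)\geq d-1$ for all $i\geq 1$. In particular, $\beta_{i+1}(\omega_R)-\beta_i(\omega_R)\geq d-1$ for all $i\geq 0$.
   Context: $R$ is an artinian local ring with residue field $k$, $\omega_R$ is its canonical module, and $\beta_i(M)=\dim_k\operatorname{Tor}_i^R(k,M)$ is the $i$-th Betti number of $M$ over $R$. *)

theory Defs
  imports
    "HOL-Algebra.Ideal_Product"
    "HOL-Algebra.QuotRing"
    "HOL-Library.Poly_Mapping"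
    "Jordan_Normal_Form.Missing_VectorSpace"
begin

section \<open>Truncated polynomial rings\<close>

text \<open>
  \<open>mpoly_ring d\<close> is the polynomial ring over the field \<open>'k\<close> in the variables
  \<open>mpoly_var 0, \<dots>, mpoly_var (d - 1)\<close>: a polynomial is a finitely supported map from
  exponent vectors to coefficients.
\<close>

definition mpoly_ring :: "nat \<Rightarrow> ((nat \<Rightarrow>\<^sub>0 nat) \<Rightarrow>\<^sub>0 'k::field) ring" where
  "mpoly_ring d =
     \<lparr>carrier = {p. \<forall>m\<in>Poly_Mapping.keys p. Poly_Mapping.keys m \<subseteq> {..<d}},
      monoid.mult = (*), one = 1, ring.zero = 0, add = (+)\<rparr>"

definition mpoly_var :: "nat \<Rightarrow> ((nat \<Rightarrow>\<^sub>0 nat) \<Rightarrow>\<^sub>0 'k::field)" where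
  "mpoly_var i = Poly_Mapping.single (Poly_Mapping.single i 1) 1"

definition ideal_power :: "('a, 'b) ring_scheme \<Rightarrow> 'a set \<Rightarrow> nat \<Rightarrow> 'a set" where
  "ideal_power R I n = (ideal_prod R I ^^ n) (carrier R)"

text \<open>The ring \<open>k[X\<^sub>1, \<dots>, X\<^sub>d] / (X\<^sub>1, \<dots>, X\<^sub>d)\<^sup>n\<close>.\<close>

definition trunc_poly_ring :: "nat \<Rightarrow> nat \<Rightarrow> (((nat \<Rightarrow>\<^sub>0 nat) \<Rightarrow>\<^sub>0 'k::field) set) ring" where
  "trunc_poly_ring d n =
     mpoly_ring d Quot
       ideal_power (mpoly_ring d) (genideal (mpoly_ring d) (mpoly_var ` {..<d})) n"


section \<open>Modules\<close>

text \<open>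
  The record type of modules extends that of rings; the fields \<open>mult\<close> and \<open>one\<close> play no
  role for modules and are filled in arbitrarily.
\<close>

definition regular_module :: "'r ring \<Rightarrow> ('r, 'r) module" where
  "regular_module R =
     \<lparr>carrier = carrier R, monoid.mult = monoid.mult R, one = one R,
      ring.zero = ring.zero R, add = add R, smult = monoid.mult R\<rparr>"

definition quotient_module :: "('r, 'm) module \<Rightarrow> 'm set \<Rightarrow> ('r, 'm set) module" where
  "quotient_module M N =
     \<lparr>carrier = a_rcosets\<^bsub>M\<^esub> N, monoid.mult = undefined, one = undefined,
      ring.zero = N, add = set_add M,
      smult = (\<lambda>r X. \<Union>x\<in>X. N +>\<^bsub>M\<^esub> (r \<odot>\<^bsub>M\<^esub> x))\<rparr>"

text \<open>The free module on the set \<open>S\<close>: finitely supported functions from \<open>S\<close> to \<open>R\<close>.\<close>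

definition free_module_on :: "'r ring \<Rightarrow> 's set \<Rightarrow> ('r, 's \<Rightarrow> 'r) module" where
  "free_module_on R S =
     \<lparr>carrier = {f. (\<forall>s\<in>S. f s \<in> carrier R) \<and> (\<forall>s. s \<notin> S \<longrightarrow> f s = \<zero>\<^bsub>R\<^esub>)
                  \<and> finite {s. f s \<noteq> \<zero>\<^bsub>R\<^esub>}},
      monoid.mult = undefined, one = undefined,
      ring.zero = (\<lambda>s. \<zero>\<^bsub>R\<^esub>), add = (\<lambda>f g s. f s \<oplus>\<^bsub>R\<^esub> g s),
      smult = (\<lambda>r f s. r \<otimes>\<^bsub>R\<^esub> f s)\<rparr>"

definition free_gen :: "'r ring \<Rightarrow> 's \<Rightarrow> 's \<Rightarrow> 'r" where
  "free_gen R s = (\<lambda>t. if t = s then \<one>\<^bsub>R\<^esub> else \<zero>\<^bsub>R\<^esub>)"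

definition finitely_generated :: "'r ring \<Rightarrow> ('r, 'm) module \<Rightarrow> bool" where
  "finitely_generated R M \<longleftrightarrow>
     (\<exists>S. finite S \<and> S \<subseteq> carrier M \<and> module.span R M S = carrier M)"

definition free_module :: "'r ring \<Rightarrow> ('r, 'm) module \<Rightarrow> bool" where
  "free_module R M \<longleftrightarrow> module R M \<and>
     (\<exists>B \<subseteq> carrier M. \<not> module.lin_dep R M B \<and> module.span R M B = carrier M)"


section \<open>Tensor products\<close>

definition tensor_rels ::
    "'r ring \<Rightarrow> ('r, 'a) module \<Rightarrow> ('r, 'b) module \<Rightarrow> ('a \<times> 'b \<Rightarrow> 'r) set" where
  "tensor_rels R A B =
     (let F = free_module_on R (carrier A \<times> carrier B); e = (\<lambda>a b. free_gen R (a, b)) in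
        {e (a \<oplus>\<^bsub>A\<^esub> a') b \<ominus>\<^bsub>F\<^esub> (e a b \<oplus>\<^bsub>F\<^esub> e a' b) | a a' b.
           a \<in> carrier A \<and> a' \<in> carrier A \<and> b \<in> carrier B}
      \<union> {e a (b \<oplus>\<^bsub>B\<^esub> b') \<ominus>\<^bsub>F\<^esub> (e a b \<oplus>\<^bsub>F\<^esub> e a b') | a b b'.
           a \<in> carrier A \<and> b \<in> carrier B \<and> b' \<in> carrier B}
      \<union> {e (r \<odot>\<^bsub>A\<^esub> a) b \<ominus>\<^bsub>F\<^esub> (r \<odot>\<^bsub>F\<^esub> e a b) | r a b.
           r \<in> carrier R \<and> a \<in> carrier A \<and> b \<in> carrier B}
      \<union> {e a (r \<odot>\<^bsub>B\<^esub> b) \<ominus>\<^bsub>F\<^esub> (r \<odot>\<^bsub>F\<^esub> e a b) | r a b.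
           r \<in> carrier R \<and> a \<in> carrier A \<and> b \<in> carrier B})"

definition tensor_null ::
    "'r ring \<Rightarrow> ('r, 'a) module \<Rightarrow> ('r, 'b) module \<Rightarrow> ('a \<times> 'b \<Rightarrow> 'r) set" where
  "tensor_null R A B =
     module.span R (free_module_on R (carrier A \<times> carrier B)) (tensor_rels R A B)"

definition tensor_module ::
    "'r ring \<Rightarrow> ('r, 'a) module \<Rightarrow> ('r, 'b) module \<Rightarrow> ('r, ('a \<times> 'b \<Rightarrow> 'r) set) module" where
  "tensor_module R A B =
     quotient_module (free_module_on R (carrier A \<times> carrier B)) (tensor_null R A B)"

definition pure_tensor ::
    "'r ring \<Rightarrow> ('r, 'a) module \<Rightarrow> ('r, 'b) module \<Rightarrow> 'a \<Rightarrow> 'b \<Rightarrow> ('a \<times> 'b \<Rightarrow> 'r) set" where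
  "pure_tensor R A B a b =
     tensor_null R A B +>\<^bsub>free_module_on R (carrier A \<times> carrier B)\<^esub> free_gen R (a, b)"

text \<open>
  The map \<open>id\<^sub>A \<otimes> f\<close> for a homomorphism \<open>f\<close> from \<open>B\<close> to \<open>C\<close>; on the carrier of
  \<open>A \<otimes> B\<close> the choice is unique.
\<close>

definition tensor_map ::
    "'r ring \<Rightarrow> ('r, 'a) module \<Rightarrow> ('r, 'b) module \<Rightarrow> ('r, 'c) module \<Rightarrow> ('b \<Rightarrow> 'c)
      \<Rightarrow> ('a \<times> 'b \<Rightarrow> 'r) set \<Rightarrow> ('a \<times> 'c \<Rightarrow> 'r) set" where
  "tensor_map R A B C f =
     (SOME h. h \<in> module_hom R (tensor_module R A B) (tensor_module R A C) \<and>
        (\<forall>a\<in>carrier A. \<forall>b\<in>carrier B. h (pure_tensor R A B a b) = pure_tensor R A C a (f b)))"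


section \<open>Free resolutions and Tor\<close>

text \<open>
  Exactness of \<open>\<dots> \<rightarrow> F 2 \<rightarrow> F 1 \<rightarrow> F 0 \<rightarrow> M \<rightarrow> 0\<close>, where \<open>\<delta> i\<close> maps \<open>F (i + 1)\<close>
  to \<open>F i\<close> and \<open>\<epsilon>\<close> maps \<open>F 0\<close> to \<open>M\<close>.
\<close>

definition free_resolution ::
    "'r ring \<Rightarrow> ('r, 'm) module \<Rightarrow> (nat \<Rightarrow> ('r, 'f) module) \<Rightarrow> (nat \<Rightarrow> 'f \<Rightarrow> 'f) \<Rightarrow> ('f \<Rightarrow> 'm) \<Rightarrow> bool"
  where
  "free_resolution R M F \<delta> \<epsilon> \<longleftrightarrow>
     (\<forall>i. free_module R (F i)) \<and>
     (\<forall>i. \<delta> i \<in> module_hom R (F (Suc i)) (F i)) \<and>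
     \<epsilon> \<in> module_hom R (F 0) M \<and>
     \<epsilon> ` carrier (F 0) = carrier M \<and>
     \<delta> 0 ` carrier (F 1) = a_kernel (F 0) M \<epsilon> \<and>
     (\<forall>i. \<delta> (Suc i) ` carrier (F (Suc (Suc i))) = a_kernel (F (Suc i)) (F i) (\<delta> i))"

text \<open>
  HOL forces the terms of a resolution to be carried by a fixed type. The type
  \<open>nat \<Rightarrow> 'r\<close> contains a copy of \<open>R\<^sup>b\<close> for every \<open>b\<close>, so every finitely generated module over
  a Noetherian ring \<open>R\<close> has a resolution of this form. Up to isomorphism Tor does not depend
  on the one that is chosen.
\<close>

definition some_resolution ::
    "'r ring \<Rightarrow> ('r, 'm) module \<Rightarrow> (nat \<Rightarrow> ('r, nat \<Rightarrow> 'r) module) \<times> (nat \<Rightarrow> (nat \<Rightarrow> 'r) \<Rightarrow> nat \<Rightarrow> 'r)"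
  where
  "some_resolution R M = (SOME (F, \<delta>). \<exists>\<epsilon>. free_resolution R M F \<delta> \<epsilon>)"

text \<open>
  \<open>homology V W D g\<close> is \<open>ker g / D\<close>, for \<open>g\<close> from \<open>V\<close> to \<open>W\<close> and \<open>D\<close> the image of the
  preceding differential.
\<close>

definition homology ::
    "('r, 'v) module \<Rightarrow> ('r, 'w) module \<Rightarrow> 'v set \<Rightarrow> ('v \<Rightarrow> 'w) \<Rightarrow> ('r, 'v set) module" where
  "homology V W D g = quotient_module (V\<lparr>carrier := a_kernel V W g\<rparr>) D"

text \<open>
  \<open>Tor R A M i\<close> is the homology in degree \<open>i\<close> of \<open>A \<otimes> F\<close>, where \<open>F\<close> is a free resolution of
  \<open>M\<close>; in degree \<open>0\<close> the complex ends with \<open>A \<otimes> F 0 \<rightarrow> 0\<close>.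
\<close>

definition Tor ::
    "'r ring \<Rightarrow> ('r, 'a) module \<Rightarrow> ('r, 'm) module \<Rightarrow> nat
      \<Rightarrow> ('r, ('a \<times> (nat \<Rightarrow> 'r) \<Rightarrow> 'r) set set) module" where
  "Tor R A M i =
     (let (F, \<delta>) = some_resolution R M;
          C = (\<lambda>j. tensor_module R A (F j));
          \<Delta> = (\<lambda>j. tensor_map R A (F (Suc j)) (F j) (\<delta> j));
          D = \<Delta> i ` carrier (C (Suc i))
      in case i of
           0 \<Rightarrow> quotient_module (C 0) D
         | Suc j \<Rightarrow> homology (C (Suc j)) (C j) D (\<Delta> j))"


section \<open>Betti numbers over a local ring\<close>

definition max_ideal :: "'r ring \<Rightarrow> 'r set" where
  "max_ideal R = (THE \<mm>. maximalideal \<mm> R)"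

definition residue_field :: "'r ring \<Rightarrow> 'r set ring" where
  "residue_field R = R Quot max_ideal R"

definition residue_module :: "'r ring \<Rightarrow> ('r, 'r set) module" where
  "residue_module R = quotient_module (regular_module R) (max_ideal R)"

text \<open>
  An \<open>R\<close>-module annihilated by the maximal ideal, viewed as a vector space over the residue
  field: a coset acts through any of its representatives.
\<close>

definition residue_space :: "('r, 'v) module \<Rightarrow> ('r set, 'v) module" where
  "residue_space V =
     \<lparr>carrier = carrier V, monoid.mult = monoid.mult V, one = one V,
      ring.zero = ring.zero V, add = add V,
      smult = (\<lambda>c v. (SOME a. a \<in> c) \<odot>\<^bsub>V\<^esub> v)\<rparr>"

definition betti :: "'r ring \<Rightarrow> ('r, 'm) module \<Rightarrow> nat \<Rightarrow> nat" where
  "betti R M i =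
     vectorspace.dim (residue_field R) (residue_space (Tor R (residue_module R) M i))"


section \<open>The canonical module of an artinian local ring\<close>

text \<open>
  Injectivity, with the test modules \<open>A\<close> and \<open>B\<close> carried by the type of elements of \<open>R\<close>.
  Since this includes all inclusions of ideals into \<open>R\<close>, Baer's criterion shows that the
  restriction to this type loses nothing.
\<close>

definition injective_module :: "'r ring \<Rightarrow> ('r, 'w) module \<Rightarrow> bool" where
  "injective_module R W \<longleftrightarrow> module R W \<and>
     (\<forall>(A :: ('r, 'r) module) (B :: ('r, 'r) module) f g.
        module R A \<and> module R B \<and> f \<in> module_hom R A B \<and> inj_on f (carrier A) \<and>
        g \<in> module_hom R A W \<longrightarrow>
        (\<exists>h\<in>module_hom R B W. \<forall>x\<in>carrier A. h (f x) = g x))"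

definition injective_hull :: "'r ring \<Rightarrow> ('r, 'v) module \<Rightarrow> ('r, 'w) module \<Rightarrow> bool" where
  "injective_hull R V W \<longleftrightarrow> injective_module R W \<and>
     (\<exists>f\<in>module_hom R V W. inj_on f (carrier V) \<and>
        (\<forall>N. submodule R N W \<and> N \<noteq> {\<zero>\<^bsub>W\<^esub>} \<longrightarrow> N \<inter> f ` carrier V \<noteq> {\<zero>\<^bsub>W\<^esub>}))"

text \<open>
  For an artinian local ring the canonical module is the injective hull of the residue field;
  it is determined up to isomorphism.
\<close>

definition canonical_module :: "'r ring \<Rightarrow> ('r, 'w) module \<Rightarrow> bool" where
  "canonical_module R W \<longleftrightarrow> injective_hull R (residue_module R) W"

end

theory Submission
  imports "HOL.Vector_Spaces" "HOL-Library.Product_Plus" "HOL-Library.Function_Algebras" Defs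
begin

text \<open>
  Let \<open>\<dots> \<rightarrow> F\<^sub>1 \<rightarrow> F\<^sub>0 \<rightarrow> M\<close> be a minimal free resolution, that is, one whose syzygies
  \<open>P\<^sub>i \<subseteq> F\<^sub>i\<close> satisfy \<open>P\<^sub>i \<subseteq> \<mm>F\<^sub>i\<close>. Tensoring it with \<open>k\<close> kills all differentials, so the Betti
  number \<open>\<beta>\<^sub>i\<close> is the rank of \<open>F\<^sub>i\<close>, and \<open>\<beta>\<^sub>i\<^sub>+\<^sub>1\<close> is the least number of generators of \<open>P\<^sub>i\<close>
  (\<open>minimal_resolution\<close>, \<open>betti_minimal\<close>). Since Tor is computed from an arbitrary resolution, this
  needs a comparison: \<open>syzygies_stably_equal\<close> relates the syzygies of any two resolutions up to
  endomorphisms that extend to the free modules around them, and \<open>residue_tensor\<close> identifies \<open>k \<otimes> F\<close>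
  with \<open>F / \<mm>F\<close>.

  The theorem thus asks how many generators a submodule \<open>P \<subseteq> \<mm>F\<close> has, where \<open>F\<close> is free of rank
  \<open>b \<ge> 1\<close>. The socle of \<open>F\<close> consists of the elements with coordinates in \<open>\<mm>\<^sup>n\<^sup>-\<^sup>1\<close>, and \<open>P\<close>
  contains it if \<open>F / P\<close> embeds into \<open>\<mm>G\<close> for a free module \<open>G\<close>, because \<open>\<mm>\<^sup>n\<^sup>-\<^sup>1\<close> kills \<open>\<mm>G\<close>
  (\<open>socle_in_syzygy\<close>). This covers \<open>P\<^sub>i\<close> for \<open>i \<ge> 1\<close>.

  In case \<open>n = 2\<close> the socle of \<open>F\<close> is \<open>\<mm>F\<close>, so \<open>P = \<mm>F\<close>, which needs \<open>d b \<ge> b + (d - 1)\<close>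
  generators (\<open>relations_square_zero\<close>).

  In case \<open>d = 2\<close> the Koszul complex \<open>0 \<rightarrow> N \<rightarrow> N\<^sup>2 \<rightarrow> N \<rightarrow> 0\<close> of the two variables on
  \<open>N = F / P\<close> has Euler characteristic \<open>0\<close>. Its outer homology groups are \<open>N / \<mm>N\<close>, of dimension
  \<open>b\<close>, and the socle of \<open>N\<close>, which is nonzero; so the middle homology has dimension at least
  \<open>b + 1\<close>. The connecting map sends a cycle \<open>(u, v)\<close> to the class of \<open>X u + Y v\<close> in \<open>P / \<mm>P\<close>. It
  is injective as soon as the Koszul cycles of \<open>F\<close> become boundaries in \<open>N\<close>. Up to socle elements
  they are boundaries in \<open>F\<close> itself (\<open>koszul_cycle\<close>), and \<open>P\<close> contains the socle. Hence \<open>P\<close> needs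
  at least \<open>b + 1\<close> generators (\<open>koszul_count\<close>, \<open>relations_two_variables\<close>).

  For the canonical module \<open>\<omega>\<close> only the first step \<open>\<beta>\<^sub>1 - \<beta>\<^sub>0\<close> remains. Its socle is \<open>k\<close>
  (\<open>socle_canonical\<close>), and injectivity provides elements that behave like the dual basis of the
  monomials (\<open>coefficient_element\<close>). These generate \<open>\<omega>\<close> (\<open>canonical_spanned\<close>), and for \<open>d = 2\<close> the
  ones dual to the variables show that each pair of elements of the socle of \<open>F\<^sub>0\<close> becomes a
  Koszul boundary in \<open>\<omega>\<close>, so that the count above applies. For \<open>n = 2\<close> the quotient
  \<open>\<mm>F\<^sub>0 / P\<^sub>0\<close> has dimension at most \<open>1\<close>, and \<open>\<omega>\<close> is not cyclic, so that
  \<open>\<beta>\<^sub>1 \<ge> d \<beta>\<^sub>0 - 1 \<ge> \<beta>\<^sub>0 + (d - 1)\<close> (\<open>betti_canonical\<close>).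

  The arguments take place in a ring with a coefficient function on the monomials of degree less
  than \<open>n\<close> (\<open>truncated_algebra\<close>); the quotient of the polynomial ring is such a ring because the
  \<open>n\<close>-th power of the ideal of the variables consists of the polynomials without terms of degree
  less than \<open>n\<close> (\<open>ideal_power_vars\<close>).
\<close>

section \<open>Homomorphisms, quotients and ideal multiples\<close>

lemma hom_zero:
  assumes "module R M" "module R N" "f \<in> module_hom R M N"
  shows "f \<zero>\<^bsub>M\<^esub> = \<zero>\<^bsub>N\<^esub>"
  using mod_hom.f0_is_0[of R M N f] assms by (simp add: mod_hom_def mod_hom_axioms_def)

lemma hom_minus:
  assumes "module R M" "module R N" "f \<in> module_hom R M N" "x \<in> carrier M" "y \<in> carrier M"
  shows "f (x \<ominus>\<^bsub>M\<^esub> y) = f x \<ominus>\<^bsub>N\<^esub> f y"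
  using mod_hom.f_minus[of R M N f] assms by (simp add: mod_hom_def mod_hom_axioms_def)

lemma hom_in: "f \<in> module_hom R M N \<Longrightarrow> x \<in> carrier M \<Longrightarrow> f x \<in> carrier N"
  by (auto simp: module_hom_def)

lemma module_homI:
  assumes "\<And>x. x \<in> carrier M \<Longrightarrow> f x \<in> carrier N"
    and "\<And>x y. x \<in> carrier M \<Longrightarrow> y \<in> carrier M \<Longrightarrow> f (x \<oplus>\<^bsub>M\<^esub> y) = f x \<oplus>\<^bsub>N\<^esub> f y"
    and "\<And>r x. r \<in> carrier R \<Longrightarrow> x \<in> carrier M \<Longrightarrow> f (r \<odot>\<^bsub>M\<^esub> x) = r \<odot>\<^bsub>N\<^esub> f x"
  shows "f \<in> module_hom R M N"
  using assms by (auto simp: module_hom_def)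

lemma hom_comp:
  assumes "f \<in> module_hom R M N" "g \<in> module_hom R N L"
  shows "(\<lambda>x. g (f x)) \<in> module_hom R M L"
  using assms by (auto simp: module_hom_def Pi_def)

lemma hom_add_pointwise:
  assumes "module R N" "f \<in> module_hom R M N" "g \<in> module_hom R M N"
  shows "(\<lambda>x. f x \<oplus>\<^bsub>N\<^esub> g x) \<in> module_hom R M N"
proof -
  interpret N: module R N by fact
  show ?thesis
    using assms by (intro module_homI)
      (auto simp: module_hom_def Pi_def N.add.m_ac N.smult_r_distr)
qed

lemma hom_minus_pointwise:
  assumes "module R N" "f \<in> module_hom R M N" "g \<in> module_hom R M N"
  shows "(\<lambda>x. f x \<ominus>\<^bsub>N\<^esub> g x) \<in> module_hom R M N"
proof -
  interpret N: module R N by fact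
  have "(\<lambda>x. \<ominus>\<^bsub>N\<^esub> g x) \<in> module_hom R M N"
    using assms by (intro module_homI)
      (auto simp: module_hom_def Pi_def N.minus_add N.smult_r_minus)
  from hom_add_pointwise[OF assms(1,2) this] show ?thesis by (simp add: a_minus_def)
qed

lemma submodule_as_module:
  assumes "module R M" "submodule R K M" shows "module R (M\<lparr>carrier := K\<rparr>)"
  using assms by (simp add: module.submodule_is_module)

lemma submoduleI':
  assumes "module R M" "N \<subseteq> carrier M" "\<zero>\<^bsub>M\<^esub> \<in> N"
    "\<And>v w. v \<in> N \<Longrightarrow> w \<in> N \<Longrightarrow> v \<oplus>\<^bsub>M\<^esub> w \<in> N"
    "\<And>c v. c \<in> carrier R \<Longrightarrow> v \<in> N \<Longrightarrow> c \<odot>\<^bsub>M\<^esub> v \<in> N"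
  shows "submodule R N M"
  using assms by (simp add: LinearCombinations.submodule_def)

lemma submodule_minus:
  assumes "submodule R N M" "x \<in> N" "y \<in> N" shows "x \<ominus>\<^bsub>M\<^esub> y \<in> N"
proof -
  interpret M: module R M using assms(1) by (simp add: LinearCombinations.submodule_def)
  have y: "y \<in> carrier M" and "(\<ominus>\<^bsub>R\<^esub> \<one>\<^bsub>R\<^esub>) \<odot>\<^bsub>M\<^esub> y \<in> N"
    using assms by (auto simp: LinearCombinations.submodule_def)
  then have "\<ominus>\<^bsub>M\<^esub> y \<in> N" using M.smult_l_minus[of "\<one>\<^bsub>R\<^esub>" y] by simp
  then show ?thesis using assms by (simp add: LinearCombinations.submodule_def a_minus_def)
qed

lemma kernel_submodule:
  assumes "module R M" "module R N" "f \<in> module_hom R M N"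
  shows "submodule R (a_kernel M N f) M"
proof -
  interpret M: module R M by fact
  interpret N: module R N by fact
  show ?thesis
    using assms hom_zero[OF assms]
    by (intro submoduleI') (auto simp: a_kernel_def' module_hom_add module_hom_smult hom_in)
qed

lemma preimage_submodule:
  assumes "module R M" "f \<in> module_hom R M N" "submodule R W N"
  shows "submodule R {x \<in> carrier M. f x \<in> W} M"
proof -
  interpret M: module R M by fact
  have N: "module R N" using assms by (simp add: LinearCombinations.submodule_def)
  show ?thesis
    using assms hom_zero[OF assms(1) N assms(2)]
    by (intro submoduleI')
      (auto simp: module_hom_add module_hom_smult LinearCombinations.submodule_def)
qed

lemma hom_restrict:
  assumes "f \<in> module_hom R M N" "K \<subseteq> carrier M" "f ` K \<subseteq> L"
  shows "f \<in> module_hom R (M\<lparr>carrier := K\<rparr>) (N\<lparr>carrier := L\<rparr>)"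
  using assms by (auto simp: module_hom_def Pi_def subset_iff image_subset_iff)

text \<open>Module axioms are inherited along surjections. This avoids checking them for the
  quotients and tensor products below.\<close>
lemma module_surj_image:
  assumes M: "module R M" and surj: "f ` carrier M = carrier V"
    and add: "\<And>x y. x \<in> carrier M \<Longrightarrow> y \<in> carrier M \<Longrightarrow> f (x \<oplus>\<^bsub>M\<^esub> y) = f x \<oplus>\<^bsub>V\<^esub> f y"
    and smult: "\<And>r x. r \<in> carrier R \<Longrightarrow> x \<in> carrier M \<Longrightarrow> f (r \<odot>\<^bsub>M\<^esub> x) = r \<odot>\<^bsub>V\<^esub> f x"
    and zero: "f \<zero>\<^bsub>M\<^esub> = \<zero>\<^bsub>V\<^esub>"
  shows "module R V"
proof -
  interpret M: module R M by fact
  have E: "\<exists>x\<in>carrier M. v = f x" if "v \<in> carrier V" for v using that surj by blast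
  have I: "f x \<in> carrier V" if "x \<in> carrier M" for x using that surj by blast
  show ?thesis
  proof (rule module_criteria)
    show "cring R" by (rule M.R.is_cring)
    show "\<zero>\<^bsub>V\<^esub> \<in> carrier V" using I zero M.M.zero_closed by metis
    show "\<forall>v w. v \<in> carrier V \<and> w \<in> carrier V \<longrightarrow> v \<oplus>\<^bsub>V\<^esub> w \<in> carrier V"
      using E I add M.M.a_closed by metis
    show "\<forall>v\<in>carrier V. \<exists>w\<in>carrier V. v \<oplus>\<^bsub>V\<^esub> w = \<zero>\<^bsub>V\<^esub>"
    proof
      fix v assume "v \<in> carrier V"
      then obtain x where x: "x \<in> carrier M" "v = f x" using E by blast
      then have "v \<oplus>\<^bsub>V\<^esub> f (\<ominus>\<^bsub>M\<^esub> x) = \<zero>\<^bsub>V\<^esub>" using add[of x "\<ominus>\<^bsub>M\<^esub> x"] zero by (simp add: M.r_neg)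
      then show "\<exists>w\<in>carrier V. v \<oplus>\<^bsub>V\<^esub> w = \<zero>\<^bsub>V\<^esub>" using I x(1) by blast
    qed
    show "\<forall>c v. c \<in> carrier R \<and> v \<in> carrier V \<longrightarrow> c \<odot>\<^bsub>V\<^esub> v \<in> carrier V"
      using E I smult M.smult_closed by metis
    show "\<forall>v w. v \<in> carrier V \<and> w \<in> carrier V \<longrightarrow> v \<oplus>\<^bsub>V\<^esub> w = w \<oplus>\<^bsub>V\<^esub> v"
      using E add M.add.m_comm by metis
    show "\<forall>v w x. v \<in> carrier V \<and> w \<in> carrier V \<and> x \<in> carrier V \<longrightarrow>
        v \<oplus>\<^bsub>V\<^esub> w \<oplus>\<^bsub>V\<^esub> x = v \<oplus>\<^bsub>V\<^esub> (w \<oplus>\<^bsub>V\<^esub> x)"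
    proof (intro allI impI)
      fix v w x assume "v \<in> carrier V \<and> w \<in> carrier V \<and> x \<in> carrier V"
      then obtain a b c where "a \<in> carrier M" "b \<in> carrier M" "c \<in> carrier M"
        "v = f a" "w = f b" "x = f c" using E by meson
      then show "v \<oplus>\<^bsub>V\<^esub> w \<oplus>\<^bsub>V\<^esub> x = v \<oplus>\<^bsub>V\<^esub> (w \<oplus>\<^bsub>V\<^esub> x)"
        using add M.add.m_assoc M.M.a_closed by metis
    qed
    show "\<forall>v\<in>carrier V. v \<oplus>\<^bsub>V\<^esub> \<zero>\<^bsub>V\<^esub> = v"
      using E add zero M.M.r_zero M.M.zero_closed by metis
    show "\<forall>a b v. a \<in> carrier R \<and> b \<in> carrier R \<and> v \<in> carrier V \<longrightarrow>
        (a \<otimes>\<^bsub>R\<^esub> b) \<odot>\<^bsub>V\<^esub> v = a \<odot>\<^bsub>V\<^esub> (b \<odot>\<^bsub>V\<^esub> v)"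
      using E smult M.smult_assoc1 M.smult_closed M.R.m_closed by metis
    show "\<forall>v\<in>carrier V. \<one>\<^bsub>R\<^esub> \<odot>\<^bsub>V\<^esub> v = v"
      using E smult M.smult_one M.R.one_closed by metis
    show "\<forall>a b v. a \<in> carrier R \<and> b \<in> carrier R \<and> v \<in> carrier V \<longrightarrow>
        (a \<oplus>\<^bsub>R\<^esub> b) \<odot>\<^bsub>V\<^esub> v = a \<odot>\<^bsub>V\<^esub> v \<oplus>\<^bsub>V\<^esub> b \<odot>\<^bsub>V\<^esub> v"
    proof (intro allI impI)
      fix a b v assume *: "a \<in> carrier R \<and> b \<in> carrier R \<and> v \<in> carrier V"
      then obtain x where x: "x \<in> carrier M" "v = f x" using E by blast
      have "(a \<oplus>\<^bsub>R\<^esub> b) \<odot>\<^bsub>V\<^esub> v = f ((a \<oplus>\<^bsub>R\<^esub> b) \<odot>\<^bsub>M\<^esub> x)" using * x smult by auto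
      also have "\<dots> = a \<odot>\<^bsub>V\<^esub> v \<oplus>\<^bsub>V\<^esub> b \<odot>\<^bsub>V\<^esub> v"
        using * x by (simp add: M.smult_l_distr add smult)
      finally show "(a \<oplus>\<^bsub>R\<^esub> b) \<odot>\<^bsub>V\<^esub> v = a \<odot>\<^bsub>V\<^esub> v \<oplus>\<^bsub>V\<^esub> b \<odot>\<^bsub>V\<^esub> v" .
    qed
    show "\<forall>a v w. a \<in> carrier R \<and> v \<in> carrier V \<and> w \<in> carrier V \<longrightarrow>
        a \<odot>\<^bsub>V\<^esub> (v \<oplus>\<^bsub>V\<^esub> w) = a \<odot>\<^bsub>V\<^esub> v \<oplus>\<^bsub>V\<^esub> a \<odot>\<^bsub>V\<^esub> w"
    proof (intro allI impI)
      fix a v w assume *: "a \<in> carrier R \<and> v \<in> carrier V \<and> w \<in> carrier V"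
      then obtain x y where x: "x \<in> carrier M" "v = f x" "y \<in> carrier M" "w = f y" using E by meson
      have "a \<odot>\<^bsub>V\<^esub> (v \<oplus>\<^bsub>V\<^esub> w) = f (a \<odot>\<^bsub>M\<^esub> (x \<oplus>\<^bsub>M\<^esub> y))" using * x smult add by simp
      also have "\<dots> = a \<odot>\<^bsub>V\<^esub> v \<oplus>\<^bsub>V\<^esub> a \<odot>\<^bsub>V\<^esub> w"
        using * x by (simp add: M.smult_r_distr add smult)
      finally show "a \<odot>\<^bsub>V\<^esub> (v \<oplus>\<^bsub>V\<^esub> w) = a \<odot>\<^bsub>V\<^esub> v \<oplus>\<^bsub>V\<^esub> a \<odot>\<^bsub>V\<^esub> w" .
    qed
  qed
qed

lemma submodule_abelian_subgroup:
  assumes "submodule R N M" shows "abelian_subgroup N M"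
proof -
  interpret M: module R M using assms by (simp add: LinearCombinations.submodule_def)
  have "subgroup N (add_monoid M)"
  proof (rule M.add.subgroupI)
    show "N \<subseteq> carrier M" "N \<noteq> {}" using assms by (auto simp: LinearCombinations.submodule_def)
    show "\<And>a b. a \<in> N \<Longrightarrow> b \<in> N \<Longrightarrow> a \<oplus>\<^bsub>M\<^esub> b \<in> N"
      using assms by (auto simp: LinearCombinations.submodule_def)
    fix a assume a: "a \<in> N"
    have "\<zero>\<^bsub>M\<^esub> \<in> N" "a \<in> carrier M" using assms a by (auto simp: LinearCombinations.submodule_def)
    then show "\<ominus>\<^bsub>M\<^esub> a \<in> N" using submodule_minus[OF assms _ a, of "\<zero>\<^bsub>M\<^esub>"]
      by (simp add: a_minus_def)
  qed
  then show ?thesis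
    by (intro abelian_subgroupI3 additive_subgroup.intro M.abelian_group_axioms)
qed

lemma quotient_coset_eq:
  assumes "submodule R N M" "x \<in> carrier M" "y \<in> carrier M"
  shows "N +>\<^bsub>M\<^esub> x = N +>\<^bsub>M\<^esub> y \<longleftrightarrow> x \<ominus>\<^bsub>M\<^esub> y \<in> N"
proof -
  interpret M: module R M using assms by (simp add: LinearCombinations.submodule_def)
  interpret N: abelian_subgroup N M using submodule_abelian_subgroup assms by blast
  have "N +>\<^bsub>M\<^esub> x = N +>\<^bsub>M\<^esub> y \<longleftrightarrow> x \<in> N +>\<^bsub>M\<^esub> y"
    using N.a_rcos_self N.a_repr_independence' assms by metis
  then show ?thesis
    using N.a_rcos_module[OF assms(3,2)] by (simp add: a_minus_def)
qed

lemma minus_eq_zero_iff: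
  assumes "abelian_group M" "x \<in> carrier M" "y \<in> carrier M"
  shows "x \<ominus>\<^bsub>M\<^esub> y = \<zero>\<^bsub>M\<^esub> \<longleftrightarrow> x = y"
proof -
  interpret M: abelian_group M by fact
  have "\<ominus>\<^bsub>M\<^esub> (\<ominus>\<^bsub>M\<^esub> y) = x" if "x \<oplus>\<^bsub>M\<^esub> \<ominus>\<^bsub>M\<^esub> y = \<zero>\<^bsub>M\<^esub>"
    by (rule M.minus_equality[OF that]) (use assms in simp_all)
  then show ?thesis using assms M.r_neg[of y] M.minus_minus[of y] by (metis a_minus_def)
qed

lemma minus_zero_right:
  assumes "abelian_group M" "x \<in> carrier M"
  shows "x \<ominus>\<^bsub>M\<^esub> \<zero>\<^bsub>M\<^esub> = x"
proof -
  interpret M: abelian_group M by fact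
  have "\<ominus>\<^bsub>M\<^esub> \<zero>\<^bsub>M\<^esub> = \<zero>\<^bsub>M\<^esub>" by (rule M.minus_equality) auto
  then show ?thesis using assms by (simp add: a_minus_def)
qed

lemma quotient_module_hom:
  assumes N: "submodule R N M"
  shows "(\<lambda>x. N +>\<^bsub>M\<^esub> x) \<in> module_hom R M (quotient_module M N)"
    and "(\<lambda>x. N +>\<^bsub>M\<^esub> x) ` carrier M = carrier (quotient_module M N)"
    and "\<And>x. x \<in> carrier M \<Longrightarrow> N +>\<^bsub>M\<^esub> x = \<zero>\<^bsub>quotient_module M N\<^esub> \<longleftrightarrow> x \<in> N"
    and "module R (quotient_module M N)"
proof -
  interpret M: module R M using assms by (simp add: LinearCombinations.submodule_def)
  interpret N: abelian_subgroup N M using submodule_abelian_subgroup assms by blast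
  have Nsub: "N \<subseteq> carrier M" using N by (simp add: LinearCombinations.submodule_def)
  show surj: "(\<lambda>x. N +>\<^bsub>M\<^esub> x) ` carrier M = carrier (quotient_module M N)"
    by (auto simp: quotient_module_def A_RCOSETS_def')
  have z: "N +>\<^bsub>M\<^esub> \<zero>\<^bsub>M\<^esub> = \<zero>\<^bsub>quotient_module M N\<^esub>"
    using Nsub by (simp add: quotient_module_def M.a_coset_add_zero)
  show "\<And>x. x \<in> carrier M \<Longrightarrow> N +>\<^bsub>M\<^esub> x = \<zero>\<^bsub>quotient_module M N\<^esub> \<longleftrightarrow> x \<in> N"
    using quotient_coset_eq[OF N, of _ "\<zero>\<^bsub>M\<^esub>"] unfolding z by (simp add: minus_zero_right[OF M.abelian_group_axioms])
  have add: "N +>\<^bsub>M\<^esub> (x \<oplus>\<^bsub>M\<^esub> y) = (N +>\<^bsub>M\<^esub> x) \<oplus>\<^bsub>quotient_module M N\<^esub> (N +>\<^bsub>M\<^esub> y)"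
    if "x \<in> carrier M" "y \<in> carrier M" for x y
    using that by (simp add: quotient_module_def N.a_rcos_sum)
  have smult: "N +>\<^bsub>M\<^esub> (r \<odot>\<^bsub>M\<^esub> x) = r \<odot>\<^bsub>quotient_module M N\<^esub> (N +>\<^bsub>M\<^esub> x)"
    if r: "r \<in> carrier R" and x: "x \<in> carrier M" for r x
  proof -
    have "N +>\<^bsub>M\<^esub> (r \<odot>\<^bsub>M\<^esub> y) = N +>\<^bsub>M\<^esub> (r \<odot>\<^bsub>M\<^esub> x)" if "y \<in> N +>\<^bsub>M\<^esub> x" for y
    proof -
      have y: "y \<in> carrier M" using N.a_elemrcos_carrier that x by blast
      have "N +>\<^bsub>M\<^esub> y = N +>\<^bsub>M\<^esub> x" using N.a_repr_independence'[OF that x] by simp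
      then have "y \<ominus>\<^bsub>M\<^esub> x \<in> N" using quotient_coset_eq[OF N y x] by simp
      then have "r \<odot>\<^bsub>M\<^esub> (y \<ominus>\<^bsub>M\<^esub> x) \<in> N"
        using N r by (simp add: LinearCombinations.submodule_def)
      then have "r \<odot>\<^bsub>M\<^esub> y \<ominus>\<^bsub>M\<^esub> r \<odot>\<^bsub>M\<^esub> x \<in> N"
        using r x y by (simp add: a_minus_def M.smult_r_distr M.smult_r_minus)
      then show ?thesis using quotient_coset_eq[OF N] r x y by simp
    qed
    moreover have "x \<in> N +>\<^bsub>M\<^esub> x" using N.a_rcos_self x by blast
    ultimately have "(\<Union>y\<in>N +>\<^bsub>M\<^esub> x. N +>\<^bsub>M\<^esub> (r \<odot>\<^bsub>M\<^esub> y)) = N +>\<^bsub>M\<^esub> (r \<odot>\<^bsub>M\<^esub> x)" by blast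
    then show ?thesis by (simp add: quotient_module_def)
  qed
  show hom: "(\<lambda>x. N +>\<^bsub>M\<^esub> x) \<in> module_hom R M (quotient_module M N)"
    using surj add smult by (intro module_homI) auto
  show "module R (quotient_module M N)"
    by (rule module_surj_image[OF M.module_axioms surj add smult z])
qed

text \<open>The submodule \<open>IM\<close>. The inductive form turns every statement about its elements into one
  about products; sums of products need not be written down.\<close>
inductive_set ideal_mult :: "'r set \<Rightarrow> ('r, 'm) module \<Rightarrow> 'm set" for I M where
  zero: "\<zero>\<^bsub>M\<^esub> \<in> ideal_mult I M"
| smult: "a \<in> I \<Longrightarrow> x \<in> carrier M \<Longrightarrow> a \<odot>\<^bsub>M\<^esub> x \<in> ideal_mult I M"
| add: "x \<in> ideal_mult I M \<Longrightarrow> y \<in> ideal_mult I M \<Longrightarrow> x \<oplus>\<^bsub>M\<^esub> y \<in> ideal_mult I M"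

lemma ideal_mult_submodule:
  assumes "module R M" "ideal I R"
  shows "submodule R (ideal_mult I M) M"
proof -
  interpret M: module R M by fact
  interpret I: ideal I R by fact
  have sub: "x \<in> carrier M" if "x \<in> ideal_mult I M" for x
    using that by induct (auto simp: I.Icarr)
  have sm: "r \<odot>\<^bsub>M\<^esub> x \<in> ideal_mult I M" if "x \<in> ideal_mult I M" "r \<in> carrier R" for x r
    using that
  proof induct
    case (smult a x)
    then have "(r \<otimes>\<^bsub>R\<^esub> a) \<odot>\<^bsub>M\<^esub> x \<in> ideal_mult I M"
      by (intro ideal_mult.smult) (auto simp: I.I_l_closed)
    then show ?case using smult by (simp add: M.smult_assoc1 I.Icarr)
  next
    case (add x y)
    then show ?case by (simp add: M.smult_r_distr sub ideal_mult.add)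
  qed (simp add: ideal_mult.zero)
  show ?thesis using sub sm
    by (intro submoduleI' assms) (auto intro: ideal_mult.zero ideal_mult.add)
qed

lemma ideal_mult_hom:
  assumes "module R M" "module R N" "f \<in> module_hom R M N" "I \<subseteq> carrier R" "x \<in> ideal_mult I M"
  shows "f x \<in> ideal_mult I N"
proof -
  interpret M: module R M by fact
  have "x \<in> carrier M \<and> f x \<in> ideal_mult I N"
    using assms(5)
  proof induct
    case zero then show ?case using hom_zero[OF assms(1-3)] by (simp add: ideal_mult.zero)
  next
    case (smult a x)
    then show ?case using assms hom_in[OF assms(3)]
      by (auto simp: module_hom_smult[OF assms(3)] subset_iff intro: ideal_mult.smult)
  next
    case (add x y)
    then show ?case by (simp add: module_hom_add[OF assms(3)] ideal_mult.add)
  qed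
  then show ?thesis ..
qed

lemma ideal_mult_lift:
  assumes "module R M" "module R N" "f \<in> module_hom R M N" "I \<subseteq> carrier R"
    "f ` carrier M = carrier N" "y \<in> ideal_mult I N"
  shows "\<exists>x\<in>ideal_mult I M. x \<in> carrier M \<and> f x = y"
  using assms(6)
proof induct
  case zero
  interpret M: module R M by fact
  show ?case using hom_zero[OF assms(1-3)] by (intro bexI[of _ "\<zero>\<^bsub>M\<^esub>"]) (auto intro: ideal_mult.zero)
next
  case (smult a y)
  interpret M: module R M by fact
  obtain x where "x \<in> carrier M" "y = f x" using smult assms(5) by blast
  then show ?case using smult assms(4)
    by (intro bexI[of _ "a \<odot>\<^bsub>M\<^esub> x"])
      (auto simp: module_hom_smult[OF assms(3)] subset_iff intro: ideal_mult.smult)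
next
  case (add x y)
  interpret M: module R M by fact
  obtain u v where "u \<in> ideal_mult I M" "u \<in> carrier M" "f u = x"
    "v \<in> ideal_mult I M" "v \<in> carrier M" "f v = y" using add by blast
  then show ?case
    by (intro bexI[of _ "u \<oplus>\<^bsub>M\<^esub> v"]) (auto simp: module_hom_add[OF assms(3)] intro: ideal_mult.add)
qed

section \<open>Free modules\<close>

lemma free_module_on_simps [simp]:
  "\<zero>\<^bsub>free_module_on R S\<^esub> = (\<lambda>s. \<zero>\<^bsub>R\<^esub>)"
  "f \<oplus>\<^bsub>free_module_on R S\<^esub> g = (\<lambda>s. f s \<oplus>\<^bsub>R\<^esub> g s)"
  "r \<odot>\<^bsub>free_module_on R S\<^esub> f = (\<lambda>s. r \<otimes>\<^bsub>R\<^esub> f s)"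
  by (simp_all add: free_module_on_def)

lemma free_module_on_carrier:
  "f \<in> carrier (free_module_on R S) \<longleftrightarrow> (\<forall>s\<in>S. f s \<in> carrier R) \<and> (\<forall>s. s \<notin> S \<longrightarrow> f s = \<zero>\<^bsub>R\<^esub>)
     \<and> finite {s. f s \<noteq> \<zero>\<^bsub>R\<^esub>}"
  by (simp add: free_module_on_def)

locale comm_base = cring R for R :: "'a ring" (structure)
begin

lemma free_module_on_in: "f \<in> carrier (free_module_on R S) \<Longrightarrow> f s \<in> carrier R"
  by (cases "s \<in> S") (auto simp: free_module_on_carrier)

lemma free_module_on_supp: "f \<in> carrier (free_module_on R S) \<Longrightarrow> {s. f s \<noteq> \<zero>} \<subseteq> S"
  by (auto simp: free_module_on_carrier)

lemma free_module_on_fin: "f \<in> carrier (free_module_on R S) \<Longrightarrow> finite {s. f s \<noteq> \<zero>}"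
  by (auto simp: free_module_on_carrier)

lemma free_module_on_carrierI:
  assumes "finite S" "\<And>s. s \<in> S \<Longrightarrow> f s \<in> carrier R" "\<And>s. s \<notin> S \<Longrightarrow> f s = \<zero>"
  shows "f \<in> carrier (free_module_on R S)"
  using assms finite_subset[of "{s. f s \<noteq> \<zero>}" S] by (auto simp: free_module_on_carrier)

lemma free_module_on_add:
  assumes "f \<in> carrier (free_module_on R S)" "g \<in> carrier (free_module_on R S)"
  shows "(\<lambda>s. f s \<oplus> g s) \<in> carrier (free_module_on R S)"
proof -
  have "{s. f s \<oplus> g s \<noteq> \<zero>} \<subseteq> {s. f s \<noteq> \<zero>} \<union> {s. g s \<noteq> \<zero>}" by auto
  then have "finite {s. f s \<oplus> g s \<noteq> \<zero>}" 
    by (rule finite_subset) (use assms in \<open>simp add: free_module_on_fin\<close>)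
  then show ?thesis using assms by (auto simp: free_module_on_carrier)
qed

lemma free_module_on_smult:
  assumes "r \<in> carrier R" "f \<in> carrier (free_module_on R S)"
  shows "(\<lambda>s. r \<otimes> f s) \<in> carrier (free_module_on R S)"
proof -
  have "{s. r \<otimes> f s \<noteq> \<zero>} \<subseteq> {s. f s \<noteq> \<zero>}" using assms by auto
  then have "finite {s. r \<otimes> f s \<noteq> \<zero>}" 
    by (rule finite_subset) (use assms in \<open>simp add: free_module_on_fin\<close>)
  then show ?thesis using assms by (auto simp: free_module_on_carrier)
qed

lemma free_module_on_module: "module R (free_module_on R S)"
proof (rule module_criteria)
  show "cring R" by (rule is_cring)
  show "\<zero>\<^bsub>free_module_on R S\<^esub> \<in> carrier (free_module_on R S)"
    by (simp add: free_module_on_carrier)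
  show "\<forall>v\<in>carrier (free_module_on R S). \<exists>w\<in>carrier (free_module_on R S).
      v \<oplus>\<^bsub>free_module_on R S\<^esub> w = \<zero>\<^bsub>free_module_on R S\<^esub>"
  proof
    fix v assume v: "v \<in> carrier (free_module_on R S)"
    have "(\<lambda>s. (\<ominus> \<one>) \<otimes> v s) \<in> carrier (free_module_on R S)" using v by (intro free_module_on_smult) auto
    moreover have "v s \<oplus> (\<ominus> \<one>) \<otimes> v s = \<zero>" for s
      using free_module_on_in[OF v, of s] by (simp add: l_minus r_neg)
    ultimately show "\<exists>w\<in>carrier (free_module_on R S).
      v \<oplus>\<^bsub>free_module_on R S\<^esub> w = \<zero>\<^bsub>free_module_on R S\<^esub>"
      by (intro bexI[of _ "\<lambda>s. (\<ominus> \<one>) \<otimes> v s"]) auto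
  qed
qed (auto simp: free_module_on_add free_module_on_smult free_module_on_in a_ac m_assoc
    l_distr r_distr fun_eq_iff)

lemma free_gen_in: "s \<in> S \<Longrightarrow> free_gen R s \<in> carrier (free_module_on R S)"
  using finite_subset[of "{t. free_gen R s t \<noteq> \<zero>}" "{s}"]
  by (auto simp: free_module_on_carrier free_gen_def)

lemma free_gen_inj: "\<one> \<noteq> \<zero> \<Longrightarrow> free_gen R s = free_gen R t \<Longrightarrow> s = t"
  by (metis free_gen_def)

definition lin_ext :: "('a, 'm) module \<Rightarrow> ('s \<Rightarrow> 'm) \<Rightarrow> ('s \<Rightarrow> 'a) \<Rightarrow> 'm" where
  "lin_ext N g f = (\<Oplus>\<^bsub>N\<^esub>s\<in>{s. f s \<noteq> \<zero>}. f s \<odot>\<^bsub>N\<^esub> g s)"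

lemma lin_ext_eq:
  assumes N: "module R N" and f: "f \<in> carrier (free_module_on R S)" and g: "g \<in> S \<rightarrow> carrier N"
    and A: "finite A" "{s. f s \<noteq> \<zero>} \<subseteq> A" "A \<subseteq> S"
  shows "lin_ext N g f = (\<Oplus>\<^bsub>N\<^esub>s\<in>A. f s \<odot>\<^bsub>N\<^esub> g s)"
proof -
  interpret N: module R N by fact
  show ?thesis unfolding lin_ext_def
    using A g f by (intro N.add.finprod_mono_neutral_cong_left)
      (auto intro!: N.smult_closed simp: free_module_on_in Pi_def subset_iff)
qed

lemma lin_ext_hom:
  assumes N: "module R N" and g: "g \<in> S \<rightarrow> carrier N"
  shows "lin_ext N g \<in> module_hom R (free_module_on R S) N"
proof (rule module_homI)
  interpret N: module R N by fact
  fix f assume f: "f \<in> carrier (free_module_on R S)"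
  note F = free_module_on_supp[OF f] free_module_on_fin[OF f] free_module_on_in[OF f]
  show "lin_ext N g f \<in> carrier N" unfolding lin_ext_def
    using F g by (intro N.finsum_closed) (auto intro!: N.smult_closed simp: Pi_def subset_iff)
  { fix h assume h: "h \<in> carrier (free_module_on R S)"
    note H = free_module_on_supp[OF h] free_module_on_fin[OF h] free_module_on_in[OF h]
    let ?A = "{s. f s \<noteq> \<zero>} \<union> {s. h s \<noteq> \<zero>}"
    have A: "finite ?A" "?A \<subseteq> S" using F H by auto
    have sub: "{s. f s \<oplus> h s \<noteq> \<zero>} \<subseteq> ?A" by auto
    have "lin_ext N g (f \<oplus>\<^bsub>free_module_on R S\<^esub> h) = (\<Oplus>\<^bsub>N\<^esub>s\<in>?A. (f s \<oplus> h s) \<odot>\<^bsub>N\<^esub> g s)"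
      using lin_ext_eq[OF N free_module_on_add[OF f h] g A(1) sub A(2)] by simp
    also have "\<dots> = (\<Oplus>\<^bsub>N\<^esub>s\<in>?A. f s \<odot>\<^bsub>N\<^esub> g s \<oplus>\<^bsub>N\<^esub> h s \<odot>\<^bsub>N\<^esub> g s)"
      using A(2) g F(3) H(3)
      by (intro N.finsum_cong') (auto intro!: N.smult_closed simp: N.smult_l_distr Pi_def subset_iff)
    also have "\<dots> = (\<Oplus>\<^bsub>N\<^esub>s\<in>?A. f s \<odot>\<^bsub>N\<^esub> g s) \<oplus>\<^bsub>N\<^esub> (\<Oplus>\<^bsub>N\<^esub>s\<in>?A. h s \<odot>\<^bsub>N\<^esub> g s)"
      using A(2) g F(3) H(3)
      by (intro N.finsum_addf) (auto intro!: N.smult_closed simp: Pi_def subset_iff)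
    also have "\<dots> = lin_ext N g f \<oplus>\<^bsub>N\<^esub> lin_ext N g h"
      using lin_ext_eq[OF N f g A(1) _ A(2)] lin_ext_eq[OF N h g A(1) _ A(2)] by auto
    finally show "lin_ext N g (f \<oplus>\<^bsub>free_module_on R S\<^esub> h) = lin_ext N g f \<oplus>\<^bsub>N\<^esub> lin_ext N g h" . }
  { fix r assume r: "r \<in> carrier R"
    have sub: "{s. r \<otimes> f s \<noteq> \<zero>} \<subseteq> {s. f s \<noteq> \<zero>}" using r by auto
    have "lin_ext N g (r \<odot>\<^bsub>free_module_on R S\<^esub> f) = (\<Oplus>\<^bsub>N\<^esub>s\<in>{s. f s \<noteq> \<zero>}. (r \<otimes> f s) \<odot>\<^bsub>N\<^esub> g s)"
      using lin_ext_eq[OF N free_module_on_smult[OF r f] g F(2) sub F(1)] by simp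
    also have "\<dots> = (\<Oplus>\<^bsub>N\<^esub>s\<in>{s. f s \<noteq> \<zero>}. r \<odot>\<^bsub>N\<^esub> (f s \<odot>\<^bsub>N\<^esub> g s))"
      using F g r by (intro N.finsum_cong') (auto intro!: N.smult_closed simp: N.smult_assoc1 Pi_def subset_iff)
    also have "\<dots> = r \<odot>\<^bsub>N\<^esub> lin_ext N g f"
      unfolding lin_ext_def using F g r
      by (subst N.finsum_smult_ldistr) (auto intro!: N.smult_closed simp: Pi_def subset_iff)
    finally show "lin_ext N g (r \<odot>\<^bsub>free_module_on R S\<^esub> f) = r \<odot>\<^bsub>N\<^esub> lin_ext N g f" . }
qed

lemma lin_ext_gen:
  assumes N: "module R N" and g: "g \<in> S \<rightarrow> carrier N" and s: "s \<in> S"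
  shows "lin_ext N g (free_gen R s) = g s"
proof -
  interpret N: module R N by fact
  have "lin_ext N g (free_gen R s) = (\<Oplus>\<^bsub>N\<^esub>t\<in>{s}. free_gen R s t \<odot>\<^bsub>N\<^esub> g t)"
    using s by (intro lin_ext_eq[OF N free_gen_in[OF s] g]) (auto simp: free_gen_def)
  then show ?thesis using g s by (simp add: free_gen_def Pi_def)
qed

lemma free_module_induct:
  assumes W: "submodule R W (free_module_on R S)" and gen: "\<And>s. s \<in> S \<Longrightarrow> free_gen R s \<in> W"
    and f: "f \<in> carrier (free_module_on R S)"
  shows "f \<in> W"
proof -
  have "f \<in> carrier (free_module_on R S) \<longrightarrow> {s. f s \<noteq> \<zero>} = A \<longrightarrow> f \<in> W" if "finite A" for A f
    using that
  proof (induction A arbitrary: f)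
    case empty
    have "f = (\<lambda>s. \<zero>)" if "{s. f s \<noteq> \<zero>} = {}" using that by auto
    then show ?case using W by (auto simp: LinearCombinations.submodule_def)
  next
    case (insert a A)
    show ?case
    proof (intro impI)
      assume f: "f \<in> carrier (free_module_on R S)" and A: "{s. f s \<noteq> \<zero>} = insert a A"
      let ?h = "f(a := \<zero>)"
      have a: "a \<in> S" using f A by (auto simp: free_module_on_carrier)
      have supp: "{s. ?h s \<noteq> \<zero>} = A" using A insert.hyps by auto
      have "?h \<in> carrier (free_module_on R S)"
        using f a insert.hyps(1) supp by (auto simp: free_module_on_carrier)
      then have h: "?h \<in> W" using insert.IH supp by blast
      have "f a \<odot>\<^bsub>free_module_on R S\<^esub> free_gen R a \<in> W"
        using W gen[OF a] free_module_on_in[OF f] unfolding LinearCombinations.submodule_def by blast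
      then have "?h \<oplus>\<^bsub>free_module_on R S\<^esub> (f a \<odot>\<^bsub>free_module_on R S\<^esub> free_gen R a) \<in> W"
        using W h unfolding LinearCombinations.submodule_def by blast
      also have "?h \<oplus>\<^bsub>free_module_on R S\<^esub> (f a \<odot>\<^bsub>free_module_on R S\<^esub> free_gen R a) = f"
        using free_module_on_in[OF f] by (auto simp: free_gen_def fun_eq_iff)
      finally show "f \<in> W" .
    qed
  qed
  from this[OF free_module_on_fin[OF f]] f show ?thesis by blast
qed

lemma free_hom_eqI:
  assumes N: "module R N" and f: "f \<in> module_hom R (free_module_on R S) N"
    and g: "g \<in> module_hom R (free_module_on R S) N"
    and eq: "\<And>s. s \<in> S \<Longrightarrow> f (free_gen R s) = g (free_gen R s)"
    and x: "x \<in> carrier (free_module_on R S)"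
  shows "f x = g x"
proof -
  interpret N: module R N by fact
  interpret F: module R "free_module_on R S" by (rule free_module_on_module)
  have "submodule R (a_kernel (free_module_on R S) N (\<lambda>x. f x \<ominus>\<^bsub>N\<^esub> g x)) (free_module_on R S)"
    by (intro kernel_submodule hom_minus_pointwise N F.module_axioms f g)
  then have "x \<in> a_kernel (free_module_on R S) N (\<lambda>x. f x \<ominus>\<^bsub>N\<^esub> g x)"
    by (rule free_module_induct[OF _ _ x])
      (use eq hom_in[OF g] in \<open>auto simp: a_kernel_def' a_minus_def N.r_neg free_gen_in\<close>)
  then have "f x \<ominus>\<^bsub>N\<^esub> g x = \<zero>\<^bsub>N\<^esub>" by (simp add: a_kernel_def')
  then show ?thesis using hom_in[OF f x] hom_in[OF g x] by (simp add: minus_eq_zero_iff[OF N.abelian_group_axioms])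
qed

end

lemma hom_inj_onI:
  assumes "module R M" "module R N" "f \<in> module_hom R M N"
    and "\<And>x. x \<in> carrier M \<Longrightarrow> f x = \<zero>\<^bsub>N\<^esub> \<Longrightarrow> x = \<zero>\<^bsub>M\<^esub>"
  shows "inj_on f (carrier M)"
proof (rule inj_onI)
  interpret M: module R M by fact
  interpret N: module R N by fact
  fix x y assume *: "x \<in> carrier M" "y \<in> carrier M" "f x = f y"
  then have "f (x \<ominus>\<^bsub>M\<^esub> y) = \<zero>\<^bsub>N\<^esub>"
    using hom_minus[OF assms(1-3)] hom_in[OF assms(3)] by (simp add: a_minus_def N.r_neg)
  then have "x \<ominus>\<^bsub>M\<^esub> y = \<zero>\<^bsub>M\<^esub>" using assms(4) * by simp
  then show "x = y" using * by (simp add: minus_eq_zero_iff[OF M.abelian_group_axioms])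
qed

lemma hom_inverse:
  assumes f: "f \<in> module_hom R M N" and bij: "bij_betw f (carrier M) (carrier N)"
    and M: "module R M"
  shows "inv_into (carrier M) f \<in> module_hom R N M"
proof (rule module_homI)
  interpret M: module R M by fact
  let ?g = "inv_into (carrier M) f"
  have fg: "f (?g y) = y" if "y \<in> carrier N" for y
    using that bij by (metis bij_betw_inv_into_right)
  have gf: "?g (f x) = x" if "x \<in> carrier M" for x
    using that bij by (metis bij_betw_inv_into_left)
  show g: "?g y \<in> carrier M" if "y \<in> carrier N" for y
    using that bij by (metis bij_betw_def inv_into_into)
  show "?g (x \<oplus>\<^bsub>N\<^esub> y) = ?g x \<oplus>\<^bsub>M\<^esub> ?g y" if "x \<in> carrier N" "y \<in> carrier N" for x y
    using that gf[of "?g x \<oplus>\<^bsub>M\<^esub> ?g y"] by (simp add: module_hom_add[OF f] g fg)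
  show "?g (r \<odot>\<^bsub>N\<^esub> x) = r \<odot>\<^bsub>M\<^esub> ?g x" if "r \<in> carrier R" "x \<in> carrier N" for r x
    using that gf[of "r \<odot>\<^bsub>M\<^esub> ?g x"] by (simp add: module_hom_smult[OF f] g fg)
qed

context comm_base begin

lemma free_module_coordinates:
  fixes F :: "('a, 'm) module"
  assumes F: "free_module R F"
  shows "\<exists>(B :: 'm set) \<theta>. \<theta> \<in> module_hom R (free_module_on R B) F \<and>
    bij_betw \<theta> (carrier (free_module_on R B)) (carrier F)"
proof -
  interpret F: module R F using F by (simp add: free_module_def)
  obtain B where B: "B \<subseteq> carrier F" "\<not> F.lin_dep B" "F.span B = carrier F"
    using F by (auto simp: free_module_def)
  let ?\<theta> = "lin_ext F (\<lambda>b. b)"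
  have id: "(\<lambda>b. b) \<in> B \<rightarrow> carrier F" using B by auto
  have hom: "?\<theta> \<in> module_hom R (free_module_on R B) F"
    by (rule lin_ext_hom[OF F.module_axioms id])
  have lc: "?\<theta> f = F.lincomb f {s. f s \<noteq> \<zero>}" for f
    by (simp add: lin_ext_def F.lincomb_def)
  have "inj_on ?\<theta> (carrier (free_module_on R B))"
  proof (rule hom_inj_onI[OF free_module_on_module F.module_axioms hom])
    fix f assume f: "f \<in> carrier (free_module_on R B)" and 0: "?\<theta> f = \<zero>\<^bsub>F\<^esub>"
    have "f v = \<zero>" for v
    proof (rule ccontr)
      assume v: "f v \<noteq> \<zero>"
      have "F.lin_dep B"
        by (rule F.lin_dep_crit[of "{s. f s \<noteq> \<zero>}" B f v])
          (use f v 0 lc free_module_on_supp[OF f] free_module_on_fin[OF f] free_module_on_in[OF f]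
            in auto)
      then show False using B by blast
    qed
    then show "f = \<zero>\<^bsub>free_module_on R B\<^esub>" by auto
  qed
  moreover have "?\<theta> ` carrier (free_module_on R B) = carrier F"
  proof
    show "?\<theta> ` carrier (free_module_on R B) \<subseteq> carrier F" using hom_in[OF hom] by auto
    show "carrier F \<subseteq> ?\<theta> ` carrier (free_module_on R B)"
    proof
      fix x assume "x \<in> carrier F"
      then obtain a A where a: "x = F.lincomb a A" "finite A" "A \<subseteq> B" "a \<in> A \<rightarrow> carrier R"
        using B(3) unfolding F.span_def by blast
      let ?f = "\<lambda>b. if b \<in> A then a b else \<zero>"
      have f: "?f \<in> carrier (free_module_on R B)"
        using a finite_subset[of "{s. ?f s \<noteq> \<zero>}" A] by (auto simp: free_module_on_carrier)
      have "?\<theta> ?f = (\<Oplus>\<^bsub>F\<^esub>s\<in>A. ?f s \<odot>\<^bsub>F\<^esub> s)"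
        by (rule lin_ext_eq[OF F.module_axioms f id]) (use a in auto)
      also have "\<dots> = x" unfolding a(1) F.lincomb_def
        using a B(1) by (intro F.finsum_cong') auto
      finally show "x \<in> ?\<theta> ` carrier (free_module_on R B)" using f by blast
    qed
  qed
  ultimately show ?thesis using hom unfolding bij_betw_def by blast
qed

text \<open>Free modules are projective.\<close>
lemma free_module_lift:
  fixes F :: "('a, 'f) module" and G :: "('a, 'g) module" and C :: "('a, 'c) module"
  assumes F: "free_module R F" and G: "module R G" and C: "module R C"
    and f: "f \<in> module_hom R F C" and q: "q \<in> module_hom R G C"
    and im: "f ` carrier F \<subseteq> q ` carrier G"
  shows "\<exists>h\<in>module_hom R F G. \<forall>x\<in>carrier F. q (h x) = f x"
proof -
  have modF: "module R F" using F by (simp add: free_module_def)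
  obtain B :: "'f set" and \<theta> where \<theta>: "\<theta> \<in> module_hom R (free_module_on R B) F"
      "bij_betw \<theta> (carrier (free_module_on R B)) (carrier F)"
    using free_module_coordinates[OF F] by blast
  have "\<exists>g. \<forall>b\<in>B. g b \<in> carrier G \<and> q (g b) = f (\<theta> (free_gen R b))"
  proof (rule bchoice, rule ballI)
    fix b assume "b \<in> B"
    then have "f (\<theta> (free_gen R b)) \<in> q ` carrier G"
      using im hom_in[OF \<theta>(1)] free_gen_in[of b B] by blast
    then show "\<exists>y. y \<in> carrier G \<and> q y = f (\<theta> (free_gen R b))" by auto
  qed
  then obtain g where g: "\<forall>b\<in>B. g b \<in> carrier G \<and> q (g b) = f (\<theta> (free_gen R b))" ..
  then have g': "g \<in> B \<rightarrow> carrier G" by auto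
  have eq: "q (lin_ext G g y) = f (\<theta> y)" if "y \<in> carrier (free_module_on R B)" for y
    by (rule free_hom_eqI[OF C hom_comp[OF lin_ext_hom[OF G g'] q] hom_comp[OF \<theta>(1) f] _ that])
      (use g lin_ext_gen[OF G g'] in auto)
  let ?i = "inv_into (carrier (free_module_on R B)) \<theta>"
  have i: "?i \<in> module_hom R F (free_module_on R B)"
    by (rule hom_inverse[OF \<theta> free_module_on_module])
  have "q (lin_ext G g (?i x)) = f x" if "x \<in> carrier F" for x
    using eq[OF hom_in[OF i that]] that \<theta>(2) by (simp add: bij_betw_inv_into_right)
  moreover have "(\<lambda>x. lin_ext G g (?i x)) \<in> module_hom R F G"
    by (rule hom_comp[OF i lin_ext_hom[OF G g']])
  ultimately show ?thesis by (intro bexI[of _ "\<lambda>x. lin_ext G g (?i x)"] ballI)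
qed

lemma free_moduleI:
  assumes "\<one> \<noteq> \<zero>" and M: "module R M" and \<theta>: "\<theta> \<in> module_hom R (free_module_on R S) M"
    and bij: "bij_betw \<theta> (carrier (free_module_on R S)) (carrier M)"
  shows "free_module R M"
proof -
  interpret M: module R M by fact
  define u where "u = (\<lambda>s. \<theta> (free_gen R s))"
  have u: "u \<in> S \<rightarrow> carrier M" using hom_in[OF \<theta> free_gen_in] by (auto simp: u_def)
  have inj: "inj_on u S"
    using bij free_gen_in free_gen_inj[OF assms(1)]
    unfolding u_def bij_betw_def inj_on_def by metis
  have lin: "\<theta> f = lin_ext M u f" if "f \<in> carrier (free_module_on R S)" for f
    by (rule free_hom_eqI[OF M \<theta> lin_ext_hom[OF M u] _ that]) (simp only: lin_ext_gen[OF M u], simp add: u_def)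
  have re: "M.lincomb a (u ` T) = (\<Oplus>\<^bsub>M\<^esub>s\<in>T. a (u s) \<odot>\<^bsub>M\<^esub> u s)"
    if "T \<subseteq> S" "a \<in> u ` T \<rightarrow> carrier R" for a T
    unfolding M.lincomb_def
  proof (rule M.add.finprod_reindex)
    show "inj_on u T" by (rule inj_on_subset[OF inj that(1)])
    show "(\<lambda>v. a v \<odot>\<^bsub>M\<^esub> v) \<in> u ` T \<rightarrow> carrier M"
      using that u by (auto intro!: M.smult_closed)
  qed
  have "M.span (u ` S) = carrier M"
  proof
    show "M.span (u ` S) \<subseteq> carrier M"
      using u by (auto simp: M.span_def intro!: M.lincomb_closed)
    show "carrier M \<subseteq> M.span (u ` S)"
    proof
      fix x assume "x \<in> carrier M"
      then obtain f where f: "f \<in> carrier (free_module_on R S)" "x = \<theta> f"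
        using bij by (auto simp: bij_betw_def)
      let ?T = "{s. f s \<noteq> \<zero>}" and ?a = "\<lambda>v. f (inv_into S u v)"
      note F = free_module_on_supp[OF f(1)] free_module_on_fin[OF f(1)] free_module_on_in[OF f(1)]
      have "M.lincomb ?a (u ` ?T) = (\<Oplus>\<^bsub>M\<^esub>s\<in>?T. ?a (u s) \<odot>\<^bsub>M\<^esub> u s)"
        by (rule re) (use F in auto)
      also have "\<dots> = (\<Oplus>\<^bsub>M\<^esub>s\<in>?T. f s \<odot>\<^bsub>M\<^esub> u s)"
        using F u inj by (intro M.finsum_cong') (auto intro!: M.smult_closed)
      also have "\<dots> = x" using lin[OF f(1)] f(2) by (simp add: lin_ext_def)
      finally have "x = M.lincomb ?a (u ` ?T)" ..
      moreover have "finite (u ` ?T)" "u ` ?T \<subseteq> u ` S" "?a \<in> u ` ?T \<rightarrow> carrier R" using F by auto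
      ultimately show "x \<in> M.span (u ` S)" unfolding M.span_def by blast
    qed
  qed
  moreover have "\<not> M.lin_dep (u ` S)"
  proof
    assume "M.lin_dep (u ` S)"
    then obtain A a v where A: "finite A" "A \<subseteq> u ` S" "a \<in> A \<rightarrow> carrier R" "M.lincomb a A = \<zero>\<^bsub>M\<^esub>"
      "v \<in> A" "a v \<noteq> \<zero>" unfolding M.lin_dep_def by blast
    let ?T = "{s \<in> S. u s \<in> A}" and ?f = "\<lambda>s. if s \<in> S \<and> u s \<in> A then a (u s) else \<zero>"
    have uT: "u ` ?T = A" using A(2) by auto
    have finT: "finite ?T"
    proof (rule finite_imageD)
      show "finite (u ` ?T)" using A(1) uT by simp
      show "inj_on u ?T" by (rule inj_on_subset[OF inj]) auto
    qed
    then have f: "?f \<in> carrier (free_module_on R S)"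
      using A(3) finite_subset[of "{s. ?f s \<noteq> \<zero>}" ?T] by (auto simp: free_module_on_carrier)
    have "lin_ext M u ?f = (\<Oplus>\<^bsub>M\<^esub>s\<in>?T. ?f s \<odot>\<^bsub>M\<^esub> u s)"
      by (rule lin_ext_eq[OF M f u finT]) auto
    also have "\<dots> = (\<Oplus>\<^bsub>M\<^esub>s\<in>?T. a (u s) \<odot>\<^bsub>M\<^esub> u s)"
      using A(3) u by (intro M.finsum_cong') (auto intro!: M.smult_closed)
    also have "\<dots> = \<zero>\<^bsub>M\<^esub>" using re[of ?T a] uT A by simp
    finally have "\<theta> ?f = \<zero>\<^bsub>M\<^esub>" using lin[OF f] by simp
    interpret F: module R "free_module_on R S" by (rule free_module_on_module)
    have "\<theta> \<zero>\<^bsub>free_module_on R S\<^esub> = \<zero>\<^bsub>M\<^esub>" by (rule hom_zero[OF F.module_axioms M \<theta>])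
    with \<open>\<theta> ?f = \<zero>\<^bsub>M\<^esub>\<close> have "?f = \<zero>\<^bsub>free_module_on R S\<^esub>"
      using bij f F.zero_closed unfolding bij_betw_def inj_on_def by metis
    then have z: "?f = (\<lambda>s. \<zero>)" unfolding free_module_on_simps(1) .
    obtain s where s: "s \<in> S" "v = u s" using A(2,5) by auto
    have "a (u s) = ?f s" using A(5) s by simp
    also have "\<dots> = \<zero>" by (rule fun_cong[OF z])
    finally show False using A(6) s by simp
  qed
  ultimately show ?thesis using u unfolding free_module_def by (intro conjI M exI[of _ "u ` S"]) auto
qed

end

section \<open>Tensor products\<close>

lemma hom_factor:
  assumes M: "module R M" and Q: "module R Q" and C: "module R C"
    and p: "p \<in> module_hom R M Q" and surj: "p ` carrier M = carrier Q"
    and f: "f \<in> module_hom R M C"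
    and ker: "\<And>x. x \<in> carrier M \<Longrightarrow> p x = \<zero>\<^bsub>Q\<^esub> \<Longrightarrow> f x = \<zero>\<^bsub>C\<^esub>"
  shows "\<exists>h\<in>module_hom R Q C. \<forall>x\<in>carrier M. h (p x) = f x"
proof -
  interpret M: module R M by fact
  interpret Q: module R Q by fact
  interpret C: module R C by fact
  let ?i = "inv_into (carrier M) p"
  let ?h = "\<lambda>y. f (?i y)"
  have i: "?i y \<in> carrier M" "p (?i y) = y" if "y \<in> carrier Q" for y
    using that surj by (metis inv_into_into) (use that surj in \<open>metis f_inv_into_f\<close>)
  have wd: "f x = f y" if "x \<in> carrier M" "y \<in> carrier M" "p x = p y" for x y
  proof -
    have "p (x \<ominus>\<^bsub>M\<^esub> y) = \<zero>\<^bsub>Q\<^esub>"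
      using that hom_minus[OF M Q p] hom_in[OF p]
      by (simp add: minus_eq_zero_iff[OF Q.abelian_group_axioms])
    then have "f (x \<ominus>\<^bsub>M\<^esub> y) = \<zero>\<^bsub>C\<^esub>" using ker that by simp
    then show ?thesis
      using that hom_minus[OF M C f] hom_in[OF f]
      by (simp add: minus_eq_zero_iff[OF C.abelian_group_axioms])
  qed
  have h: "?h (p x) = f x" if "x \<in> carrier M" for x
    using wd[of "?i (p x)" x] i[of "p x"] that hom_in[OF p] by blast
  have "?h \<in> module_hom R Q C"
  proof (rule module_homI)
    show "?h x \<in> carrier C" if "x \<in> carrier Q" for x
      using i(1)[OF that] by (rule hom_in[OF f])
    show "?h (x \<oplus>\<^bsub>Q\<^esub> y) = ?h x \<oplus>\<^bsub>C\<^esub> ?h y" if "x \<in> carrier Q" "y \<in> carrier Q" for x y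
      using h[of "?i x \<oplus>\<^bsub>M\<^esub> ?i y"] i[OF that(1)] i[OF that(2)]
      by (simp add: module_hom_add[OF p] module_hom_add[OF f])
    show "?h (r \<odot>\<^bsub>Q\<^esub> x) = r \<odot>\<^bsub>C\<^esub> ?h x" if "r \<in> carrier R" "x \<in> carrier Q" for r x
      using h[of "r \<odot>\<^bsub>M\<^esub> ?i x"] i[OF that(2)] that(1)
      by (simp add: module_hom_smult[OF p] module_hom_smult[OF f])
  qed
  then show ?thesis using h by (intro bexI[of _ ?h] ballI)
qed

context comm_base begin

context
  fixes A :: "('a, 'm) module" and B :: "('a, 'n) module"
  assumes A: "module R A" and B: "module R B"
begin

interpretation A: module R A by (rule A)
interpretation B: module R B by (rule B)

abbreviation (input) "FAB \<equiv> free_module_on R (carrier A \<times> carrier B)"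

interpretation FAB: module R FAB by (rule free_module_on_module)

abbreviation (input) "gAB a b \<equiv> free_gen R (a, b)"

lemma gAB_in: "a \<in> carrier A \<Longrightarrow> b \<in> carrier B \<Longrightarrow> gAB a b \<in> carrier FAB"
  by (intro free_gen_in) simp

lemma tensor_rels_cases:
  assumes "x \<in> tensor_rels R A B"
  obtains (add1) a a' b where "a \<in> carrier A" "a' \<in> carrier A" "b \<in> carrier B"
      "x = gAB (a \<oplus>\<^bsub>A\<^esub> a') b \<ominus>\<^bsub>FAB\<^esub> (gAB a b \<oplus>\<^bsub>FAB\<^esub> gAB a' b)"
  | (add2) a b b' where "a \<in> carrier A" "b \<in> carrier B" "b' \<in> carrier B"
      "x = gAB a (b \<oplus>\<^bsub>B\<^esub> b') \<ominus>\<^bsub>FAB\<^esub> (gAB a b \<oplus>\<^bsub>FAB\<^esub> gAB a b')"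
  | (smult1) r a b where "r \<in> carrier R" "a \<in> carrier A" "b \<in> carrier B"
      "x = gAB (r \<odot>\<^bsub>A\<^esub> a) b \<ominus>\<^bsub>FAB\<^esub> (r \<odot>\<^bsub>FAB\<^esub> gAB a b)"
  | (smult2) r a b where "r \<in> carrier R" "a \<in> carrier A" "b \<in> carrier B"
      "x = gAB a (r \<odot>\<^bsub>B\<^esub> b) \<ominus>\<^bsub>FAB\<^esub> (r \<odot>\<^bsub>FAB\<^esub> gAB a b)"
  using assms unfolding tensor_rels_def Let_def Un_iff mem_Collect_eq
  by (elim disjE exE conjE)
    (rule add1, assumption, assumption, assumption, assumption,
     rule add2, assumption, assumption, assumption, assumption,
     rule smult1, assumption, assumption, assumption, assumption,
     rule smult2, assumption, assumption, assumption, assumption)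

lemma tensor_rels_mem:
  "a \<in> carrier A \<Longrightarrow> a' \<in> carrier A \<Longrightarrow> b \<in> carrier B \<Longrightarrow>
    gAB (a \<oplus>\<^bsub>A\<^esub> a') b \<ominus>\<^bsub>FAB\<^esub> (gAB a b \<oplus>\<^bsub>FAB\<^esub> gAB a' b) \<in> tensor_rels R A B"
  "a \<in> carrier A \<Longrightarrow> b \<in> carrier B \<Longrightarrow> b' \<in> carrier B \<Longrightarrow>
    gAB a (b \<oplus>\<^bsub>B\<^esub> b') \<ominus>\<^bsub>FAB\<^esub> (gAB a b \<oplus>\<^bsub>FAB\<^esub> gAB a b') \<in> tensor_rels R A B"
  "r \<in> carrier R \<Longrightarrow> a \<in> carrier A \<Longrightarrow> b \<in> carrier B \<Longrightarrow>
    gAB (r \<odot>\<^bsub>A\<^esub> a) b \<ominus>\<^bsub>FAB\<^esub> (r \<odot>\<^bsub>FAB\<^esub> gAB a b) \<in> tensor_rels R A B"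
  "r \<in> carrier R \<Longrightarrow> a \<in> carrier A \<Longrightarrow> b \<in> carrier B \<Longrightarrow>
    gAB a (r \<odot>\<^bsub>B\<^esub> b) \<ominus>\<^bsub>FAB\<^esub> (r \<odot>\<^bsub>FAB\<^esub> gAB a b) \<in> tensor_rels R A B"
  unfolding tensor_rels_def Let_def Un_iff mem_Collect_eq
  by (rule disjI1, rule disjI1, rule disjI1, intro exI conjI, rule refl, assumption+)
    (rule disjI1, rule disjI1, rule disjI2, intro exI conjI, rule refl, assumption+,
     rule disjI1, rule disjI2, intro exI conjI, rule refl, assumption+,
     rule disjI2, intro exI conjI, rule refl, assumption+)

lemma tensor_rels_in: "tensor_rels R A B \<subseteq> carrier FAB"
proof
  fix x assume "x \<in> tensor_rels R A B"
  then show "x \<in> carrier FAB"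
    by (cases rule: tensor_rels_cases)
      (simp_all only: gAB_in FAB.minus_closed FAB.M.a_closed FAB.smult_closed A.M.a_closed
         B.M.a_closed A.smult_closed B.smult_closed)
qed

lemma tensor_null_submodule: "submodule R (tensor_null R A B) FAB"
  unfolding tensor_null_def using tensor_rels_in by (rule FAB.span_is_submodule)

lemma tensor_relI: "x \<in> tensor_rels R A B \<Longrightarrow> x \<in> tensor_null R A B"
  unfolding tensor_null_def using FAB.in_own_span[OF tensor_rels_in] by blast

lemma tensor_module_module: "module R (tensor_module R A B)"
  unfolding tensor_module_def by (rule quotient_module_hom(4)[OF tensor_null_submodule])

lemma tensor_quot_eq:
  assumes "x \<in> carrier FAB" "y \<in> carrier FAB" "x \<ominus>\<^bsub>FAB\<^esub> y \<in> tensor_rels R A B"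
  shows "tensor_null R A B +>\<^bsub>FAB\<^esub> x = tensor_null R A B +>\<^bsub>FAB\<^esub> y"
  using quotient_coset_eq[OF tensor_null_submodule assms(1,2)] tensor_relI[OF assms(3)] by simp

lemmas tensor_quot_hom = quotient_module_hom[OF tensor_null_submodule, folded tensor_module_def]

lemma pure_tensor_in:
  "a \<in> carrier A \<Longrightarrow> b \<in> carrier B \<Longrightarrow> pure_tensor R A B a b \<in> carrier (tensor_module R A B)"
  unfolding pure_tensor_def by (rule hom_in[OF tensor_quot_hom(1) gAB_in])

lemma pure_tensor_add_right:
  assumes "a \<in> carrier A" "b \<in> carrier B" "b' \<in> carrier B"
  shows "pure_tensor R A B a (b \<oplus>\<^bsub>B\<^esub> b') =
    pure_tensor R A B a b \<oplus>\<^bsub>tensor_module R A B\<^esub> pure_tensor R A B a b'"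
proof -
  have "pure_tensor R A B a (b \<oplus>\<^bsub>B\<^esub> b') = tensor_null R A B +>\<^bsub>FAB\<^esub> (gAB a b \<oplus>\<^bsub>FAB\<^esub> gAB a b')"
    unfolding pure_tensor_def
    by (rule tensor_quot_eq)
      (use assms in \<open>simp_all only: tensor_rels_mem gAB_in FAB.M.a_closed B.M.a_closed\<close>)
  then show ?thesis
    using assms module_hom_add[OF tensor_quot_hom(1), OF gAB_in gAB_in]
    unfolding pure_tensor_def by metis
qed

lemma pure_tensor_smult_left:
  assumes "r \<in> carrier R" "a \<in> carrier A" "b \<in> carrier B"
  shows "pure_tensor R A B (r \<odot>\<^bsub>A\<^esub> a) b = r \<odot>\<^bsub>tensor_module R A B\<^esub> pure_tensor R A B a b"
proof -
  have "pure_tensor R A B (r \<odot>\<^bsub>A\<^esub> a) b = tensor_null R A B +>\<^bsub>FAB\<^esub> (r \<odot>\<^bsub>FAB\<^esub> gAB a b)"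
    unfolding pure_tensor_def
    by (rule tensor_quot_eq)
      (use assms in \<open>simp_all only: tensor_rels_mem gAB_in FAB.smult_closed A.smult_closed\<close>)
  then show ?thesis
    using assms module_hom_smult[OF tensor_quot_hom(1), OF _ gAB_in]
    unfolding pure_tensor_def by metis
qed

lemma pure_tensor_smult_right:
  assumes "r \<in> carrier R" "a \<in> carrier A" "b \<in> carrier B"
  shows "pure_tensor R A B a (r \<odot>\<^bsub>B\<^esub> b) = r \<odot>\<^bsub>tensor_module R A B\<^esub> pure_tensor R A B a b"
proof -
  have "pure_tensor R A B a (r \<odot>\<^bsub>B\<^esub> b) = tensor_null R A B +>\<^bsub>FAB\<^esub> (r \<odot>\<^bsub>FAB\<^esub> gAB a b)"
    unfolding pure_tensor_def
    by (rule tensor_quot_eq)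
      (use assms in \<open>simp_all only: tensor_rels_mem gAB_in FAB.smult_closed B.smult_closed\<close>)
  then show ?thesis
    using assms module_hom_smult[OF tensor_quot_hom(1), OF _ gAB_in]
    unfolding pure_tensor_def by metis
qed

lemma tensor_induct:
  assumes W: "submodule R W (tensor_module R A B)"
    and pure: "\<And>a b. a \<in> carrier A \<Longrightarrow> b \<in> carrier B \<Longrightarrow> pure_tensor R A B a b \<in> W"
    and t: "t \<in> carrier (tensor_module R A B)"
  shows "t \<in> W"
proof -
  let ?p = "\<lambda>x. tensor_null R A B +>\<^bsub>FAB\<^esub> x"
  obtain f where f: "f \<in> carrier FAB" "t = ?p f"
    using t tensor_quot_hom(2) by (metis (no_types, lifting) imageE)
  have "f \<in> {x \<in> carrier FAB. ?p x \<in> W}"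
  proof (rule free_module_induct[OF preimage_submodule[OF FAB.module_axioms tensor_quot_hom(1) W] _ f(1)])
    fix s assume "s \<in> carrier A \<times> carrier B"
    then obtain a b where s: "s = (a, b)" "a \<in> carrier A" "b \<in> carrier B" by blast
    show "free_gen R s \<in> {x \<in> carrier FAB. ?p x \<in> W}"
      using s pure[OF s(2,3)] gAB_in[OF s(2,3)] unfolding pure_tensor_def by simp
  qed
  then show ?thesis using f by simp
qed

text \<open>A bilinear map extends linearly to the free module on all pairs, and bilinearity says that this
  extension vanishes on the relations.\<close>
lemma tensor_universal:
  fixes C :: "('a, 'c) module"
  assumes C: "module R C"
    and \<beta>: "\<And>a b. a \<in> carrier A \<Longrightarrow> b \<in> carrier B \<Longrightarrow> \<beta> a b \<in> carrier C"
    and add1: "\<And>a a' b. a \<in> carrier A \<Longrightarrow> a' \<in> carrier A \<Longrightarrow> b \<in> carrier B \<Longrightarrow>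
        \<beta> (a \<oplus>\<^bsub>A\<^esub> a') b = \<beta> a b \<oplus>\<^bsub>C\<^esub> \<beta> a' b"
    and add2: "\<And>a b b'. a \<in> carrier A \<Longrightarrow> b \<in> carrier B \<Longrightarrow> b' \<in> carrier B \<Longrightarrow>
        \<beta> a (b \<oplus>\<^bsub>B\<^esub> b') = \<beta> a b \<oplus>\<^bsub>C\<^esub> \<beta> a b'"
    and smult1: "\<And>r a b. r \<in> carrier R \<Longrightarrow> a \<in> carrier A \<Longrightarrow> b \<in> carrier B \<Longrightarrow>
        \<beta> (r \<odot>\<^bsub>A\<^esub> a) b = r \<odot>\<^bsub>C\<^esub> \<beta> a b"
    and smult2: "\<And>r a b. r \<in> carrier R \<Longrightarrow> a \<in> carrier A \<Longrightarrow> b \<in> carrier B \<Longrightarrow>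
        \<beta> a (r \<odot>\<^bsub>B\<^esub> b) = r \<odot>\<^bsub>C\<^esub> \<beta> a b"
  shows "\<exists>h\<in>module_hom R (tensor_module R A B) C.
    \<forall>a\<in>carrier A. \<forall>b\<in>carrier B. h (pure_tensor R A B a b) = \<beta> a b"
proof -
  interpret C: module R C by fact
  let ?g = "\<lambda>(a, b). \<beta> a b"
  define L where "L = lin_ext C ?g"
  have g: "?g \<in> carrier A \<times> carrier B \<rightarrow> carrier C" using \<beta> by auto
  have L: "L \<in> module_hom R FAB C" unfolding L_def by (rule lin_ext_hom[OF C g])
  have Lg: "L (gAB a b) = \<beta> a b" if "a \<in> carrier A" "b \<in> carrier B" for a b
    using lin_ext_gen[OF C g, of "(a, b)"] that by (simp add: L_def)
  have Lmin: "L (x \<ominus>\<^bsub>FAB\<^esub> y) = \<zero>\<^bsub>C\<^esub>" if "L x = L y" "x \<in> carrier FAB" "y \<in> carrier FAB" for x y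
    using hom_minus[OF FAB.module_axioms C L that(2,3)] that(1) hom_in[OF L that(3)]
      minus_eq_zero_iff[OF C.abelian_group_axioms] by metis
  note closed = gAB_in FAB.M.a_closed FAB.smult_closed A.M.a_closed B.M.a_closed
    A.smult_closed B.smult_closed
  have "tensor_rels R A B \<subseteq> a_kernel FAB C L"
  proof
    fix x assume x: "x \<in> tensor_rels R A B"
    then have "L x = \<zero>\<^bsub>C\<^esub>"
    proof (cases rule: tensor_rels_cases)
      case (add1 a a' b)
      show ?thesis unfolding add1(4)
        by (rule Lmin)
          (use add1 assms(3) in \<open>simp_all only: Lg module_hom_add[OF L] closed\<close>)
    next
      case (add2 a b b')
      show ?thesis unfolding add2(4)
        by (rule Lmin)
          (use add2 assms(4) in \<open>simp_all only: Lg module_hom_add[OF L] closed\<close>)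
    next
      case (smult1 r a b)
      show ?thesis unfolding smult1(4)
        by (rule Lmin)
          (use smult1 assms(5) in \<open>simp_all only: Lg module_hom_smult[OF L] closed\<close>)
    next
      case (smult2 r a b)
      show ?thesis unfolding smult2(4)
        by (rule Lmin)
          (use smult2 assms(6) in \<open>simp_all only: Lg module_hom_smult[OF L] closed\<close>)
    qed
    then show "x \<in> a_kernel FAB C L" using x tensor_rels_in unfolding a_kernel_def' by blast
  qed
  then have null: "tensor_null R A B \<subseteq> a_kernel FAB C L"
    unfolding tensor_null_def
    by (rule FAB.span_is_subset[OF _ kernel_submodule[OF FAB.module_axioms C L]])
  have "\<exists>h\<in>module_hom R (tensor_module R A B) C. \<forall>x\<in>carrier FAB. h (tensor_null R A B +>\<^bsub>FAB\<^esub> x) = L x"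
  proof (rule hom_factor[OF FAB.module_axioms tensor_module_module C tensor_quot_hom(1,2) L])
    fix x assume "x \<in> carrier FAB" "tensor_null R A B +>\<^bsub>FAB\<^esub> x = \<zero>\<^bsub>tensor_module R A B\<^esub>"
    then show "L x = \<zero>\<^bsub>C\<^esub>" using tensor_quot_hom(3) null unfolding a_kernel_def' by blast
  qed
  then obtain h where h: "h \<in> module_hom R (tensor_module R A B) C"
    "\<forall>x\<in>carrier FAB. h (tensor_null R A B +>\<^bsub>FAB\<^esub> x) = L x" ..
  have "h (pure_tensor R A B a b) = \<beta> a b" if "a \<in> carrier A" "b \<in> carrier B" for a b
    using h(2) gAB_in[OF that] Lg[OF that] unfolding pure_tensor_def by simp
  then show ?thesis using h(1) by (intro bexI[of _ h] ballI)
qed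

end
end

section \<open>Reduction modulo the maximal ideal of a local ring\<close>

locale local_base = comm_base +
  fixes \<mm> :: "'a set"
  assumes maximal: "maximalideal \<mm> R"
    and units: "r \<in> carrier R \<Longrightarrow> r \<notin> \<mm> \<Longrightarrow> r \<in> Units R"
begin

sublocale maximalideal \<mm> R by (rule maximal)

lemma mm_ideal: "ideal \<mm> R" ..

lemma mm_sub: "\<mm> \<subseteq> carrier R" using Icarr by blast

lemma one_not_mm: "\<one> \<notin> \<mm>"
  using I_notcarr one_imp_carrier by blast

lemma one_not_zero: "\<one> \<noteq> \<zero>"
  using one_not_mm zero_closed by metis

lemma proper_ideal_le_mm:
  assumes J: "ideal J R" "J \<noteq> carrier R" shows "J \<subseteq> \<mm>"
proof
  interpret J: ideal J R by fact
  fix r assume r: "r \<in> J"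
  show "r \<in> \<mm>"
  proof (rule ccontr)
    assume "r \<notin> \<mm>"
    then have "r \<in> Units R" using units r J.Icarr by blast
    then have "inv r \<otimes> r = \<one>" "inv r \<in> carrier R" by auto
    then have "\<one> \<in> J" using J.I_l_closed[OF r, of "inv r"] by simp
    then show False using J.one_imp_carrier J(2) by blast
  qed
qed

lemma max_ideal_eq: "max_ideal R = \<mm>"
  unfolding max_ideal_def
proof (rule the_equality)
  fix J assume "maximalideal J R"
  then interpret J: maximalideal J R .
  have "J \<subseteq> \<mm>" using proper_ideal_le_mm[OF J.is_ideal] J.I_notcarr by blast
  then show "J = \<mm>" using J.I_maximal[OF mm_ideal] mm_sub I_notcarr by blast
qed (rule maximal)

lemma regular_module_simps [simp]:
  "carrier (regular_module R) = carrier R" "\<zero>\<^bsub>regular_module R\<^esub> = \<zero>"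
  "x \<oplus>\<^bsub>regular_module R\<^esub> y = x \<oplus> y" "r \<odot>\<^bsub>regular_module R\<^esub> y = r \<otimes> y"
  by (simp_all add: regular_module_def)

lemma regular_module_module: "module R (regular_module R)"
proof (rule module_criteria[OF is_cring])
  show "\<forall>v\<in>carrier (regular_module R). \<exists>w\<in>carrier (regular_module R).
      v \<oplus>\<^bsub>regular_module R\<^esub> w = \<zero>\<^bsub>regular_module R\<^esub>"
    using r_neg by (auto intro!: bexI[where x="\<ominus> v" for v])
qed (simp_all add: a_ac m_assoc l_distr r_distr)

lemma ideal_regular_submodule: "ideal I R \<Longrightarrow> submodule R I (regular_module R)"
proof (rule submoduleI'[OF regular_module_module])
  assume "ideal I R"
  then interpret I: ideal I R .
  show "I \<subseteq> carrier (regular_module R)" "\<zero>\<^bsub>regular_module R\<^esub> \<in> I"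
    "\<And>v w. v \<in> I \<Longrightarrow> w \<in> I \<Longrightarrow> v \<oplus>\<^bsub>regular_module R\<^esub> w \<in> I"
    "\<And>c v. c \<in> carrier R \<Longrightarrow> v \<in> I \<Longrightarrow> c \<odot>\<^bsub>regular_module R\<^esub> v \<in> I"
    by (auto simp: I.Icarr I.I_l_closed)
qed

abbreviation "\<kappa> \<equiv> residue_module R"

definition res :: "'a \<Rightarrow> 'a set" where "res r = \<mm> +>\<^bsub>regular_module R\<^esub> r"

lemmas res_hom = quotient_module_hom[OF ideal_regular_submodule[OF mm_ideal],
    folded max_ideal_eq, folded residue_module_def, unfolded max_ideal_eq, folded res_def]

lemma res_module: "module R \<kappa>" by (rule res_hom(4))

lemma res_hom': "res \<in> module_hom R (regular_module R) \<kappa>"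
  using res_hom(1) unfolding res_def .

lemma res_in: "r \<in> carrier R \<Longrightarrow> res r \<in> carrier \<kappa>"
  using hom_in[OF res_hom'] by simp

lemma res_surj: "a \<in> carrier \<kappa> \<Longrightarrow> \<exists>r\<in>carrier R. a = res r"
  using res_hom(2) by (auto simp: image_iff)

lemma res_add: "x \<in> carrier R \<Longrightarrow> y \<in> carrier R \<Longrightarrow> res (x \<oplus> y) = res x \<oplus>\<^bsub>\<kappa>\<^esub> res y"
  using module_hom_add[OF res_hom', of x y] by simp

lemma res_smult: "r \<in> carrier R \<Longrightarrow> y \<in> carrier R \<Longrightarrow> res (r \<otimes> y) = r \<odot>\<^bsub>\<kappa>\<^esub> res y"
  using module_hom_smult[OF res_hom', of r y] by simp

lemma res_zero: "x \<in> \<mm> \<Longrightarrow> res x = \<zero>\<^bsub>\<kappa>\<^esub>"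
  using res_hom(3)[of x] Icarr by simp

lemma res_eq: 
  assumes "x \<in> carrier R" "y \<in> carrier R" "res x = res y" shows "x \<ominus> y \<in> \<mm>"
proof -
  have "x \<ominus>\<^bsub>regular_module R\<^esub> y \<in> \<mm>"
    using quotient_coset_eq[OF ideal_regular_submodule[OF mm_ideal], of x y] assms
    by (simp add: res_def)
  moreover have "\<ominus>\<^bsub>regular_module R\<^esub> y = \<ominus> y"
    by (simp add: a_inv_def m_inv_def regular_module_def)
  ultimately show ?thesis by (simp add: a_minus_def)
qed

text \<open>This makes the action of the residue field on \<open>F / \<mm>F\<close> well defined.\<close>
lemma quotient_killed:
  fixes F :: "('a, 'f) module"
  assumes F: "module R F" and x: "x \<in> carrier F" and rs: "r \<in> carrier R" "s \<in> carrier R" "r \<ominus> s \<in> \<mm>"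
  shows "ideal_mult \<mm> F +>\<^bsub>F\<^esub> (r \<odot>\<^bsub>F\<^esub> x) = ideal_mult \<mm> F +>\<^bsub>F\<^esub> (s \<odot>\<^bsub>F\<^esub> x)"
proof -
  interpret F: module R F by fact
  have "r \<odot>\<^bsub>F\<^esub> x \<ominus>\<^bsub>F\<^esub> s \<odot>\<^bsub>F\<^esub> x = (r \<ominus> s) \<odot>\<^bsub>F\<^esub> x"
    using rs x by (simp add: a_minus_def F.smult_l_distr F.smult_l_minus)
  also have "\<dots> \<in> ideal_mult \<mm> F" using rs x by (intro ideal_mult.smult)
  finally show ?thesis
    using quotient_coset_eq[OF ideal_mult_submodule[OF F mm_ideal]] rs x by simp
qed

text \<open>Up to the isomorphism \<open>\<kappa> \<otimes> F = F / \<mm>F\<close>, this is the projection of \<open>F\<close> onto \<open>F / \<mm>F\<close>.\<close>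
definition \<tau> :: "('a, 'f) module \<Rightarrow> 'f \<Rightarrow> ('a set \<times> 'f \<Rightarrow> 'a) set" where
  "\<tau> F x = pure_tensor R \<kappa> F (res \<one>) x"

text \<open>Only the kernel of \<open>\<tau>\<close> needs an idea: the bilinear map from \<open>\<kappa>\<close> and \<open>F\<close> to \<open>F / \<mm>F\<close> that lifts
  an element of \<open>\<kappa>\<close> to \<open>R\<close> induces a map on the tensor product through which the projection
  factors.\<close>
lemma residue_tensor:
  fixes F :: "('a, 'f) module"
  assumes F: "module R F"
  shows "\<tau> F \<in> module_hom R F (tensor_module R \<kappa> F)" (is ?hom)
    and "\<And>r x. r \<in> carrier R \<Longrightarrow> x \<in> carrier F \<Longrightarrow> pure_tensor R \<kappa> F (res r) x = \<tau> F (r \<odot>\<^bsub>F\<^esub> x)"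
    and "\<tau> F ` carrier F = carrier (tensor_module R \<kappa> F)" (is ?surj)
    and "\<And>x. x \<in> carrier F \<Longrightarrow> \<tau> F x = \<zero>\<^bsub>tensor_module R \<kappa> F\<^esub> \<longleftrightarrow> x \<in> ideal_mult \<mm> F"
proof -
  interpret F: module R F by fact
  interpret K: module R \<kappa> by (rule res_module)
  let ?T = "tensor_module R \<kappa> F"
  interpret T: module R ?T by (rule tensor_module_module[OF res_module F])
  note rules = res_in[OF one_closed]
  show hom: ?hom
    by (rule module_homI) (simp_all only: \<tau>_def pure_tensor_in[OF res_module F] rules
        pure_tensor_add_right[OF res_module F] pure_tensor_smult_right[OF res_module F])
  show pure: "pure_tensor R \<kappa> F (res r) x = \<tau> F (r \<odot>\<^bsub>F\<^esub> x)" if "r \<in> carrier R" "x \<in> carrier F" for r x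
    using pure_tensor_smult_left[OF res_module F that(1) rules that(2)]
      pure_tensor_smult_right[OF res_module F that(1) rules that(2)] res_smult[OF that(1) one_closed] that
    by (simp add: \<tau>_def)
  show ?surj
  proof
    show "\<tau> F ` carrier F \<subseteq> carrier ?T" using hom_in[OF hom] by auto
    have im: "submodule R (\<tau> F ` carrier F) ?T"
      using mod_hom.im_is_submodule[of R F ?T "\<tau> F"] hom F.module_axioms T.module_axioms
      by (simp add: mod_hom_def mod_hom_axioms_def mod_hom.im_def)
    show "carrier ?T \<subseteq> \<tau> F ` carrier F"
    proof
      fix t assume t: "t \<in> carrier ?T"
      show "t \<in> \<tau> F ` carrier F"
      proof (rule tensor_induct[OF res_module F im _ t])
        fix a b assume "a \<in> carrier \<kappa>" "b \<in> carrier F"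
        moreover from this obtain r where "r \<in> carrier R" "a = res r" using res_surj by blast
        ultimately show "pure_tensor R \<kappa> F a b \<in> \<tau> F ` carrier F"
          using pure F.smult_closed by (intro image_eqI[of _ _ "r \<odot>\<^bsub>F\<^esub> b"]) simp_all
      qed
    qed
  qed
  fix x assume x: "x \<in> carrier F"
  show "\<tau> F x = \<zero>\<^bsub>?T\<^esub> \<longleftrightarrow> x \<in> ideal_mult \<mm> F"
  proof
    assume "x \<in> ideal_mult \<mm> F"
    then show "\<tau> F x = \<zero>\<^bsub>?T\<^esub>"
    proof induct
      case zero then show ?case by (rule hom_zero[OF F T.module_axioms hom])
    next
      case (smult a x)
      have "\<tau> F (a \<odot>\<^bsub>F\<^esub> x) = pure_tensor R \<kappa> F (\<zero> \<odot>\<^bsub>\<kappa>\<^esub> \<zero>\<^bsub>\<kappa>\<^esub>) x"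
        using pure[of a x] smult Icarr res_zero by simp
      also have "\<dots> = \<zero>\<^bsub>?T\<^esub>"
        by (subst pure_tensor_smult_left[OF res_module F])
          (simp_all add: smult pure_tensor_in[OF res_module F])
      finally show ?case .
    next
      case (add x y)
      then have "x \<in> carrier F" "y \<in> carrier F"
        using ideal_mult_submodule[OF F mm_ideal] unfolding LinearCombinations.submodule_def by blast+
      then show ?case using add by (simp add: module_hom_add[OF hom])
    qed
  next
    let ?Q = "quotient_module F (ideal_mult \<mm> F)" and ?q = "\<lambda>x. ideal_mult \<mm> F +>\<^bsub>F\<^esub> x"
    note q = quotient_module_hom[OF ideal_mult_submodule[OF F mm_ideal]]
    interpret Q: module R ?Q by (rule q(4))
    define rep where "rep a = (SOME r. r \<in> carrier R \<and> a = res r)" for a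
    have rep: "rep a \<in> carrier R" "res (rep a) = a" if "a \<in> carrier \<kappa>" for a
      using someI_ex[of "\<lambda>r. r \<in> carrier R \<and> a = res r"] res_surj[OF that] unfolding rep_def by auto
    let ?\<beta> = "\<lambda>a x. ?q (rep a \<odot>\<^bsub>F\<^esub> x)"
    have \<beta>: "?\<beta> a x = ?q (r \<odot>\<^bsub>F\<^esub> x)" if "r \<in> carrier R" "a = res r" "x \<in> carrier F" for a r x
      using that rep[of a] res_in res_eq by (intro quotient_killed[OF F]) simp_all
    have "\<exists>h\<in>module_hom R ?T ?Q. \<forall>a\<in>carrier \<kappa>. \<forall>b\<in>carrier F. h (pure_tensor R \<kappa> F a b) = ?\<beta> a b"
    proof (rule tensor_universal[OF res_module F Q.module_axioms])
      show "?\<beta> a b \<in> carrier ?Q" if "a \<in> carrier \<kappa>" "b \<in> carrier F" for a b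
        using that rep by (intro hom_in[OF q(1)] F.smult_closed)
      show "?\<beta> (a \<oplus>\<^bsub>\<kappa>\<^esub> a') b = ?\<beta> a b \<oplus>\<^bsub>?Q\<^esub> ?\<beta> a' b"
        if "a \<in> carrier \<kappa>" "a' \<in> carrier \<kappa>" "b \<in> carrier F" for a a' b
      proof -
        have "?\<beta> (a \<oplus>\<^bsub>\<kappa>\<^esub> a') b = ?q ((rep a \<oplus> rep a') \<odot>\<^bsub>F\<^esub> b)"
          using that rep by (intro \<beta>) (simp_all add: res_add)
        then show ?thesis
          using that rep by (simp add: F.smult_l_distr module_hom_add[OF q(1)])
      qed
      show "?\<beta> a (b \<oplus>\<^bsub>F\<^esub> b') = ?\<beta> a b \<oplus>\<^bsub>?Q\<^esub> ?\<beta> a b'"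
        if "a \<in> carrier \<kappa>" "b \<in> carrier F" "b' \<in> carrier F" for a b b'
        using that rep by (simp add: F.smult_r_distr module_hom_add[OF q(1)])
      show "?\<beta> (r \<odot>\<^bsub>\<kappa>\<^esub> a) b = r \<odot>\<^bsub>?Q\<^esub> ?\<beta> a b"
        if "r \<in> carrier R" "a \<in> carrier \<kappa>" "b \<in> carrier F" for r a b
      proof -
        have "?\<beta> (r \<odot>\<^bsub>\<kappa>\<^esub> a) b = ?q ((r \<otimes> rep a) \<odot>\<^bsub>F\<^esub> b)"
          using that rep by (intro \<beta>) (simp_all add: res_smult)
        then show ?thesis
          using that rep by (simp add: F.smult_assoc1 module_hom_smult[OF q(1)])
      qed
      show "?\<beta> a (r \<odot>\<^bsub>F\<^esub> b) = r \<odot>\<^bsub>?Q\<^esub> ?\<beta> a b"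
        if "r \<in> carrier R" "a \<in> carrier \<kappa>" "b \<in> carrier F" for r a b
      proof -
        have "rep a \<odot>\<^bsub>F\<^esub> (r \<odot>\<^bsub>F\<^esub> b) = r \<odot>\<^bsub>F\<^esub> (rep a \<odot>\<^bsub>F\<^esub> b)"
          using that rep by (simp add: F.smult_assoc1[symmetric] m_comm)
        then show ?thesis
          using that rep by (simp add: module_hom_smult[OF q(1)])
      qed
    qed
    then obtain h where h: "h \<in> module_hom R ?T ?Q"
      "\<forall>a\<in>carrier \<kappa>. \<forall>b\<in>carrier F. h (pure_tensor R \<kappa> F a b) = ?\<beta> a b" ..
    assume "\<tau> F x = \<zero>\<^bsub>?T\<^esub>"
    then have "h (\<tau> F x) = \<zero>\<^bsub>?Q\<^esub>" using hom_zero[OF T.module_axioms Q.module_axioms h(1)] by simp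
    moreover have "h (\<tau> F x) = ?q x"
      using h(2) rules x \<beta>[OF one_closed refl x] by (simp add: \<tau>_def)
    ultimately show "x \<in> ideal_mult \<mm> F" using q(3)[OF x] by simp
  qed
qed

lemma tensor_map_residue:
  fixes F :: "('a, 'f) module" and G :: "('a, 'g) module"
  assumes F: "module R F" and G: "module R G" and f: "f \<in> module_hom R F G"
  shows "tensor_map R \<kappa> F G f \<in> module_hom R (tensor_module R \<kappa> F) (tensor_module R \<kappa> G)"
    and "\<And>x. x \<in> carrier F \<Longrightarrow> tensor_map R \<kappa> F G f (\<tau> F x) = \<tau> G (f x)"
proof -
  interpret F: module R F by fact
  interpret G: module R G by fact
  let ?A = "tensor_module R \<kappa> F" and ?B = "tensor_module R \<kappa> G"
  have A: "module R ?A" and B: "module R ?B"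
    by (rule tensor_module_module[OF res_module F], rule tensor_module_module[OF res_module G])
  note tF = residue_tensor[OF F] and tG = residue_tensor[OF G]
  let ?P = "\<lambda>h. h \<in> module_hom R ?A ?B \<and>
    (\<forall>a\<in>carrier \<kappa>. \<forall>b\<in>carrier F. h (pure_tensor R \<kappa> F a b) = pure_tensor R \<kappa> G a (f b))"
  have "\<exists>h\<in>module_hom R ?A ?B. \<forall>x\<in>carrier F. h (\<tau> F x) = \<tau> G (f x)"
    by (rule hom_factor[OF F A B tF(1,3) hom_comp[OF f tG(1)]])
      (use tF(4) tG(4) hom_in[OF f] ideal_mult_hom[OF F G f mm_sub] in blast)
  then obtain h where h: "h \<in> module_hom R ?A ?B" "\<forall>x\<in>carrier F. h (\<tau> F x) = \<tau> G (f x)" ..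
  have "?P h"
  proof (intro conjI ballI)
    fix a b assume ab: "a \<in> carrier \<kappa>" "b \<in> carrier F"
    then obtain r where r: "r \<in> carrier R" "a = res r" using res_surj by blast
    show "h (pure_tensor R \<kappa> F a b) = pure_tensor R \<kappa> G a (f b)"
      using r ab h(2) tF(2)[OF r(1) ab(2)] tG(2)[OF r(1) hom_in[OF f ab(2)]]
      by (simp add: module_hom_smult[OF f])
  qed (rule h(1))
  then have P: "?P (tensor_map R \<kappa> F G f)" unfolding tensor_map_def by (rule someI[of ?P])
  then show "tensor_map R \<kappa> F G f \<in> module_hom R ?A ?B" by blast
  show "tensor_map R \<kappa> F G f (\<tau> F x) = \<tau> G (f x)" if "x \<in> carrier F" for x
    using P that res_in[OF one_closed] by (simp add: \<tau>_def)
qed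

end

context local_base begin

lemma coset_field: "field (residue_field R)"
  unfolding residue_field_def max_ideal_eq by (rule quotient_is_field[OF is_cring])

lemma residue_field_hom: "(\<lambda>r. \<mm> +> r) \<in> ring_hom R (residue_field R)"
  unfolding residue_field_def max_ideal_eq by (rule rcos_ring_hom)

lemma residue_field_surj: "c \<in> carrier (residue_field R) \<Longrightarrow> \<exists>r\<in>carrier R. c = \<mm> +> r"
  unfolding residue_field_def max_ideal_eq by (auto simp: FactRing_def A_RCOSETS_def')

lemma residue_field_zero: "r \<in> carrier R \<Longrightarrow> \<mm> +> r = \<zero>\<^bsub>residue_field R\<^esub> \<longleftrightarrow> r \<in> \<mm>"
  using a_rcos_const[of r] a_rcos_self[of r]
  unfolding residue_field_def max_ideal_eq by (auto simp: FactRing_def)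

text \<open>The images of the generators form a basis: they span by surjectivity, and a linear relation
  between them over the residue field lifts to an element of the kernel.\<close>
lemma residue_dim:
  fixes V :: "('a, 'v) module" and S :: "'s set"
  assumes fin: "finite S" and V: "module R V"
    and \<Omega>: "\<Omega> \<in> module_hom R (free_module_on R S) V"
    and surj: "\<Omega> ` carrier (free_module_on R S) = carrier V"
    and ker: "\<And>f. f \<in> carrier (free_module_on R S) \<Longrightarrow> \<Omega> f = \<zero>\<^bsub>V\<^esub> \<longleftrightarrow> (\<forall>s\<in>S. f s \<in> \<mm>)"
  shows "vectorspace.dim (residue_field R) (residue_space V) = card S"
proof -
  let ?F = "free_module_on R S" and ?K = "residue_field R" and ?W = "residue_space V"
  interpret V: module R V by fact
  interpret F: module R ?F by (rule free_module_on_module)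
  interpret K: field ?K by (rule coset_field)
  note K_hom = residue_field_hom
  have W: "carrier ?W = carrier V" "\<zero>\<^bsub>?W\<^esub> = \<zero>\<^bsub>V\<^esub>" "x \<oplus>\<^bsub>?W\<^esub> y = x \<oplus>\<^bsub>V\<^esub> y" for x y
    by (simp_all add: residue_space_def)
  have killed: "r \<odot>\<^bsub>V\<^esub> v = \<zero>\<^bsub>V\<^esub>" if r: "r \<in> \<mm>" and v: "v \<in> carrier V" for r v
  proof -
    obtain f where f: "f \<in> carrier ?F" "v = \<Omega> f" using v surj by (metis imageE)
    have rR: "r \<in> carrier R" using r Icarr by blast
    have "\<Omega> (r \<odot>\<^bsub>?F\<^esub> f) = \<zero>\<^bsub>V\<^esub>"
      using ker[OF F.smult_closed[OF rR f(1)]] I_r_closed[OF r free_module_on_in[OF f(1)]] by simp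
    then show ?thesis using f module_hom_smult[OF \<Omega> rR f(1)] by simp
  qed
  have sm: "(\<mm> +> r) \<odot>\<^bsub>?W\<^esub> v = r \<odot>\<^bsub>V\<^esub> v" if r: "r \<in> carrier R" and v: "v \<in> carrier V" for r v
  proof -
    define a where "a = (SOME a. a \<in> \<mm> +> r)"
    have a: "a \<in> \<mm> +> r" unfolding a_def by (rule someI) (rule a_rcos_self[OF r])
    have aR: "a \<in> carrier R" by (rule a_elemrcos_carrier[OF r a])
    have "a \<ominus> r \<in> \<mm>" using a_rcos_module_imp[OF r a] by (simp add: a_minus_def)
    then have "(a \<ominus> r) \<odot>\<^bsub>V\<^esub> v = \<zero>\<^bsub>V\<^esub>" using killed v by blast
    then have "a \<odot>\<^bsub>V\<^esub> v \<ominus>\<^bsub>V\<^esub> r \<odot>\<^bsub>V\<^esub> v = \<zero>\<^bsub>V\<^esub>"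
      using aR r v by (simp add: a_minus_def V.smult_l_distr V.smult_l_minus)
    then have "a \<odot>\<^bsub>V\<^esub> v = r \<odot>\<^bsub>V\<^esub> v"
      using minus_eq_zero_iff[OF V.abelian_group_axioms] aR r v by simp
    then show ?thesis by (simp add: residue_space_def a_def)
  qed
  note rep = residue_field_surj
  have modW: "module ?K ?W"
  proof (rule module_criteria[OF K.is_cring])
    show "\<forall>v\<in>carrier ?W. \<exists>w\<in>carrier ?W. v \<oplus>\<^bsub>?W\<^esub> w = \<zero>\<^bsub>?W\<^esub>"
      unfolding W using V.r_neg V.a_inv_closed by metis
    show "\<forall>c v. c \<in> carrier ?K \<and> v \<in> carrier ?W \<longrightarrow> c \<odot>\<^bsub>?W\<^esub> v \<in> carrier ?W"
      unfolding W using rep sm V.smult_closed by metis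
    show "\<forall>a b v. a \<in> carrier ?K \<and> b \<in> carrier ?K \<and> v \<in> carrier ?W \<longrightarrow>
       (a \<otimes>\<^bsub>?K\<^esub> b) \<odot>\<^bsub>?W\<^esub> v = a \<odot>\<^bsub>?W\<^esub> (b \<odot>\<^bsub>?W\<^esub> v)"
    proof (intro allI impI, elim conjE)
      fix a b v assume "a \<in> carrier ?K" "b \<in> carrier ?K" and v: "v \<in> carrier ?W"
      then obtain r s where rs: "r \<in> carrier R" "s \<in> carrier R" "a = \<mm> +> r" "b = \<mm> +> s"
        using rep by metis
      then show "(a \<otimes>\<^bsub>?K\<^esub> b) \<odot>\<^bsub>?W\<^esub> v = a \<odot>\<^bsub>?W\<^esub> (b \<odot>\<^bsub>?W\<^esub> v)"
        using v by (simp add: ring_hom_mult[OF K_hom, symmetric] sm W V.smult_assoc1)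
    qed
    show "\<forall>v\<in>carrier ?W. \<one>\<^bsub>?K\<^esub> \<odot>\<^bsub>?W\<^esub> v = v"
      by (simp add: ring_hom_one[OF K_hom, symmetric] sm W)
    show "\<forall>a b v. a \<in> carrier ?K \<and> b \<in> carrier ?K \<and> v \<in> carrier ?W \<longrightarrow>
       (a \<oplus>\<^bsub>?K\<^esub> b) \<odot>\<^bsub>?W\<^esub> v = a \<odot>\<^bsub>?W\<^esub> v \<oplus>\<^bsub>?W\<^esub> b \<odot>\<^bsub>?W\<^esub> v"
    proof (intro allI impI, elim conjE)
      fix a b v assume "a \<in> carrier ?K" "b \<in> carrier ?K" and v: "v \<in> carrier ?W"
      then obtain r s where rs: "r \<in> carrier R" "s \<in> carrier R" "a = \<mm> +> r" "b = \<mm> +> s"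
        using rep by metis
      then show "(a \<oplus>\<^bsub>?K\<^esub> b) \<odot>\<^bsub>?W\<^esub> v = a \<odot>\<^bsub>?W\<^esub> v \<oplus>\<^bsub>?W\<^esub> b \<odot>\<^bsub>?W\<^esub> v"
        using v by (simp add: ring_hom_add[OF K_hom, symmetric] sm W V.smult_l_distr)
    qed
    show "\<forall>a v w. a \<in> carrier ?K \<and> v \<in> carrier ?W \<and> w \<in> carrier ?W \<longrightarrow>
       a \<odot>\<^bsub>?W\<^esub> (v \<oplus>\<^bsub>?W\<^esub> w) = a \<odot>\<^bsub>?W\<^esub> v \<oplus>\<^bsub>?W\<^esub> a \<odot>\<^bsub>?W\<^esub> w"
    proof (intro allI impI, elim conjE)
      fix a v w assume "a \<in> carrier ?K" and v: "v \<in> carrier ?W" "w \<in> carrier ?W"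
      then obtain r where "r \<in> carrier R" "a = \<mm> +> r" using rep by metis
      then show "a \<odot>\<^bsub>?W\<^esub> (v \<oplus>\<^bsub>?W\<^esub> w) = a \<odot>\<^bsub>?W\<^esub> v \<oplus>\<^bsub>?W\<^esub> a \<odot>\<^bsub>?W\<^esub> w"
        using v by (simp add: sm W V.smult_r_distr)
    qed
  qed (simp_all add: W V.a_ac)
  interpret W: module ?K ?W by (rule modW)
  interpret W: vectorspace ?K ?W by (rule vectorspace.intro[OF modW K.field_axioms])
  define b where "b s = \<Omega> (free_gen R s)" for s
  have b: "b \<in> S \<rightarrow> carrier V" using hom_in[OF \<Omega> free_gen_in] by (auto simp: b_def)
  have b_inj: "inj_on b S"
  proof (rule inj_onI, rule ccontr)
    fix s t assume st: "s \<in> S" "t \<in> S" "b s = b t" "s \<noteq> t"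
    let ?f = "free_gen R s \<oplus>\<^bsub>?F\<^esub> ((\<ominus> \<one>) \<odot>\<^bsub>?F\<^esub> free_gen R t)"
    have gens: "free_gen R s \<in> carrier ?F" "free_gen R t \<in> carrier ?F"
      "(\<ominus> \<one>) \<odot>\<^bsub>?F\<^esub> free_gen R t \<in> carrier ?F"
      by (rule free_gen_in[OF st(1)], rule free_gen_in[OF st(2)],
          rule F.smult_closed[OF _ free_gen_in[OF st(2)]], simp)
    have "\<Omega> ?f = b s \<oplus>\<^bsub>V\<^esub> (\<ominus> \<one>) \<odot>\<^bsub>V\<^esub> b t"
      using module_hom_add[OF \<Omega> gens(1,3)] module_hom_smult[OF \<Omega> _ gens(2), of "\<ominus> \<one>"]
      by (simp add: b_def del: free_module_on_simps)
    also have "\<dots> = \<zero>\<^bsub>V\<^esub>"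
      using st b by (simp add: V.smult_l_minus V.r_neg Pi_iff)
    finally have "?f s \<in> \<mm>" using ker[OF F.M.a_closed[OF gens(1,3)]] st(1) by blast
    then show False using st(4) one_not_mm by (simp add: free_gen_def)
  qed
  have sum_eq: "finsum ?W h T = finsum V h T" if "finite T" "h \<in> T \<rightarrow> carrier V" for h and T :: "'v set"
    using that
  proof (induction T)
    case (insert x T)
    then show ?case
      using W.finsum_insert[of T x h] V.finsum_insert[of T x h] by (simp add: W Pi_iff)
  qed (simp add: W)
  let ?c = "\<lambda>f v. \<mm> +> f (inv_into S b v)"
  have c_in: "?c f \<in> b ` S \<rightarrow> carrier ?K" if "f \<in> carrier ?F" for f
    using ring_hom_closed[OF K_hom] free_module_on_in[OF that] by simp
  have lc: "W.lincomb (?c f) (b ` S) = \<Omega> f" if f: "f \<in> carrier ?F" for f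
  proof -
    have "\<Omega> f = lin_ext V b f"
      by (rule free_hom_eqI[OF V \<Omega> lin_ext_hom[OF V b] _ f]) (simp only: lin_ext_gen[OF V b] b_def)
    also have "\<dots> = (\<Oplus>\<^bsub>V\<^esub>s\<in>S. f s \<odot>\<^bsub>V\<^esub> b s)"
      by (rule lin_ext_eq[OF V f b fin free_module_on_supp[OF f] subset_refl])
    also have "\<dots> = (\<Oplus>\<^bsub>V\<^esub>s\<in>S. ?c f (b s) \<odot>\<^bsub>?W\<^esub> b s)"
      using b free_module_on_in[OF f] b_inj
      by (intro V.finsum_cong') (simp_all add: sm Pi_iff)
    also have "\<dots> = (\<Oplus>\<^bsub>V\<^esub>v\<in>b ` S. ?c f v \<odot>\<^bsub>?W\<^esub> v)"
      using b free_module_on_in[OF f]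
      by (intro V.add.finprod_reindex[symmetric] b_inj) (auto simp: sm Pi_iff)
    also have "\<dots> = finsum ?W (\<lambda>v. ?c f v \<odot>\<^bsub>?W\<^esub> v) (b ` S)"
      using b free_module_on_in[OF f] fin by (intro sum_eq[symmetric]) (auto simp: sm Pi_iff)
    finally show ?thesis unfolding W.lincomb_def by (rule sym)
  qed
  have bS: "finite (b ` S)" "b ` S \<subseteq> carrier ?W" using fin b by (auto simp: W)
  have "W.lin_indpt (b ` S)"
  proof (rule W.finite_lin_indpt2[OF bS])
    fix a assume a: "a \<in> b ` S \<rightarrow> carrier ?K" "W.lincomb a (b ` S) = \<zero>\<^bsub>?W\<^esub>"
    have "\<exists>r. \<forall>s\<in>S. r s \<in> carrier R \<and> a (b s) = \<mm> +> r s"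
    proof (rule bchoice, rule ballI)
      fix s assume "s \<in> S"
      then have "a (b s) \<in> carrier ?K" using a(1) by auto
      then show "\<exists>r. r \<in> carrier R \<and> a (b s) = \<mm> +> r" using rep by blast
    qed
    then obtain r where r: "\<forall>s\<in>S. r s \<in> carrier R \<and> a (b s) = \<mm> +> r s" ..
    define f where "f s = (if s \<in> S then r s else \<zero>)" for s
    have f: "f \<in> carrier ?F" using r fin by (intro free_module_on_carrierI) (auto simp: f_def)
    have "W.lincomb a (b ` S) = W.lincomb (?c f) (b ` S)"
      by (rule W.lincomb_cong[OF refl bS(2)])
        (use r b_inj c_in[OF f] in \<open>auto simp: f_def\<close>)
    then have "\<Omega> f = \<zero>\<^bsub>V\<^esub>" using lc[OF f] a(2) W by simp
    then have "\<forall>s\<in>S. f s \<in> \<mm>" using ker[OF f] by blast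
    then show "\<forall>v\<in>b ` S. a v = \<zero>\<^bsub>?K\<^esub>"
      using r residue_field_zero by (auto simp: f_def)
  qed
  moreover have "W.span (b ` S) = carrier ?W"
  proof
    show "W.span (b ` S) \<subseteq> carrier ?W"
      unfolding W.finite_span[OF bS] using W.lincomb_closed[OF bS(2)] by blast
    show "carrier ?W \<subseteq> W.span (b ` S)"
    proof
      fix v assume "v \<in> carrier ?W"
      then obtain f where f: "f \<in> carrier ?F" "v = \<Omega> f" using surj W by (metis imageE)
      show "v \<in> W.span (b ` S)"
        unfolding W.finite_span[OF bS] using lc[OF f(1)] f(2) c_in[OF f(1)]
        by (intro CollectI exI[of _ "?c f"]) simp
    qed
  qed
  ultimately have "W.basis (b ` S)" using bS unfolding W.basis_def by blast
  then have "W.dim = card (b ` S)" by (rule W.dim_basis[OF bS(1)])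
  then show ?thesis using card_image[OF b_inj] by simp
qed

end

section \<open>Comparison of resolutions\<close>

context comm_base begin

lemma comparison_step:
  fixes F :: "('a, 'f) module" and G :: "('a, 'g) module" and A :: "('a, 'm) module" and B :: "('a, 'n) module"
  assumes F: "free_module R F" and G: "free_module R G" and A: "module R A" and B: "module R B"
    and p: "p \<in> module_hom R F A" and q: "q \<in> module_hom R G B"
    and a: "a \<in> module_hom R A B" and b: "b \<in> module_hom R B A"
    and apq: "\<And>x. x \<in> carrier F \<Longrightarrow> a (p x) \<in> q ` carrier G"
    and bqp: "\<And>y. y \<in> carrier G \<Longrightarrow> b (q y) \<in> p ` carrier F"
  shows "\<exists>f g. f \<in> module_hom R F G \<and> g \<in> module_hom R G F \<and>
    (\<forall>x\<in>carrier F. q (f x) = a (p x)) \<and> (\<forall>y\<in>carrier G. p (g y) = b (q y))"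
proof -
  have mF: "module R F" and mG: "module R G" using F G by (simp_all add: free_module_def)
  have "\<exists>f\<in>module_hom R F G. \<forall>x\<in>carrier F. q (f x) = a (p x)"
    by (rule free_module_lift[OF F mG B hom_comp[OF p a] q]) (use apq in auto)
  moreover have "\<exists>g\<in>module_hom R G F. \<forall>y\<in>carrier G. p (g y) = b (q y)"
    by (rule free_module_lift[OF G mF A hom_comp[OF q b] p]) (use bqp in auto)
  ultimately show ?thesis by (elim bexE) (intro exI conjI)
qed

text \<open>The hypothesis \<open>pe\<close> says that \<open>b \<circ> a\<close> is the identity up to a map that factors through
  \<open>F\<close>. The conclusion says the same of \<open>g \<circ> f\<close> on the kernels, with a map \<open>u\<close> that is defined on all
  of the free module \<open>F\<close>. The witness is \<open>u = g \<circ> f - id - e \<circ> p\<close>.\<close>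
lemma comparison_homotopy:
  fixes F :: "('a, 'f) module" and G :: "('a, 'g) module" and A :: "('a, 'm) module" and B :: "('a, 'n) module"
  assumes F: "module R F" and A: "module R A"
    and p: "p \<in> module_hom R F A" 
    and f: "f \<in> module_hom R F G" and g: "g \<in> module_hom R G F"
    and qf: "\<And>x. x \<in> carrier F \<Longrightarrow> q (f x) = a (p x)" and pg: "\<And>y. y \<in> carrier G \<Longrightarrow> p (g y) = b (q y)"
    and e: "e \<in> module_hom R A F" 
    and pe: "\<And>x. x \<in> carrier F \<Longrightarrow> b (a (p x)) = p (e (p x)) \<oplus>\<^bsub>A\<^esub> p x"
  shows "\<exists>u\<in>module_hom R F F. (\<forall>x\<in>carrier F. u x \<in> a_kernel F A p) \<and>
    (\<forall>x\<in>a_kernel F A p. g (f x) = u x \<oplus>\<^bsub>F\<^esub> x)"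
proof -
  interpret F: module R F by (rule F)
  interpret A: module R A by (rule A)
  let ?u = "\<lambda>x. (g (f x) \<ominus>\<^bsub>F\<^esub> x) \<ominus>\<^bsub>F\<^esub> e (p x)"
  note hom_ins = hom_in[OF f] hom_in[OF g] hom_in[OF p] hom_in[OF e] F.minus_closed
  have id: "(\<lambda>x. x) \<in> module_hom R F F" by (rule module_homI) simp_all
  have "?u \<in> module_hom R F F"
    by (intro hom_minus_pointwise F hom_comp[OF f g] hom_comp[OF p e] id)
  moreover have "?u x \<in> a_kernel F A p" if x: "x \<in> carrier F" for x
  proof -
    have "p (?u x) = (p (g (f x)) \<ominus>\<^bsub>A\<^esub> p x) \<ominus>\<^bsub>A\<^esub> p (e (p x))"
      using x by (simp only: hom_minus[OF F A p] hom_ins)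
    also have "p (g (f x)) = p (e (p x)) \<oplus>\<^bsub>A\<^esub> p x"
      using x by (simp only: pg qf pe hom_ins)
    also have "(p (e (p x)) \<oplus>\<^bsub>A\<^esub> p x \<ominus>\<^bsub>A\<^esub> p x) \<ominus>\<^bsub>A\<^esub> p (e (p x)) = \<zero>\<^bsub>A\<^esub>"
      using hom_in[OF p hom_in[OF e hom_in[OF p x]]] hom_in[OF p x]
      by (simp add: a_minus_def A.add.m_assoc A.r_neg)
    finally show ?thesis using x by (simp only: a_kernel_def' mem_Collect_eq hom_ins)
  qed
  moreover have "g (f x) = ?u x \<oplus>\<^bsub>F\<^esub> x" if x: "x \<in> a_kernel F A p" for x
  proof -
    have x': "x \<in> carrier F" "p x = \<zero>\<^bsub>A\<^esub>" using x by (simp_all add: a_kernel_def')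
    then have "?u x = g (f x) \<ominus>\<^bsub>F\<^esub> x"
      using hom_zero[OF A F e] hom_ins
      by (simp only: minus_zero_right[OF F.abelian_group_axioms])
    then show ?thesis using x'(1) hom_in[OF g hom_in[OF f x'(1)]]
      by (simp add: a_minus_def F.add.m_assoc F.l_neg)
  qed
  ultimately show ?thesis by (intro bexI[of _ ?u]) auto
qed

end

text \<open>The numbering starts at the kernel of the augmentation, so that \<open>syzygy F \<delta> M \<epsilon> j\<close> is a submodule
  of \<open>F j\<close>.\<close>
definition syzygy ::
    "(nat \<Rightarrow> ('r, 'f) module) \<Rightarrow> (nat \<Rightarrow> 'f \<Rightarrow> 'f) \<Rightarrow> ('r, 'm) module \<Rightarrow> ('f \<Rightarrow> 'm) \<Rightarrow> nat \<Rightarrow> 'f set" where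
  "syzygy F \<delta> M \<epsilon> j =
     (case j of 0 \<Rightarrow> a_kernel (F 0) M \<epsilon> | Suc i \<Rightarrow> a_kernel (F (Suc i)) (F i) (\<delta> i))"

lemma free_resolution_module: "free_resolution R M F \<delta> \<epsilon> \<Longrightarrow> module R (F j)"
  by (simp add: free_resolution_def free_module_def)

lemma free_resolution_exact:
  "free_resolution R M F \<delta> \<epsilon> \<Longrightarrow> \<delta> j ` carrier (F (Suc j)) = syzygy F \<delta> M \<epsilon> j"
  by (cases j) (simp_all add: free_resolution_def syzygy_def)

lemma syzygy_submodule:
  assumes "module R M" "free_resolution R M F \<delta> \<epsilon>"
  shows "submodule R (syzygy F \<delta> M \<epsilon> j) (F j)"
proof (cases j)
  case 0
  then show ?thesis unfolding syzygy_def using assms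
    by (simp add: kernel_submodule[OF free_resolution_module[OF assms(2)] assms(1)] free_resolution_def)
next
  case (Suc i)
  then show ?thesis unfolding syzygy_def using assms(2)
    by (simp add: kernel_submodule[OF free_resolution_module[OF assms(2)] free_resolution_module[OF assms(2)]]
        free_resolution_def)
qed

text \<open>The submodules \<open>K\<close> of \<open>F\<close> and \<open>L\<close> of \<open>G\<close> are isomorphic up to endomorphisms that extend to
  the ambient modules \<open>F\<close> and \<open>G\<close>. If \<open>F\<close> and \<open>G\<close> are free, this is an isomorphism in the stable
  category. The form avoids the notion of a homotopy and is what the computation of Tor
  consumes: \<open>u\<close> sends \<open>\<mm>F\<close> into \<open>\<mm>K\<close> because it is defined on all of \<open>F\<close>.\<close>
definition stably_equal where
  "stably_equal R F K G L \<longleftrightarrow> (\<exists>f g u v. f \<in> module_hom R F G \<and> g \<in> module_hom R G F \<and>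
     u \<in> module_hom R F F \<and> v \<in> module_hom R G G \<and>
     (\<forall>x\<in>K. f x \<in> L) \<and> (\<forall>y\<in>L. g y \<in> K) \<and>
     (\<forall>x\<in>carrier F. u x \<in> K) \<and> (\<forall>y\<in>carrier G. v y \<in> L) \<and>
     (\<forall>x\<in>K. g (f x) = u x \<oplus>\<^bsub>F\<^esub> x) \<and> (\<forall>y\<in>L. f (g y) = v y \<oplus>\<^bsub>G\<^esub> y))"

context comm_base begin

lemma stably_equal_step:
  fixes F :: "('a, 'f) module" and G :: "('a, 'g) module" and A :: "('a, 'm) module" and B :: "('a, 'n) module"
  assumes F: "free_module R F" and G: "free_module R G" and A: "module R A" and B: "module R B"
    and p: "p \<in> module_hom R F A" and q: "q \<in> module_hom R G B"
    and a: "a \<in> module_hom R A B" and b: "b \<in> module_hom R B A"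
    and apq: "\<And>x. x \<in> carrier F \<Longrightarrow> a (p x) \<in> q ` carrier G"
    and bqp: "\<And>y. y \<in> carrier G \<Longrightarrow> b (q y) \<in> p ` carrier F"
    and e: "e \<in> module_hom R A F"
    and pe: "\<And>x. x \<in> carrier F \<Longrightarrow> b (a (p x)) = p (e (p x)) \<oplus>\<^bsub>A\<^esub> p x"
    and e': "e' \<in> module_hom R B G"
    and qe: "\<And>y. y \<in> carrier G \<Longrightarrow> a (b (q y)) = q (e' (q y)) \<oplus>\<^bsub>B\<^esub> q y"
  shows "stably_equal R F (a_kernel F A p) G (a_kernel G B q)"
proof -
  have mF: "module R F" and mG: "module R G" using F G by (simp_all add: free_module_def)
  obtain f g where f: "f \<in> module_hom R F G" and g: "g \<in> module_hom R G F"
    and qf: "\<forall>x\<in>carrier F. q (f x) = a (p x)" and pg: "\<forall>y\<in>carrier G. p (g y) = b (q y)"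
    using comparison_step[OF F G A B p q a b apq bqp] by metis
  obtain u where u: "u \<in> module_hom R F F" "\<forall>x\<in>carrier F. u x \<in> a_kernel F A p"
      "\<forall>x\<in>a_kernel F A p. g (f x) = u x \<oplus>\<^bsub>F\<^esub> x"
    using comparison_homotopy[where a=a and b=b and q=q, OF mF A p f g bspec[OF qf] bspec[OF pg] e pe] by metis
  obtain v where v: "v \<in> module_hom R G G" "\<forall>x\<in>carrier G. v x \<in> a_kernel G B q"
      "\<forall>x\<in>a_kernel G B q. f (g x) = v x \<oplus>\<^bsub>G\<^esub> x"
    using comparison_homotopy[where a=b and b=a and q=p, OF mG B q g f bspec[OF pg] bspec[OF qf] e' qe] by metis
  have "f x \<in> a_kernel G B q" if "x \<in> a_kernel F A p" for x
    using that qf hom_in[OF f] hom_zero[OF A B a] by (simp add: a_kernel_def')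
  moreover have "g y \<in> a_kernel F A p" if "y \<in> a_kernel G B q" for y
    using that pg hom_in[OF g] hom_zero[OF B A b] by (simp add: a_kernel_def')
  ultimately show ?thesis unfolding stably_equal_def
    by (intro exI[of _ f] exI[of _ g] exI[of _ u] exI[of _ v] conjI f g u v ballI)
qed

text \<open>The comparison theorem for resolutions, by induction along the resolution. Since \<open>F j\<close> is
  projective, the error term \<open>u\<close> of one step lifts to \<open>F (Suc j)\<close>, which supplies the map \<open>e\<close> of the
  next step. In degree \<open>0\<close> the error term is \<open>0\<close>.\<close>
lemma syzygies_stably_equal:
  fixes M :: "('a, 'm) module" and F :: "nat \<Rightarrow> ('a, 'f) module" and G :: "nat \<Rightarrow> ('a, 'g) module"
  assumes M: "module R M" and resF: "free_resolution R M F \<delta> \<epsilon>" and resG: "free_resolution R M G \<gamma> \<eta>"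
  shows "stably_equal R (F j) (syzygy F \<delta> M \<epsilon> j) (G j) (syzygy G \<gamma> M \<eta> j)"
proof (induction j)
  case 0
  interpret M: module R M by (rule M)
  interpret F0: module R "F 0" by (rule free_resolution_module[OF resF])
  interpret G0: module R "G 0" by (rule free_resolution_module[OF resG])
  have F: "free_module R (F 0)" and \<epsilon>: "\<epsilon> \<in> module_hom R (F 0) M" "\<epsilon> ` carrier (F 0) = carrier M"
    using resF by (simp_all add: free_resolution_def)
  have G: "free_module R (G 0)" and \<eta>: "\<eta> \<in> module_hom R (G 0) M" "\<eta> ` carrier (G 0) = carrier M"
    using resG by (simp_all add: free_resolution_def)
  have id: "(\<lambda>x. x) \<in> module_hom R M M" by (rule module_homI) simp_all
  have zF: "(\<lambda>x. \<zero>\<^bsub>F 0\<^esub>) \<in> module_hom R M (F 0)" and zG: "(\<lambda>x. \<zero>\<^bsub>G 0\<^esub>) \<in> module_hom R M (G 0)"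
    by (rule module_homI; simp)+
  have "stably_equal R (F 0) (a_kernel (F 0) M \<epsilon>) (G 0) (a_kernel (G 0) M \<eta>)"
    by (rule stably_equal_step[OF F G M M \<epsilon>(1) \<eta>(1) id id _ _ zF _ zG])
      (use \<epsilon>(2) \<eta>(2) hom_in[OF \<epsilon>(1)] hom_in[OF \<eta>(1)] hom_zero[OF F0.module_axioms M \<epsilon>(1)]
         hom_zero[OF G0.module_axioms M \<eta>(1)] in \<open>simp_all\<close>)
  then show ?case by (simp add: syzygy_def)
next
  case (Suc j)
  let ?K = "syzygy F \<delta> M \<epsilon> j" and ?L = "syzygy G \<gamma> M \<eta> j"
  obtain f g u v where fg: "f \<in> module_hom R (F j) (G j)" "g \<in> module_hom R (G j) (F j)"
     "u \<in> module_hom R (F j) (F j)" "v \<in> module_hom R (G j) (G j)"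
     "\<forall>x\<in>?K. f x \<in> ?L" "\<forall>y\<in>?L. g y \<in> ?K"
     "\<forall>x\<in>carrier (F j). u x \<in> ?K" "\<forall>y\<in>carrier (G j). v y \<in> ?L"
     "\<forall>x\<in>?K. g (f x) = u x \<oplus>\<^bsub>F j\<^esub> x" "\<forall>y\<in>?L. f (g y) = v y \<oplus>\<^bsub>G j\<^esub> y"
    using Suc unfolding stably_equal_def by (elim exE conjE)
  have F: "free_module R (F i)" "\<delta> i \<in> module_hom R (F (Suc i)) (F i)" for i
    using resF by (simp_all add: free_resolution_def)
  have G: "free_module R (G i)" "\<gamma> i \<in> module_hom R (G (Suc i)) (G i)" for i
    using resG by (simp_all add: free_resolution_def)
  note mF = free_resolution_module[OF resF] and mG = free_resolution_module[OF resG]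
  note exF = free_resolution_exact[OF resF, of j] and exG = free_resolution_exact[OF resG, of j]
  have inK: "\<delta> j x \<in> ?K" if "x \<in> carrier (F (Suc j))" for x using that exF by blast
  have inL: "\<gamma> j y \<in> ?L" if "y \<in> carrier (G (Suc j))" for y using that exG by blast
  have "u ` carrier (F j) \<subseteq> \<delta> j ` carrier (F (Suc j))" using fg(7) unfolding exF by blast
  from free_module_lift[OF F(1) mF mF fg(3) F(2) this]
  obtain e where e: "e \<in> module_hom R (F j) (F (Suc j))" "\<forall>x\<in>carrier (F j). \<delta> j (e x) = u x" ..
  have "v ` carrier (G j) \<subseteq> \<gamma> j ` carrier (G (Suc j))" using fg(8) unfolding exG by blast
  from free_module_lift[OF G(1) mG mG fg(4) G(2) this]
  obtain e' where e': "e' \<in> module_hom R (G j) (G (Suc j))" "\<forall>x\<in>carrier (G j). \<gamma> j (e' x) = v x" ..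
  have "stably_equal R (F (Suc j)) (a_kernel (F (Suc j)) (F j) (\<delta> j))
      (G (Suc j)) (a_kernel (G (Suc j)) (G j) (\<gamma> j))"
  proof (rule stably_equal_step[OF F(1) G(1) mF mG F(2) G(2) fg(1,2) _ _ e(1) _ e'(1)])
    show "f (\<delta> j x) \<in> \<gamma> j ` carrier (G (Suc j))" if "x \<in> carrier (F (Suc j))" for x
      using inK[OF that] fg(5) unfolding exG by blast
    show "g (\<gamma> j y) \<in> \<delta> j ` carrier (F (Suc j))" if "y \<in> carrier (G (Suc j))" for y
      using inL[OF that] fg(6) unfolding exF by blast
    show "g (f (\<delta> j x)) = \<delta> j (e (\<delta> j x)) \<oplus>\<^bsub>F j\<^esub> \<delta> j x" if "x \<in> carrier (F (Suc j))" for x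
      using fg(9) inK[OF that] e(2) hom_in[OF F(2) that] by simp
    show "f (g (\<gamma> j y)) = \<gamma> j (e' (\<gamma> j y)) \<oplus>\<^bsub>G j\<^esub> \<gamma> j y" if "y \<in> carrier (G (Suc j))" for y
      using fg(10) inL[OF that] e'(2) hom_in[OF G(2) that] by simp
  qed
  then show ?case by (simp add: syzygy_def)
qed

end

lemma image_submodule:
  assumes "module R M" "module R N" "f \<in> module_hom R M N" "submodule R K M"
  shows "submodule R (f ` K) N"
proof (rule submoduleI'[OF assms(2)])
  have K: "K \<subseteq> carrier M" "\<zero>\<^bsub>M\<^esub> \<in> K" "\<And>x y. x \<in> K \<Longrightarrow> y \<in> K \<Longrightarrow> x \<oplus>\<^bsub>M\<^esub> y \<in> K"
    "\<And>r x. r \<in> carrier R \<Longrightarrow> x \<in> K \<Longrightarrow> r \<odot>\<^bsub>M\<^esub> x \<in> K"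
    using assms(4) by (auto simp: LinearCombinations.submodule_def)
  show "f ` K \<subseteq> carrier N" using K(1) hom_in[OF assms(3)] by auto
  show "\<zero>\<^bsub>N\<^esub> \<in> f ` K" using K(2) hom_zero[OF assms(1-3)] by (metis image_eqI)
  fix v w assume "v \<in> f ` K" "w \<in> f ` K"
  then obtain x y where xy: "x \<in> K" "y \<in> K" "v = f x" "w = f y" by auto
  then have "f (x \<oplus>\<^bsub>M\<^esub> y) = v \<oplus>\<^bsub>N\<^esub> w" using module_hom_add[OF assms(3)] K(1) by auto
  then show "v \<oplus>\<^bsub>N\<^esub> w \<in> f ` K" using K(3)[OF xy(1,2)] by (metis image_eqI)
next
  have K: "K \<subseteq> carrier M" "\<And>r x. r \<in> carrier R \<Longrightarrow> x \<in> K \<Longrightarrow> r \<odot>\<^bsub>M\<^esub> x \<in> K"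
    using assms(4) by (auto simp: LinearCombinations.submodule_def)
  fix c v assume c: "c \<in> carrier R" and "v \<in> f ` K"
  then obtain x where x: "x \<in> K" "v = f x" by auto
  then have "f (c \<odot>\<^bsub>M\<^esub> x) = c \<odot>\<^bsub>N\<^esub> v" using module_hom_smult[OF assms(3) c] K(1) by auto
  then show "c \<odot>\<^bsub>N\<^esub> v \<in> f ` K" using K(2)[OF c x(1)] by (metis image_eqI)
qed

lemma submodule_in: "submodule R K M \<Longrightarrow> x \<in> K \<Longrightarrow> x \<in> carrier M"
  by (auto simp: LinearCombinations.submodule_def)

lemma submodule_add: "submodule R K M \<Longrightarrow> x \<in> K \<Longrightarrow> y \<in> K \<Longrightarrow> x \<oplus>\<^bsub>M\<^esub> y \<in> K"
  by (auto simp: LinearCombinations.submodule_def)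

lemma submodule_zero: "submodule R K M \<Longrightarrow> \<zero>\<^bsub>M\<^esub> \<in> K"
  by (auto simp: LinearCombinations.submodule_def)

lemma submodule_smult: "submodule R K M \<Longrightarrow> r \<in> carrier R \<Longrightarrow> x \<in> K \<Longrightarrow> r \<odot>\<^bsub>M\<^esub> x \<in> K"
  by (auto simp: LinearCombinations.submodule_def)

lemma submodule_in_submodule:
  assumes "module R M" "submodule R K M" "submodule R D M" "D \<subseteq> K"
  shows "submodule R D (M\<lparr>carrier := K\<rparr>)"
  using assms submodule_as_module[OF assms(1,2)]
  by (intro submoduleI') (simp_all add: LinearCombinations.submodule_def)

lemma submodule_of_submodule:
  assumes "module R M" "submodule R K M" "submodule R D (M\<lparr>carrier := K\<rparr>)"
  shows "submodule R D M"
  using assms by (intro submoduleI'[OF assms(1)]) (auto simp: LinearCombinations.submodule_def)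

lemma finsum_in_submodule:
  assumes "submodule R K M" "finite T" "h \<in> T \<rightarrow> K"
  shows "finsum M h T \<in> K"
proof -
  interpret M: module R M using assms(1) by (simp add: LinearCombinations.submodule_def)
  show ?thesis using assms(2,3)
  proof (induction T)
    case (insert x T)
    have "h \<in> T \<rightarrow> carrier M" "h x \<in> carrier M" 
      using insert.prems submodule_in[OF assms(1)] by auto
    then have "finsum M h (insert x T) = h x \<oplus>\<^bsub>M\<^esub> finsum M h T"
      using insert.hyps by (intro M.finsum_insert)
    also have "\<dots> \<in> K" using insert by (intro submodule_add[OF assms(1)]) auto
    finally show ?case .
  qed (simp add: submodule_zero[OF assms(1)])
qed

context comm_base begin

lemma free_expand:
  assumes f: "f \<in> carrier (free_module_on R S)"
  shows "lin_ext (free_module_on R S) (free_gen R) f = f"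
proof -
  have g: "free_gen R \<in> S \<rightarrow> carrier (free_module_on R S)" using free_gen_in by auto
  have id: "(\<lambda>x. x) \<in> module_hom R (free_module_on R S) (free_module_on R S)"
    by (rule module_homI) (simp_all only:)
  show ?thesis
    by (rule free_hom_eqI[OF free_module_on_module lin_ext_hom[OF free_module_on_module g] id _ f])
      (rule lin_ext_gen[OF free_module_on_module g])
qed

lemma ideal_mult_free:
  assumes I: "ideal I R"
  shows "f \<in> ideal_mult I (free_module_on R S) \<longleftrightarrow>
    f \<in> carrier (free_module_on R S) \<and> (\<forall>s\<in>S. f s \<in> I)"
proof
  interpret I: ideal I R by (rule I)
  let ?F = "free_module_on R S"
  note sub = ideal_mult_submodule[OF free_module_on_module I]
  { assume "f \<in> ideal_mult I ?F"
    then have "f \<in> carrier ?F" "\<forall>s\<in>S. f s \<in> I"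
      by (rule submodule_in[OF sub], induct)
        (auto simp: I.I_r_closed free_module_on_in)
    then show "f \<in> carrier ?F \<and> (\<forall>s\<in>S. f s \<in> I)" .. }
  assume f: "f \<in> carrier ?F \<and> (\<forall>s\<in>S. f s \<in> I)"
  then have f1: "f \<in> carrier ?F" ..
  have "lin_ext ?F (free_gen R) f \<in> ideal_mult I ?F"
    unfolding lin_ext_def
  proof (rule finsum_in_submodule[OF sub free_module_on_fin[OF f1]], rule Pi_I)
    fix s assume "s \<in> {s. f s \<noteq> \<zero>}"
    then have "s \<in> S" using free_module_on_supp[OF f1] by blast
    then show "f s \<odot>\<^bsub>?F\<^esub> free_gen R s \<in> ideal_mult I ?F"
      using f free_gen_in by (intro ideal_mult.smult) auto
  qed
  then show "f \<in> ideal_mult I ?F" unfolding free_expand[OF f1] .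
qed

end

section \<open>Betti numbers from minimal resolutions\<close>

lemma some_resolution_resolution:
  fixes G :: "nat \<Rightarrow> ('r, nat \<Rightarrow> 'r) module"
  assumes "free_resolution R M G \<gamma> \<eta>"
  shows "\<exists>F \<delta> \<epsilon>. some_resolution R M = (F, \<delta>) \<and> free_resolution R M F \<delta> \<epsilon>"
proof -
  let ?P = "\<lambda>(F :: nat \<Rightarrow> ('r, nat \<Rightarrow> 'r) module, \<delta>). \<exists>\<epsilon>. free_resolution R M F \<delta> \<epsilon>"
  have "\<exists>z. ?P z" by (rule exI[of _ "(G, \<gamma>)"]) (use assms in auto)
  from someI_ex[OF this] have "?P (some_resolution R M)" unfolding some_resolution_def .
  then show ?thesis by (cases "some_resolution R M") auto
qed

context local_base begin

text \<open>By exactness, the boundaries of the complex \<open>\<kappa> \<otimes> F\<close> are therefore the images of the syzygies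
  under \<open>\<tau>\<close>.\<close>
lemma tensor_map_image:
  fixes F :: "('a, 'f) module" and G :: "('a, 'g) module"
  assumes F: "module R F" and G: "module R G" and f: "f \<in> module_hom R F G"
  shows "tensor_map R \<kappa> F G f ` carrier (tensor_module R \<kappa> F) = \<tau> G ` f ` carrier F"
  unfolding residue_tensor(3)[OF F, symmetric] image_image
  by (rule image_cong[OF refl]) (rule tensor_map_residue(2)[OF F G f])

lemma tau_in_image:
  fixes F :: "('a, 'f) module"
  assumes F: "module R F" and K: "submodule R K F" and x: "x \<in> carrier F"
  shows "\<tau> F x \<in> \<tau> F ` K \<longleftrightarrow> (\<exists>k\<in>K. x \<ominus>\<^bsub>F\<^esub> k \<in> ideal_mult \<mm> F)"
proof -
  interpret F: module R F by (rule F)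
  interpret T: module R "tensor_module R \<kappa> F" by (rule tensor_module_module[OF res_module F])
  note t = residue_tensor[OF F]
  have "\<tau> F x = \<tau> F k \<longleftrightarrow> x \<ominus>\<^bsub>F\<^esub> k \<in> ideal_mult \<mm> F" if "k \<in> K" for k
  proof -
    have k: "k \<in> carrier F" using submodule_in[OF K that] .
    have "\<tau> F (x \<ominus>\<^bsub>F\<^esub> k) = \<zero>\<^bsub>tensor_module R \<kappa> F\<^esub> \<longleftrightarrow> \<tau> F x = \<tau> F k"
      unfolding hom_minus[OF F T.module_axioms t(1) x k]
      by (rule minus_eq_zero_iff[OF T.abelian_group_axioms hom_in[OF t(1) x] hom_in[OF t(1) k]])
    then show ?thesis using t(4) x k by simp
  qed
  then show ?thesis by auto
qed

lemma residue_dim_Tor: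
  fixes V :: "('a, 'v) module"
  assumes fin: "finite S" and V: "module R V"
    and \<Omega>: "\<Omega> \<in> module_hom R (free_module_on R S) V"
    and surj: "carrier V \<subseteq> \<Omega> ` carrier (free_module_on R S)"
    and ker: "\<And>f. f \<in> carrier (free_module_on R S) \<Longrightarrow>
        \<Omega> f = \<zero>\<^bsub>V\<^esub> \<longleftrightarrow> f \<in> ideal_mult \<mm> (free_module_on R S)"
  shows "vectorspace.dim (residue_field R) (residue_space V) = card S"
proof (rule residue_dim[OF fin V \<Omega>])
  show "\<Omega> ` carrier (free_module_on R S) = carrier V" using surj hom_in[OF \<Omega>] by blast
  show "\<Omega> f = \<zero>\<^bsub>V\<^esub> \<longleftrightarrow> (\<forall>s\<in>S. f s \<in> \<mm>)" if "f \<in> carrier (free_module_on R S)" for f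
    using ker[OF that] ideal_mult_free[OF mm_ideal] that by blast
qed

context
  fixes M :: "('a, 'm) module" and S :: "nat \<Rightarrow> nat set" and \<gamma> \<eta>
  assumes M: "module R M" and fin: "\<And>j. finite (S j)"
    and resG: "free_resolution R M (\<lambda>j. free_module_on R (S j)) \<gamma> \<eta>"
    and min: "\<And>j. syzygy (\<lambda>j. free_module_on R (S j)) \<gamma> M \<eta> j \<subseteq> ideal_mult \<mm> (free_module_on R (S j))"
begin

abbreviation (input) "GG j \<equiv> free_module_on R (S j)"
abbreviation (input) "LL \<equiv> syzygy (\<lambda>j. free_module_on R (S j)) \<gamma> M \<eta>"

lemma modG: "module R (GG j)" by (rule free_module_on_module)

text \<open>By minimality an element of a term of the resolution lies in \<open>\<mm>G\<close> as soon as its image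
  lies in \<open>\<mm>\<close> times the image.\<close>
lemma minimal_cancel:
  fixes N :: "('a, 'n) module"
  assumes N: "module R N" and q: "q \<in> module_hom R (GG j) N" "q ` carrier (GG j) = carrier N"
    and ker: "\<And>y. y \<in> carrier (GG j) \<Longrightarrow> q y = \<zero>\<^bsub>N\<^esub> \<Longrightarrow> y \<in> LL j"
    and y: "y \<in> carrier (GG j)" "q y \<in> ideal_mult \<mm> N"
  shows "y \<in> ideal_mult \<mm> (GG j)"
proof -
  interpret G: module R "GG j" by (rule modG)
  interpret N: module R N by (rule N)
  obtain z where z: "z \<in> ideal_mult \<mm> (GG j)" "z \<in> carrier (GG j)" "q z = q y"
    using ideal_mult_lift[OF modG N q(1) mm_sub q(2) y(2)] by blast
  have "q (y \<ominus>\<^bsub>GG j\<^esub> z) = \<zero>\<^bsub>N\<^esub>"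
    unfolding hom_minus[OF modG N q(1) y(1) z(2)] z(3)
    using minus_eq_zero_iff[OF N.abelian_group_axioms hom_in[OF q(1) y(1)] hom_in[OF q(1) y(1)]] by simp
  then have "y \<ominus>\<^bsub>GG j\<^esub> z \<in> ideal_mult \<mm> (GG j)"
    using min ker[OF G.minus_closed[OF y(1) z(2)]] by blast
  then have "(y \<ominus>\<^bsub>GG j\<^esub> z) \<oplus>\<^bsub>GG j\<^esub> z \<in> ideal_mult \<mm> (GG j)"
    using z(1) by (rule submodule_add[OF ideal_mult_submodule[OF modG mm_ideal]])
  also have "(y \<ominus>\<^bsub>GG j\<^esub> z) \<oplus>\<^bsub>GG j\<^esub> z = y"
    using y(1) z(2) unfolding a_minus_def by (simp only: G.add.m_assoc G.l_neg G.a_inv_closed G.M.r_zero)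
  finally show ?thesis .
qed

text \<open>Both \<open>F 0\<close> and \<open>G 0\<close> present \<open>M\<close>, so \<open>\<kappa> \<otimes> F 0\<close> modulo the image of \<open>\<kappa> \<otimes> F 1\<close> is \<open>M / \<mm>M\<close>, which is
  \<open>G 0 / \<mm>(G 0)\<close> by minimality. The isomorphism is induced by a lift of the augmentations.\<close>
lemma betti_0: "betti R M 0 = card (S 0)"
proof -
  obtain F \<delta> \<epsilon> where some: "some_resolution R M = (F, \<delta>)" and resF: "free_resolution R M F \<delta> \<epsilon>"
    using some_resolution_resolution[OF resG] by blast
  note mF = free_resolution_module[OF resF]
  interpret F: module R "F 0" by (rule mF)
  interpret M: module R M by (rule M)
  have F: "free_module R (F i)" "\<delta> i \<in> module_hom R (F (Suc i)) (F i)" for i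
    using resF by (simp_all add: free_resolution_def)
  have G: "free_module R (GG i)" "\<gamma> i \<in> module_hom R (GG (Suc i)) (GG i)" for i
    using resG by (simp_all add: free_resolution_def)
  have \<epsilon>: "\<epsilon> \<in> module_hom R (F 0) M" "\<epsilon> ` carrier (F 0) = carrier M"
    using resF by (simp_all add: free_resolution_def)
  have \<eta>: "\<eta> \<in> module_hom R (GG 0) M" "\<eta> ` carrier (GG 0) = carrier M"
    using resG by (simp_all add: free_resolution_def)
  have "\<eta> ` carrier (GG 0) \<subseteq> \<epsilon> ` carrier (F 0)" unfolding \<epsilon>(2) \<eta>(2) by (rule subset_refl)
  from free_module_lift[OF G(1) mF M \<eta>(1) \<epsilon>(1) this]
  obtain g where g: "g \<in> module_hom R (GG 0) (F 0)" "\<forall>y\<in>carrier (GG 0). \<epsilon> (g y) = \<eta> y" ..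
  let ?C = "tensor_module R \<kappa> (F 0)" and ?K = "syzygy F \<delta> M \<epsilon> 0"
  let ?D = "\<tau> (F 0) ` ?K"
  have K: "submodule R ?K (F 0)" by (rule syzygy_submodule[OF M resF])
  have C: "module R ?C" by (rule tensor_module_module[OF res_module mF])
  note t = residue_tensor[OF mF[of 0]]
  have D: "submodule R ?D ?C" by (rule image_submodule[OF mF C t(1) K])
  note \<pi> = quotient_module_hom[OF D]
  have Tor: "Tor R \<kappa> M 0 = quotient_module ?C ?D"
    using tensor_map_image[OF mF mF F(2)] free_resolution_exact[OF resF, of 0]
    by (simp add: Tor_def some)
  let ?V = "quotient_module ?C ?D" and ?\<pi> = "\<lambda>z. ?D +>\<^bsub>?C\<^esub> z"
  have inK: "x \<in> ?K \<longleftrightarrow> x \<in> carrier (F 0) \<and> \<epsilon> x = \<zero>\<^bsub>M\<^esub>" for x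
    by (simp add: syzygy_def a_kernel_def')
  have sub: "w \<ominus>\<^bsub>F 0\<^esub> x \<in> ?K" if "w \<in> carrier (F 0)" "x \<in> carrier (F 0)" "\<epsilon> w = \<epsilon> x" for w x
    using that hom_minus[OF mF M \<epsilon>(1) that(1,2)] hom_in[OF \<epsilon>(1) that(2)]
      minus_eq_zero_iff[OF M.abelian_group_axioms]
    unfolding inK by simp
  have "vectorspace.dim (residue_field R) (residue_space ?V) = card (S 0)"
  proof (rule residue_dim_Tor[OF fin \<pi>(4) hom_comp[OF hom_comp[OF g(1) t(1)] \<pi>(1)]])
    show "carrier ?V \<subseteq> (\<lambda>y. ?\<pi> (\<tau> (F 0) (g y))) ` carrier (GG 0)"
    proof
      fix w assume "w \<in> carrier ?V"
      then obtain x where x: "x \<in> carrier (F 0)" "w = ?\<pi> (\<tau> (F 0) x)"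
        unfolding \<pi>(2)[symmetric] t(3)[symmetric] by blast
      have "\<epsilon> x \<in> \<eta> ` carrier (GG 0)" unfolding \<eta>(2) by (rule hom_in[OF \<epsilon>(1) x(1)])
      then obtain y where y: "y \<in> carrier (GG 0)" "\<epsilon> x = \<eta> y" by blast
      have gy: "g y \<in> carrier (F 0)" by (rule hom_in[OF g(1) y(1)])
      have "x \<ominus>\<^bsub>F 0\<^esub> g y \<in> ?K" using sub[OF x(1) gy] g(2) y by simp
      then have "\<tau> (F 0) x \<ominus>\<^bsub>?C\<^esub> \<tau> (F 0) (g y) \<in> ?D"
        using hom_minus[OF mF C t(1) x(1) gy] by (metis image_eqI)
      then have "w = ?\<pi> (\<tau> (F 0) (g y))"
        unfolding x(2) using quotient_coset_eq[OF D hom_in[OF t(1) x(1)] hom_in[OF t(1) gy]] by blast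
      then show "w \<in> (\<lambda>y. ?\<pi> (\<tau> (F 0) (g y))) ` carrier (GG 0)" using y(1) by (rule image_eqI)
    qed
    fix y assume y: "y \<in> carrier (GG 0)"
    have gy: "g y \<in> carrier (F 0)" by (rule hom_in[OF g(1) y])
    have "?\<pi> (\<tau> (F 0) (g y)) = \<zero>\<^bsub>?V\<^esub> \<longleftrightarrow> (\<exists>k\<in>?K. g y \<ominus>\<^bsub>F 0\<^esub> k \<in> ideal_mult \<mm> (F 0))"
      using \<pi>(3)[OF hom_in[OF t(1) gy]] tau_in_image[OF mF K gy] by blast
    also have "\<dots> \<longleftrightarrow> y \<in> ideal_mult \<mm> (GG 0)"
    proof
      assume "y \<in> ideal_mult \<mm> (GG 0)"
      then have "g y \<in> ideal_mult \<mm> (F 0)" by (rule ideal_mult_hom[OF modG mF g(1) mm_sub])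
      then have "g y \<ominus>\<^bsub>F 0\<^esub> \<zero>\<^bsub>F 0\<^esub> \<in> ideal_mult \<mm> (F 0)"
        unfolding minus_zero_right[OF F.abelian_group_axioms gy] .
      then show "\<exists>k\<in>?K. g y \<ominus>\<^bsub>F 0\<^esub> k \<in> ideal_mult \<mm> (F 0)"
        using submodule_zero[OF K] by blast
    next
      assume "\<exists>k\<in>?K. g y \<ominus>\<^bsub>F 0\<^esub> k \<in> ideal_mult \<mm> (F 0)"
      then obtain k where k: "k \<in> ?K" "g y \<ominus>\<^bsub>F 0\<^esub> k \<in> ideal_mult \<mm> (F 0)" ..
      then have k': "k \<in> carrier (F 0)" "\<epsilon> k = \<zero>\<^bsub>M\<^esub>" unfolding inK by simp_all
      have "\<epsilon> (g y \<ominus>\<^bsub>F 0\<^esub> k) = \<eta> y"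
        unfolding hom_minus[OF mF M \<epsilon>(1) gy k'(1)] k'(2)
        using g(2) y minus_zero_right[OF M.abelian_group_axioms hom_in[OF \<eta>(1) y]] by simp
      then have "\<eta> y \<in> ideal_mult \<mm> M"
        using ideal_mult_hom[OF mF M \<epsilon>(1) mm_sub k(2)] by simp
      then show "y \<in> ideal_mult \<mm> (GG 0)"
        by (intro minimal_cancel[OF M \<eta> _ y]) (simp_all add: syzygy_def a_kernel_def')
    qed
    finally show "?\<pi> (\<tau> (F 0) (g y)) = \<zero>\<^bsub>?V\<^esub> \<longleftrightarrow> y \<in> ideal_mult \<mm> (GG 0)" .
  qed
  then show ?thesis unfolding betti_def Tor .
qed

text \<open>Let \<open>K \<subseteq> F j\<close> and \<open>L \<subseteq> G j\<close> be the syzygies. Under \<open>\<delta>\<close>, the cycles of \<open>\<kappa> \<otimes> F\<close> in degree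
  \<open>j + 1\<close> correspond to the elements of \<open>K\<close> that lie in \<open>\<mm>(F j)\<close> (fact \<open>inZ\<close>), and the boundaries
  to \<open>\<mm>K\<close> (fact \<open>inD\<close>); so the homology is the part of \<open>K / \<mm>K\<close> that dies in \<open>F j / \<mm>(F j)\<close>. For the
  minimal resolution this is all of \<open>L / \<mm>L\<close>, and that has the dimension \<open>card (S (Suc j))\<close>.
  The maps of the stable equality induce inverse isomorphisms of the two spaces, because
  their error terms send \<open>\<mm>(F j)\<close> into \<open>\<mm>K\<close> and \<open>\<mm>(G j)\<close> into \<open>\<mm>L\<close>.\<close>
lemma betti_Suc: "betti R M (Suc j) = card (S (Suc j))"
proof -
  obtain F \<delta> \<epsilon> where some: "some_resolution R M = (F, \<delta>)" and resF: "free_resolution R M F \<delta> \<epsilon>"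
    using some_resolution_resolution[OF resG] by blast
  note mF = free_resolution_module[OF resF]
  interpret F: module R "F j" by (rule mF)
  interpret F1: module R "F (Suc j)" by (rule mF)
  have F: "free_module R (F i)" "\<delta> i \<in> module_hom R (F (Suc i)) (F i)" for i
    using resF by (simp_all add: free_resolution_def)
  have G: "free_module R (GG i)" "\<gamma> i \<in> module_hom R (GG (Suc i)) (GG i)" for i
    using resG by (simp_all add: free_resolution_def)
  let ?K = "syzygy F \<delta> M \<epsilon> j" and ?L = "LL j"
  let ?Km = "(F j)\<lparr>carrier := ?K\<rparr>" and ?Lm = "(GG j)\<lparr>carrier := ?L\<rparr>"
  note exF = free_resolution_exact[OF resF] and exG = free_resolution_exact[OF resG]
  have K: "submodule R ?K (F j)" by (rule syzygy_submodule[OF M resF])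
  have L: "submodule R ?L (GG j)" by (rule syzygy_submodule[OF M resG])
  have Km: "module R ?Km" by (rule submodule_as_module[OF mF K])
  have Lm: "module R ?Lm" by (rule submodule_as_module[OF modG L])
  obtain f g u v where fg: "f \<in> module_hom R (F j) (GG j)" "g \<in> module_hom R (GG j) (F j)"
     "u \<in> module_hom R (F j) (F j)" "v \<in> module_hom R (GG j) (GG j)"
     "\<forall>x\<in>?K. f x \<in> ?L" "\<forall>y\<in>?L. g y \<in> ?K"
     "\<forall>x\<in>carrier (F j). u x \<in> ?K" "\<forall>y\<in>carrier (GG j). v y \<in> ?L"
     "\<forall>x\<in>?K. g (f x) = u x \<oplus>\<^bsub>F j\<^esub> x" "\<forall>y\<in>?L. f (g y) = v y \<oplus>\<^bsub>GG j\<^esub> y"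
    using syzygies_stably_equal[OF M resF resG, of j] unfolding stably_equal_def by (elim exE conjE)
  have inK: "\<delta> j x \<in> ?K" if "x \<in> carrier (F (Suc j))" for x using that exF by blast
  have inL: "\<gamma> j y \<in> ?L" if "y \<in> carrier (GG (Suc j))" for y using that exG by blast
  have hom_K: "h \<in> module_hom R N ?Km" if "h \<in> module_hom R N (F j)" "\<forall>x\<in>carrier N. h x \<in> ?K"
    for h and N :: "('a, nat \<Rightarrow> 'a) module"
    using that unfolding module_hom_def by auto
  have hom_L: "h \<in> module_hom R N ?Lm" if "h \<in> module_hom R N (GG j)" "\<forall>x\<in>carrier N. h x \<in> ?L"
    for h and N :: "('a, nat \<Rightarrow> 'a) module"
    using that unfolding module_hom_def by auto
  have \<delta>K: "\<delta> j \<in> module_hom R (F (Suc j)) ?Km" using F(2) inK by (intro hom_K) auto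
  have \<gamma>L: "\<gamma> j \<in> module_hom R (GG (Suc j)) ?Lm" using G(2) inL by (intro hom_L) auto
  have uK: "u \<in> module_hom R (F j) ?Km" by (rule hom_K[OF fg(3,7)])
  have vL: "v \<in> module_hom R (GG j) ?Lm" by (rule hom_L[OF fg(4,8)])
  have fKL: "f \<in> module_hom R ?Km ?Lm"
    by (rule hom_restrict[OF fg(1)]) (use submodule_in[OF K] fg(5) in auto)
  have gLK: "g \<in> module_hom R ?Lm ?Km"
    by (rule hom_restrict[OF fg(2)]) (use submodule_in[OF L] fg(6) in auto)
  let ?mK = "ideal_mult \<mm> ?Km" and ?mL = "ideal_mult \<mm> ?Lm"
  have mK: "submodule R ?mK (F j)"
    by (rule submodule_of_submodule[OF mF K ideal_mult_submodule[OF Km mm_ideal]])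
  have mL: "submodule R ?mL (GG j)"
    by (rule submodule_of_submodule[OF modG L ideal_mult_submodule[OF Lm mm_ideal]])
  have "(\<lambda>y. g (\<gamma> j y)) ` carrier (GG (Suc j)) \<subseteq> \<delta> j ` carrier (F (Suc j))"
    using fg(6) inL unfolding exF by auto
  from free_module_lift[OF G(1) mF mF hom_comp[OF G(2) fg(2)] F(2) this]
  obtain g1 where g1: "g1 \<in> module_hom R (GG (Suc j)) (F (Suc j))"
      "\<forall>y\<in>carrier (GG (Suc j)). \<delta> j (g1 y) = g (\<gamma> j y)" ..

  let ?C1 = "tensor_module R \<kappa> (F (Suc j))" and ?C = "tensor_module R \<kappa> (F j)"
  let ?t1 = "\<tau> (F (Suc j))" and ?t = "\<tau> (F j)"
  let ?K1 = "syzygy F \<delta> M \<epsilon> (Suc j)"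
  let ?D = "?t1 ` ?K1" and ?\<Delta> = "tensor_map R \<kappa> (F (Suc j)) (F j) (\<delta> j)"
  let ?Z = "a_kernel ?C1 ?C ?\<Delta>"
  let ?Zm = "?C1\<lparr>carrier := ?Z\<rparr>"
  have K1: "submodule R ?K1 (F (Suc j))" by (rule syzygy_submodule[OF M resF])
  have C1: "module R ?C1" and C: "module R ?C"
    by (rule tensor_module_module[OF res_module mF])+
  note t1 = residue_tensor[OF mF[of "Suc j"]] and t = residue_tensor[OF mF[of j]]
  note \<Delta> = tensor_map_residue[OF mF mF F(2)[of j]]
  have Z: "submodule R ?Z ?C1" by (rule kernel_submodule[OF C1 C \<Delta>(1)])
  have inZ: "?t1 x \<in> ?Z \<longleftrightarrow> \<delta> j x \<in> ideal_mult \<mm> (F j)" if x: "x \<in> carrier (F (Suc j))" for x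
    using x \<Delta>(2)[OF x] t(4)[OF hom_in[OF F(2) x]] hom_in[OF t1(1) x]
    unfolding a_kernel_def' by simp
  have in_K1: "x \<in> ?K1 \<longleftrightarrow> x \<in> carrier (F (Suc j)) \<and> \<delta> j x = \<zero>\<^bsub>F j\<^esub>" for x
    by (simp add: syzygy_def a_kernel_def')
  have DZ: "?D \<subseteq> ?Z"
    using inZ submodule_zero[OF ideal_mult_submodule[OF mF mm_ideal]] in_K1 by auto
  have D: "submodule R ?D ?C1" by (rule image_submodule[OF mF C1 t1(1) K1])
  have D': "submodule R ?D ?Zm" by (rule submodule_in_submodule[OF C1 Z D DZ])
  have inD: "?t1 x \<in> ?D \<longleftrightarrow> \<delta> j x \<in> ?mK" if x: "x \<in> carrier (F (Suc j))" for x
  proof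
    assume "?t1 x \<in> ?D"
    then obtain k where k: "k \<in> ?K1" "x \<ominus>\<^bsub>F (Suc j)\<^esub> k \<in> ideal_mult \<mm> (F (Suc j))"
      using tau_in_image[OF mF K1 x] by blast
    have k': "k \<in> carrier (F (Suc j))" "\<delta> j k = \<zero>\<^bsub>F j\<^esub>" using k(1) unfolding in_K1 by simp_all
    have "\<delta> j (x \<ominus>\<^bsub>F (Suc j)\<^esub> k) = \<delta> j x"
      unfolding hom_minus[OF mF mF F(2) x k'(1)] k'(2)
      by (rule minus_zero_right[OF F.abelian_group_axioms hom_in[OF F(2) x]])
    then show "\<delta> j x \<in> ?mK" using ideal_mult_hom[OF mF Km \<delta>K mm_sub k(2)] by simp
  next
    assume "\<delta> j x \<in> ?mK"
    moreover have "\<delta> j ` carrier (F (Suc j)) = carrier ?Km" using exF by simp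
    ultimately obtain x' where x': "x' \<in> ideal_mult \<mm> (F (Suc j))" "x' \<in> carrier (F (Suc j))" "\<delta> j x' = \<delta> j x"
      using ideal_mult_lift[OF mF Km \<delta>K mm_sub] by blast
    let ?k = "x \<ominus>\<^bsub>F (Suc j)\<^esub> x'"
    have "\<delta> j ?k = \<zero>\<^bsub>F j\<^esub>"
      unfolding hom_minus[OF mF mF F(2) x x'(2)] x'(3)
      using minus_eq_zero_iff[OF F.abelian_group_axioms hom_in[OF F(2) x] hom_in[OF F(2) x]] by simp
    then have "?k \<in> ?K1" unfolding in_K1 using x x'(2) by simp
    moreover have "x \<ominus>\<^bsub>F (Suc j)\<^esub> ?k = x'"
      using x x'(2) by (simp add: a_minus_def F1.minus_add F1.M.minus_minus F1.add.m_assoc[symmetric] F1.r_neg)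
    ultimately show "?t1 x \<in> ?D" using tau_in_image[OF mF K1 x] x'(1) by metis
  qed
  have Tor: "Tor R \<kappa> M (Suc j) = quotient_module ?Zm ?D"
    using tensor_map_image[OF mF mF F(2)] exF
    by (simp add: Tor_def some homology_def)
  note \<pi> = quotient_module_hom[OF D']
  let ?V = "quotient_module ?Zm ?D" and ?\<pi> = "\<lambda>z. ?D +>\<^bsub>?Zm\<^esub> z"
  have g1_in: "g1 y \<in> carrier (F (Suc j))" if "y \<in> carrier (GG (Suc j))" for y
    by (rule hom_in[OF g1(1) that])
  have g1_Z: "?t1 (g1 y) \<in> ?Z" if "y \<in> carrier (GG (Suc j))" for y
  proof -
    have "g (\<gamma> j y) \<in> ideal_mult \<mm> (F j)"
      using ideal_mult_hom[OF modG mF fg(2) mm_sub] inL[OF that] min by blast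
    then show ?thesis using inZ[OF g1_in[OF that]] g1(2) that by simp
  qed
  have \<omega>: "(\<lambda>y. ?t1 (g1 y)) \<in> module_hom R (GG (Suc j)) ?Zm"
    using hom_comp[OF g1(1) t1(1)] g1_Z unfolding module_hom_def by simp
  have "vectorspace.dim (residue_field R) (residue_space ?V) = card (S (Suc j))"
  proof (rule residue_dim_Tor[OF fin \<pi>(4) hom_comp[OF \<omega> \<pi>(1)]])
    show "carrier ?V \<subseteq> (\<lambda>y. ?\<pi> (?t1 (g1 y))) ` carrier (GG (Suc j))"
    proof
      fix w assume "w \<in> carrier ?V"
      then obtain z where z: "z \<in> ?Z" "w = ?\<pi> z" unfolding \<pi>(2)[symmetric] by auto
      then have "z \<in> carrier ?C1" using submodule_in[OF Z] by blast
      then obtain x where x: "x \<in> carrier (F (Suc j))" "z = ?t1 x" unfolding t1(3)[symmetric] by blast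
      have \<delta>x: "\<delta> j x \<in> ideal_mult \<mm> (F j)" using z(1) inZ[OF x(1)] x(2) by simp
      have "f (\<delta> j x) \<in> \<gamma> j ` carrier (GG (Suc j))" using fg(5) inK[OF x(1)] unfolding exG by blast
      then obtain y where y: "y \<in> carrier (GG (Suc j))" "f (\<delta> j x) = \<gamma> j y" by blast
      note gy = g1_in[OF y(1)]
      let ?d = "x \<ominus>\<^bsub>F (Suc j)\<^esub> g1 y"
      have d: "?d \<in> carrier (F (Suc j))" using x(1) gy by simp
      have ud: "u (\<delta> j x) \<in> ?mK" by (rule ideal_mult_hom[OF mF Km uK mm_sub \<delta>x])
      have dx: "\<delta> j x \<in> carrier (F j)" "u (\<delta> j x) \<in> carrier (F j)"
        using hom_in[OF F(2) x(1)] hom_in[OF fg(3)] by auto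
      have "\<delta> j ?d = \<delta> j x \<ominus>\<^bsub>F j\<^esub> (u (\<delta> j x) \<oplus>\<^bsub>F j\<^esub> \<delta> j x)"
        using hom_minus[OF mF mF F(2) x(1) gy] bspec[OF g1(2) y(1)]
          bspec[OF fg(9) inK[OF x(1)], unfolded y(2)] by (simp only:)
      also have "\<dots> = \<zero>\<^bsub>F j\<^esub> \<ominus>\<^bsub>F j\<^esub> u (\<delta> j x)"
        using dx by (simp add: a_minus_def F.minus_add F.add.m_lcomm[of "\<delta> j x"] F.r_neg)
      also have "\<dots> \<in> ?mK" by (rule submodule_minus[OF mK submodule_zero[OF mK] ud])
      finally have "?t1 ?d \<in> ?D" using inD[OF d] by blast
      moreover from this have "?\<pi> (?t1 ?d) = \<zero>\<^bsub>?V\<^esub>" using \<pi>(3)[of "?t1 ?d"] DZ by auto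
      moreover have "z = ?t1 ?d \<oplus>\<^bsub>?C1\<^esub> ?t1 (g1 y)"
        using module_hom_add[OF t1(1) d gy] x gy
        by (simp add: a_minus_def F1.add.m_assoc F1.l_neg)
      moreover interpret V: module R ?V by (rule \<pi>(4))
      have "?\<pi> (?t1 ?d \<oplus>\<^bsub>?C1\<^esub> ?t1 (g1 y)) = ?\<pi> (?t1 ?d) \<oplus>\<^bsub>?V\<^esub> ?\<pi> (?t1 (g1 y))"
        using module_hom_add[OF \<pi>(1), of "?t1 ?d" "?t1 (g1 y)"] g1_Z[OF y(1)] calculation(1) DZ by auto
      moreover have "?\<pi> (?t1 (g1 y)) \<in> carrier ?V"
        using hom_in[OF \<pi>(1), of "?t1 (g1 y)"] g1_Z[OF y(1)] by simp
      ultimately have "w = ?\<pi> (?t1 (g1 y))" using z(2) V.M.l_zero by simp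
      then show "w \<in> (\<lambda>y. ?\<pi> (?t1 (g1 y))) ` carrier (GG (Suc j))" using y(1) by (rule image_eqI)
    qed
    fix y assume y: "y \<in> carrier (GG (Suc j))"
    have "?\<pi> (?t1 (g1 y)) = \<zero>\<^bsub>?V\<^esub> \<longleftrightarrow> g (\<gamma> j y) \<in> ?mK"
      using \<pi>(3)[of "?t1 (g1 y)"] g1_Z[OF y] inD[OF g1_in[OF y]] g1(2) y by simp
    also have "\<dots> \<longleftrightarrow> y \<in> ideal_mult \<mm> (GG (Suc j))"
    proof
      assume "y \<in> ideal_mult \<mm> (GG (Suc j))"
      then show "g (\<gamma> j y) \<in> ?mK"
        by (rule ideal_mult_hom[OF modG Km hom_comp[OF \<gamma>L gLK] mm_sub])
    next
      assume "g (\<gamma> j y) \<in> ?mK"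
      then have "f (g (\<gamma> j y)) \<in> ?mL" by (rule ideal_mult_hom[OF Km Lm fKL mm_sub])
      moreover have "v (\<gamma> j y) \<in> ?mL"
        using ideal_mult_hom[OF modG Lm vL mm_sub] inL[OF y] min by blast
      ultimately have "f (g (\<gamma> j y)) \<ominus>\<^bsub>GG j\<^esub> v (\<gamma> j y) \<in> ?mL" by (rule submodule_minus[OF mL])
      also have "f (g (\<gamma> j y)) = v (\<gamma> j y) \<oplus>\<^bsub>GG j\<^esub> \<gamma> j y" using fg(10) inL[OF y] by blast
      also have "(v (\<gamma> j y) \<oplus>\<^bsub>GG j\<^esub> \<gamma> j y) \<ominus>\<^bsub>GG j\<^esub> v (\<gamma> j y) = \<gamma> j y"
      proof -
        interpret G: module R "GG j" by (rule modG)
        have "v (\<gamma> j y) \<in> carrier (GG j)" "\<gamma> j y \<in> carrier (GG j)"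
          using hom_in[OF G(2) y] hom_in[OF fg(4)] by auto
        then show ?thesis unfolding a_minus_def
          by (simp only: G.add.m_comm[of "v (\<gamma> j y)"] G.add.m_assoc G.r_neg G.M.r_zero G.a_inv_closed)
      qed
      finally have *: "\<gamma> j y \<in> ?mL" .
      have ex: "\<gamma> j ` carrier (GG (Suc j)) = carrier ?Lm" using exG by simp
      show "y \<in> ideal_mult \<mm> (GG (Suc j))"
        by (rule minimal_cancel[OF Lm \<gamma>L ex _ y *]) (simp add: syzygy_def a_kernel_def')
    qed
    finally show "?\<pi> (?t1 (g1 y)) = \<zero>\<^bsub>?V\<^esub> \<longleftrightarrow> y \<in> ideal_mult \<mm> (GG (Suc j))" .
  qed
  then show ?thesis unfolding betti_def Tor .
qed

lemma betti_minimal: "betti R M i = card (S i)"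
  using betti_0 betti_Suc by (cases i) simp_all

end
end

section \<open>Existence of minimal resolutions\<close>

context comm_base begin

lemma free_module_free_module_on: "\<one> \<noteq> \<zero> \<Longrightarrow> free_module R (free_module_on R S)"
  by (rule free_moduleI[where \<theta>="\<lambda>x. x"])
    (simp_all add: free_module_on_module bij_betw_def module_hom_def)

text \<open>Generators are indexed by natural numbers so that all terms of a resolution have the same
  type.\<close>
definition fin_pres :: "nat set \<Rightarrow> ((nat \<Rightarrow> 'a) \<Rightarrow> 'm) \<Rightarrow> ('a, 'm) module \<Rightarrow> bool" where
  "fin_pres S p N \<longleftrightarrow> finite S \<and> p \<in> module_hom R (free_module_on R S) N \<and>
     p ` carrier (free_module_on R S) = carrier N"

lemma finitely_generated_pres:
  fixes M :: "('a, 'm) module"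
  assumes M: "module R M" and fg: "finitely_generated R M"
  shows "\<exists>S p. fin_pres S p M"
proof -
  interpret M: module R M by (rule M)
  obtain A where A: "finite A" "A \<subseteq> carrier M" "M.span A = carrier M"
    using fg unfolding finitely_generated_def by blast
  obtain h where h: "bij_betw h {0..<card A} A" using ex_bij_betw_nat_finite[OF A(1)] ..
  let ?S = "{0..<card A}"
  have h': "h \<in> ?S \<rightarrow> carrier M" using h A(2) by (auto simp: bij_betw_def)
  note hom = lin_ext_hom[OF M h']
  let ?W = "lin_ext M h ` carrier (free_module_on R ?S)"
  have W: "submodule R ?W M"
    by (rule image_submodule[OF free_module_on_module M hom])
      (rule submoduleI'[OF free_module_on_module], simp_all add: free_module_on_add free_module_on_smult
        free_module_on_carrier[of "\<lambda>s. \<zero>"])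
  have "A \<subseteq> ?W"
  proof
    fix a assume "a \<in> A"
    then obtain i where i: "i \<in> ?S" "a = h i" using h unfolding bij_betw_def by blast
    show "a \<in> ?W" unfolding i(2) lin_ext_gen[OF M h' i(1), symmetric]
      by (rule imageI) (rule free_gen_in[OF i(1)])
  qed
  then have "M.span A \<subseteq> ?W" using W by (rule M.span_is_subset)
  then have "fin_pres ?S (lin_ext M h) M"
    unfolding fin_pres_def using hom hom_in[OF hom] A(3) by auto
  then show ?thesis by blast
qed

end

context local_base begin

text \<open>A relation with a unit coefficient makes one of the generators redundant.\<close>
lemma redundant_generator:
  fixes N :: "('a, 'm) module"
  assumes N: "module R N" and p: "fin_pres S p N" and f: "f \<in> carrier (free_module_on R S)"
    and pf: "p f = \<zero>\<^bsub>N\<^esub>" and s: "s \<in> S" "f s \<notin> \<mm>"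
  shows "fin_pres (S - {s}) p N"
proof -
  let ?F = "free_module_on R S" and ?F' = "free_module_on R (S - {s})"
  interpret N: module R N by (rule N)
  interpret F: module R ?F by (rule free_module_on_module)
  have fin: "finite S" and hom: "p \<in> module_hom R ?F N" and surj: "p ` carrier ?F = carrier N"
    using p by (simp_all add: fin_pres_def)
  have sub: "carrier ?F' \<subseteq> carrier ?F"
  proof
    fix x assume x: "x \<in> carrier ?F'"
    then show "x \<in> carrier ?F"
      using free_module_on_in[OF x] by (simp add: free_module_on_carrier)
  qed
  have hom': "p \<in> module_hom R ?F' N"
    using hom sub unfolding module_hom_def by (auto simp: subset_iff)
  let ?W = "p ` carrier ?F'"
  have W: "submodule R ?W N"
    by (rule image_submodule[OF free_module_on_module N hom'])
      (rule submoduleI'[OF free_module_on_module], simp_all add: free_module_on_add free_module_on_smult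
        free_module_on_carrier[of "\<lambda>s. \<zero>"])
  let ?f' = "f(s := \<zero>)"
  have "finite {t. ?f' t \<noteq> \<zero>}"
    by (rule finite_subset[OF _ free_module_on_fin[OF f]]) auto
  then have f': "?f' \<in> carrier ?F'"
    using f by (auto simp: free_module_on_carrier)
  have fs: "f s \<in> Units R" using units[OF free_module_on_in[OF f] s(2)] .
  have e: "free_gen R s \<in> carrier ?F" by (rule free_gen_in[OF s(1)])
  have fse: "f s \<odot>\<^bsub>?F\<^esub> free_gen R s \<in> carrier ?F" using e free_module_on_in[OF f] by (intro F.smult_closed)
  have "f = ?f' \<oplus>\<^bsub>?F\<^esub> (f s \<odot>\<^bsub>?F\<^esub> free_gen R s)"
    using free_module_on_in[OF f] by (auto simp: free_gen_def fun_eq_iff)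
  then have "p f = p ?f' \<oplus>\<^bsub>N\<^esub> f s \<odot>\<^bsub>N\<^esub> p (free_gen R s)"
    using module_hom_add[OF hom _ fse, of ?f'] f' sub module_hom_smult[OF hom free_module_on_in[OF f] e]
    by (metis subsetD)
  then have "f s \<odot>\<^bsub>N\<^esub> p (free_gen R s) = \<zero>\<^bsub>N\<^esub> \<ominus>\<^bsub>N\<^esub> p ?f'"
    using pf hom_in[OF hom' f'] hom_in[OF hom e] free_module_on_in[OF f]
      N.minus_equality[of "f s \<odot>\<^bsub>N\<^esub> p (free_gen R s)" "p ?f'"]
    by (simp add: a_minus_def N.add.m_comm)
  also have "\<dots> \<in> ?W" using submodule_minus[OF W submodule_zero[OF W]] f' by blast
  finally have "f s \<odot>\<^bsub>N\<^esub> p (free_gen R s) \<in> ?W" .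
  then have "inv (f s) \<odot>\<^bsub>N\<^esub> (f s \<odot>\<^bsub>N\<^esub> p (free_gen R s)) \<in> ?W"
    by (rule submodule_smult[OF W Units_inv_closed[OF fs]])
  also have "inv (f s) \<odot>\<^bsub>N\<^esub> (f s \<odot>\<^bsub>N\<^esub> p (free_gen R s)) = p (free_gen R s)"
    using fs hom_in[OF hom e] free_module_on_in[OF f, of s]
    by (simp add: N.smult_assoc1[symmetric])
  finally have ps: "p (free_gen R s) \<in> ?W" .
  have all: "x \<in> {x \<in> carrier ?F. p x \<in> ?W}" if "x \<in> carrier ?F" for x
  proof (rule free_module_induct[OF preimage_submodule[OF F.module_axioms hom W] _ that])
    fix t assume t: "t \<in> S"
    have "p (free_gen R t) \<in> ?W"
    proof (cases "t = s")
      case False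
      then show ?thesis using t by (intro imageI free_gen_in) auto
    qed (simp add: ps)
    then show "free_gen R t \<in> {x \<in> carrier ?F. p x \<in> ?W}" using free_gen_in[OF t] by simp
  qed
  have "?W = carrier N"
  proof
    show "?W \<subseteq> carrier N" by (rule image_subsetI) (rule hom_in[OF hom'])
    show "carrier N \<subseteq> ?W" unfolding surj[symmetric] by (rule image_subsetI) (use all in simp)
  qed
  then show ?thesis unfolding fin_pres_def using fin hom' by simp
qed

text \<open>A presentation with the least number of generators has no redundant one.\<close>
lemma minimal_presentation:
  fixes N :: "('a, 'm) module"
  assumes N: "module R N" and ex: "fin_pres S0 p0 N"
  shows "\<exists>S p. fin_pres S p N \<and>
    a_kernel (free_module_on R S) N p \<subseteq> ideal_mult \<mm> (free_module_on R S)"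
proof -
  define P where "P n \<longleftrightarrow> (\<exists>S p. fin_pres S p N \<and> card S = n)" for n
  have "P (card S0)" unfolding P_def using ex by blast
  then have "P (LEAST n. P n)" by (rule LeastI)
  then obtain S p where p: "fin_pres S p N" "card S = (LEAST n. P n)" unfolding P_def by blast
  have "f \<in> ideal_mult \<mm> (free_module_on R S)" if "f \<in> a_kernel (free_module_on R S) N p" for f
  proof (rule ccontr)
    assume f': "f \<notin> ideal_mult \<mm> (free_module_on R S)"
    have f: "f \<in> carrier (free_module_on R S)" "p f = \<zero>\<^bsub>N\<^esub>" using that by (simp_all add: a_kernel_def')
    then obtain s where s: "s \<in> S" "f s \<notin> \<mm>" using f' ideal_mult_free[OF mm_ideal] by blast
    have "P (card (S - {s}))" unfolding P_def using redundant_generator[OF N p(1) f s] by blast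
    then have "card S \<le> card (S - {s})" unfolding p(2) by (rule Least_le)
    moreover have "card (S - {s}) < card S"
      using p(1) s(1) by (intro psubset_card_mono) (auto simp: fin_pres_def)
    ultimately show False by simp
  qed
  then show ?thesis using p(1) by blast
qed

text \<open>The resolution is built by dependent choice. A state \<open>(S, K)\<close> consists of the index set of the
  current free module and of the syzygy in it; the differentials are chosen afterwards.\<close>
theorem minimal_resolution:
  fixes M :: "('a, 'm) module"
  assumes M: "module R M" and fg: "finitely_generated R M"
    and noetherian: "\<And>(S :: nat set) P. finite S \<Longrightarrow> submodule R P (free_module_on R S) \<Longrightarrow>
      \<exists>T p. fin_pres T p ((free_module_on R S)\<lparr>carrier := P\<rparr>)"
  shows "\<exists>(S :: nat \<Rightarrow> nat set) \<gamma> \<eta>. (\<forall>j. finite (S j)) \<and> free_resolution R M (\<lambda>j. free_module_on R (S j)) \<gamma> \<eta> \<and>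
    (\<forall>j. syzygy (\<lambda>j. free_module_on R (S j)) \<gamma> M \<eta> j \<subseteq> ideal_mult \<mm> (free_module_on R (S j)))"
proof -
  let ?F = "\<lambda>S :: nat set. free_module_on R S"
  obtain S0 \<eta> where \<eta>: "fin_pres S0 \<eta> M" "a_kernel (?F S0) M \<eta> \<subseteq> ideal_mult \<mm> (?F S0)"
    using minimal_presentation[OF M] finitely_generated_pres[OF M fg] by blast
  define K0 where "K0 = a_kernel (?F S0) M \<eta>"
  define P where "P n z \<longleftrightarrow> (case z of (S, K) \<Rightarrow> finite S \<and> submodule R K (?F S) \<and>
      K \<subseteq> ideal_mult \<mm> (?F S) \<and> (n = (0::nat) \<longrightarrow> z = (S0, K0)))" for n z
  define Q where "Q z z' \<longleftrightarrow> (\<exists>q. q \<in> module_hom R (?F (fst z')) (?F (fst z)) \<and>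
      q ` carrier (?F (fst z')) = snd z \<and> snd z' = a_kernel (?F (fst z')) (?F (fst z)) q)" for z z'
  have "\<exists>h. \<forall>n. P n (h n) \<and> Q (h n) (h (Suc n))"
  proof (rule dependent_nat_choice)
    have "P 0 (S0, K0)"
      unfolding P_def K0_def using \<eta>
      by (simp add: fin_pres_def kernel_submodule[OF free_module_on_module M])
    then show "\<exists>z. P 0 z" by blast
    fix z n assume "P n z"
    then obtain S K where z: "z = (S, K)" "finite S" "submodule R K (?F S)" unfolding P_def by auto
    let ?K = "(?F S)\<lparr>carrier := K\<rparr>"
    have Km: "module R ?K" by (rule submodule_as_module[OF free_module_on_module z(3)])
    obtain T q where q: "fin_pres T q ?K" "a_kernel (?F T) ?K q \<subseteq> ideal_mult \<mm> (?F T)"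
      using minimal_presentation[OF Km] noetherian[OF z(2,3)] by blast
    have hom: "q \<in> module_hom R (?F T) (?F S)"
      using q(1) submodule_in[OF z(3)] unfolding fin_pres_def module_hom_def by auto
    have ker: "a_kernel (?F T) ?K q = a_kernel (?F T) (?F S) q" by (simp add: a_kernel_def')
    have "P (Suc n) (T, a_kernel (?F T) (?F S) q)"
      using q ker kernel_submodule[OF free_module_on_module free_module_on_module hom]
      by (simp add: P_def fin_pres_def)
    moreover have "Q z (T, a_kernel (?F T) (?F S) q)"
      unfolding Q_def z(1) using hom q(1) by (intro exI[of _ q]) (simp add: fin_pres_def)
    ultimately show "\<exists>z'. P (Suc n) z' \<and> Q z z'" by blast
  qed
  then obtain h where h: "\<And>n. P n (h n)" "\<And>n. Q (h n) (h (Suc n))" by blast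
  define S where "S n = fst (h n)" for n
  define K where "K n = snd (h n)" for n
  have S: "finite (S n)" "K n \<subseteq> ideal_mult \<mm> (?F (S n))" for n
    using h(1)[of n] by (auto simp: P_def S_def K_def split: prod.splits)
  have 0: "S 0 = S0" "K 0 = K0" using h(1)[of 0] by (auto simp: P_def S_def K_def split: prod.splits)
  have "\<forall>n. \<exists>q. q \<in> module_hom R (?F (S (Suc n))) (?F (S n)) \<and>
      q ` carrier (?F (S (Suc n))) = K n \<and> K (Suc n) = a_kernel (?F (S (Suc n))) (?F (S n)) q"
    using h(2) unfolding Q_def S_def K_def by blast
  from choice[OF this] obtain \<gamma> where \<gamma>: "\<forall>n. \<gamma> n \<in> module_hom R (?F (S (Suc n))) (?F (S n)) \<and>
      \<gamma> n ` carrier (?F (S (Suc n))) = K n \<and> K (Suc n) = a_kernel (?F (S (Suc n))) (?F (S n)) (\<gamma> n)" ..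
  have syz: "syzygy (\<lambda>j. ?F (S j)) \<gamma> M \<eta> j = K j" for j
    using \<gamma> 0 by (cases j) (simp_all add: syzygy_def K0_def)
  have free: "free_module R (?F T)" for T by (rule free_module_free_module_on[OF one_not_zero])
  have "free_resolution R M (\<lambda>j. ?F (S j)) \<gamma> \<eta>"
    unfolding free_resolution_def
    using \<gamma> 0 \<eta>(1) free
    by (simp add: fin_pres_def K0_def)
  then show ?thesis using S syz by (intro exI[of _ S] exI[of _ \<gamma>] exI[of _ \<eta>]) simp
qed

end

section \<open>Counting dimensions\<close>

context vector_space begin

text \<open>Finite dimension is a property of subspaces here, since the ambient function spaces are
  infinite-dimensional.\<close>
definition fin_dim_set :: "'b set \<Rightarrow> bool" where
  "fin_dim_set U \<longleftrightarrow> (\<exists>B. finite B \<and> U \<subseteq> span B)"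

lemma fin_dim_set_subset: "fin_dim_set U \<Longrightarrow> W \<subseteq> U \<Longrightarrow> fin_dim_set W"
  unfolding fin_dim_set_def by blast

lemma fin_dim_set_basis:
  assumes "fin_dim_set U"
  obtains B where "finite B" "B \<subseteq> U" "independent B" "U \<subseteq> span B" "card B = dim U"
proof -
  obtain B where B: "B \<subseteq> U" "independent B" "U \<subseteq> span B" "card B = dim U"
    using basis_exists by blast
  moreover obtain C where "finite C" "U \<subseteq> span C" using assms unfolding fin_dim_set_def by blast
  ultimately have "finite B" using independent_span_bound[of C B] by blast
  then show ?thesis using B that by blast
qed

lemma dim_less_fin:
  assumes U: "fin_dim_set U" and W: "subspace W" "W \<subseteq> U" and z: "z \<in> U" "z \<notin> W"
  shows "dim W < dim U"
proof -
  obtain B where B: "finite B" "B \<subseteq> W" "independent B" "W \<subseteq> span B" "card B = dim W"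
    using fin_dim_set_basis[OF fin_dim_set_subset[OF U W(2)]] by metis
  have "span B \<subseteq> W" using B(2) W(1) by (rule span_minimal)
  then have zB: "z \<notin> span B" using z(2) by blast
  then have ind: "independent (insert z B)" using B(3) by (simp add: independent_insert)
  obtain C where C: "finite C" "U \<subseteq> span C" "card C = dim U" using fin_dim_set_basis[OF U] by metis
  have "insert z B \<subseteq> span C" using C(2) z(1) B(2) W(2) by blast
  then have "card (insert z B) \<le> card C" using independent_span_bound[OF C(1) ind] by blast
  moreover have "z \<notin> B" using zB span_base by blast
  ultimately show ?thesis using B(1,5) C(3) by simp
qed

end

context vector_space_pair begin

lemma rank_nullity:
  assumes f: "Vector_Spaces.linear s1 s2 f" and U: "vs1.subspace U" "vs1.fin_dim_set U"
  shows "vs1.dim U = vs2.dim (f ` U) + vs1.dim {x \<in> U. f x = 0}"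
proof -
  interpret f: linear s1 s2 f by (rule f)
  let ?K = "{x \<in> U. f x = 0}"
  obtain A where A: "finite A" "A \<subseteq> ?K" "vs1.independent A" "?K \<subseteq> vs1.span A" "card A = vs1.dim ?K"
    using vs1.fin_dim_set_basis[OF vs1.fin_dim_set_subset[OF U(2), of ?K]] by auto
  obtain B where B: "A \<subseteq> B" "B \<subseteq> U" "vs1.independent B" "U \<subseteq> vs1.span B"
    using vs1.maximal_independent_subset_extend[of A U] A(2,3) by auto
  obtain C0 where "finite C0" "U \<subseteq> vs1.span C0" using U(2) unfolding vs1.fin_dim_set_def by blast
  then have finB: "finite B" using vs1.independent_span_bound[of C0 B] B(2,3) by blast
  have dimU: "vs1.dim U = card B" using vs1.basis_card_eq_dim[OF B(2,4,3)] by simp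
  let ?C = "B - A"
  have indC: "vs1.independent ?C" using B(3) vs1.independent_mono by blast
  have ker: "x = 0" if x: "x \<in> vs1.span ?C" "f x = 0" for x
  proof -
    have "vs1.span ?C \<subseteq> U" using B(2) U(1) by (intro vs1.span_minimal) auto
    then have "x \<in> vs1.span A" using x A(4) by blast
    then obtain u where u: "x = (\<Sum>a\<in>A. s1 (u a) a)" using vs1.span_finite[OF A(1)] by auto
    obtain v where v: "x = (\<Sum>a\<in>?C. s1 (v a) a)" using x(1) vs1.span_finite[of ?C] finB by auto
    let ?w = "\<lambda>a. if a \<in> A then u a else - v a"
    have "(\<Sum>a\<in>B. s1 (?w a) a) = (\<Sum>a\<in>?C. s1 (?w a) a) + (\<Sum>a\<in>A. s1 (?w a) a)"
      using sum.subset_diff[OF B(1) finB] by blast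
    also have "(\<Sum>a\<in>?C. s1 (?w a) a) = - x"
      unfolding v sum_negf[symmetric] by (intro sum.cong) auto
    also have "(\<Sum>a\<in>A. s1 (?w a) a) = x" unfolding u by (intro sum.cong) auto
    finally have "(\<Sum>a\<in>B. s1 (?w a) a) = 0" by simp
    then have "?w a = 0" if "a \<in> B" for a
      by (rule vs1.independentD[OF B(3) finB subset_refl _ that])
    then have "u a = 0" if "a \<in> A" for a using that B(1) by force
    then show "x = 0" unfolding u by simp
  qed
  have inj: "inj_on f (vs1.span ?C)"
  proof (rule inj_onI)
    fix x y assume "x \<in> vs1.span ?C" "y \<in> vs1.span ?C" "f x = f y"
    then have "x - y = 0" by (intro ker) (auto simp: vs1.span_diff f.diff)
    then show "x = y" by simp
  qed
  have "vs2.dim (f ` U) = card (f ` ?C)"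
  proof (rule vs2.basis_card_eq_dim[symmetric])
    show "f ` ?C \<subseteq> f ` U" using B(2) by auto
    show "vs2.independent (f ` ?C)" by (rule linear_independent_injective_image[OF f indC inj])
    show "f ` U \<subseteq> vs2.span (f ` ?C)"
    proof -
      have "f b \<in> vs2.span (f ` ?C)" if "b \<in> B" for b
      proof (cases "b \<in> A")
        case True then have "f b = 0" using A(2) by auto
        then show ?thesis by (simp add: vs2.span_zero)
      qed (use that in \<open>auto intro: vs2.span_base\<close>)
      then have "vs2.span (f ` B) \<subseteq> vs2.span (f ` ?C)" by (intro vs2.span_minimal vs2.subspace_span) auto
      then show ?thesis using B(4) f.span_image[of B] by blast
    qed
  qed
  also have "\<dots> = card ?C" using inj vs1.span_superset[of ?C] by (intro card_image) (rule inj_on_subset)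
  also have "\<dots> = card B - card A" using B(1) finB A(1) by (intro card_Diff_subset)
  finally show ?thesis using A(5) dimU card_mono[OF finB B(1)] by simp
qed

lemma fin_dim_image:
  assumes f: "Vector_Spaces.linear s1 s2 f" and U: "vs1.fin_dim_set U"
  shows "vs2.fin_dim_set (f ` U)"
proof -
  interpret f: linear s1 s2 f by (rule f)
  obtain B where "finite B" "U \<subseteq> vs1.span B" using U unfolding vs1.fin_dim_set_def by blast
  then have "finite (f ` B)" "f ` U \<subseteq> vs2.span (f ` B)" using f.span_image[of B] by auto
  then show ?thesis unfolding vs2.fin_dim_set_def by blast
qed

definition prod_scale :: "'a \<Rightarrow> 'b \<times> 'c \<Rightarrow> 'b \<times> 'c" where
  "prod_scale c p = (s1 c (fst p), s2 c (snd p))"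

lemma prod_vector_space: "vector_space prod_scale"
  by unfold_locales
    (simp_all add: prod_scale_def vs1.scale_right_distrib vs2.scale_right_distrib
      vs1.scale_left_distrib vs2.scale_left_distrib prod_eq_iff)

interpretation p: vector_space prod_scale by (rule prod_vector_space)

lemma linear_fst: "Vector_Spaces.linear prod_scale s1 fst"
  by (intro linear.intro module_hom.intro module_hom_axioms.intro p.vector_space_axioms
      vs1.vector_space_axioms p.module_axioms vs1.module_axioms) (simp_all add: prod_scale_def)

lemma linear_snd: "Vector_Spaces.linear prod_scale s2 snd"
  by (intro linear.intro module_hom.intro module_hom_axioms.intro p.vector_space_axioms
      vs2.vector_space_axioms p.module_axioms vs2.module_axioms) (simp_all add: prod_scale_def)

lemma subspace_Times: "vs1.subspace U \<Longrightarrow> vs2.subspace W \<Longrightarrow> p.subspace (U \<times> W)"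
  by (auto simp: p.subspace_def vs1.subspace_def vs2.subspace_def prod_scale_def zero_prod_def)

lemma fin_dim_Times:
  assumes "vs1.fin_dim_set U" "vs2.fin_dim_set W" shows "p.fin_dim_set (U \<times> W)"
proof -
  obtain A B where AB: "finite A" "U \<subseteq> vs1.span A" "finite B" "W \<subseteq> vs2.span B"
    using assms unfolding vs1.fin_dim_set_def vs2.fin_dim_set_def by blast
  let ?C = "(\<lambda>a. (a, 0)) ` A \<union> (\<lambda>b. (0, b)) ` B"
  interpret l: linear s1 prod_scale "\<lambda>a. (a, 0)"
    by (intro linear.intro module_hom.intro module_hom_axioms.intro p.vector_space_axioms
      vs1.vector_space_axioms p.module_axioms vs1.module_axioms) (simp_all add: prod_scale_def)
  interpret r: linear s2 prod_scale "\<lambda>a. (0, a)"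
    by (intro linear.intro module_hom.intro module_hom_axioms.intro p.vector_space_axioms
      vs2.vector_space_axioms p.module_axioms vs2.module_axioms) (simp_all add: prod_scale_def)
  have "(u, w) \<in> p.span ?C" if "u \<in> U" "w \<in> W" for u w
  proof -
    have "(u, 0) \<in> p.span ((\<lambda>a. (a, 0)) ` A)" using that AB l.span_image[of A] by auto
    then have 1: "(u, 0) \<in> p.span ?C" using p.span_mono[of "(\<lambda>a. (a, 0)) ` A" ?C] by blast
    have "(0, w) \<in> p.span ((\<lambda>a. (0, a)) ` B)" using that AB r.span_image[of B] by auto
    then have 2: "(0, w) \<in> p.span ?C" using p.span_mono[of "(\<lambda>a. (0, a)) ` B" ?C] by blast
    show ?thesis using p.span_add[OF 1 2] by simp
  qed
  then show ?thesis using AB unfolding p.fin_dim_set_def by (intro exI[of _ ?C]) auto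
qed

lemma dim_Times:
  assumes U: "vs1.subspace U" "vs1.fin_dim_set U" and W: "vs2.subspace W" "vs2.fin_dim_set W"
  shows "p.dim (U \<times> W) = vs1.dim U + vs2.dim W"
proof -
  interpret p1: vector_space_pair prod_scale s1 by unfold_locales
  interpret p2: vector_space_pair prod_scale s2 by unfold_locales
  have 0: "0 \<in> U" "0 \<in> W" using U W by (auto simp: vs1.subspace_0 vs2.subspace_0)
  have T: "p.subspace (U \<times> W)" "p.fin_dim_set (U \<times> W)"
    using subspace_Times fin_dim_Times U W by blast+
  have k: "{x \<in> U \<times> W. fst x = 0} = {0} \<times> W" using 0 by auto
  have "fst ` (U \<times> W) = U" using 0 by force
  then have 1: "p.dim (U \<times> W) = vs1.dim U + p.dim ({0} \<times> W)"
    using p1.rank_nullity[OF linear_fst T] k by simp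
  have T': "p.subspace ({0} \<times> W)" by (rule subspace_Times[OF vs1.subspace_single_0 W(1)])
  have fT': "p.fin_dim_set ({0} \<times> W)" by (rule p.fin_dim_set_subset[OF T(2)]) (use 0 in auto)
  have k2: "{x \<in> {0} \<times> W. snd x = 0} = {0}" using 0 by (auto simp: zero_prod_def)
  have im2: "snd ` ({0} \<times> W) = W" by force
  have d0: "p.dim {0} = 0" using p.dim_le_card[of "{0}" "{}"] p.span_empty by simp
  have "p.dim ({0} \<times> W) = vs2.dim W"
    using p2.rank_nullity[OF linear_snd T' fT'] unfolding k2 im2 d0 by simp
  with 1 show ?thesis by simp
qed

end

context vector_space begin

text \<open>The Euler characteristic of the Koszul complex of the commuting operators \<open>X\<close>, \<open>Y\<close> on
  \<open>F / P\<close>, in a form that only mentions subspaces of \<open>F\<close>. Let \<open>?N\<close> be the space of Koszul cycles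
  of \<open>F\<close>, of dimension \<open>dim F + b\<close>, and let \<open>?W\<close> be spanned by \<open>P \<times> P\<close> and the Koszul boundaries of
  \<open>F\<close>. By \<open>H\<close>, \<open>?N\<close> is the kernel of \<open>(u, v) \<mapsto> X u + Y v\<close> on \<open>?W\<close>, and the image is
  \<open>?mP = X P + Y P\<close>; hence \<open>dim ?W = dim ?mP + dim F + b\<close>. On the other hand \<open>?W\<close> is an image of
  \<open>(P \<times> P) \<times> F\<close>, and the kernel is isomorphic to the space \<open>?Q\<close> of the elements that \<open>X\<close> and \<open>Y\<close> send
  into \<open>P\<close>, which is larger than \<open>P\<close> because of \<open>z\<close>; hence \<open>dim ?W < dim P + dim F\<close>. Together,
  \<open>dim ?mP + b < dim P\<close>, and \<open>A\<close> spans \<open>P\<close> modulo \<open>?mP\<close>.\<close>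
lemma koszul_count:
  assumes X: "Vector_Spaces.linear scale scale X" and Y: "Vector_Spaces.linear scale scale Y"
    and comm: "\<And>w. w \<in> F \<Longrightarrow> X (Y w) = Y (X w)"
    and F: "subspace F" "fin_dim_set F" "X ` F \<subseteq> F" "Y ` F \<subseteq> F"
    and P: "subspace P" "P \<subseteq> F" "X ` P \<subseteq> P" "Y ` P \<subseteq> P"
    and b: "dim F = dim {X u + Y v |u v. u \<in> F \<and> v \<in> F} + b"
    and H: "\<And>u v. u \<in> F \<Longrightarrow> v \<in> F \<Longrightarrow> X u + Y v = 0 \<Longrightarrow> \<exists>w\<in>F. u + Y w \<in> P \<and> v - X w \<in> P"
    and z: "z \<in> F" "z \<notin> P" "X z \<in> P" "Y z \<in> P"
    and A: "finite A" "\<And>p. p \<in> P \<Longrightarrow> \<exists>a\<in>span A. \<exists>u\<in>P. \<exists>v\<in>P. p = a + X u + Y v"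
  shows "b + 1 \<le> card A"
proof -
  interpret X: linear scale scale X by (rule X)
  interpret Y: linear scale scale Y by (rule Y)
  interpret q: vector_space_pair scale scale by unfold_locales
  interpret p: vector_space q.prod_scale by (rule q.prod_vector_space)
  interpret r: vector_space_pair q.prod_scale scale by unfold_locales
  interpret t: vector_space r.prod_scale by (rule r.prod_vector_space)
  interpret tp: vector_space_pair r.prod_scale q.prod_scale by unfold_locales
  interpret ts: vector_space_pair r.prod_scale scale by unfold_locales
  have fP: "fin_dim_set P" using F(2) P(2) by (rule fin_dim_set_subset)
  let ?\<Phi> = "\<lambda>x. X (fst x) + Y (snd x)"
  have \<Phi>: "Vector_Spaces.linear q.prod_scale scale ?\<Phi>"
    by (intro linear.intro module_hom.intro module_hom_axioms.intro p.vector_space_axioms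
      vector_space_axioms p.module_axioms module_axioms)
      (simp_all add: q.prod_scale_def X.add Y.add X.scale Y.scale scale_right_distrib)
  let ?N = "{x \<in> F \<times> F. ?\<Phi> x = 0}"
  let ?\<Psi> = "\<lambda>((a, c), w). (a - Y w, c + X w)"
  let ?T = "(P \<times> P) \<times> F"
  have \<Psi>: "Vector_Spaces.linear r.prod_scale q.prod_scale ?\<Psi>"
    by (intro linear.intro module_hom.intro module_hom_axioms.intro p.vector_space_axioms
      t.vector_space_axioms p.module_axioms t.module_axioms)
      (auto simp: q.prod_scale_def r.prod_scale_def X.add Y.add X.scale Y.scale scale_right_distrib
        scale_right_diff_distrib)
  let ?W = "?\<Psi> ` ?T"
  have imF: "?\<Phi> ` (F \<times> F) = {X u + Y v |u v. u \<in> F \<and> v \<in> F}" by force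
  have FF: "p.subspace (F \<times> F)" "p.fin_dim_set (F \<times> F)" "p.dim (F \<times> F) = dim F + dim F"
    using q.subspace_Times q.fin_dim_Times q.dim_Times F(1,2) by auto
  have PP: "p.subspace (P \<times> P)" "p.fin_dim_set (P \<times> P)" "p.dim (P \<times> P) = dim P + dim P"
    using q.subspace_Times q.fin_dim_Times q.dim_Times P(1) fP by auto
  have T: "t.subspace ?T" "t.fin_dim_set ?T" "t.dim ?T = dim P + dim P + dim F"
    using r.subspace_Times r.fin_dim_Times r.dim_Times PP F(1,2) by auto
  have dimN: "p.dim ?N = dim F + b"
    using r.rank_nullity[OF \<Phi> FF(1,2)] FF(3) b unfolding imF by simp
  have NW: "?N \<subseteq> ?W"
  proof
    fix x assume "x \<in> ?N"
    then obtain u v where x: "x = (u, v)" "u \<in> F" "v \<in> F" "X u + Y v = 0" by auto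
    then obtain w where w: "w \<in> F" "u + Y w \<in> P" "v - X w \<in> P" using H by blast
    have "x = ?\<Psi> ((u + Y w, v - X w), w)" using x(1) by simp
    then show "x \<in> ?W" using w by (intro image_eqI[of _ _ "((u + Y w, v - X w), w)"]) auto
  qed
  have WF: "?W \<subseteq> F \<times> F"
  proof (rule image_subsetI)
    fix x assume "x \<in> ?T"
    then obtain a c w where x: "x = ((a, c), w)" "a \<in> F" "c \<in> F" "w \<in> F" using P(2) by auto
    then have "a - Y w \<in> F" "c + X w \<in> F"
      using F(3,4) subspace_add[OF F(1)] subspace_diff[OF F(1)] by blast+
    then show "?\<Psi> x \<in> F \<times> F" using x(1) by simp
  qed
  have NW': "?N = {x \<in> ?W. ?\<Phi> x = 0}" using NW WF by blast
  have W: "p.subspace ?W" by (rule tp.linear_subspace_image[OF \<Psi> T(1)])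
  have fW: "p.fin_dim_set ?W" by (rule tp.fin_dim_image[OF \<Psi> T(2)])
  let ?mP = "?\<Phi> ` ?W"
  have dimW: "p.dim ?W = dim ?mP + (dim F + b)"
    using r.rank_nullity[OF \<Phi> W fW] dimN unfolding NW'[symmetric] by simp
  let ?Q = "{w \<in> F. X w \<in> P \<and> Y w \<in> P}"
  have Q: "subspace ?Q"
    using F(1) P(1) by (auto simp: subspace_def X.add Y.add X.scale Y.scale X.zero Y.zero)
  have fQ: "fin_dim_set ?Q" using F(2) by (rule fin_dim_set_subset) auto
  have PQ: "dim P < dim ?Q"
    by (rule dim_less_fin[OF fQ P(1) _ _ z(2)]) (use P z in auto)
  let ?k = "{x \<in> ?T. ?\<Psi> x = 0}"
  \<comment> \<open>An element \<open>((a, c), w)\<close> of the kernel is determined by \<open>w\<close>, since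
    \<open>a = Y w\<close> and \<open>c = - X w\<close>.\<close>
  have k: "snd ` ?k = ?Q"
  proof
    show "snd ` ?k \<subseteq> ?Q"
    proof (rule image_subsetI)
      fix x assume "x \<in> ?k"
      then obtain a c w where x: "x = ((a, c), w)" "a \<in> P" "c \<in> P" "w \<in> F"
        "a - Y w = 0" "c + X w = 0" by (auto simp: zero_prod_def)
      then have "X w = - c" "Y w = a" by (simp_all add: add_eq_0_iff)
      then show "snd x \<in> ?Q" using x subspace_neg[OF P(1)] by simp
    qed
    show "?Q \<subseteq> snd ` ?k"
    proof
      fix w assume w: "w \<in> ?Q"
      then have "((Y w, - X w), w) \<in> ?k" using subspace_neg[OF P(1)] by (auto simp: zero_prod_def)
      then show "w \<in> snd ` ?k" by force
    qed
  qed
  have "?k = ?T \<inter> {x. ?\<Psi> x = 0}" by blast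
  then have "t.subspace ?k"
    using t.subspace_inter[OF T(1) tp.linear_subspace_kernel[OF \<Psi>]] by simp
  moreover have "t.fin_dim_set ?k" using T(2) by (rule t.fin_dim_set_subset) auto
  ultimately have "dim ?Q \<le> t.dim ?k"
    using ts.rank_nullity[OF r.linear_snd, of ?k] k by simp
  moreover have "t.dim ?T = p.dim ?W + t.dim ?k" by (rule tp.rank_nullity[OF \<Psi> T(1,2)])
  ultimately have mP: "dim ?mP + b + 1 \<le> dim P" using PQ T(3) dimW by linarith
  have mPeq: "X u + Y v \<in> ?mP" if "u \<in> P" "v \<in> P" for u v
  proof -
    have "(u, v) = ?\<Psi> ((u, v), 0)" by (simp add: X.zero Y.zero)
    then have "(u, v) \<in> ?W" using that subspace_0[OF F(1)] by blast
    then show ?thesis by force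
  qed
  have fmP: "fin_dim_set ?mP" by (rule r.fin_dim_image[OF \<Phi> fW])
  obtain B where B: "finite B" "?mP \<subseteq> span B" "card B = dim ?mP"
    by (rule fin_dim_set_basis[OF fmP]) (rule that; assumption)
  have "P \<subseteq> span (A \<union> B)"
  proof
    fix p assume "p \<in> P"
    then obtain a u v where *: "a \<in> span A" "u \<in> P" "v \<in> P" "p = a + X u + Y v" using A(2) by blast
    have "a \<in> span (A \<union> B)" using *(1) span_mono[of A "A \<union> B"] by blast
    moreover have "X u + Y v \<in> span (A \<union> B)" 
      using subsetD[OF B(2) mPeq[OF *(2,3)]] span_mono[of B "A \<union> B"] by blast
    ultimately show "p \<in> span (A \<union> B)" using span_add *(4) by (simp add: add.assoc)
  qed
  then have "dim P \<le> card (A \<union> B)" using A(1) B(1) by (intro dim_le_card) auto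
  also have "\<dots> \<le> card A + card B" by (rule card_Un_le)
  finally show ?thesis using B(3) mP by linarith
qed

end

section \<open>Spaces of functions\<close>

definition fun_scale :: "'k::field \<Rightarrow> ('j \<Rightarrow> 'k) \<Rightarrow> 'j \<Rightarrow> 'k" where
  "fun_scale c f = (\<lambda>j. c * f j)"

interpretation fs: vector_space fun_scale
  by unfold_locales (auto simp: fun_scale_def fun_eq_iff algebra_simps)

definition fun_unit :: "'j \<Rightarrow> 'j \<Rightarrow> 'k::field" where
  "fun_unit j = (\<lambda>i. if i = j then 1 else 0)"

definition fun_space :: "'j set \<Rightarrow> ('j \<Rightarrow> 'k::field) set" where
  "fun_space J = {f. \<forall>j. j \<notin> J \<longrightarrow> f j = 0}"

lemma fun_space_subspace: "fs.subspace (fun_space J)"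
  by (auto simp: fs.subspace_def fun_space_def fun_scale_def)

lemma sum_fun_unit:
  assumes "finite J" shows "(\<Sum>j\<in>J. fun_scale (c j) (fun_unit j)) i = (if i \<in> J then c i else 0)"
proof -
  have "(\<Sum>j\<in>J. fun_scale (c j) (fun_unit j)) i = (\<Sum>j\<in>J. fun_scale (c j) (fun_unit j) i)"
    by (induction J rule: infinite_finite_induct) auto
  also have "\<dots> = (\<Sum>j\<in>J. if j = i then c j else 0)"
    by (intro sum.cong) (auto simp: fun_scale_def fun_unit_def)
  finally show ?thesis using assms by (simp add: sum.delta)
qed

lemma fun_space_span:
  assumes "finite J" shows "fun_space J \<subseteq> fs.span (fun_unit ` J)"
proof
  fix f assume f: "f \<in> fun_space J"
  have "f = (\<Sum>j\<in>J. fun_scale (f j) (fun_unit j))"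
    using f by (auto simp: fun_eq_iff sum_fun_unit[OF assms] fun_space_def)
  also have "\<dots> \<in> fs.span (fun_unit ` J)"
    by (intro fs.span_sum fs.span_scale fs.span_base) auto
  finally show "f \<in> fs.span (fun_unit ` J)" .
qed

lemma fun_space_dim:
  assumes "finite J"
  shows "fs.fin_dim_set (fun_space J :: ('j \<Rightarrow> 'k::field) set)"
    and "fs.dim (fun_space J :: ('j \<Rightarrow> 'k::field) set) = card J"
proof -
  let ?u = "fun_unit :: 'j \<Rightarrow> 'j \<Rightarrow> 'k"
  show "fs.fin_dim_set (fun_space J :: ('j \<Rightarrow> 'k::field) set)"
    unfolding fs.fin_dim_set_def using fun_space_span[OF assms] assms by blast
  have inj: "inj_on ?u J"
    by (rule inj_onI) (metis (full_types) fun_unit_def zero_neq_one)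
  have "fs.independent (?u ` J)"
  proof (rule fs.independent_if_scalars_zero)
    fix c x assume *: "(\<Sum>x\<in>?u ` J. fun_scale (c x) x) = 0" "x \<in> ?u ` J"
    then obtain j where j: "j \<in> J" "x = ?u j" by blast
    have "(\<Sum>i\<in>J. fun_scale (c (?u i)) (?u i)) = 0" using *(1) by (simp add: sum.reindex[OF inj])
    then have "(\<Sum>i\<in>J. fun_scale (c (?u i)) (?u i)) j = 0" by simp
    then show "c x = 0" using j by (simp add: sum_fun_unit[OF assms])
  qed (use assms in simp)
  then have "fs.dim (fun_space J :: ('j \<Rightarrow> 'k) set) = card (?u ` J)"
    using fun_space_span[OF assms]
    by (intro fs.basis_card_eq_dim[symmetric]) (auto simp: fun_space_def fun_unit_def)
  then show "fs.dim (fun_space J :: ('j \<Rightarrow> 'k::field) set) = card J" using card_image[OF inj] by simp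
qed

section \<open>Truncated polynomial algebras in coordinates\<close>

definition mdeg :: "nat \<Rightarrow> (nat \<Rightarrow>\<^sub>0 nat) \<Rightarrow> nat" where
  "mdeg d \<mu> = (\<Sum>i<d. Poly_Mapping.lookup \<mu> i)"

text \<open>The monomials with these exponents form a basis of the truncated polynomial ring.\<close>
definition mons :: "nat \<Rightarrow> nat \<Rightarrow> (nat \<Rightarrow>\<^sub>0 nat) set" where
  "mons d n = {\<mu>. Poly_Mapping.keys \<mu> \<subseteq> {..<d} \<and> mdeg d \<mu> < n}"

abbreviation unit_mon :: "nat \<Rightarrow> nat \<Rightarrow>\<^sub>0 nat" where
  "unit_mon i \<equiv> Poly_Mapping.single i (Suc 0)"

lemma mdeg_add: "mdeg d (\<mu> + \<nu>) = mdeg d \<mu> + mdeg d \<nu>"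
  by (simp add: mdeg_def lookup_add sum.distrib)

lemma mdeg_unit: "i < d \<Longrightarrow> mdeg d (unit_mon i) = 1"
  by (simp add: mdeg_def lookup_single when_def)

lemma mdeg_zero [simp]: "mdeg d 0 = 0"
  by (simp add: mdeg_def)

lemma mon_split:
  assumes "Poly_Mapping.lookup \<mu> i > 0" shows "\<exists>\<nu>. \<mu> = \<nu> + unit_mon i"
proof
  show "\<mu> = (\<mu> - unit_mon i) + unit_mon i"
    using assms by (intro poly_mapping_eqI) (auto simp: lookup_add lookup_minus lookup_single when_def)
qed

lemma keys_add_unit: "Poly_Mapping.keys (\<nu> + unit_mon i) = insert i (Poly_Mapping.keys \<nu>)"
  by (auto simp: in_keys_iff lookup_add lookup_single when_def split: if_splits)

lemma mons_add_unit:
  "i < d \<Longrightarrow> \<nu> + unit_mon i \<in> mons d n \<longleftrightarrow> \<nu> \<in> mons d (n - 1)"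
  by (auto simp: mons_def keys_add_unit mdeg_add mdeg_unit)

lemma mons_mono: "m \<le> n \<Longrightarrow> mons d m \<subseteq> mons d n"
  by (auto simp: mons_def)

lemma mons_nonzero:
  assumes "\<mu> \<in> mons d n" "\<mu> \<noteq> 0" shows "\<exists>i<d. Poly_Mapping.lookup \<mu> i > 0"
proof -
  obtain i where i: "i \<in> Poly_Mapping.keys \<mu>" using assms(2) by (metis ex_in_conv keys_eq_empty)
  then have "i < d" using assms(1) unfolding mons_def by blast
  moreover have "Poly_Mapping.lookup \<mu> i > 0" using i by (simp add: in_keys_iff)
  ultimately show ?thesis by blast
qed

lemma zero_in_mons: "0 < n \<Longrightarrow> 0 \<in> mons d n"
  by (simp add: mons_def)

lemma finite_mons: "finite (mons d n)"
proof (rule finite_imageD)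
  let ?r = "\<lambda>\<mu>. restrict (Poly_Mapping.lookup \<mu>) {..<d}"
  have "Poly_Mapping.lookup \<mu> i < n" if "\<mu> \<in> mons d n" "i < d" for \<mu> i
    using that member_le_sum[of i "{..<d}" "Poly_Mapping.lookup \<mu>"] by (auto simp: mons_def mdeg_def)
  then have "?r ` mons d n \<subseteq> PiE {..<d} (\<lambda>_. {..<n})"
    by (intro image_subsetI) (auto simp: PiE_iff)
  then show "finite (?r ` mons d n)" by (rule finite_subset) (intro finite_PiE; simp)
  show "inj_on ?r (mons d n)"
  proof (rule inj_onI, rule poly_mapping_eqI)
    fix \<mu> \<nu> i assume *: "\<mu> \<in> mons d n" "\<nu> \<in> mons d n" "?r \<mu> = ?r \<nu>"
    show "Poly_Mapping.lookup \<mu> i = Poly_Mapping.lookup \<nu> i"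
    proof (cases "i < d")
      case True then show ?thesis using fun_cong[OF *(3), of i] by simp
    next
      case False
      then have "i \<notin> Poly_Mapping.keys \<mu>" "i \<notin> Poly_Mapping.keys \<nu>" using * by (auto simp: mons_def)
      then show ?thesis by (simp add: in_keys_iff)
    qed
  qed
qed

lemma unit_mon_nonzero: "unit_mon i \<noteq> 0"
proof
  assume "unit_mon i = 0"
  then have "Poly_Mapping.lookup (unit_mon i) i = Poly_Mapping.lookup 0 i" by simp
  then show False by simp
qed

lemma mons_two:
  "mons d 2 - {0} = unit_mon ` {..<d}"
proof
  show "mons d 2 - {0} \<subseteq> unit_mon ` {..<d}"
  proof
    fix \<mu> assume \<mu>: "\<mu> \<in> mons d 2 - {0}"
    then obtain i where i: "i < d" "Poly_Mapping.lookup \<mu> i > 0" using mons_nonzero by blast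
    then obtain \<nu> where \<nu>: "\<mu> = \<nu> + unit_mon i" using mon_split by blast
    then have "\<nu> \<in> mons d 1" using \<mu> mons_add_unit[OF i(1), of \<nu> 2] by simp
    then have "\<not> (\<exists>i<d. Poly_Mapping.lookup \<nu> i > 0)" by (auto simp: mons_def mdeg_def)
    then have "\<nu> = 0" using mons_nonzero \<open>\<nu> \<in> mons d 1\<close> by blast
    then show "\<mu> \<in> unit_mon ` {..<d}" using \<nu> i(1) by simp
  qed
  show "unit_mon ` {..<d} \<subseteq> mons d 2 - {0}"
    by (auto simp: mons_def mdeg_unit unit_mon_nonzero)
qed

lemma card_mons_two: "card (mons d 2 - {0}) = d"
proof -
  have "inj_on unit_mon {..<d}"
  proof (rule inj_onI)
    fix i j :: nat assume "unit_mon i = unit_mon j"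
    then have "Poly_Mapping.keys (unit_mon i) = Poly_Mapping.keys (unit_mon j)" by simp
    then show "i = j" by simp
  qed
  then show ?thesis unfolding mons_two by (simp add: card_image)
qed

text \<open>The ring \<open>k[X\<^sub>0, \<dots>, X\<^sub>d\<^sub>-\<^sub>1] / (X\<^sub>0, \<dots>, X\<^sub>d\<^sub>-\<^sub>1)\<^sup>n\<close> seen through its coefficient function \<open>cf\<close>.
  Multiplication is only described for constants and variables, where it is linear and a shift of
  exponents; this avoids convolution sums. General products enter only through their terms of
  lowest degree (\<open>mult_low\<close>).\<close>
locale truncated_algebra = comm_base R for R :: "'a ring" (structure) +
  fixes d n :: nat and cf :: "'a \<Rightarrow> (nat \<Rightarrow>\<^sub>0 nat) \<Rightarrow> 'k::field"
    and const :: "'k \<Rightarrow> 'a" and X :: "nat \<Rightarrow> 'a"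
  assumes n: "n > 1"
    and cf_inj: "r \<in> carrier R \<Longrightarrow> s \<in> carrier R \<Longrightarrow> cf r = cf s \<Longrightarrow> r = s"
    and cf_onto: "f \<in> fun_space (mons d n) \<Longrightarrow> \<exists>r\<in>carrier R. cf r = f"
    and cf_supp: "r \<in> carrier R \<Longrightarrow> \<mu> \<notin> mons d n \<Longrightarrow> cf r \<mu> = 0"
    and cf_add: "r \<in> carrier R \<Longrightarrow> s \<in> carrier R \<Longrightarrow> cf (r \<oplus> s) = (\<lambda>\<mu>. cf r \<mu> + cf s \<mu>)"
    and const_in: "const c \<in> carrier R"
    and cf_const: "r \<in> carrier R \<Longrightarrow> cf (const c \<otimes> r) = (\<lambda>\<mu>. c * cf r \<mu>)"
    and cf_one: "cf \<one> 0 = 1"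
    and X_in: "i < d \<Longrightarrow> X i \<in> carrier R"
    and cf_X: "i < d \<Longrightarrow> r \<in> carrier R \<Longrightarrow> \<nu> + unit_mon i \<in> mons d n \<Longrightarrow>
        cf (X i \<otimes> r) (\<nu> + unit_mon i) = cf r \<nu>"
    and cf_X0: "i < d \<Longrightarrow> r \<in> carrier R \<Longrightarrow> Poly_Mapping.lookup \<mu> i = 0 \<Longrightarrow> cf (X i \<otimes> r) \<mu> = 0"
begin

lemma cf_zero: "cf \<zero> = (\<lambda>\<mu>. 0)"
proof
  fix \<mu>
  have "cf \<zero> \<mu> = cf \<zero> \<mu> + cf \<zero> \<mu>"
    using fun_cong[OF cf_add[OF zero_closed zero_closed], of \<mu>] unfolding l_zero[OF zero_closed] .
  then show "cf \<zero> \<mu> = 0" by (simp only: add_cancel_right_right)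
qed

lemma cf_uminus: assumes "r \<in> carrier R" shows "cf (\<ominus> r) \<mu> = - cf r \<mu>"
proof -
  have "cf (r \<oplus> \<ominus> r) \<mu> = cf r \<mu> + cf (\<ominus> r) \<mu>" using cf_add[of r "\<ominus> r"] assms by simp
  then show ?thesis using assms by (simp add: r_neg cf_zero eq_neg_iff_add_eq_0 add.commute)
qed

lemma cf_minus: "r \<in> carrier R \<Longrightarrow> s \<in> carrier R \<Longrightarrow> cf (r \<ominus> s) \<mu> = cf r \<mu> - cf s \<mu>"
  by (simp add: a_minus_def cf_add cf_uminus)

lemma cf_finsum:
  assumes "finite T" "h \<in> T \<rightarrow> carrier R"
  shows "cf (\<Oplus>i\<in>T. h i) \<mu> = (\<Sum>i\<in>T. cf (h i) \<mu>)"
  using assms by (induction T) (auto simp: cf_zero cf_add Pi_iff)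

lemma eq_zeroI: "r \<in> carrier R \<Longrightarrow> (\<And>\<mu>. \<mu> \<in> mons d n \<Longrightarrow> cf r \<mu> = 0) \<Longrightarrow> r = \<zero>"
  using cf_supp by (intro cf_inj) (auto simp: cf_zero fun_eq_iff)

definition mm (\<open>\<mm>\<close>) where "\<mm> = {r \<in> carrier R. cf r 0 = 0}"

text \<open>Each monomial other than \<open>1\<close> is assigned to the first variable that divides it.\<close>
lemma mm_decompose:
  assumes r: "r \<in> \<mm>"
  shows "\<exists>\<rho>. \<rho> \<in> {..<d} \<rightarrow> carrier R \<and> r = (\<Oplus>i\<in>{..<d}. X i \<otimes> \<rho> i)"
proof -
  have rR: "r \<in> carrier R" and r0: "cf r 0 = 0" using r by (simp_all add: mm_def)
  define k where "k \<mu> = (LEAST i. Poly_Mapping.lookup \<mu> i > 0)" for \<mu> :: "nat \<Rightarrow>\<^sub>0 nat"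
  define f where "f i \<nu> = (if \<nu> + unit_mon i \<in> mons d n \<and> k (\<nu> + unit_mon i) = i
      then cf r (\<nu> + unit_mon i) else 0)" for i \<nu>
  have "\<exists>\<rho>. \<forall>i\<in>{..<d}. \<rho> i \<in> carrier R \<and> cf (\<rho> i) = f i"
  proof (rule bchoice, rule ballI)
    fix i assume "i \<in> {..<d}"
    then have "f i \<in> fun_space (mons d n)"
      using mons_mono[of "n - 1" n d] by (auto simp: fun_space_def f_def mons_add_unit)
    then show "\<exists>s. s \<in> carrier R \<and> cf s = f i" using cf_onto by blast
  qed
  then obtain \<rho> where \<rho>: "\<forall>i\<in>{..<d}. \<rho> i \<in> carrier R \<and> cf (\<rho> i) = f i" ..
  have h: "(\<lambda>i. X i \<otimes> \<rho> i) \<in> {..<d} \<rightarrow> carrier R" using \<rho> X_in by auto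
  have "cf (\<Oplus>i\<in>{..<d}. X i \<otimes> \<rho> i) \<mu> = cf r \<mu>" for \<mu>
  proof (cases "\<mu> \<in> mons d n \<and> \<mu> \<noteq> 0")
    case False
    then have "cf r \<mu> = 0" using r0 cf_supp[OF rR] by blast
    moreover have "cf (\<Oplus>i\<in>{..<d}. X i \<otimes> \<rho> i) \<mu> = 0"
    proof (cases "\<mu> = 0")
      case True
      then show ?thesis unfolding cf_finsum[OF finite_lessThan h]
        using \<rho> by (intro sum.neutral) (auto intro!: cf_X0)
    next
      case False
      then have "\<mu> \<notin> mons d n" using \<open>\<not> (\<mu> \<in> mons d n \<and> \<mu> \<noteq> 0)\<close> by blast
      then show ?thesis using h by (intro cf_supp finsum_closed)
    qed
    ultimately show ?thesis by simp
  next
    case True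
    then obtain i0 where i0: "i0 < d" "Poly_Mapping.lookup \<mu> i0 > 0" using mons_nonzero by blast
    have k: "Poly_Mapping.lookup \<mu> (k \<mu>) > 0" "k \<mu> < d"
      unfolding k_def using i0 LeastI[of "\<lambda>i. Poly_Mapping.lookup \<mu> i > 0" i0]
        Least_le[of "\<lambda>i. Poly_Mapping.lookup \<mu> i > 0" i0] by auto
    have "cf (X i \<otimes> \<rho> i) \<mu> = (if i = k \<mu> then cf r \<mu> else 0)" if i: "i \<in> {..<d}" for i
    proof (cases "Poly_Mapping.lookup \<mu> i = 0")
      case False
      then obtain \<nu> where \<nu>: "\<mu> = \<nu> + unit_mon i" using mon_split by blast
      have "cf (X i \<otimes> \<rho> i) \<mu> = cf (\<rho> i) \<nu>"
        unfolding \<nu> using i \<rho> True \<nu> by (intro cf_X) auto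
      also have "cf (\<rho> i) \<nu> = f i \<nu>" using \<rho> i by simp
      also have "f i \<nu> = (if i = k \<mu> then cf r \<mu> else 0)" using True by (auto simp: f_def \<nu>)
      finally show ?thesis .
    next
      case True
      then have "i \<noteq> k \<mu>" using k(1) by auto
      then show ?thesis using cf_X0[of i "\<rho> i" \<mu>] True i \<rho> by simp
    qed
    then show ?thesis unfolding cf_finsum[OF finite_lessThan h]
      using k(2) by (simp add: sum.delta)
  qed
  then have "(\<Oplus>i\<in>{..<d}. X i \<otimes> \<rho> i) = r"
    using h rR by (intro cf_inj finsum_closed) auto
  then show ?thesis using \<rho> by (intro exI[of _ \<rho>]) auto
qed

text \<open>This is the power \<open>\<mm>\<^sup>j\<close> of the maximal ideal.\<close>
definition mpow :: "nat \<Rightarrow> 'a set" where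
  "mpow j = {r \<in> carrier R. \<forall>\<mu>. mdeg d \<mu> < j \<longrightarrow> cf r \<mu> = 0}"

lemma mpowD: "r \<in> mpow j \<Longrightarrow> r \<in> carrier R" "r \<in> mpow j \<Longrightarrow> mdeg d \<mu> < j \<Longrightarrow> cf r \<mu> = 0"
  by (auto simp: mpow_def)

lemma pow_top: "n \<le> j \<Longrightarrow> r \<in> mpow j \<Longrightarrow> r = \<zero>"
  by (rule eq_zeroI) (auto simp: mpow_def mons_def)

lemma X_pow:
  assumes i: "i < d" and r: "r \<in> mpow j" shows "X i \<otimes> r \<in> mpow (Suc j)"
proof -
  have rR: "r \<in> carrier R" using mpowD r by blast
  have "cf (X i \<otimes> r) \<mu> = 0" if \<mu>: "mdeg d \<mu> < Suc j" for \<mu>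
  proof (cases "Poly_Mapping.lookup \<mu> i = 0 \<or> \<mu> \<notin> mons d n")
    case True
    then show ?thesis using cf_X0[OF i rR] cf_supp[OF m_closed[OF X_in[OF i] rR]] by blast
  next
    case False
    then obtain \<nu> where \<nu>: "\<mu> = \<nu> + unit_mon i" using mon_split by blast
    then have "mdeg d \<nu> < j" using \<mu> i by (simp add: mdeg_add mdeg_unit)
    then show ?thesis using cf_X[OF i rR, of \<nu>] False \<nu> mpowD(2)[OF r] by simp
  qed
  then show ?thesis using X_in[OF i] rR by (simp add: mpow_def)
qed

lemma split_const:
  assumes r: "r \<in> carrier R"
  shows "\<exists>r1\<in>\<mm>. r = const (cf r 0) \<oplus> r1"
proof -
  let ?c = "const (cf r 0)"
  have "cf (?c \<otimes> \<one>) 0 = cf r 0" by (simp add: cf_const cf_one)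
  then have "cf ?c 0 = cf r 0" using const_in by simp
  then have "r \<ominus> ?c \<in> \<mm>" using r const_in by (simp add: mm_def cf_minus)
  moreover have "r = ?c \<oplus> (r \<ominus> ?c)"
    using r const_in by (simp add: a_minus_def a_lcomm r_neg)
  ultimately show ?thesis by blast
qed

text \<open>In lowest degree, multiplication by \<open>r\<close> is multiplication by its constant term. The induction runs
  downwards from \<open>j = n\<close>: writing \<open>r\<close> as a constant plus \<open>\<Sum> X\<^sub>i \<rho>\<^sub>i\<close>, the product \<open>X\<^sub>i f\<close>
  lies one step deeper, where \<open>\<rho>\<^sub>i\<close> acts by its constant term.\<close>
lemma mult_low:
  "f \<in> mpow j \<Longrightarrow> r \<in> carrier R \<Longrightarrow> mdeg d \<mu> \<le> j \<Longrightarrow> cf (r \<otimes> f) \<mu> = cf r 0 * cf f \<mu>"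
proof (induction "n - j" arbitrary: j f r \<mu> rule: less_induct)
  case less
  have f: "f \<in> carrier R" using less.prems mpowD by blast
  show ?case
  proof (cases "n \<le> j")
    case True
    then have "f = \<zero>" using pow_top less.prems by blast
    then show ?thesis using less.prems by (simp add: cf_zero)
  next
    case False
    obtain r1 where r1: "r1 \<in> \<mm>" "r = const (cf r 0) \<oplus> r1" using split_const less.prems by blast
    obtain \<rho> where \<rho>: "\<rho> \<in> {..<d} \<rightarrow> carrier R" "r1 = (\<Oplus>i\<in>{..<d}. X i \<otimes> \<rho> i)"
      using mm_decompose[OF r1(1)] by blast
    have h: "(\<lambda>i. X i \<otimes> \<rho> i) \<in> {..<d} \<rightarrow> carrier R" using \<rho> X_in by auto
    have h': "(\<lambda>i. X i \<otimes> \<rho> i \<otimes> f) \<in> {..<d} \<rightarrow> carrier R" using h f by auto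
    have r1R: "r1 \<in> carrier R" using r1(1) by (simp add: mm_def)
    have "r1 \<otimes> f = (\<Oplus>i\<in>{..<d}. X i \<otimes> \<rho> i \<otimes> f)"
      unfolding \<rho>(2) by (rule finsum_ldistr[OF finite_lessThan f h])
    then have "cf (r1 \<otimes> f) \<mu> = (\<Sum>i<d. cf (X i \<otimes> \<rho> i \<otimes> f) \<mu>)"
      by (simp add: cf_finsum[OF finite_lessThan h'])
    also have "\<dots> = 0"
    proof (rule sum.neutral, rule ballI)
      fix i assume i: "i \<in> {..<d}"
      then have \<rho>i: "\<rho> i \<in> carrier R" "X i \<in> carrier R" using \<rho>(1) X_in by auto
      have Xf: "X i \<otimes> f \<in> mpow (Suc j)" using X_pow less.prems i by simp
      have "cf (\<rho> i \<otimes> (X i \<otimes> f)) \<mu> = cf (\<rho> i) 0 * cf (X i \<otimes> f) \<mu>"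
        using False less.prems(3) by (intro less.hyps[OF _ Xf \<rho>i(1)]) auto
      also have "\<dots> = 0" using mpowD(2)[OF Xf] less.prems(3) by simp
      also have "\<rho> i \<otimes> (X i \<otimes> f) = X i \<otimes> \<rho> i \<otimes> f" using \<rho>i f by (simp add: m_ac)
      finally show "cf (X i \<otimes> \<rho> i \<otimes> f) \<mu> = 0" .
    qed
    finally have "cf (r1 \<otimes> f) \<mu> = 0" .
    moreover have "r \<otimes> f = const (cf r 0) \<otimes> f \<oplus> r1 \<otimes> f"
      using l_distr[OF const_in r1R f, of "cf r 0"] unfolding r1(2)[symmetric] .
    ultimately show ?thesis using f r1R const_in by (simp add: cf_add cf_const)
  qed
qed

lemma pow_smult: "f \<in> mpow j \<Longrightarrow> r \<in> carrier R \<Longrightarrow> r \<otimes> f \<in> mpow j"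
  using mult_low[of f j r] by (auto simp: mpow_def)

lemma pow_ideal: "ideal (mpow j) R"
proof (rule idealI[OF ring_axioms])
  show "subgroup (mpow j) (add_monoid R)"
    by (rule add.subgroupI) (auto simp: mpow_def cf_add cf_uminus cf_zero)
  show "\<And>a x. a \<in> mpow j \<Longrightarrow> x \<in> carrier R \<Longrightarrow> x \<otimes> a \<in> mpow j" by (rule pow_smult)
  show "\<And>a x. a \<in> mpow j \<Longrightarrow> x \<in> carrier R \<Longrightarrow> a \<otimes> x \<in> mpow j"
    using pow_smult mpowD(1) m_comm by metis
qed

lemma mm_pow: "\<mm> = mpow 1"
proof
  show "mpow 1 \<subseteq> \<mm>" by (auto simp: mpow_def mm_def)
  show "\<mm> \<subseteq> mpow 1"
  proof
    fix r assume r: "r \<in> \<mm>"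
    have "cf r \<mu> = 0" if "mdeg d \<mu> < 1" for \<mu>
    proof (cases "\<mu> \<in> mons d n \<and> \<mu> \<noteq> 0")
      case True
      then obtain i where i: "i < d" "Poly_Mapping.lookup \<mu> i > 0" using mons_nonzero by blast
      then have "mdeg d \<mu> > 0" using member_le_sum[of i "{..<d}" "Poly_Mapping.lookup \<mu>"]
        by (simp add: mdeg_def)
      then show ?thesis using that by simp
    next
      case False then show ?thesis using r cf_supp by (auto simp: mm_def)
    qed
    then show "r \<in> mpow 1" using r by (auto simp: mpow_def mm_def)
  qed
qed

lemma mm_pow_mult: "x \<in> \<mm> \<Longrightarrow> r \<in> mpow j \<Longrightarrow> x \<otimes> r \<in> mpow (Suc j)"
  using mult_low[of r j x] by (auto simp: mpow_def mm_def less_Suc_eq_le)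

text \<open>Successive approximation: the error \<open>e = 1 - u v\<close> moves one power of \<open>\<mm>\<close> deeper when \<open>v\<close> is corrected
  by \<open>e\<close> divided by the constant term of \<open>u\<close>.\<close>
lemma unit_if_nonzero_const:
  assumes u: "u \<in> carrier R" "cf u 0 \<noteq> 0" shows "u \<in> Units R"
proof -
  have "\<exists>v\<in>carrier R. \<one> \<ominus> u \<otimes> v \<in> mpow j" for j
  proof (induction j)
    case 0
    show ?case by (intro bexI[of _ \<zero>]) (use u in \<open>auto simp: mpow_def\<close>)
  next
    case (Suc j)
    then obtain v where v: "v \<in> carrier R" "\<one> \<ominus> u \<otimes> v \<in> mpow j" by blast
    let ?e = "\<one> \<ominus> u \<otimes> v" and ?k = "const (1 / cf u 0)"
    have e: "?e \<in> carrier R" using u v by simp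
    have ke: "?k \<otimes> ?e \<in> mpow j" by (rule pow_smult[OF v(2) const_in])
    have "\<one> \<ominus> u \<otimes> (v \<oplus> ?k \<otimes> ?e) = ?e \<ominus> u \<otimes> (?k \<otimes> ?e)"
      using u v e const_in by (simp add: a_minus_def r_distr minus_add a_assoc)
    moreover have "cf (?e \<ominus> u \<otimes> (?k \<otimes> ?e)) \<mu> = 0" if "mdeg d \<mu> < Suc j" for \<mu>
      using mult_low[OF ke u(1), of \<mu>] that e u const_in
      by (simp add: cf_minus cf_const)
    ultimately have "\<one> \<ominus> u \<otimes> (v \<oplus> ?k \<otimes> ?e) \<in> mpow (Suc j)"
      using u v e const_in by (simp add: mpow_def)
    then show ?case using v e const_in by (intro bexI[of _ "v \<oplus> ?k \<otimes> ?e"]) auto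
  qed
  then obtain v where v: "v \<in> carrier R" "\<one> \<ominus> u \<otimes> v \<in> mpow n" by blast
  then have "\<one> \<ominus> u \<otimes> v = \<zero>" using pow_top by blast
  then have "\<one> = u \<otimes> v" using u(1) v(1) minus_eq_zero_iff[OF abelian_group_axioms] by simp
  then show ?thesis using u(1) v(1) m_comm unfolding Units_def by auto
qed

lemma mm_maximal: "maximalideal \<mm> R"
proof (rule maximalidealI)
  show "ideal \<mm> R" unfolding mm_pow by (rule pow_ideal)
  have "\<one> \<notin> \<mm>" by (simp add: mm_def cf_one)
  then show "carrier R \<noteq> \<mm>" by blast
  fix J assume J: "ideal J R" "\<mm> \<subseteq> J" "J \<subseteq> carrier R"
  interpret J: ideal J R by (rule J(1))
  show "J = \<mm> \<or> J = carrier R"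
  proof (rule disjCI)
    assume "J \<noteq> carrier R"
    have "r \<in> \<mm>" if r: "r \<in> J" for r
    proof (rule ccontr)
      assume "r \<notin> \<mm>"
      then have "r \<in> Units R" using unit_if_nonzero_const r J(3) by (auto simp: mm_def)
      then have "inv r \<otimes> r = \<one>" "inv r \<in> carrier R" by auto
      then have "\<one> \<in> J" using J.I_l_closed[OF r, of "inv r"] by simp
      then show False using J.one_imp_carrier \<open>J \<noteq> carrier R\<close> by blast
    qed
    then show "J = \<mm>" using J(2) by blast
  qed
qed

end

sublocale truncated_algebra \<subseteq> local_base R \<mm>
proof (rule local_base.intro[OF comm_base_axioms local_base_axioms.intro[OF mm_maximal]])
  fix r assume "r \<in> carrier R" "r \<notin> \<mm>"
  then show "r \<in> Units R" by (intro unit_if_nonzero_const) (simp_all add: mm_def)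
qed

lemma sum_fun_apply: "(\<Sum>i\<in>A. f i) z = (\<Sum>i\<in>A. f i z :: 'k::comm_monoid_add)"
  by (induction A rule: infinite_finite_induct) auto

lemma linearI':
  assumes "vector_space s1" "vector_space s2" "\<And>x y. f (x + y) = f x + f y" "\<And>c x. f (s1 c x) = s2 c (f x)"
  shows "Vector_Spaces.linear s1 s2 f"
proof -
  interpret vs1: vector_space s1 by fact
  interpret vs2: vector_space s2 by fact
  show ?thesis using assms(3,4)
    by (intro linear.intro module_hom.intro module_hom_axioms.intro vs1.vector_space_axioms
      vs2.vector_space_axioms vs1.module_axioms vs2.module_axioms)
qed

context comm_base begin

lemma free_module_on_minus:
  assumes "f \<in> carrier (free_module_on R S)" "g \<in> carrier (free_module_on R S)"
  shows "f \<ominus>\<^bsub>free_module_on R S\<^esub> g = (\<lambda>s. f s \<ominus> g s)"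
proof -
  interpret F: module R "free_module_on R S" by (rule free_module_on_module)
  have "\<ominus>\<^bsub>free_module_on R S\<^esub> g = (\<ominus> \<one>) \<odot>\<^bsub>free_module_on R S\<^esub> g"
    using F.smult_l_minus[OF one_closed assms(2)] F.smult_one[OF assms(2)] by simp
  then show ?thesis using free_module_on_in[OF assms(2)] by (simp add: a_minus_def l_minus)
qed

end

context truncated_algebra begin

lemma mm_iff: "r \<in> carrier R \<Longrightarrow> r \<in> \<mm> \<longleftrightarrow> cf r 0 = 0"
  unfolding mm_def by blast

lemma X_family_in:
  assumes \<rho>: "\<rho> \<in> {..<d} \<rightarrow> carrier R"
  shows "(\<lambda>i. X i \<otimes> \<rho> i) \<in> {..<d} \<rightarrow> carrier R"
proof (rule Pi_I)
  fix i assume i: "i \<in> {..<d}"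
  then have "i < d" by simp
  then show "X i \<otimes> \<rho> i \<in> carrier R" by (rule m_closed[OF X_in funcset_mem[OF \<rho> i]])
qed

text \<open>The identification of a free module of rank \<open>card S\<close> with a space of functions on
  \<open>S \<times> mons d n\<close>, under which multiplication by the variable \<open>X i\<close> becomes \<open>shift i\<close>. It makes the
  dimension theory of subspaces available for submodules.\<close>
definition coords :: "(nat \<Rightarrow> 'a) \<Rightarrow> nat \<times> (nat \<Rightarrow>\<^sub>0 nat) \<Rightarrow> 'k" where
  "coords f = (\<lambda>(s, \<mu>). cf (f s) \<mu>)"

definition shift :: "nat \<Rightarrow> (nat \<times> (nat \<Rightarrow>\<^sub>0 nat) \<Rightarrow> 'k) \<Rightarrow> nat \<times> (nat \<Rightarrow>\<^sub>0 nat) \<Rightarrow> 'k" where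
  "shift i h = (\<lambda>(s, \<mu>). if Poly_Mapping.lookup \<mu> i > 0 \<and> \<mu> \<in> mons d n then h (s, \<mu> - unit_mon i) else 0)"

abbreviation (input) "FM S \<equiv> free_module_on R (S :: nat set)"

lemma cf_X_shift:
  assumes "i < d" "r \<in> carrier R"
  shows "cf (X i \<otimes> r) \<mu> =
    (if Poly_Mapping.lookup \<mu> i > 0 \<and> \<mu> \<in> mons d n then cf r (\<mu> - unit_mon i) else 0)"
proof (cases "Poly_Mapping.lookup \<mu> i > 0 \<and> \<mu> \<in> mons d n")
  case True
  then obtain \<nu> where "\<mu> = \<nu> + unit_mon i" using mon_split by blast
  then show ?thesis using cf_X[OF assms, of \<nu>] True by simp
next
  case False
  then show ?thesis using cf_X0[OF assms, of \<mu>] cf_supp[OF m_closed[OF X_in[OF assms(1)] assms(2)], of \<mu>]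
    by auto
qed

lemma linear_shift: "Vector_Spaces.linear fun_scale fun_scale (shift i)"
  by (intro linearI' fs.vector_space_axioms) (auto simp: shift_def fun_scale_def fun_eq_iff)

interpretation shift: Vector_Spaces.linear fun_scale fun_scale "shift i" for i by (rule linear_shift)

lemma coords_supp:
  assumes f: "f \<in> carrier (FM S)" shows "coords f \<in> fun_space (S \<times> mons d n)"
proof -
  have "cf (f s) \<mu> = 0" if "s \<notin> S \<or> \<mu> \<notin> mons d n" for s \<mu>
  proof (cases "s \<in> S")
    case True then show ?thesis using that cf_supp[OF free_module_on_in[OF f]] by blast
  next
    case False
    then have "f s = \<zero>" using f by (simp add: free_module_on_carrier)
    then show ?thesis by (simp add: cf_zero)
  qed
  then show ?thesis by (auto simp: fun_space_def coords_def)
qed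

lemma coords_inj:
  assumes "f \<in> carrier (FM S)" "g \<in> carrier (FM S)" "coords f = coords g" shows "f = g"
proof
  fix s
  have "cf (f s) = cf (g s)"
  proof
    fix \<mu> show "cf (f s) \<mu> = cf (g s) \<mu>" using fun_cong[OF assms(3), of "(s, \<mu>)"] by (simp add: coords_def)
  qed
  then show "f s = g s" by (rule cf_inj[OF free_module_on_in[OF assms(1)] free_module_on_in[OF assms(2)]])
qed

lemma coords_onto:
  assumes S: "finite S" and g: "g \<in> fun_space (S \<times> mons d n)"
  shows "\<exists>f\<in>carrier (FM S). coords f = g"
proof -
  have "\<exists>r. r \<in> carrier R \<and> cf r = (\<lambda>\<mu>. g (s, \<mu>))" for s
  proof -
    have "(\<lambda>\<mu>. g (s, \<mu>)) \<in> fun_space (mons d n)" using g by (auto simp: fun_space_def)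
    then show ?thesis using cf_onto by blast
  qed
  then obtain r where r: "\<And>s. r s \<in> carrier R" "\<And>s. cf (r s) = (\<lambda>\<mu>. g (s, \<mu>))" by metis
  let ?f = "\<lambda>s. if s \<in> S then r s else \<zero>"
  have "?f \<in> carrier (FM S)" using r(1) by (intro free_module_on_carrierI[OF S]) auto
  moreover have "coords ?f = g" using r(2) g by (auto simp: coords_def fun_eq_iff cf_zero fun_space_def)
  ultimately show ?thesis by blast
qed

lemma coords_add:
  "f \<in> carrier (FM S) \<Longrightarrow> g \<in> carrier (FM S) \<Longrightarrow> coords (f \<oplus>\<^bsub>FM S\<^esub> g) = coords f + coords g"
  by (simp add: coords_def fun_eq_iff cf_add free_module_on_in[of f S] free_module_on_in[of g S])

lemma coords_minus:
  "f \<in> carrier (FM S) \<Longrightarrow> g \<in> carrier (FM S) \<Longrightarrow> coords (f \<ominus>\<^bsub>FM S\<^esub> g) = coords f - coords g"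
  by (simp add: free_module_on_minus coords_def fun_eq_iff cf_minus free_module_on_in[of f S] free_module_on_in[of g S])

lemma coords_zero: "coords \<zero>\<^bsub>FM S\<^esub> = 0"
  by (simp add: coords_def fun_eq_iff cf_zero)

lemma coords_const: "f \<in> carrier (FM S) \<Longrightarrow> coords (const c \<odot>\<^bsub>FM S\<^esub> f) = fun_scale c (coords f)"
  by (simp add: coords_def fun_scale_def fun_eq_iff cf_const free_module_on_in[of f S])

lemma coords_X: "i < d \<Longrightarrow> f \<in> carrier (FM S) \<Longrightarrow> coords (X i \<odot>\<^bsub>FM S\<^esub> f) = shift i (coords f)"
  by (simp add: coords_def shift_def fun_eq_iff cf_X_shift free_module_on_in[of f S])

lemma coords_subspace:
  assumes W: "submodule R W (FM S)" shows "fs.subspace (coords ` W)"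
proof -
  have "0 \<in> coords ` W" using coords_zero[of S] submodule_zero[OF W] by (metis image_eqI)
  moreover have "x + y \<in> coords ` W" if xy: "x \<in> coords ` W" "y \<in> coords ` W" for x y
  proof -
    obtain f g where fg: "f \<in> W" "g \<in> W" "x = coords f" "y = coords g" using xy by blast
    then have "x + y = coords (f \<oplus>\<^bsub>FM S\<^esub> g)"
      using coords_add[OF submodule_in[OF W fg(1)] submodule_in[OF W fg(2)]] by (simp only:)
    then show ?thesis using submodule_add[OF W fg(1,2)] by blast
  qed
  moreover have "fun_scale c x \<in> coords ` W" if x: "x \<in> coords ` W" for c x
  proof -
    obtain f where f: "f \<in> W" "x = coords f" using x by blast
    then have "fun_scale c x = coords (const c \<odot>\<^bsub>FM S\<^esub> f)"
      using coords_const[OF submodule_in[OF W f(1)]] by (simp only:)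
    then show ?thesis using submodule_smult[OF W const_in f(1)] by blast
  qed
  ultimately show ?thesis by (simp add: fs.subspace_def)
qed

lemma fin_dim_space: "finite S \<Longrightarrow> fs.fin_dim_set (fun_space (S \<times> mons d n) :: (nat \<times> _ \<Rightarrow> 'k) set)"
  by (intro fun_space_dim(1) finite_cartesian_product finite_mons)

text \<open>A submodule is in particular a finite-dimensional subspace, so a vector space basis generates
  it.\<close>
lemma noetherian:
  assumes S: "finite S" and P: "submodule R P (FM S)"
  shows "\<exists>T p. fin_pres T p ((FM S)\<lparr>carrier := P\<rparr>)"
proof -
  let ?P = "(FM S)\<lparr>carrier := P\<rparr>"
  have mP: "module R ?P" by (rule submodule_as_module[OF free_module_on_module P])
  have "coords ` P \<subseteq> fun_space (S \<times> mons d n)" using coords_supp submodule_in[OF P] by blast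
  then have "fs.fin_dim_set (coords ` P)" by (rule fs.fin_dim_set_subset[OF fin_dim_space[OF S]])
  then obtain B where B: "finite B" "B \<subseteq> coords ` P" "coords ` P \<subseteq> fs.span B"
    by (rule fs.fin_dim_set_basis) (rule that; assumption)
  obtain h where h: "bij_betw h {0..<card B} B" using ex_bij_betw_nat_finite[OF B(1)] ..
  let ?T = "{0..<card B}"
  have "\<forall>i\<in>?T. \<exists>x. x \<in> P \<and> coords x = h i"
  proof
    fix i assume "i \<in> ?T"
    then have "h i \<in> coords ` P" using h B(2) unfolding bij_betw_def by blast
    then show "\<exists>x. x \<in> P \<and> coords x = h i" by auto
  qed
  from bchoice[OF this] obtain g where g: "\<forall>i\<in>?T. g i \<in> P \<and> coords (g i) = h i" ..
  have g': "g \<in> ?T \<rightarrow> carrier ?P" using g by simp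
  note hom = lin_ext_hom[OF mP g']
  let ?W = "lin_ext ?P g ` carrier (FM ?T)"
  have "submodule R ?W ?P"
    by (rule image_submodule[OF free_module_on_module mP hom])
      (rule submoduleI'[OF free_module_on_module], simp_all add: free_module_on_add free_module_on_smult
        free_module_on_carrier[of "\<lambda>s. \<zero>"])
  then have W: "submodule R ?W (FM S)" by (rule submodule_of_submodule[OF free_module_on_module P])
  have "B \<subseteq> coords ` ?W"
  proof
    fix b assume "b \<in> B"
    then obtain i where i: "i \<in> ?T" "b = h i" using h unfolding bij_betw_def by blast
    have "g i \<in> ?W" unfolding lin_ext_gen[OF mP g' i(1), symmetric]
      by (rule imageI) (rule free_gen_in[OF i(1)])
    moreover have "b = coords (g i)" using g i by simp
    ultimately show "b \<in> coords ` ?W" by blast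
  qed
  then have "fs.span B \<subseteq> coords ` ?W" using coords_subspace[OF W] by (rule fs.span_minimal)
  then have CfP: "coords ` P \<subseteq> coords ` ?W" using B(3) by blast
  have "x \<in> ?W" if x: "x \<in> P" for x
  proof -
    obtain w where w: "w \<in> ?W" "coords x = coords w" using CfP x by blast
    have "x = w" by (rule coords_inj[OF submodule_in[OF P x] submodule_in[OF W w(1)] w(2)])
    then show ?thesis using w(1) by simp
  qed
  moreover have "?W \<subseteq> P" using hom_in[OF hom] by auto
  ultimately have "?W = P" by blast
  then have "fin_pres ?T (lin_ext ?P g) ?P" using hom by (simp add: fin_pres_def)
  then show ?thesis by blast
qed

text \<open>The elements \<open>\<rho> i\<close> do not depend on \<open>x\<close>, so that scalar multiplication commutes with
  homomorphisms in this form.\<close>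
lemma coords_smult:
  assumes r: "r \<in> carrier R"
  shows "\<exists>c \<rho>. \<rho> \<in> {..<d} \<rightarrow> carrier R \<and> (\<forall>x\<in>carrier (FM S). 
    coords (r \<odot>\<^bsub>FM S\<^esub> x) = fun_scale c (coords x) + (\<Sum>i<d. shift i (coords (\<rho> i \<odot>\<^bsub>FM S\<^esub> x))))"
proof -
  obtain r1 where r1: "r1 \<in> \<mm>" "r = const (cf r 0) \<oplus> r1" using split_const[OF r] by blast
  obtain \<rho> where \<rho>: "\<rho> \<in> {..<d} \<rightarrow> carrier R" "r1 = (\<Oplus>i\<in>{..<d}. X i \<otimes> \<rho> i)"
    using mm_decompose[OF r1(1)] by blast
  note h = X_family_in[OF \<rho>(1)]
  have r1R: "r1 \<in> carrier R" by (rule Icarr[OF r1(1)])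
  have *: "cf (r \<otimes> y) \<mu> = cf r 0 * cf y \<mu> + (\<Sum>i<d. cf (X i \<otimes> (\<rho> i \<otimes> y)) \<mu>)" if y: "y \<in> carrier R" for y \<mu>
  proof -
    have h': "(\<lambda>i. X i \<otimes> \<rho> i \<otimes> y) \<in> {..<d} \<rightarrow> carrier R"
      by (rule Pi_I) (rule m_closed[OF funcset_mem[OF h] y])
    have "r1 \<otimes> y = (\<Oplus>i\<in>{..<d}. X i \<otimes> \<rho> i \<otimes> y)"
      unfolding \<rho>(2) by (rule finsum_ldistr[OF finite_lessThan y h])
    then have "cf (r1 \<otimes> y) \<mu> = (\<Sum>i<d. cf (X i \<otimes> \<rho> i \<otimes> y) \<mu>)"
      by (simp add: cf_finsum[OF finite_lessThan h'])
    also have "\<dots> = (\<Sum>i<d. cf (X i \<otimes> (\<rho> i \<otimes> y)) \<mu>)"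
      using \<rho>(1) X_in y by (intro sum.cong) (auto simp: m_assoc Pi_iff)
    finally have "cf (r1 \<otimes> y) \<mu> = \<dots>" .
    moreover have "r \<otimes> y = const (cf r 0) \<otimes> y \<oplus> r1 \<otimes> y"
      using l_distr[OF const_in r1R y, of "cf r 0"] unfolding r1(2)[symmetric] .
    ultimately show ?thesis using y r1R const_in by (simp add: cf_add cf_const)
  qed
  have "coords (r \<odot>\<^bsub>FM S\<^esub> x) = fun_scale (cf r 0) (coords x) + (\<Sum>i<d. shift i (coords (\<rho> i \<odot>\<^bsub>FM S\<^esub> x)))"
    if x: "x \<in> carrier (FM S)" for x
  proof
    fix z :: "nat \<times> (nat \<Rightarrow>\<^sub>0 nat)"
    obtain s \<mu> where z: "z = (s, \<mu>)" by fastforce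
    have sum_z: "(\<Sum>i<d. shift i (coords (\<rho> i \<odot>\<^bsub>FM S\<^esub> x))) z = (\<Sum>i<d. shift i (coords (\<rho> i \<odot>\<^bsub>FM S\<^esub> x)) z)"
      by (rule sum_fun_apply)
    also have "\<dots> = (\<Sum>i<d. cf (X i \<otimes> (\<rho> i \<otimes> x s)) \<mu>)"
      unfolding z using \<rho>(1) free_module_on_in[OF x]
      by (intro sum.cong) (auto simp: shift_def coords_def cf_X_shift Pi_iff)
    finally show "coords (r \<odot>\<^bsub>FM S\<^esub> x) z = (fun_scale (cf r 0) (coords x) + (\<Sum>i<d. shift i (coords (\<rho> i \<odot>\<^bsub>FM S\<^esub> x)))) z"
      using *[OF free_module_on_in[OF x]] by (simp add: z coords_def fun_scale_def)
  qed
  then show ?thesis using \<rho>(1) by blast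
qed

text \<open>Nakayama: modulo \<open>\<mm>\<close> times the image, the images of the generators span over \<open>k\<close>.\<close>
lemma generators_span:
  assumes q: "q \<in> module_hom R (FM T) (FM S)" and f: "f \<in> carrier (FM T)"
  shows "\<exists>a\<in>fs.span (coords ` q ` free_gen R ` T). \<exists>g. g \<in> {..<d} \<rightarrow> carrier (FM T) \<and>
    coords (q f) = a + (\<Sum>i<d. shift i (coords (q (g i))))"
proof -
  interpret FT: module R "FM T" by (rule free_module_on_module)
  interpret FS: module R "FM S" by (rule free_module_on_module)
  let ?A = "fs.span (coords ` q ` free_gen R ` T)"
  let ?P = "\<lambda>f a g. a \<in> ?A \<and> g \<in> {..<d} \<rightarrow> carrier (FM T) \<and> coords (q f) = a + (\<Sum>i<d. shift i (coords (q (g i))))"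
  define W where "W = {f \<in> carrier (FM T). \<exists>a g. ?P f a g}"
  have q0: "coords (q \<zero>\<^bsub>FM T\<^esub>) = 0"
    using hom_zero[OF FT.module_axioms FS.module_axioms q] coords_zero by metis
  have sum0: "(\<Sum>i<d. shift i (coords (q \<zero>\<^bsub>FM T\<^esub>))) = 0"
    unfolding q0 shift.zero by simp
  have "submodule R W (FM T)"
  proof (rule submoduleI'[OF FT.module_axioms])
    show "W \<subseteq> carrier (FM T)" unfolding W_def by blast
    have "?P \<zero>\<^bsub>FM T\<^esub> 0 (\<lambda>_. \<zero>\<^bsub>FM T\<^esub>)"
      using q0 sum0 fs.span_zero FT.M.zero_closed by simp
    then show "\<zero>\<^bsub>FM T\<^esub> \<in> W" unfolding W_def using FT.M.zero_closed by blast
    fix x y assume "x \<in> W" "y \<in> W"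
    then obtain a g b h where x: "x \<in> carrier (FM T)" "?P x a g" and y: "y \<in> carrier (FM T)" "?P y b h"
      unfolding W_def by blast
    have gh: "g i \<in> carrier (FM T)" "h i \<in> carrier (FM T)" if "i < d" for i using x y that by auto
    have "coords (q (x \<oplus>\<^bsub>FM T\<^esub> y)) = coords (q x) + coords (q y)"
      using module_hom_add[OF q x(1) y(1)] coords_add[OF hom_in[OF q x(1)] hom_in[OF q y(1)]] by simp
    also have "\<dots> = (a + b) + (\<Sum>i<d. shift i (coords (q (g i))) + shift i (coords (q (h i))))"
      using x(2) y(2) by (simp add: sum.distrib algebra_simps)
    also have "(\<Sum>i<d. shift i (coords (q (g i))) + shift i (coords (q (h i)))) = (\<Sum>i<d. shift i (coords (q (g i \<oplus>\<^bsub>FM T\<^esub> h i))))"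
    proof (rule sum.cong[OF refl])
      fix i assume "i \<in> {..<d}"
      then have i: "g i \<in> carrier (FM T)" "h i \<in> carrier (FM T)" using gh by auto
      show "shift i (coords (q (g i))) + shift i (coords (q (h i))) = shift i (coords (q (g i \<oplus>\<^bsub>FM T\<^esub> h i)))"
        unfolding module_hom_add[OF q i] coords_add[OF hom_in[OF q i(1)] hom_in[OF q i(2)]] shift.add ..
    qed
    finally have eq: "coords (q (x \<oplus>\<^bsub>FM T\<^esub> y)) = (a + b) + (\<Sum>i<d. shift i (coords (q (g i \<oplus>\<^bsub>FM T\<^esub> h i))))" .
    have "?P (x \<oplus>\<^bsub>FM T\<^esub> y) (a + b) (\<lambda>i. g i \<oplus>\<^bsub>FM T\<^esub> h i)"
    proof (intro conjI eq)
      show "a + b \<in> ?A" using x(2) y(2) by (intro fs.span_add) blast+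
      show "(\<lambda>i. g i \<oplus>\<^bsub>FM T\<^esub> h i) \<in> {..<d} \<rightarrow> carrier (FM T)"
        by (intro Pi_I FT.M.a_closed gh) simp_all
    qed
    then show "x \<oplus>\<^bsub>FM T\<^esub> y \<in> W" unfolding W_def using FT.M.a_closed[OF x(1) y(1)] by blast
  next
    fix r x assume r: "r \<in> carrier R" and "x \<in> W"
    then obtain a g where x: "x \<in> carrier (FM T)" "?P x a g" unfolding W_def by blast
    have g: "g i \<in> carrier (FM T)" if "i < d" for i using x that by auto
    obtain c \<rho> where \<rho>: "\<rho> \<in> {..<d} \<rightarrow> carrier R" "\<forall>x\<in>carrier (FM S). 
        coords (r \<odot>\<^bsub>FM S\<^esub> x) = fun_scale c (coords x) + (\<Sum>i<d. shift i (coords (\<rho> i \<odot>\<^bsub>FM S\<^esub> x)))"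
      using coords_smult[OF r] by blast
    let ?g = "\<lambda>i. const c \<odot>\<^bsub>FM T\<^esub> g i \<oplus>\<^bsub>FM T\<^esub> \<rho> i \<odot>\<^bsub>FM T\<^esub> x"
    have g': "?g i \<in> carrier (FM T)" if "i < d" for i
      using g[OF that] x(1) \<rho>(1) that const_in by (intro FT.M.a_closed FT.smult_closed) auto
    have "coords (q (r \<odot>\<^bsub>FM T\<^esub> x)) = fun_scale c (coords (q x)) + (\<Sum>i<d. shift i (coords (\<rho> i \<odot>\<^bsub>FM S\<^esub> q x)))"
      unfolding module_hom_smult[OF q r x(1)] using \<rho>(2) hom_in[OF q x(1)] by blast
    also have "fun_scale c (coords (q x)) = fun_scale c a + (\<Sum>i<d. fun_scale c (shift i (coords (q (g i)))))"
      using x(2) by (simp add: fs.scale_right_distrib fs.scale_sum_right)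
    finally have "coords (q (r \<odot>\<^bsub>FM T\<^esub> x)) = fun_scale c a + (\<Sum>i<d. fun_scale c (shift i (coords (q (g i))))) +
        (\<Sum>i<d. shift i (coords (\<rho> i \<odot>\<^bsub>FM S\<^esub> q x)))" .
    also have "\<dots> = fun_scale c a +
        (\<Sum>i<d. fun_scale c (shift i (coords (q (g i)))) + shift i (coords (\<rho> i \<odot>\<^bsub>FM S\<^esub> q x)))"
      by (simp only: sum.distrib add.assoc)
    also have "(\<Sum>i<d. fun_scale c (shift i (coords (q (g i)))) + shift i (coords (\<rho> i \<odot>\<^bsub>FM S\<^esub> q x))) =
        (\<Sum>i<d. shift i (coords (q (?g i))))"
    proof (rule sum.cong[OF refl])
      fix i assume "i \<in> {..<d}"
      then have i: "g i \<in> carrier (FM T)" "\<rho> i \<in> carrier R" using g \<rho>(1) by auto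
      note c1 = FT.smult_closed[OF const_in i(1), of c] FT.smult_closed[OF i(2) x(1)]
      have "coords (q (?g i)) = coords (q (const c \<odot>\<^bsub>FM T\<^esub> g i) \<oplus>\<^bsub>FM S\<^esub> q (\<rho> i \<odot>\<^bsub>FM T\<^esub> x))"
        by (simp only: module_hom_add[OF q c1])
      also have "\<dots> = coords (q (const c \<odot>\<^bsub>FM T\<^esub> g i)) + coords (q (\<rho> i \<odot>\<^bsub>FM T\<^esub> x))"
        by (rule coords_add[OF hom_in[OF q c1(1)] hom_in[OF q c1(2)]])
      also have "\<dots> = fun_scale c (coords (q (g i))) + coords (\<rho> i \<odot>\<^bsub>FM S\<^esub> q x)"
        by (simp only: module_hom_smult[OF q const_in i(1)] module_hom_smult[OF q i(2) x(1)]
          coords_const[OF hom_in[OF q i(1)]])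
      finally have "coords (q (?g i)) = fun_scale c (coords (q (g i))) + coords (\<rho> i \<odot>\<^bsub>FM S\<^esub> q x)" .
      then show "fun_scale c (shift i (coords (q (g i)))) + shift i (coords (\<rho> i \<odot>\<^bsub>FM S\<^esub> q x)) = shift i (coords (q (?g i)))"
        by (simp only: shift.add shift.scale)
    qed
    finally have eq: "coords (q (r \<odot>\<^bsub>FM T\<^esub> x)) = fun_scale c a + (\<Sum>i<d. shift i (coords (q (?g i))))" .
    have "?P (r \<odot>\<^bsub>FM T\<^esub> x) (fun_scale c a) ?g"
    proof (intro conjI eq)
      show "fun_scale c a \<in> ?A" using x(2) by (intro fs.span_scale) blast
      show "?g \<in> {..<d} \<rightarrow> carrier (FM T)" by (intro Pi_I g') simp
    qed
    then show "r \<odot>\<^bsub>FM T\<^esub> x \<in> W" unfolding W_def using FT.smult_closed[OF r x(1)] by blast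
  qed
  moreover have "free_gen R t \<in> W" if "t \<in> T" for t
  proof -
    have "?P (free_gen R t) (coords (q (free_gen R t))) (\<lambda>_. \<zero>\<^bsub>FM T\<^esub>)"
      using that sum0 FT.M.zero_closed by (simp add: fs.span_base del: free_module_on_simps)
    then show ?thesis unfolding W_def using free_gen_in[OF that] by blast
  qed
  ultimately have "f \<in> W" by (rule free_module_induct[OF _ _ f])
  then show ?thesis unfolding W_def by blast
qed

lemma mm_free_space:
  "f \<in> ideal_mult \<mm> (FM S) \<longleftrightarrow> f \<in> carrier (FM S) \<and> coords f \<in> fun_space (S \<times> (mons d n - {0}))"
proof (cases "f \<in> carrier (FM S)")
  case f: True
  have "(\<forall>s\<in>S. f s \<in> \<mm>) \<longleftrightarrow> (\<forall>s\<in>S. cf (f s) 0 = 0)"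
    using mm_iff[OF free_module_on_in[OF f]] by blast
  also have "\<dots> \<longleftrightarrow> coords f \<in> fun_space (S \<times> (mons d n - {0}))"
    using coords_supp[OF f] unfolding fun_space_def coords_def by auto
  finally show ?thesis using ideal_mult_free[OF mm_ideal] f by blast
qed (use ideal_mult_free[OF mm_ideal] in blast)

lemma mm_free_decompose:
  assumes S: "finite S" and f: "f \<in> ideal_mult \<mm> (FM S)"
  shows "\<exists>g. g \<in> {..<d} \<rightarrow> carrier (FM S) \<and> coords f = (\<Sum>i<d. shift i (coords (g i)))"
proof -
  have f': "f \<in> carrier (FM S)" "\<forall>s\<in>S. f s \<in> \<mm>" using f ideal_mult_free[OF mm_ideal, of f S] by blast+
  have "\<forall>s\<in>S. \<exists>\<rho>. \<rho> \<in> {..<d} \<rightarrow> carrier R \<and> f s = (\<Oplus>i\<in>{..<d}. X i \<otimes> \<rho> i)"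
    using f'(2) mm_decompose by blast
  from bchoice[OF this] obtain \<rho> where
    \<rho>: "\<forall>s\<in>S. \<rho> s \<in> {..<d} \<rightarrow> carrier R \<and> f s = (\<Oplus>i\<in>{..<d}. X i \<otimes> \<rho> s i)" ..
  define g where "g i s = (if s \<in> S then \<rho> s i else \<zero>)" for i s
  have g: "g i \<in> carrier (FM S)" if "i < d" for i
    using \<rho> that by (intro free_module_on_carrierI[OF S]) (auto simp: g_def)
  have "coords f z = (\<Sum>i<d. shift i (coords (g i))) z" for z
  proof -
    obtain s \<mu> where z: "z = (s, \<mu>)" by fastforce
    have "(\<Sum>i<d. shift i (coords (g i))) z = (\<Sum>i<d. shift i (coords (g i)) z)"
      by (rule sum_fun_apply)
    also have "\<dots> = (\<Sum>i<d. cf (X i \<otimes> g i s) \<mu>)"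
      unfolding z using free_module_on_in[OF g]
      by (intro sum.cong) (auto simp: shift_def coords_def cf_X_shift)
    also have "\<dots> = cf (f s) \<mu>"
    proof (cases "s \<in> S")
      case True
      then have h: "(\<lambda>i. X i \<otimes> \<rho> s i) \<in> {..<d} \<rightarrow> carrier R" using X_family_in[of "\<rho> s"] \<rho> by blast
      have "f s = (\<Oplus>i\<in>{..<d}. X i \<otimes> \<rho> s i)" using \<rho> True by blast
      then show ?thesis using True by (simp add: cf_finsum[OF finite_lessThan h] g_def)
    next
      case False
      then have "f s = \<zero>" using f'(1) by (simp add: free_module_on_carrier)
      then show ?thesis using False X_in by (simp add: cf_zero g_def)
    qed
    finally show ?thesis by (simp add: z coords_def)
  qed
  then have "coords f = (\<Sum>i<d. shift i (coords (g i)))" by (rule ext)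
  then show ?thesis using g by (intro exI[of _ g]) auto
qed

lemma soc_killed: "x \<in> \<mm> \<Longrightarrow> r \<in> mpow (n - 1) \<Longrightarrow> x \<otimes> r = \<zero>"
  using mm_pow_mult[of x r "n - 1"] pow_top[of n "x \<otimes> r"] n by simp

lemma X_mm: "i < d \<Longrightarrow> X i \<in> \<mm>"
  using mm_iff[OF X_in] cf_X0[OF _ one_closed, of i 0] X_in by simp

end

section \<open>Lower bounds for the number of relations\<close>

context truncated_algebra begin

interpretation shift: Vector_Spaces.linear fun_scale fun_scale "shift i" for i by (rule linear_shift)

text \<open>The Koszul complex of the polynomial ring is exact, and truncation at degree \<open>n\<close> only spoils
  the comparison of coefficients in degree \<open>n - 1\<close>.\<close>
lemma koszul_cycle:
  assumes d: "d = 2" and u: "u \<in> carrier R" and v: "v \<in> carrier R" and uv: "X 0 \<otimes> u \<oplus> X 1 \<otimes> v = \<zero>"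
  shows "\<exists>w\<in>carrier R. u \<oplus> X 1 \<otimes> w \<in> mpow (n - 1) \<and> v \<ominus> X 0 \<otimes> w \<in> mpow (n - 1)"
proof -
  have i: "0 < d" "1 < d" using d by simp_all
  note XR = X_in[OF i(1)] X_in[OF i(2)]
  have Z: "cf (X 0 \<otimes> u) \<mu> + cf (X 1 \<otimes> v) \<mu> = 0" for \<mu>
    using fun_cong[OF cf_add[OF m_closed[OF XR(1) u] m_closed[OF XR(2) v]], of \<mu>]
    unfolding uv cf_zero by simp
  \<comment> \<open>The multiple \<open>X 0 \<otimes> w\<close> has to cancel all terms of \<open>v\<close> below the top degree, which are divisible
    by \<open>X 0\<close> because of \<open>uv\<close>.\<close>
  define f where "f \<mu> = (if \<mu> + unit_mon 0 \<in> mons d n then cf v (\<mu> + unit_mon 0) else 0)" for \<mu>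
  have "f \<in> fun_space (mons d n)"
    using mons_mono[of "n - 1" n d] by (auto simp: fun_space_def f_def mons_add_unit[OF i(1)])
  then obtain w where w: "w \<in> carrier R" "cf w = f" using cf_onto by blast
  note XwR = m_closed[OF XR(1) w(1)] m_closed[OF XR(2) w(1)]
  have up: "\<mu> + unit_mon j \<in> mons d n" if "\<mu> \<in> mons d n" "mdeg d \<mu> < n - 1" "j < d" for \<mu> j
    using that unfolding mons_add_unit[OF that(3)] by (simp add: mons_def)
  have "cf (u \<oplus> X 1 \<otimes> w) \<mu> = 0" if \<mu>: "mdeg d \<mu> < n - 1" for \<mu>
  proof (cases "\<mu> \<in> mons d n")
    case True
    note U0 = up[OF True \<mu> i(1)]
    have "cf (X 1 \<otimes> v) (\<mu> + unit_mon 0) = cf (X 1 \<otimes> w) \<mu>"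
    proof (cases "Poly_Mapping.lookup \<mu> 1 = 0")
      case True
      then show ?thesis
        using cf_X0[OF i(2) w(1) True] cf_X0[OF i(2) v, of "\<mu> + unit_mon 0"]
        by (simp add: lookup_add lookup_single)
    next
      case False
      then obtain \<nu> where \<nu>: "\<mu> = \<nu> + unit_mon 1" using mon_split by blast
      have eq: "\<mu> + unit_mon 0 = (\<nu> + unit_mon 0) + unit_mon 1" unfolding \<nu> by (simp only: add_ac)
      have 1: "cf (X 1 \<otimes> v) (\<mu> + unit_mon 0) = cf v (\<nu> + unit_mon 0)"
        using cf_X[OF i(2) v, of "\<nu> + unit_mon 0"] U0 unfolding eq by blast
      have "\<nu> + unit_mon 0 \<in> mons d n"
        using U0 mons_mono[of "n - 1" n d] unfolding eq mons_add_unit[OF i(2)] by auto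
      then have "f \<nu> = cf v (\<nu> + unit_mon 0)" by (simp add: f_def)
      moreover have "cf (X 1 \<otimes> w) \<mu> = f \<nu>"
        using cf_X[OF i(2) w(1), of \<nu>] \<open>\<mu> \<in> mons d n\<close> unfolding \<nu> w(2) by blast
      ultimately show ?thesis using 1 by simp
    qed
    moreover have "cf (X 0 \<otimes> u) (\<mu> + unit_mon 0) = cf u \<mu>" by (rule cf_X[OF i(1) u U0])
    ultimately show ?thesis using Z[of "\<mu> + unit_mon 0"] cf_add[OF u XwR(2)] by simp
  next
    case False
    then show ?thesis by (rule cf_supp[OF add.m_closed[OF u XwR(2)]])
  qed
  moreover have "cf (v \<ominus> X 0 \<otimes> w) \<mu> = 0" if \<mu>: "mdeg d \<mu> < n - 1" for \<mu>
  proof (cases "\<mu> \<in> mons d n")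
    case True
    have "cf (X 0 \<otimes> w) \<mu> = cf v \<mu>"
    proof (cases "Poly_Mapping.lookup \<mu> 0 = 0")
      case l: True
      have "cf (X 0 \<otimes> u) (\<mu> + unit_mon 1) = 0"
        using l by (intro cf_X0[OF i(1) u]) (simp add: lookup_add lookup_single)
      moreover have "cf (X 1 \<otimes> v) (\<mu> + unit_mon 1) = cf v \<mu>" by (rule cf_X[OF i(2) v up[OF True \<mu> i(2)]])
      ultimately show ?thesis using Z[of "\<mu> + unit_mon 1"] cf_X0[OF i(1) w(1) l] by simp
    next
      case False
      then obtain \<nu> where \<nu>: "\<mu> = \<nu> + unit_mon 0" using mon_split by blast
      then show ?thesis using cf_X[OF i(1) w(1), of \<nu>] True by (simp add: w(2) f_def)
    qed
    then show ?thesis using cf_minus[OF v XwR(1)] by simp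
  next
    case False
    then show ?thesis by (rule cf_supp[OF minus_closed[OF v XwR(1)]])
  qed
  ultimately show ?thesis using w(1) add.m_closed[OF u XwR(2)] minus_closed[OF v XwR(1)]
    by (intro bexI[of _ w]) (simp_all add: mpow_def)
qed

text \<open>The module \<open>F / P\<close> is nonzero, so it has an element in its socle: take the last power of \<open>\<mm>\<close>
  for which \<open>\<mm>\<^sup>kF\<close> is not contained in \<open>P\<close>.\<close>
lemma socle_element:
  assumes S: "finite S" and P: "submodule R P (FM S)" and sub: "P \<subseteq> ideal_mult \<mm> (FM S)" and ne: "S \<noteq> {}"
  shows "\<exists>z\<in>carrier (FM S). z \<notin> P \<and> (\<forall>i<d. X i \<odot>\<^bsub>FM S\<^esub> z \<in> P)"
proof -
  interpret F: module R "FM S" by (rule free_module_on_module)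
  define B where "B k = {f \<in> carrier (FM S). \<forall>s. f s \<in> mpow k}" for k
  have "B n \<subseteq> P"
  proof
    fix f assume f: "f \<in> B n"
    then have "f = \<zero>\<^bsub>FM S\<^esub>" unfolding B_def using pow_top by (auto simp: fun_eq_iff)
    then show "f \<in> P" using submodule_zero[OF P] by simp
  qed
  define k where "k = (LEAST k. B k \<subseteq> P)"
  have k: "B k \<subseteq> P" unfolding k_def by (rule LeastI[of "\<lambda>k. B k \<subseteq> P"]) fact
  obtain s where s: "s \<in> S" using ne by blast
  have "free_gen R s \<in> B 0" using free_gen_in[OF s] free_module_on_in[OF free_gen_in[OF s]]
    by (simp add: B_def mpow_def)
  moreover have "free_gen R s \<notin> P"
  proof
    assume "free_gen R s \<in> P"
    then have "free_gen R s s \<in> \<mm>" using sub s ideal_mult_free[OF mm_ideal, of _ S] by blast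
    then show False using one_not_mm by (simp add: free_gen_def)
  qed
  ultimately have "k \<noteq> 0" using k by (intro notI) (simp add: subset_iff)
  then obtain l where l: "k = Suc l" by (cases k) auto
  have "\<not> B l \<subseteq> P" using not_less_Least[of l "\<lambda>k. B k \<subseteq> P"] l by (simp add: k_def)
  then obtain z where z: "z \<in> B l" "z \<notin> P" by blast
  have zc: "z \<in> carrier (FM S)" "\<And>s. z s \<in> mpow l" using z(1) by (auto simp: B_def)
  have "X i \<odot>\<^bsub>FM S\<^esub> z \<in> B k" if i: "i < d" for i
    using F.smult_closed[OF X_in[OF i] zc(1)] X_pow[OF i zc(2)] unfolding B_def l by simp
  then show ?thesis using z(2) zc(1) k by blast
qed

text \<open>The hypothesis \<open>H\<close> says that a pair of elements of the socle of \<open>F\<close> becomes a Koszul boundary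
  in \<open>F / P\<close>. With \<open>koszul_cycle\<close> it follows that all Koszul cycles of \<open>F\<close> do, which is what the
  count of dimensions requires. Here \<open>b\<close> is the rank \<open>card S\<close>, the dimension of \<open>F / \<mm>F\<close>.\<close>
lemma relations_two_variables:
  assumes d: "d = 2" and S: "finite S" and T: "finite T" and ne: "S \<noteq> {}"
    and q: "q \<in> module_hom R (FM T) (FM S)" and P: "P = q ` carrier (FM T)"
    and sub: "P \<subseteq> ideal_mult \<mm> (FM S)"
    and H: "\<And>u v. u \<in> carrier (FM S) \<Longrightarrow> v \<in> carrier (FM S) \<Longrightarrow> \<forall>s. u s \<in> mpow (n - 1) \<Longrightarrow>
      \<forall>s. v s \<in> mpow (n - 1) \<Longrightarrow>
      \<exists>w\<in>carrier (FM S). u \<oplus>\<^bsub>FM S\<^esub> X 1 \<odot>\<^bsub>FM S\<^esub> w \<in> P \<and> v \<ominus>\<^bsub>FM S\<^esub> X 0 \<odot>\<^bsub>FM S\<^esub> w \<in> P"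
  shows "card S + 1 \<le> card T"
proof -
  interpret F: module R "FM S" by (rule free_module_on_module)
  interpret FT: module R "FM T" by (rule free_module_on_module)
  have i: "0 < d" "1 < d" using d by simp_all
  have sum2: "(\<Sum>i<d. h i) = h 0 + h 1" for h :: "nat \<Rightarrow> nat \<times> (nat \<Rightarrow>\<^sub>0 nat) \<Rightarrow> 'k"
    unfolding d by (simp add: numeral_2_eq_2)
  have subP: "submodule R P (FM S)"
    unfolding P
    by (rule image_submodule[OF free_module_on_module free_module_on_module q])
      (rule submoduleI'[OF free_module_on_module], simp_all add: free_module_on_add free_module_on_smult
        free_module_on_carrier[of "\<lambda>s. \<zero>"])
  let ?F = "fun_space (S \<times> mons d n) :: (nat \<times> (nat \<Rightarrow>\<^sub>0 nat) \<Rightarrow> 'k) set"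
  let ?mF = "fun_space (S \<times> (mons d n - {0})) :: (nat \<times> (nat \<Rightarrow>\<^sub>0 nat) \<Rightarrow> 'k) set"
  let ?P = "coords ` P"
  note onto = coords_onto[OF S]
  note XF = F.smult_closed[OF X_in[OF i(1)]] F.smult_closed[OF X_in[OF i(2)]]
  have shF: "shift j f \<in> ?F" if "f \<in> ?F" "j < d" for j f
  proof -
    obtain x where x: "x \<in> carrier (FM S)" "coords x = f" using onto \<open>f \<in> ?F\<close> by blast
    show ?thesis using coords_supp[OF F.smult_closed[OF X_in[OF that(2)] x(1)]]
      unfolding coords_X[OF that(2) x(1)] x(2) .
  qed
  have comm: "shift 0 (shift 1 w) = shift 1 (shift 0 w)" if "w \<in> ?F" for w
  proof -
    obtain x where x: "x \<in> carrier (FM S)" "coords x = w" using onto \<open>w \<in> ?F\<close> by blast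
    have "shift 0 (shift 1 w) = coords (X 0 \<odot>\<^bsub>FM S\<^esub> (X 1 \<odot>\<^bsub>FM S\<^esub> x))"
      by (simp only: x(2)[symmetric] coords_X[OF i(1) XF(2)[OF x(1)]] coords_X[OF i(2) x(1)])
    also have "X 0 \<odot>\<^bsub>FM S\<^esub> (X 1 \<odot>\<^bsub>FM S\<^esub> x) = X 1 \<odot>\<^bsub>FM S\<^esub> (X 0 \<odot>\<^bsub>FM S\<^esub> x)"
      using x(1) X_in[OF i(1)] X_in[OF i(2)] by (simp only: F.smult_assoc1[symmetric] m_comm)
    also have "coords \<dots> = shift 1 (shift 0 w)"
      by (simp only: x(2)[symmetric] coords_X[OF i(2) XF(1)[OF x(1)]] coords_X[OF i(1) x(1)])
    finally show ?thesis .
  qed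
  have shP: "shift j ` ?P \<subseteq> ?P" if "j < d" for j
  proof (rule image_subsetI)
    fix f assume "f \<in> ?P"
    then obtain x where x: "x \<in> P" "f = coords x" by blast
    show "shift j f \<in> ?P"
      unfolding x(2) coords_X[OF that submodule_in[OF subP x(1)], symmetric]
      by (rule imageI) (rule submodule_smult[OF subP X_in[OF that] x(1)])
  qed
  have PF: "?P \<subseteq> ?F" using coords_supp submodule_in[OF subP] by blast
  have mF: "{shift 0 u + shift 1 v |u v. u \<in> ?F \<and> v \<in> ?F} = ?mF"
  proof
    show "{shift 0 u + shift 1 v |u v. u \<in> ?F \<and> v \<in> ?F} \<subseteq> ?mF"
    proof
      fix g assume "g \<in> {shift 0 u + shift 1 v |u v. u \<in> ?F \<and> v \<in> ?F}"
      then obtain u v where uv: "g = shift 0 u + shift 1 v" "u \<in> ?F" "v \<in> ?F" by blast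
      have "g \<in> ?F" unfolding uv(1) by (rule fs.subspace_add[OF fun_space_subspace shF[OF uv(2) i(1)] shF[OF uv(3) i(2)]])
      moreover have "g (s, 0) = 0" for s unfolding uv(1) by (simp add: shift_def)
      ultimately show "g \<in> ?mF" by (auto simp: fun_space_def)
    qed
    show "?mF \<subseteq> {shift 0 u + shift 1 v |u v. u \<in> ?F \<and> v \<in> ?F}"
    proof
      fix g assume g: "g \<in> ?mF"
      then have "g \<in> ?F" by (auto simp: fun_space_def)
      then obtain x where x: "x \<in> carrier (FM S)" "coords x = g" using onto by blast
      then have "x \<in> ideal_mult \<mm> (FM S)" using g mm_free_space by blast
      then obtain h where h: "h \<in> {..<d} \<rightarrow> carrier (FM S)" "coords x = (\<Sum>i<d. shift i (coords (h i)))"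
        using mm_free_decompose[OF S] by blast
      have "coords (h 0) \<in> ?F" "coords (h 1) \<in> ?F" using h(1) i by (auto intro!: coords_supp)
      then show "g \<in> {shift 0 u + shift 1 v |u v. u \<in> ?F \<and> v \<in> ?F}"
        using h(2) x(2) unfolding sum2 by blast
    qed
  qed
  have finm: "finite (S \<times> mons d n)" "finite (S \<times> (mons d n - {0}))" using S finite_mons by auto
  have "0 \<in> mons d n" using n by (intro zero_in_mons) simp
  then have "card (mons d n) = Suc (card (mons d n - {0}))"
    using card.remove[OF finite_mons] by blast
  then have b: "fs.dim ?F = fs.dim {shift 0 u + shift 1 v |u v. u \<in> ?F \<and> v \<in> ?F} + card S"
    unfolding mF fun_space_dim(2)[OF finm(1)] fun_space_dim(2)[OF finm(2)] card_cartesian_product by simp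
  have H': "\<exists>w\<in>?F. u + shift 1 w \<in> ?P \<and> v - shift 0 w \<in> ?P"
    if uF: "u \<in> ?F" and vF: "v \<in> ?F" and 0: "shift 0 u + shift 1 v = 0" for u v
  proof -
    obtain x where x: "x \<in> carrier (FM S)" "coords x = u" using onto uF by blast
    obtain y where y: "y \<in> carrier (FM S)" "coords y = v" using onto vF by blast
    note xs = free_module_on_in[OF x(1)] and ys = free_module_on_in[OF y(1)]
    have "coords (X 0 \<odot>\<^bsub>FM S\<^esub> x \<oplus>\<^bsub>FM S\<^esub> X 1 \<odot>\<^bsub>FM S\<^esub> y) = coords \<zero>\<^bsub>FM S\<^esub>"
      unfolding coords_add[OF XF(1)[OF x(1)] XF(2)[OF y(1)]] coords_X[OF i(1) x(1)] coords_X[OF i(2) y(1)] x(2) y(2) 0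
        coords_zero ..
    then have "X 0 \<odot>\<^bsub>FM S\<^esub> x \<oplus>\<^bsub>FM S\<^esub> X 1 \<odot>\<^bsub>FM S\<^esub> y = \<zero>\<^bsub>FM S\<^esub>"
      by (rule coords_inj[OF F.M.a_closed[OF XF(1)[OF x(1)] XF(2)[OF y(1)]] F.M.zero_closed])
    then have "X 0 \<otimes> x s \<oplus> X 1 \<otimes> y s = \<zero>" for s by (simp add: fun_eq_iff)
    then have "\<forall>s. \<exists>w. w \<in> carrier R \<and> x s \<oplus> X 1 \<otimes> w \<in> mpow (n - 1) \<and> y s \<ominus> X 0 \<otimes> w \<in> mpow (n - 1)"
      using koszul_cycle[OF d xs ys] by blast
    from choice[OF this] obtain w0 where w0: "\<forall>s. w0 s \<in> carrier R \<and>
      x s \<oplus> X 1 \<otimes> w0 s \<in> mpow (n - 1) \<and> y s \<ominus> X 0 \<otimes> w0 s \<in> mpow (n - 1)" ..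
    define w where "w s = (if s \<in> S then w0 s else \<zero>)" for s
    have w: "w \<in> carrier (FM S)" using w0 by (intro free_module_on_carrierI[OF S]) (auto simp: w_def)
    have zero_pow: "\<zero> \<in> mpow (n - 1)" by (simp add: mpow_def cf_zero)
    let ?x = "x \<oplus>\<^bsub>FM S\<^esub> X 1 \<odot>\<^bsub>FM S\<^esub> w" and ?y = "y \<ominus>\<^bsub>FM S\<^esub> X 0 \<odot>\<^bsub>FM S\<^esub> w"
    have xy: "?x \<in> carrier (FM S)" "?y \<in> carrier (FM S)"
      by (rule F.M.a_closed[OF x(1) XF(2)[OF w]], rule F.minus_closed[OF y(1) XF(1)[OF w]])
    have xp: "?x s \<in> mpow (n - 1)" for s
    proof (cases "s \<in> S")
      case True then show ?thesis using w0 by (simp add: w_def)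
    next
      case False then show ?thesis using xy(1) zero_pow by (metis free_module_on_carrier)
    qed
    have yp: "?y s \<in> mpow (n - 1)" for s
    proof (cases "s \<in> S")
      case True
      then show ?thesis using w0 unfolding free_module_on_minus[OF y(1) XF(1)[OF w]] by (simp add: w_def)
    next
      case False then show ?thesis using xy(2) zero_pow by (metis free_module_on_carrier)
    qed
    obtain w' where w': "w' \<in> carrier (FM S)" "?x \<oplus>\<^bsub>FM S\<^esub> X 1 \<odot>\<^bsub>FM S\<^esub> w' \<in> P" "?y \<ominus>\<^bsub>FM S\<^esub> X 0 \<odot>\<^bsub>FM S\<^esub> w' \<in> P"
      using H[OF xy] xp yp by blast
    have "coords (?x \<oplus>\<^bsub>FM S\<^esub> X 1 \<odot>\<^bsub>FM S\<^esub> w') = u + shift 1 (coords w + coords w')"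
      unfolding coords_add[OF xy(1) XF(2)[OF w'(1)]] coords_add[OF x(1) XF(2)[OF w]] coords_X[OF i(2) w] coords_X[OF i(2) w'(1)] x(2) shift.add
      by (simp only: add.assoc)
    moreover have "coords (?y \<ominus>\<^bsub>FM S\<^esub> X 0 \<odot>\<^bsub>FM S\<^esub> w') = v - shift 0 (coords w + coords w')"
      unfolding coords_minus[OF xy(2) XF(1)[OF w'(1)]] coords_minus[OF y(1) XF(1)[OF w]] coords_X[OF i(1) w] coords_X[OF i(1) w'(1)] y(2) shift.add
      by (simp only: diff_diff_eq)
    ultimately have "u + shift 1 (coords w + coords w') \<in> ?P" "v - shift 0 (coords w + coords w') \<in> ?P" using w'(2,3) by (metis imageI)+
    moreover have "coords w + coords w' \<in> ?F" by (rule fs.subspace_add[OF fun_space_subspace coords_supp[OF w] coords_supp[OF w'(1)]])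
    ultimately show ?thesis by blast
  qed
  obtain z where z: "z \<in> carrier (FM S)" "z \<notin> P" "\<forall>i<d. X i \<odot>\<^bsub>FM S\<^esub> z \<in> P"
    using socle_element[OF S subP sub ne] by blast
  have zP: "coords z \<notin> ?P"
  proof
    assume "coords z \<in> ?P"
    then obtain y where y: "y \<in> P" "coords z = coords y" by blast
    then have "z = y" using coords_inj[OF z(1) submodule_in[OF subP y(1)]] by blast
    then show False using y(1) z(2) by simp
  qed
  have zX: "shift j (coords z) \<in> ?P" if "j < d" for j
    unfolding coords_X[OF that z(1), symmetric] using z(3) that by blast
  let ?A = "coords ` q ` free_gen R ` T"
  have gen: "\<exists>a\<in>fs.span ?A. \<exists>u\<in>?P. \<exists>v\<in>?P. p = a + shift 0 u + shift 1 v" if pP: "p \<in> ?P" for p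
  proof -
    obtain f where f: "f \<in> carrier (FM T)" "p = coords (q f)" using pP unfolding P by blast
    obtain a g where a: "a \<in> fs.span ?A" "g \<in> {..<d} \<rightarrow> carrier (FM T)"
        "coords (q f) = a + (\<Sum>i<d. shift i (coords (q (g i))))"
      using generators_span[OF q f(1)] by blast
    have "g 0 \<in> carrier (FM T)" "g 1 \<in> carrier (FM T)" using a(2) i by auto
    then have "coords (q (g 0)) \<in> ?P" "coords (q (g 1)) \<in> ?P" unfolding P by blast+
    moreover have "p = a + shift 0 (coords (q (g 0))) + shift 1 (coords (q (g 1)))"
      using a(3) f(2) unfolding sum2 by (simp only: add.assoc)
    ultimately show ?thesis using a(1) by blast
  qed
  have finA: "finite ?A" using T by simp
  have "card S + 1 \<le> card ?A"
    by (rule fs.koszul_count[OF linear_shift linear_shift comm fun_space_subspace fin_dim_space[OF S] _ _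
          coords_subspace[OF subP] PF shP[OF i(1)] shP[OF i(2)] b H' coords_supp[OF z(1)] zP zX[OF i(1)] zX[OF i(2)] finA gen])
      (use shF i in auto)
  also have "card ?A \<le> card T"
    by (rule order_trans[OF card_image_le order_trans[OF card_image_le card_image_le]]) (use T in simp_all)
  finally show ?thesis .
qed

text \<open>If \<open>\<mm>\<^sup>2 = 0\<close> then \<open>\<mm>P = 0\<close>, so the generators of \<open>P\<close> span it as a vector space. Together
  with \<open>t\<close> they span \<open>\<mm>F\<close>, a space of dimension \<open>d * card S\<close>. The case \<open>t = 0\<close> serves
  the higher syzygies, the other one the canonical module.\<close>
lemma relations_square_zero:
  assumes n2: "n = 2" and S: "finite S" and T: "finite T"
    and q: "q \<in> module_hom R (FM T) (FM S)" and P: "P = q ` carrier (FM T)"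
    and sub: "P \<subseteq> ideal_mult \<mm> (FM S)" and t: "t \<in> carrier (FM S)"
    and cod: "\<And>u. u \<in> ideal_mult \<mm> (FM S) \<Longrightarrow> \<exists>c. u \<ominus>\<^bsub>FM S\<^esub> const c \<odot>\<^bsub>FM S\<^esub> t \<in> P"
  shows "d * card S \<le> card T + (if t = \<zero>\<^bsub>FM S\<^esub> then 0 else 1)"
proof -
  interpret F: module R "FM S" by (rule free_module_on_module)
  let ?mF = "fun_space (S \<times> (mons d n - {0})) :: (nat \<times> (nat \<Rightarrow>\<^sub>0 nat) \<Rightarrow> 'k) set"
  let ?A = "coords ` q ` free_gen R ` T"
  have killed: "shift i (coords x) = 0" if i: "i < d" and x: "x \<in> ideal_mult \<mm> (FM S)" for i x
  proof -
    have x': "x \<in> carrier (FM S)" "\<forall>s\<in>S. x s \<in> \<mm>"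
      using x ideal_mult_free[OF mm_ideal, of x S] by blast+
    have "X i \<otimes> x s = \<zero>" for s
    proof (cases "s \<in> S")
      case True
      then have "x s \<in> mpow (n - 1)" using x'(2) mm_pow by (simp add: n2)
      then show ?thesis by (rule soc_killed[OF X_mm[OF i]])
    next
      case False
      then have "x s = \<zero>" using x'(1) by (simp add: free_module_on_carrier)
      then show ?thesis using X_in[OF i] by simp
    qed
    then have "X i \<odot>\<^bsub>FM S\<^esub> x = \<zero>\<^bsub>FM S\<^esub>" by (simp add: fun_eq_iff)
    then show ?thesis using coords_X[OF i x'(1)] coords_zero[of S] by metis
  qed
  have spanP: "coords p \<in> fs.span ?A" if "p \<in> P" for p
  proof -
    obtain f where f: "f \<in> carrier (FM T)" "p = q f" using \<open>p \<in> P\<close> unfolding P by blast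
    obtain a g where a: "a \<in> fs.span ?A" "g \<in> {..<d} \<rightarrow> carrier (FM T)"
        "coords (q f) = a + (\<Sum>i<d. shift i (coords (q (g i))))"
      using generators_span[OF q f(1)] by blast
    have "(\<Sum>i<d. shift i (coords (q (g i)))) = 0"
    proof (rule sum.neutral, rule ballI)
      fix i assume i: "i \<in> {..<d}"
      then have "q (g i) \<in> ideal_mult \<mm> (FM S)" using a(2) sub unfolding P by blast
      then show "shift i (coords (q (g i))) = 0" using killed i by simp
    qed
    then show ?thesis using a(1,3) f(2) by simp
  qed
  have span: "?mF \<subseteq> fs.span (insert (coords t) ?A)"
  proof
    fix g assume g: "g \<in> ?mF"
    then have "g \<in> fun_space (S \<times> mons d n)" by (auto simp: fun_space_def)
    then obtain u where u: "u \<in> carrier (FM S)" "coords u = g" using coords_onto[OF S] by blast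
    then have "u \<in> ideal_mult \<mm> (FM S)" using g mm_free_space by blast
    then obtain c where c: "u \<ominus>\<^bsub>FM S\<^esub> const c \<odot>\<^bsub>FM S\<^esub> t \<in> P" using cod by blast
    have "coords (u \<ominus>\<^bsub>FM S\<^esub> const c \<odot>\<^bsub>FM S\<^esub> t) = g - fun_scale c (coords t)"
      unfolding coords_minus[OF u(1) F.smult_closed[OF const_in t]] coords_const[OF t] u(2) ..
    then have "g - fun_scale c (coords t) \<in> fs.span (insert (coords t) ?A)"
      using spanP[OF c] fs.span_mono[of ?A "insert (coords t) ?A"] by auto
    moreover have "fun_scale c (coords t) \<in> fs.span (insert (coords t) ?A)"
      by (intro fs.span_scale fs.span_base) simp
    ultimately have "g - fun_scale c (coords t) + fun_scale c (coords t) \<in> fs.span (insert (coords t) ?A)"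
      by (rule fs.span_add)
    then show "g \<in> fs.span (insert (coords t) ?A)" by (simp only: diff_add_cancel)
  qed
  have cardA: "card ?A \<le> card T"
    by (rule order_trans[OF card_image_le order_trans[OF card_image_le card_image_le]]) (use T in simp_all)
  have finA: "finite ?A" using T by simp
  have "finite (S \<times> (mons d n - {0}))" using S finite_mons by auto
  then have dim: "fs.dim ?mF = d * card S"
    unfolding n2 by (subst fun_space_dim(2)) (simp_all add: card_cartesian_product card_mons_two del: One_nat_def)
  show ?thesis
  proof (cases "t = \<zero>\<^bsub>FM S\<^esub>")
    case True
    then have "coords t = 0" using coords_zero by metis
    then have "?mF \<subseteq> fs.span ?A" using span by (simp only: fs.span_insert_0)
    then have "fs.dim ?mF \<le> card ?A" by (rule fs.dim_le_card[OF _ finA])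
    then show ?thesis using cardA dim True by (simp del: free_module_on_simps)
  next
    case False
    have "fs.dim ?mF \<le> card (insert (coords t) ?A)" by (rule fs.dim_le_card[OF span]) (use finA in simp)
    also have "\<dots> \<le> card ?A + 1" using finA by (simp add: card_insert_if)
    finally show ?thesis using cardA dim False by (simp del: free_module_on_simps)
  qed
qed

end

section \<open>The canonical module\<close>

context truncated_algebra begin

lemma const_mult_one: "cf (const c) = (\<lambda>\<mu>. c * cf \<one> \<mu>)"
  using cf_const[OF one_closed, of c] const_in by simp

lemma const_add: "const (a + b) = const a \<oplus> const b"
  by (rule cf_inj) (simp_all add: const_in cf_add const_mult_one algebra_simps)

lemma const_mult: "const a \<otimes> const b = const (a * b)"
  by (rule cf_inj) (simp_all add: const_in cf_const const_mult_one algebra_simps)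

lemma const_zero: "const 0 = \<zero>"
  by (rule cf_inj) (simp_all add: const_in cf_zero const_mult_one)

lemma const_one: "const 1 = \<one>"
  by (rule cf_inj) (simp_all add: const_in const_mult_one)

definition mon_el :: "(nat \<Rightarrow>\<^sub>0 nat) \<Rightarrow> 'a" where
  "mon_el \<nu> = (SOME r. r \<in> carrier R \<and> cf r = fun_unit \<nu>)"

lemma mon_el:
  assumes "\<nu> \<in> mons d n"
  shows "mon_el \<nu> \<in> carrier R" "cf (mon_el \<nu>) = fun_unit \<nu>"
proof -
  have "(fun_unit \<nu> :: _ \<Rightarrow> 'k) \<in> fun_space (mons d n)" using assms by (auto simp: fun_space_def fun_unit_def)
  then have "\<exists>r. r \<in> carrier R \<and> cf r = fun_unit \<nu>" using cf_onto by blast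
  from someI_ex[OF this] show "mon_el \<nu> \<in> carrier R" "cf (mon_el \<nu>) = fun_unit \<nu>"
    unfolding mon_el_def by blast+
qed

context
  fixes W :: "('a, 'w) module"
  assumes can: "canonical_module R W"
begin

lemma W_module: "module R W"
  using can by (simp add: canonical_module_def injective_hull_def injective_module_def)

interpretation W: module R W by (rule W_module)

text \<open>The embedding of the residue field of which \<open>W\<close> is an injective hull.\<close>
definition socle_emb :: "'a set \<Rightarrow> 'w" where
  "socle_emb = (SOME f. f \<in> module_hom R \<kappa> W \<and> inj_on f (carrier \<kappa>) \<and>
     (\<forall>N. submodule R N W \<and> N \<noteq> {\<zero>\<^bsub>W\<^esub>} \<longrightarrow> N \<inter> f ` carrier \<kappa> \<noteq> {\<zero>\<^bsub>W\<^esub>}))"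

lemma socle_emb: "socle_emb \<in> module_hom R \<kappa> W" "inj_on socle_emb (carrier \<kappa>)"
  "submodule R N W \<Longrightarrow> N \<noteq> {\<zero>\<^bsub>W\<^esub>} \<Longrightarrow> N \<inter> socle_emb ` carrier \<kappa> \<noteq> {\<zero>\<^bsub>W\<^esub>}"
proof -
  let ?P = "\<lambda>f. f \<in> module_hom R \<kappa> W \<and> inj_on f (carrier \<kappa>) \<and>
     (\<forall>N. submodule R N W \<and> N \<noteq> {\<zero>\<^bsub>W\<^esub>} \<longrightarrow> N \<inter> f ` carrier \<kappa> \<noteq> {\<zero>\<^bsub>W\<^esub>})"
  have "\<exists>f. ?P f" using can unfolding canonical_module_def injective_hull_def by blast
  then have P: "?P socle_emb" unfolding socle_emb_def by (rule someI_ex)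
  then show "socle_emb \<in> module_hom R \<kappa> W" "inj_on socle_emb (carrier \<kappa>)" by blast+
  show "N \<inter> socle_emb ` carrier \<kappa> \<noteq> {\<zero>\<^bsub>W\<^esub>}" if "submodule R N W" "N \<noteq> {\<zero>\<^bsub>W\<^esub>}"
    using P that by blast
qed

text \<open>The field \<open>k\<close> is identified with the image of the residue field, which turns out to be the socle
  of the canonical module.\<close>
definition \<sigma> :: "'k \<Rightarrow> 'w" where "\<sigma> c = socle_emb (res (const c))"

lemma sigma_in: "\<sigma> c \<in> carrier W"
  unfolding \<sigma>_def by (rule hom_in[OF socle_emb(1) res_in[OF const_in]])

lemma socle_emb_res:
  assumes "r \<in> carrier R" shows "socle_emb (res r) = \<sigma> (cf r 0)"
proof -
  obtain r1 where r1: "r1 \<in> \<mm>" "r = const (cf r 0) \<oplus> r1" using split_const[OF assms] by blast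
  interpret K: module R \<kappa> by (rule res_module)
  have "res (const (cf r 0) \<oplus> r1) = res (const (cf r 0))"
    unfolding res_add[OF const_in Icarr[OF r1(1)]] res_zero[OF r1(1)]
    by (rule K.M.r_zero[OF res_in[OF const_in]])
  then show ?thesis unfolding \<sigma>_def r1(2)[symmetric] by simp
qed

lemma sigma_smult: "r \<in> carrier R \<Longrightarrow> r \<odot>\<^bsub>W\<^esub> \<sigma> c = \<sigma> (cf r 0 * c)"
proof -
  assume r: "r \<in> carrier R"
  have "r \<odot>\<^bsub>W\<^esub> \<sigma> c = socle_emb (res (r \<otimes> const c))"
    unfolding \<sigma>_def res_smult[OF r const_in] by (rule module_hom_smult[OF socle_emb(1) r res_in[OF const_in], symmetric])
  also have "\<dots> = \<sigma> (cf (const c \<otimes> r) 0)"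
    using socle_emb_res[OF m_closed[OF r const_in]] m_comm[OF r const_in] by simp
  also have "cf (const c \<otimes> r) 0 = cf r 0 * c" using cf_const[OF r, of c] by simp
  finally show "r \<odot>\<^bsub>W\<^esub> \<sigma> c = \<sigma> (cf r 0 * c)" .
qed

lemma sigma_add: "\<sigma> (a + b) = \<sigma> a \<oplus>\<^bsub>W\<^esub> \<sigma> b"
  unfolding \<sigma>_def const_add res_add[OF const_in const_in]
  by (rule module_hom_add[OF socle_emb(1) res_in[OF const_in] res_in[OF const_in]])

lemma sigma_zero: "\<sigma> 0 = \<zero>\<^bsub>W\<^esub>"
  using sigma_add[of 0 0] sigma_in[of 0] by simp

lemma sigma_sum: "finite T \<Longrightarrow> (\<Oplus>\<^bsub>W\<^esub>i\<in>T. \<sigma> (h i)) = \<sigma> (\<Sum>i\<in>T. h i)"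
  by (induction T rule: finite_induct) (simp_all add: sigma_zero sigma_add sigma_in Pi_iff)

lemma sigma_eq_zero: "\<sigma> c = \<zero>\<^bsub>W\<^esub> \<Longrightarrow> c = 0"
proof -
  assume "\<sigma> c = \<zero>\<^bsub>W\<^esub>"
  interpret K: module R \<kappa> by (rule res_module)
  have "socle_emb (res (const c)) = socle_emb \<zero>\<^bsub>\<kappa>\<^esub>"
    using \<open>\<sigma> c = \<zero>\<^bsub>W\<^esub>\<close> hom_zero[OF res_module W_module socle_emb(1)] unfolding \<sigma>_def by simp
  then have "res (const c) = \<zero>\<^bsub>\<kappa>\<^esub>"
    by (rule inj_onD[OF socle_emb(2) _ res_in[OF const_in] K.M.zero_closed])
  then have "const c \<in> \<mm>" using res_hom(3)[of "const c"] const_in by simp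
  then show "c = 0" using mm_iff[OF const_in] by (simp add: const_mult_one cf_one)
qed

text \<open>A nonzero element \<open>w\<close> of the socle generates a submodule that is a line over \<open>k\<close>. By
  essentiality this line meets the image of the residue field, so it is contained in it.\<close>
lemma socle_canonical:
  assumes w: "w \<in> carrier W" and X: "\<And>i. i < d \<Longrightarrow> X i \<odot>\<^bsub>W\<^esub> w = \<zero>\<^bsub>W\<^esub>"
  shows "\<exists>c. w = \<sigma> c"
proof (cases "w = \<zero>\<^bsub>W\<^esub>")
  case True then show ?thesis using sigma_zero by metis
next
  case False
  have mm: "r \<odot>\<^bsub>W\<^esub> w = \<zero>\<^bsub>W\<^esub>" if r: "r \<in> \<mm>" for r
  proof -
    obtain \<rho> where \<rho>: "\<rho> \<in> {..<d} \<rightarrow> carrier R" "r = (\<Oplus>i\<in>{..<d}. X i \<otimes> \<rho> i)"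
      using mm_decompose[OF r] by blast
    let ?A = "{x \<in> carrier R. x \<odot>\<^bsub>W\<^esub> w = \<zero>\<^bsub>W\<^esub>}"
    have hom: "(\<lambda>x. x \<odot>\<^bsub>W\<^esub> w) \<in> module_hom R (regular_module R) W"
      using w by (intro module_homI) (simp_all add: W.smult_l_distr W.smult_assoc1)
    have "submodule R (a_kernel (regular_module R) W (\<lambda>x. x \<odot>\<^bsub>W\<^esub> w)) (regular_module R)"
      by (rule kernel_submodule[OF regular_module_module W_module hom])
    then have A: "submodule R ?A (regular_module R)" by (simp add: a_kernel_def')
    have "finsum (regular_module R) (\<lambda>i. X i \<otimes> \<rho> i) {..<d} \<in> ?A"
    proof (rule finsum_in_submodule[OF A finite_lessThan], rule Pi_I)
      fix i assume i: "i \<in> {..<d}"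
      have \<rho>i: "\<rho> i \<in> carrier R" by (rule funcset_mem[OF \<rho>(1) i])
      have Xi: "X i \<in> carrier R" using X_in i by simp
      have "(X i \<otimes> \<rho> i) \<odot>\<^bsub>W\<^esub> w = \<rho> i \<odot>\<^bsub>W\<^esub> (X i \<odot>\<^bsub>W\<^esub> w)"
        unfolding m_comm[OF Xi \<rho>i] by (rule W.smult_assoc1[OF \<rho>i Xi w])
      then show "X i \<otimes> \<rho> i \<in> ?A" using X i \<rho>i Xi by simp
    qed
    moreover have "finsum (regular_module R) (\<lambda>i. X i \<otimes> \<rho> i) {..<d} = r"
      unfolding \<rho>(2) by (simp add: finsum_def finprod_def regular_module_def)
    ultimately show ?thesis by simp
  qed
  let ?N = "(\<lambda>x. x \<odot>\<^bsub>W\<^esub> w) ` carrier R"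
  have hom: "(\<lambda>x. x \<odot>\<^bsub>W\<^esub> w) \<in> module_hom R (regular_module R) W"
    using w by (intro module_homI) (simp_all add: W.smult_l_distr W.smult_assoc1)
  have full: "submodule R (carrier R) (regular_module R)"
    by (rule submoduleI'[OF regular_module_module]) simp_all
  have N: "submodule R ?N W" by (rule image_submodule[OF regular_module_module W_module hom full])
  have wN: "w \<in> ?N" using W.smult_one[OF w] by (metis image_eqI one_closed)
  then have "?N \<noteq> {\<zero>\<^bsub>W\<^esub>}" using False by blast
  from socle_emb(3)[OF N this] have "?N \<inter> socle_emb ` carrier \<kappa> \<noteq> {\<zero>\<^bsub>W\<^esub>}" .
  moreover have "\<zero>\<^bsub>W\<^esub> \<in> ?N \<inter> socle_emb ` carrier \<kappa>"
  proof -
    have "\<zero>\<^bsub>W\<^esub> = socle_emb (res (const 0))" using sigma_zero unfolding \<sigma>_def by simp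
    then show ?thesis using submodule_zero[OF N] res_in[OF const_in] by blast
  qed
  ultimately obtain y where y: "y \<in> ?N" "y \<in> socle_emb ` carrier \<kappa>" "y \<noteq> \<zero>\<^bsub>W\<^esub>" by blast
  obtain r where r: "r \<in> carrier R" "y = r \<odot>\<^bsub>W\<^esub> w" using y(1) by blast
  obtain a where a: "a \<in> carrier R" "y = socle_emb (res a)" using y(2) res_surj by blast
  obtain r1 where r1: "r1 \<in> \<mm>" "r = const (cf r 0) \<oplus> r1" using split_const[OF r(1)] by blast
  let ?c = "cf r 0"
  have "y = const ?c \<odot>\<^bsub>W\<^esub> w \<oplus>\<^bsub>W\<^esub> r1 \<odot>\<^bsub>W\<^esub> w"
    using W.smult_l_distr[OF const_in Icarr[OF r1(1)] w, of ?c] unfolding r1(2)[symmetric] r(2) .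
  then have y': "y = const ?c \<odot>\<^bsub>W\<^esub> w"
    unfolding mm[OF r1(1)] using W.smult_closed[OF const_in w] by simp
  have c: "?c \<noteq> 0"
  proof
    assume "?c = 0"
    then have "y = \<zero>\<^bsub>W\<^esub>" unfolding y' using w by (simp add: const_zero)
    then show False using y(3) by blast
  qed
  have "w = const (1 / ?c) \<odot>\<^bsub>W\<^esub> y"
    unfolding y' W.smult_assoc1[OF const_in const_in w, symmetric] const_mult
    using c w by (simp add: const_one)
  also have "\<dots> = const (1 / ?c) \<odot>\<^bsub>W\<^esub> \<sigma> (cf a 0)" using a socle_emb_res by simp
  finally show ?thesis unfolding sigma_smult[OF const_in] by blast
qed

text \<open>Injectivity realizes the functional "coefficient at \<open>\<nu>\<close>", which is \<open>R\<close>-linear on the power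
  of the maximal ideal in which the monomial \<open>\<nu>\<close> has the least degree, by an element.\<close>
lemma coefficient_element:
  "\<exists>w\<in>carrier W. \<forall>r\<in>mpow (mdeg d \<nu>). r \<odot>\<^bsub>W\<^esub> w = \<sigma> (cf r \<nu>)"
proof -
  let ?j = "mdeg d \<nu>"
  let ?B = "regular_module R"
  let ?A = "?B\<lparr>carrier := mpow ?j\<rparr>"
  have sub: "submodule R (mpow ?j) ?B" by (rule ideal_regular_submodule[OF pow_ideal])
  have A: "module R ?A" by (rule submodule_as_module[OF regular_module_module sub])
  have inR: "r \<in> carrier R" if "r \<in> mpow ?j" for r using that by (rule mpowD(1))
  have f: "(\<lambda>x. x) \<in> module_hom R ?A ?B" using inR by (intro module_homI) simp_all
  have g: "(\<lambda>r. \<sigma> (cf r \<nu>)) \<in> module_hom R ?A W"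
  proof (rule module_homI)
    show "\<sigma> (cf x \<nu>) \<in> carrier W" for x by (rule sigma_in)
    fix x assume "x \<in> carrier ?A"
    then have x: "x \<in> mpow ?j" by simp
    { fix y assume "y \<in> carrier ?A"
      then show "\<sigma> (cf (x \<oplus>\<^bsub>?A\<^esub> y) \<nu>) = \<sigma> (cf x \<nu>) \<oplus>\<^bsub>W\<^esub> \<sigma> (cf y \<nu>)"
        using inR x by (simp add: cf_add sigma_add) }
    fix r assume r: "r \<in> carrier R"
    show "\<sigma> (cf (r \<odot>\<^bsub>?A\<^esub> x) \<nu>) = r \<odot>\<^bsub>W\<^esub> \<sigma> (cf x \<nu>)"
      using mult_low[OF x r order_refl] by (simp add: sigma_smult[OF r])
  qed
  have "\<forall>(A :: ('a, 'a) module) (B :: ('a, 'a) module) f g.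
        module R A \<and> module R B \<and> f \<in> module_hom R A B \<and> inj_on f (carrier A) \<and>
        g \<in> module_hom R A W \<longrightarrow> (\<exists>h\<in>module_hom R B W. \<forall>x\<in>carrier A. h (f x) = g x)"
    using can unfolding canonical_module_def injective_hull_def injective_module_def by (elim conjE)
  from this[THEN spec[of _ ?A], THEN spec[of _ ?B], THEN spec[of _ "\<lambda>x. x"],
      THEN spec[of _ "\<lambda>r. \<sigma> (cf r \<nu>)"], THEN mp,
      OF conjI[OF A conjI[OF regular_module_module conjI[OF f conjI[OF inj_on_id2 g]]]]]
  obtain h where h: "h \<in> module_hom R ?B W" "\<forall>x\<in>carrier ?A. h x = \<sigma> (cf x \<nu>)" ..
  have "r \<odot>\<^bsub>W\<^esub> h \<one> = \<sigma> (cf r \<nu>)" if r: "r \<in> mpow ?j" for r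
    using module_hom_smult[OF h(1) inR[OF r], of \<one>] h(2) r inR[OF r] by simp
  moreover have "h \<one> \<in> carrier W" by (rule hom_in[OF h(1)]) simp
  ultimately show ?thesis by blast
qed

text \<open>Only the action on \<open>\<mm>\<^sup>j\<close> with \<open>j\<close> the degree of \<open>\<nu>\<close> is prescribed; on elements of lower order the
  coefficient at \<open>\<nu>\<close> is not linear over \<open>R\<close>.\<close>
definition coeff_elem :: "(nat \<Rightarrow>\<^sub>0 nat) \<Rightarrow> 'w" where
  "coeff_elem \<nu> = (SOME w. w \<in> carrier W \<and> (\<forall>r\<in>mpow (mdeg d \<nu>). r \<odot>\<^bsub>W\<^esub> w = \<sigma> (cf r \<nu>)))"

lemma coeff_elem: "coeff_elem \<nu> \<in> carrier W" "r \<in> mpow (mdeg d \<nu>) \<Longrightarrow> r \<odot>\<^bsub>W\<^esub> coeff_elem \<nu> = \<sigma> (cf r \<nu>)"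
proof -
  have "\<exists>w. w \<in> carrier W \<and> (\<forall>r\<in>mpow (mdeg d \<nu>). r \<odot>\<^bsub>W\<^esub> w = \<sigma> (cf r \<nu>))"
    using coefficient_element by blast
  from someI_ex[OF this]
  show "coeff_elem \<nu> \<in> carrier W" "r \<in> mpow (mdeg d \<nu>) \<Longrightarrow> r \<odot>\<^bsub>W\<^esub> coeff_elem \<nu> = \<sigma> (cf r \<nu>)"
    unfolding coeff_elem_def by blast+
qed

text \<open>By induction on the power \<open>j\<close> of \<open>\<mm>\<close> that kills \<open>w\<close>. If \<open>\<mm>\<^sup>j\<^sup>+\<^sup>1\<close> kills \<open>w\<close>, then each monomial of
  degree \<open>j\<close> sends \<open>w\<close> into the socle \<open>k\<close>. The combination of the coefficient elements of degree
  \<open>j\<close> with these values agrees with \<open>w\<close> as a functional on \<open>\<mm>\<^sup>j\<close>, so the difference is killed by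
  \<open>\<mm>\<^sup>j\<close>.\<close>
lemma canonical_spanned:
  assumes N: "submodule R N W" and gens: "\<And>\<nu>. \<nu> \<in> mons d n \<Longrightarrow> coeff_elem \<nu> \<in> N"
  shows "w \<in> carrier W \<Longrightarrow> (\<And>r. r \<in> mpow j \<Longrightarrow> r \<odot>\<^bsub>W\<^esub> w = \<zero>\<^bsub>W\<^esub>) \<Longrightarrow> w \<in> N"
proof (induction j arbitrary: w)
  case 0
  have "\<one> \<in> mpow 0" by (simp add: mpow_def)
  then have "w = \<zero>\<^bsub>W\<^esub>" using "0.prems" W.smult_one by metis
  then show ?case using submodule_zero[OF N] by simp
next
  case (Suc j)
  note w = Suc.prems(1)
  let ?T = "{\<nu> \<in> mons d n. mdeg d \<nu> = j}"
  have finT: "finite ?T" using finite_mons by simp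
  have xp: "mon_el \<nu> \<in> mpow j" if "\<nu> \<in> ?T" for \<nu>
    using mon_el[of \<nu>] that by (auto simp: mpow_def fun_unit_def)
  have "\<forall>\<nu>\<in>?T. \<exists>c. mon_el \<nu> \<odot>\<^bsub>W\<^esub> w = \<sigma> c"
  proof
    fix \<nu> assume \<nu>: "\<nu> \<in> ?T"
    have m: "mon_el \<nu> \<in> carrier R" using mon_el(1) \<nu> by blast
    show "\<exists>c. mon_el \<nu> \<odot>\<^bsub>W\<^esub> w = \<sigma> c"
    proof (rule socle_canonical[OF W.smult_closed[OF m w]])
      fix i assume i: "i < d"
      show "X i \<odot>\<^bsub>W\<^esub> (mon_el \<nu> \<odot>\<^bsub>W\<^esub> w) = \<zero>\<^bsub>W\<^esub>"
        unfolding W.smult_assoc1[OF X_in[OF i] m w, symmetric]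
        by (rule Suc.prems(2)[OF X_pow[OF i xp[OF \<nu>]]])
    qed
  qed
  from bchoice[OF this] obtain c where c: "\<forall>\<nu>\<in>?T. mon_el \<nu> \<odot>\<^bsub>W\<^esub> w = \<sigma> (c \<nu>)" ..
  define v where "v = (\<Oplus>\<^bsub>W\<^esub>\<nu>\<in>?T. const (c \<nu>) \<odot>\<^bsub>W\<^esub> coeff_elem \<nu>)"
  have v_fam: "(\<lambda>\<nu>. const (c \<nu>) \<odot>\<^bsub>W\<^esub> coeff_elem \<nu>) \<in> ?T \<rightarrow> carrier W"
    by (rule Pi_I) (rule W.smult_closed[OF const_in coeff_elem(1)])
  have vN: "v \<in> N" unfolding v_def
    by (rule finsum_in_submodule[OF N finT], rule Pi_I, rule submodule_smult[OF N const_in], rule gens) simp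
  have vW: "v \<in> carrier W" by (rule submodule_in[OF N vN])
  have rv: "r \<odot>\<^bsub>W\<^esub> v = \<sigma> (\<Sum>\<nu>\<in>?T. c \<nu> * cf r \<nu>)" if r: "r \<in> mpow j" for r
  proof -
    note rR = mpowD(1)[OF r]
    have "r \<odot>\<^bsub>W\<^esub> v = (\<Oplus>\<^bsub>W\<^esub>\<nu>\<in>?T. r \<odot>\<^bsub>W\<^esub> (const (c \<nu>) \<odot>\<^bsub>W\<^esub> coeff_elem \<nu>))"
      unfolding v_def by (rule W.finsum_smult_ldistr[OF finT rR v_fam])
    also have "\<dots> = (\<Oplus>\<^bsub>W\<^esub>\<nu>\<in>?T. \<sigma> (c \<nu> * cf r \<nu>))"
    proof (rule W.finsum_cong'[OF refl])
      show "(\<lambda>\<nu>. \<sigma> (c \<nu> * cf r \<nu>)) \<in> ?T \<rightarrow> carrier W" by (rule Pi_I) (rule sigma_in)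
      fix \<nu> assume \<nu>: "\<nu> \<in> ?T"
      have "r \<odot>\<^bsub>W\<^esub> (const (c \<nu>) \<odot>\<^bsub>W\<^esub> coeff_elem \<nu>) = const (c \<nu>) \<odot>\<^bsub>W\<^esub> (r \<odot>\<^bsub>W\<^esub> coeff_elem \<nu>)"
        by (simp only: W.smult_assoc1[OF rR const_in coeff_elem(1), symmetric] m_comm[OF rR const_in]
          W.smult_assoc1[OF const_in rR coeff_elem(1)])
      also have "r \<odot>\<^bsub>W\<^esub> coeff_elem \<nu> = \<sigma> (cf r \<nu>)" using \<nu> r by (intro coeff_elem(2)) simp
      also have "const (c \<nu>) \<odot>\<^bsub>W\<^esub> \<sigma> (cf r \<nu>) = \<sigma> (c \<nu> * cf r \<nu>)"
        by (simp add: sigma_smult[OF const_in] const_mult_one cf_one)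
      finally show "r \<odot>\<^bsub>W\<^esub> (const (c \<nu>) \<odot>\<^bsub>W\<^esub> coeff_elem \<nu>) = \<sigma> (c \<nu> * cf r \<nu>)" .
    qed
    also have "\<dots> = \<sigma> (\<Sum>\<nu>\<in>?T. c \<nu> * cf r \<nu>)" by (rule sigma_sum[OF finT])
    finally show ?thesis .
  qed
  have rw: "r \<odot>\<^bsub>W\<^esub> w = \<sigma> (\<Sum>\<nu>\<in>?T. c \<nu> * cf r \<nu>)" if r: "r \<in> mpow j" for r
  proof -
    note rR = mpowD(1)[OF r]
    let ?f = "\<lambda>\<nu>. const (cf r \<nu>) \<otimes> mon_el \<nu>"
    have f: "?f \<in> ?T \<rightarrow> carrier R" by (rule Pi_I) (rule m_closed[OF const_in], rule mon_el(1), simp)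
    let ?y = "\<Oplus>\<nu>\<in>?T. ?f \<nu>"
    have y: "?y \<in> carrier R" by (rule finsum_closed[OF f])
    have cfy: "cf ?y \<mu> = (if \<mu> \<in> ?T then cf r \<mu> else 0)" for \<mu>
    proof -
      have "cf ?y \<mu> = (\<Sum>\<nu>\<in>?T. cf (?f \<nu>) \<mu>)" by (rule cf_finsum[OF finT f])
      also have "\<dots> = (\<Sum>\<nu>\<in>?T. if \<nu> = \<mu> then cf r \<nu> else 0)"
        using mon_el by (intro sum.cong) (auto simp: cf_const fun_unit_def)
      finally show ?thesis using finT by (simp add: sum.delta)
    qed
    have "r \<ominus> ?y \<in> mpow (Suc j)"
    proof -
      have "cf (r \<ominus> ?y) \<mu> = 0" if \<mu>: "mdeg d \<mu> < Suc j" for \<mu>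
        unfolding cf_minus[OF rR y] cfy using \<mu> mpowD(2)[OF r, of \<mu>] cf_supp[OF rR, of \<mu>]
        by (auto simp: less_Suc_eq)
      then show ?thesis using rR y by (simp add: mpow_def)
    qed
    then have "(r \<ominus> ?y) \<odot>\<^bsub>W\<^esub> w = \<zero>\<^bsub>W\<^esub>" by (rule Suc.prems(2))
    moreover have "(r \<ominus> ?y) \<odot>\<^bsub>W\<^esub> w = r \<odot>\<^bsub>W\<^esub> w \<ominus>\<^bsub>W\<^esub> ?y \<odot>\<^bsub>W\<^esub> w"
      unfolding a_minus_def W.smult_l_distr[OF rR add.inv_closed[OF y] w] W.smult_l_minus[OF y w] ..
    ultimately have "r \<odot>\<^bsub>W\<^esub> w = ?y \<odot>\<^bsub>W\<^esub> w"
      using minus_eq_zero_iff[OF W.abelian_group_axioms W.smult_closed[OF rR w] W.smult_closed[OF y w]] by simp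
    also have "\<dots> = (\<Oplus>\<^bsub>W\<^esub>\<nu>\<in>?T. ?f \<nu> \<odot>\<^bsub>W\<^esub> w)"
      using finT f
    proof (induction rule: finite_induct)
      case empty then show ?case using w by simp
    next
      case (insert x T)
      then show ?case using w by (simp add: Pi_iff W.smult_l_distr)
    qed
    also have "\<dots> = (\<Oplus>\<^bsub>W\<^esub>\<nu>\<in>?T. \<sigma> (c \<nu> * cf r \<nu>))"
    proof (rule W.finsum_cong'[OF refl])
      show "(\<lambda>\<nu>. \<sigma> (c \<nu> * cf r \<nu>)) \<in> ?T \<rightarrow> carrier W" by (rule Pi_I) (rule sigma_in)
      fix \<nu> assume \<nu>: "\<nu> \<in> ?T"
      then have m: "mon_el \<nu> \<in> carrier R" using mon_el(1) by blast
      have "?f \<nu> \<odot>\<^bsub>W\<^esub> w = const (cf r \<nu>) \<odot>\<^bsub>W\<^esub> \<sigma> (c \<nu>)"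
        unfolding W.smult_assoc1[OF const_in m w] using c \<nu> by simp
      also have "\<dots> = \<sigma> (c \<nu> * cf r \<nu>)"
        by (simp add: sigma_smult[OF const_in] const_mult_one cf_one mult.commute)
      finally show "?f \<nu> \<odot>\<^bsub>W\<^esub> w = \<sigma> (c \<nu> * cf r \<nu>)" .
    qed
    also have "\<dots> = \<sigma> (\<Sum>\<nu>\<in>?T. c \<nu> * cf r \<nu>)" by (rule sigma_sum[OF finT])
    finally show ?thesis .
  qed
  have "w \<ominus>\<^bsub>W\<^esub> v \<in> N"
  proof (rule Suc.IH[OF W.minus_closed[OF w vW]])
    fix r assume r: "r \<in> mpow j"
    have "r \<odot>\<^bsub>W\<^esub> (w \<ominus>\<^bsub>W\<^esub> v) = r \<odot>\<^bsub>W\<^esub> w \<ominus>\<^bsub>W\<^esub> r \<odot>\<^bsub>W\<^esub> v"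
      using mpowD(1)[OF r] w vW by (simp add: a_minus_def W.smult_r_distr W.smult_r_minus)
    also have "\<dots> = \<zero>\<^bsub>W\<^esub>"
      unfolding rw[OF r] rv[OF r] using minus_eq_zero_iff[OF W.abelian_group_axioms sigma_in sigma_in] by blast
    finally show "r \<odot>\<^bsub>W\<^esub> (w \<ominus>\<^bsub>W\<^esub> v) = \<zero>\<^bsub>W\<^esub>" .
  qed
  then have "(w \<ominus>\<^bsub>W\<^esub> v) \<oplus>\<^bsub>W\<^esub> v \<in> N" using vN by (rule submodule_add[OF N])
  also have "(w \<ominus>\<^bsub>W\<^esub> v) \<oplus>\<^bsub>W\<^esub> v = w" using w vW by (simp add: a_minus_def W.add.m_assoc W.l_neg)
  finally show ?case .
qed

lemma canonical_finitely_generated: "finitely_generated R W"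
proof -
  let ?S = "coeff_elem ` mons d n"
  have S: "?S \<subseteq> carrier W" using coeff_elem(1) by blast
  have N: "submodule R (W.span ?S) W" by (rule W.span_is_submodule[OF S])
  have "carrier W \<subseteq> W.span ?S"
  proof
    fix w assume w: "w \<in> carrier W"
    show "w \<in> W.span ?S"
    proof (rule canonical_spanned[OF N _ w])
      show "\<And>\<nu>. \<nu> \<in> mons d n \<Longrightarrow> coeff_elem \<nu> \<in> W.span ?S" using W.in_own_span[OF S] by blast
      show "r \<odot>\<^bsub>W\<^esub> w = \<zero>\<^bsub>W\<^esub>" if "r \<in> mpow n" for r using pow_top[OF order_refl that] w by simp
    qed
  qed
  then have "W.span ?S = carrier W" using submodule_in[OF N] by blast
  then show ?thesis unfolding finitely_generated_def using S finite_mons by (intro exI[of _ ?S]) simp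
qed

text \<open>The elements for the variables are dual to the variables; they solve the equations
  \<open>X 0 \<odot> y = \<sigma> b\<close> and \<open>X 1 \<odot> y = \<sigma> a\<close> for the first syzygy of the canonical module.\<close>
lemma X_coeff_elem:
  assumes "i < d" "j < d"
  shows "X i \<odot>\<^bsub>W\<^esub> coeff_elem (unit_mon j) = (if i = j then \<sigma> 1 else \<zero>\<^bsub>W\<^esub>)"
proof -
  have "X i \<in> mpow (mdeg d (unit_mon j))"
    using X_mm[OF assms(1)] mm_pow mdeg_unit[OF assms(2)] by simp
  then have "X i \<odot>\<^bsub>W\<^esub> coeff_elem (unit_mon j) = \<sigma> (cf (X i) (unit_mon j))" by (rule coeff_elem(2))
  moreover have "cf (X i) (unit_mon j) = (if i = j then 1 else 0)"
  proof (cases "i = j")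
    case True
    have "unit_mon i \<in> mons d n" using mons_add_unit[OF assms(1), of 0 n] zero_in_mons[of "n - 1" d] n by simp
    then show ?thesis using cf_X[OF assms(1) one_closed, of 0] X_in[OF assms(1)] True by (simp add: cf_one)
  next
    case False
    then show ?thesis using cf_X0[OF assms(1) one_closed, of "unit_mon j"] X_in[OF assms(1)]
      by (simp add: lookup_single)
  qed
  ultimately show ?thesis using sigma_zero by simp
qed

end
end

section \<open>Growth of the Betti numbers\<close>

context truncated_algebra begin

lemma minimal_resolution_exists:
  fixes M :: "('a, 'm) module"
  assumes "module R M" "finitely_generated R M"
  shows "\<exists>(S :: nat \<Rightarrow> nat set) \<gamma> \<eta>. (\<forall>j. finite (S j)) \<and>
    free_resolution R M (\<lambda>j. free_module_on R (S j)) \<gamma> \<eta> \<and>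
    (\<forall>j. syzygy (\<lambda>j. free_module_on R (S j)) \<gamma> M \<eta> j \<subseteq> ideal_mult \<mm> (free_module_on R (S j)))"
  by (rule minimal_resolution[OF assms]) (rule noetherian)

lemma mult_bound: "1 < (d :: nat) \<Longrightarrow> 0 < s \<Longrightarrow> s + (d - 1) \<le> d * s"
  by (cases d; cases s) (simp_all add: algebra_simps)

context
  fixes M :: "('a, 'm) module" and S :: "nat \<Rightarrow> nat set" and \<gamma> \<eta>
  assumes dn: "d > 1" "d = 2 \<or> n = 2"
    and M: "module R M" and fin: "\<And>j. finite (S j)"
    and res: "free_resolution R M (\<lambda>j. free_module_on R (S j)) \<gamma> \<eta>"
    and min: "\<And>j. syzygy (\<lambda>j. free_module_on R (S j)) \<gamma> M \<eta> j \<subseteq> ideal_mult \<mm> (free_module_on R (S j))"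
begin

lemma res_gamma: "\<gamma> j \<in> module_hom R (FM (S (Suc j))) (FM (S j))"
  using res by (simp add: free_resolution_def)

lemma res_image: "\<gamma> j ` carrier (FM (S (Suc j))) \<subseteq> ideal_mult \<mm> (FM (S j))"
  using min[of j] free_resolution_exact[OF res, of j] by simp

text \<open>The map \<open>\<gamma> j\<close> has image in \<open>\<mm>\<close> times a free module, and \<open>\<mm>\<^sup>n\<^sup>-\<^sup>1\<close> kills \<open>\<mm>\<close>. This is what fails
  for the augmentation and confines the theorem to \<open>i \<ge> 1\<close> for a general module.\<close>
lemma socle_in_syzygy:
  assumes u: "u \<in> carrier (FM (S (Suc j)))" and soc: "\<forall>s. u s \<in> mpow (n - 1)"
  shows "\<gamma> j u = \<zero>\<^bsub>FM (S j)\<^esub>"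
proof -
  let ?G = "FM (S j)" and ?g = "\<lambda>s. \<gamma> j (free_gen R s)"
  interpret G: module R ?G by (rule free_module_on_module)
  have g: "?g \<in> S (Suc j) \<rightarrow> carrier ?G" by (rule Pi_I) (rule hom_in[OF res_gamma free_gen_in])
  have "\<gamma> j u = lin_ext ?G ?g u"
    by (rule free_hom_eqI[OF G.module_axioms res_gamma lin_ext_hom[OF G.module_axioms g] _ u])
      (rule lin_ext_gen[OF G.module_axioms g, symmetric])
  also have "\<dots> \<in> {\<zero>\<^bsub>?G\<^esub>}"
    unfolding lin_ext_def
  proof (rule finsum_in_submodule[OF _ free_module_on_fin[OF u]])
    show "submodule R {\<zero>\<^bsub>?G\<^esub>} ?G" 
      by (rule submoduleI'[OF G.module_axioms]) (simp_all del: free_module_on_simps)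
    show "(\<lambda>s. u s \<odot>\<^bsub>?G\<^esub> ?g s) \<in> {s. u s \<noteq> \<zero>} \<rightarrow> {\<zero>\<^bsub>?G\<^esub>}"
    proof
      fix s assume "s \<in> {s. u s \<noteq> \<zero>}"
      then have s: "s \<in> S (Suc j)" using free_module_on_supp[OF u] by blast
      have y: "?g s \<in> ideal_mult \<mm> ?G" using res_image free_gen_in[OF s] by blast
      have "u s \<otimes> ?g s t = \<zero>" for t
      proof (cases "t \<in> S j")
        case True
        then have "?g s t \<in> \<mm>" using y ideal_mult_free[OF mm_ideal, of "?g s" "S j"] by blast
        then show ?thesis
          using soc_killed[of "?g s t" "u s"] soc m_comm[OF free_module_on_in[OF u] Icarr] by simp
      next
        case False
        have "?g s \<in> carrier ?G" by (rule hom_in[OF res_gamma free_gen_in[OF s]])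
        then have "?g s t = \<zero>" using False by (simp add: free_module_on_carrier)
        then show ?thesis using free_module_on_in[OF u] by simp
      qed
      then show "u s \<odot>\<^bsub>?G\<^esub> ?g s \<in> {\<zero>\<^bsub>?G\<^esub>}" by (simp add: fun_eq_iff)
    qed
  qed
  finally show ?thesis by blast
qed

lemma syzygy_step:
  assumes ne: "S (Suc j) \<noteq> {}"
  shows "card (S (Suc j)) + (d - 1) \<le> card (S (Suc (Suc j)))"
proof -
  let ?F = "FM (S (Suc j))" and ?T = "S (Suc (Suc j))"
  let ?P = "\<gamma> (Suc j) ` carrier (FM ?T)"
  interpret F: module R ?F by (rule free_module_on_module)
  have P: "?P = a_kernel ?F (FM (S j)) (\<gamma> j)"
    using free_resolution_exact[OF res, of "Suc j"] by (simp add: syzygy_def)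
  have soc: "u \<in> ?P" if "u \<in> carrier ?F" "\<forall>s. u s \<in> mpow (n - 1)" for u
    unfolding P a_kernel_def' using socle_in_syzygy[OF that] that(1) by blast
  have card: "card (S (Suc j)) > 0" using ne fin by (simp add: card_gt_0_iff)
  from dn(2) show ?thesis
  proof
    assume d2: "d = 2"
    have "card (S (Suc j)) + 1 \<le> card ?T"
    proof (rule relations_two_variables[OF d2 fin fin ne res_gamma refl res_image])
      fix u v assume uv: "u \<in> carrier ?F" "v \<in> carrier ?F" "\<forall>s. u s \<in> mpow (n - 1)" "\<forall>s. v s \<in> mpow (n - 1)"
      have X: "X 0 \<in> carrier R" "X 1 \<in> carrier R" using X_in d2 by simp_all
      have "u \<oplus>\<^bsub>?F\<^esub> X 1 \<odot>\<^bsub>?F\<^esub> \<zero>\<^bsub>?F\<^esub> = u"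
        unfolding F.smult_r_null[OF X(2)] by (rule F.M.r_zero[OF uv(1)])
      moreover have "v \<ominus>\<^bsub>?F\<^esub> X 0 \<odot>\<^bsub>?F\<^esub> \<zero>\<^bsub>?F\<^esub> = v"
        unfolding F.smult_r_null[OF X(1)] by (rule minus_zero_right[OF F.abelian_group_axioms uv(2)])
      ultimately show "\<exists>w\<in>carrier ?F. u \<oplus>\<^bsub>?F\<^esub> X 1 \<odot>\<^bsub>?F\<^esub> w \<in> ?P \<and> v \<ominus>\<^bsub>?F\<^esub> X 0 \<odot>\<^bsub>?F\<^esub> w \<in> ?P"
        using soc[OF uv(1,3)] soc[OF uv(2,4)] F.M.zero_closed by (intro bexI[of _ "\<zero>\<^bsub>?F\<^esub>"]) (simp_all only:)
    qed
    then show ?thesis using d2 by simp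
  next
    assume n2: "n = 2"
    have "d * card (S (Suc j)) \<le> card ?T + (if \<zero>\<^bsub>?F\<^esub> = \<zero>\<^bsub>?F\<^esub> then 0 else 1)"
    proof (rule relations_square_zero[OF n2 fin fin res_gamma refl res_image F.M.zero_closed])
      fix u assume u: "u \<in> ideal_mult \<mm> ?F"
      have u': "u \<in> carrier ?F" "\<forall>s\<in>S (Suc j). u s \<in> \<mm>"
        using u ideal_mult_free[OF mm_ideal, of u "S (Suc j)"] by blast+
      have "u s \<in> mpow (n - 1)" for s
      proof (cases "s \<in> S (Suc j)")
        case True then show ?thesis using u'(2) mm_pow by (simp add: n2)
      next
        case False
        then have "u s = \<zero>" using u'(1) by (simp add: free_module_on_carrier)
        then show ?thesis by (simp add: mpow_def cf_zero)
      qed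
      then have "u \<in> ?P" using soc[OF u'(1)] by blast
      moreover have "u \<ominus>\<^bsub>?F\<^esub> const 0 \<odot>\<^bsub>?F\<^esub> \<zero>\<^bsub>?F\<^esub> = u"
        unfolding F.smult_r_null[OF const_in] by (rule minus_zero_right[OF F.abelian_group_axioms u'(1)])
      ultimately show "\<exists>c. u \<ominus>\<^bsub>?F\<^esub> const c \<odot>\<^bsub>?F\<^esub> \<zero>\<^bsub>?F\<^esub> \<in> ?P" by metis
    qed
    then have "d * card (S (Suc j)) \<le> card ?T" by (simp del: free_module_on_simps)
    then show ?thesis using mult_bound[OF dn(1) card] by linarith
  qed
qed

lemma syzygies_nonzero: "S 1 \<noteq> {} \<Longrightarrow> S (Suc j) \<noteq> {}"
proof (induction j)
  case (Suc j)
  then have "card (S (Suc (Suc j))) > 0" using syzygy_step[of j] dn(1) by simp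
  then show ?case by auto
qed simp

lemma betti_increase:
  assumes "S 1 \<noteq> {}" "i \<ge> 1"
  shows "betti R M i + (d - 1) \<le> betti R M (Suc i)"
proof -
  obtain j where "i = Suc j" using assms(2) by (cases i) auto
  then show ?thesis
    using syzygy_step[OF syzygies_nonzero[OF assms(1)], of j] betti_minimal[OF M fin res min] by simp
qed

text \<open>If the first syzygy vanishes then the augmentation is an isomorphism.\<close>
lemma first_syzygy_nonzero:
  assumes "\<not> free_module R M" shows "S 1 \<noteq> {}"
proof
  assume S1: "S 1 = {}"
  let ?F = "FM (S 0)"
  interpret F: module R ?F by (rule free_module_on_module)
  have \<eta>: "\<eta> \<in> module_hom R ?F M" "\<eta> ` carrier ?F = carrier M"
    using res by (simp_all add: free_resolution_def)
  have "a_kernel ?F M \<eta> = \<gamma> 0 ` carrier (FM (S 1))"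
    using res by (simp add: free_resolution_def)
  also have "carrier (FM (S 1)) = {\<zero>\<^bsub>FM (S 1)\<^esub>}"
    unfolding S1 by (auto simp: free_module_on_carrier)
  also have "\<gamma> 0 ` {\<zero>\<^bsub>FM (S 1)\<^esub>} = {\<zero>\<^bsub>?F\<^esub>}"
    using hom_zero[OF free_module_on_module free_module_on_module res_gamma[of 0]]
    by (simp del: free_module_on_simps)
  finally have ker: "a_kernel ?F M \<eta> = {\<zero>\<^bsub>?F\<^esub>}" .
  have "inj_on \<eta> (carrier ?F)"
    by (rule hom_inj_onI[OF F.module_axioms M \<eta>(1)]) (use ker in \<open>auto simp: a_kernel_def' simp del: free_module_on_simps\<close>)
  then have "free_module R M"
    using free_moduleI[OF one_not_zero M \<eta>(1)] \<eta>(2) by (simp add: bij_betw_def)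
  then show False using assms by blast
qed

end

theorem betti_nonfree:
  fixes M :: "('a, 'm) module"
  assumes dn: "d > 1" "d = 2 \<or> n = 2" and M: "module R M" and fg: "finitely_generated R M"
    and nf: "\<not> free_module R M" and i: "i \<ge> 1"
  shows "betti R M i + (d - 1) \<le> betti R M (Suc i)"
proof -
  obtain S :: "nat \<Rightarrow> nat set" and \<gamma> \<eta> where
    "\<forall>j. finite (S j)" "free_resolution R M (\<lambda>j. FM (S j)) \<gamma> \<eta>"
    "\<forall>j. syzygy (\<lambda>j. FM (S j)) \<gamma> M \<eta> j \<subseteq> ideal_mult \<mm> (FM (S j))"
    using minimal_resolution_exists[OF M fg] by (elim exE conjE)
  note r = spec[OF this(1)] this(2) spec[OF this(3)]
  show ?thesis
    by (rule betti_increase[OF dn M r first_syzygy_nonzero[OF dn M r nf] i])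
qed

text \<open>After the first step the bounds for general modules apply; they do not cover \<open>i = 0\<close>, where the
  augmentation is not a map into a free module. There, the socle of \<open>F 0\<close> is mapped to the
  socle of \<open>W\<close>, which is \<open>k\<close> (fact \<open>soc\<close>). For \<open>d = 2\<close>, two socle elements with images \<open>\<sigma> a\<close> and
  \<open>\<sigma> b\<close> are corrected by an element \<open>y\<close> of \<open>W\<close> with \<open>X 0 \<odot> y = \<sigma> b\<close> and \<open>X 1 \<odot> y = \<sigma> (- a)\<close>. For
  \<open>n = 2\<close> the bound \<open>d b - 1\<close> on the number of relations is large enough once the number \<open>b\<close> of
  generators is at least \<open>2\<close>.\<close>
theorem betti_canonical:
  fixes W :: "('a, 'w) module"
  assumes dn: "d > 1" "d = 2 \<or> n = 2" and can: "canonical_module R W"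
  shows "betti R W i + (d - 1) \<le> betti R W (Suc i)"
proof -
  note W = W_module[OF can]
  interpret W: module R W by (rule W)
  let ?s = "\<sigma> W"
  note s_in = sigma_in[OF can] and s_zero = sigma_zero[OF can] and s_nz = sigma_eq_zero[OF can]
    and X_coeff_elem' = X_coeff_elem[OF can] and coeff_elem_in = coeff_elem(1)[OF can]
  obtain S :: "nat \<Rightarrow> nat set" and \<gamma> \<eta> where
    "\<forall>j. finite (S j)" and res: "free_resolution R W (\<lambda>j. FM (S j)) \<gamma> \<eta>" and
    "\<forall>j. syzygy (\<lambda>j. FM (S j)) \<gamma> W \<eta> j \<subseteq> ideal_mult \<mm> (FM (S j))"
    using minimal_resolution_exists[OF W canonical_finitely_generated[OF can]] by (elim exE conjE)
  note r = spec[OF this(1)] res spec[OF this(3)]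
  let ?F = "FM (S 0)" and ?P = "\<gamma> 0 ` carrier (FM (S (Suc 0)))"
  interpret F: module R ?F by (rule free_module_on_module)
  have \<eta>: "\<eta> \<in> module_hom R ?F W" "\<eta> ` carrier ?F = carrier W"
    using res by (simp_all add: free_resolution_def)
  have P: "x \<in> ?P \<longleftrightarrow> x \<in> carrier ?F \<and> \<eta> x = \<zero>\<^bsub>W\<^esub>" for x
    using res by (simp add: free_resolution_def a_kernel_def')
  note g0 = res_gamma[OF dn W r, of 0] and im0 = res_image[OF dn W r, of 0]
  have nonzero: "\<exists>x\<in>carrier ?F. \<eta> x = w" if "w \<in> carrier W" for w
    using \<eta>(2) that by (metis imageE)
  have ne: "S 0 \<noteq> {}"
  proof
    assume "S 0 = {}"
    then have "carrier ?F = {\<zero>\<^bsub>?F\<^esub>}" by (auto simp: free_module_on_carrier)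
    then have "?s 1 = \<zero>\<^bsub>W\<^esub>"
      using nonzero[OF s_in, of 1] hom_zero[OF F.module_axioms W \<eta>(1)] by auto
    then show False using s_nz[of 1] by simp
  qed
  have soc: "\<exists>c. \<eta> u = ?s c" if u: "u \<in> carrier ?F" "\<forall>s. u s \<in> mpow (n - 1)" for u
  proof (rule socle_canonical[OF can hom_in[OF \<eta>(1) u(1)]])
    fix i assume i: "i < d"
    have "X i \<odot>\<^bsub>?F\<^esub> u = \<zero>\<^bsub>?F\<^esub>" using soc_killed[OF X_mm[OF i]] u(2) by (simp add: fun_eq_iff)
    then show "X i \<odot>\<^bsub>W\<^esub> \<eta> u = \<zero>\<^bsub>W\<^esub>"
      using module_hom_smult[OF \<eta>(1) X_in[OF i] u(1)] hom_zero[OF F.module_axioms W \<eta>(1)] by metis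
  qed
  have s_smult: "const c \<odot>\<^bsub>W\<^esub> ?s 1 = ?s c" for c
    using sigma_smult[OF can const_in, of c 1] by (simp add: const_mult_one cf_one)
  have first: "card (S 0) + (d - 1) \<le> card (S (Suc 0))"
    using dn(2)
  proof
    assume d2: "d = 2"
    have i: "0 < d" "1 < d" using d2 by simp_all
    note XR = X_in[OF i(1)] X_in[OF i(2)]
    let ?e0 = "coeff_elem W (unit_mon 0)" and ?e1 = "coeff_elem W (unit_mon 1)"
    have "card (S 0) + 1 \<le> card (S (Suc 0))"
    proof (rule relations_two_variables[OF d2 r(1) r(1) ne g0 refl im0])
      fix u v assume uv: "u \<in> carrier ?F" "v \<in> carrier ?F" "\<forall>s. u s \<in> mpow (n - 1)" "\<forall>s. v s \<in> mpow (n - 1)"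
      obtain a where a: "\<eta> u = ?s a" using soc[OF uv(1,3)] by blast
      obtain b where b: "\<eta> v = ?s b" using soc[OF uv(2,4)] by blast
      define y where "y = const b \<odot>\<^bsub>W\<^esub> ?e0 \<oplus>\<^bsub>W\<^esub> const (- a) \<odot>\<^bsub>W\<^esub> ?e1"
      have parts: "const b \<odot>\<^bsub>W\<^esub> ?e0 \<in> carrier W" "const (- a) \<odot>\<^bsub>W\<^esub> ?e1 \<in> carrier W"
        by (rule W.smult_closed[OF const_in coeff_elem_in])+
      have y: "y \<in> carrier W" unfolding y_def by (rule W.M.a_closed[OF parts])
      have Xy: "X j \<odot>\<^bsub>W\<^esub> y = const b \<odot>\<^bsub>W\<^esub> (X j \<odot>\<^bsub>W\<^esub> ?e0) \<oplus>\<^bsub>W\<^esub> const (- a) \<odot>\<^bsub>W\<^esub> (X j \<odot>\<^bsub>W\<^esub> ?e1)"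
        if XjR: "X j \<in> carrier R" for j
        unfolding y_def W.smult_r_distr[OF XjR parts]
        by (simp only: W.smult_assoc1[OF XjR const_in coeff_elem_in, symmetric] m_comm[OF XjR const_in]
            W.smult_assoc1[OF const_in XjR coeff_elem_in])
      have y0: "X 0 \<odot>\<^bsub>W\<^esub> y = ?s b"
        unfolding Xy[OF XR(1)] using X_coeff_elem'[OF i(1) i(1)] X_coeff_elem'[OF i(1) i(2)] s_smult s_in const_in by simp
      have y1: "X 1 \<odot>\<^bsub>W\<^esub> y = ?s (- a)"
        unfolding Xy[OF XR(2)] using X_coeff_elem'[OF i(2) i(1)] X_coeff_elem'[OF i(2) i(2)] s_smult s_in const_in by simp
      obtain w where w: "w \<in> carrier ?F" "\<eta> w = y" using nonzero[OF y] by blast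
      note Xw = F.smult_closed[OF XR(1) w(1)] F.smult_closed[OF XR(2) w(1)]
      have "\<eta> (u \<oplus>\<^bsub>?F\<^esub> X 1 \<odot>\<^bsub>?F\<^esub> w) = ?s a \<oplus>\<^bsub>W\<^esub> ?s (- a)"
        unfolding module_hom_add[OF \<eta>(1) uv(1) Xw(2)] module_hom_smult[OF \<eta>(1) XR(2) w(1)] w(2) a y1 ..
      also have "\<dots> = \<zero>\<^bsub>W\<^esub>" unfolding sigma_add[OF can, symmetric] using s_zero by simp
      finally have "u \<oplus>\<^bsub>?F\<^esub> X 1 \<odot>\<^bsub>?F\<^esub> w \<in> ?P" unfolding P using F.M.a_closed[OF uv(1) Xw(2)] by blast
      moreover have "\<eta> (v \<ominus>\<^bsub>?F\<^esub> X 0 \<odot>\<^bsub>?F\<^esub> w) = ?s b \<ominus>\<^bsub>W\<^esub> ?s b"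
        unfolding hom_minus[OF F.module_axioms W \<eta>(1) uv(2) Xw(1)] module_hom_smult[OF \<eta>(1) XR(1) w(1)] w(2) b y0 ..
      then have "v \<ominus>\<^bsub>?F\<^esub> X 0 \<odot>\<^bsub>?F\<^esub> w \<in> ?P"
        unfolding P using F.minus_closed[OF uv(2) Xw(1)] minus_eq_zero_iff[OF W.abelian_group_axioms s_in s_in, of b b]
        by simp
      ultimately show "\<exists>w\<in>carrier ?F. u \<oplus>\<^bsub>?F\<^esub> X 1 \<odot>\<^bsub>?F\<^esub> w \<in> ?P \<and> v \<ominus>\<^bsub>?F\<^esub> X 0 \<odot>\<^bsub>?F\<^esub> w \<in> ?P"
        using w(1) by blast
    qed
    then show ?thesis using d2 by simp
  next
    assume n2: "n = 2"
    have i: "0 < d" "1 < d" using dn(1) by simp_all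
    obtain t where t: "t \<in> carrier ?F" "\<eta> t = ?s 1" using nonzero[OF s_in] by blast
    have "d * card (S 0) \<le> card (S (Suc 0)) + (if t = \<zero>\<^bsub>?F\<^esub> then 0 else 1)"
    proof (rule relations_square_zero[OF n2 r(1) r(1) g0 refl im0 t(1)])
      fix u assume u: "u \<in> ideal_mult \<mm> ?F"
      have u': "u \<in> carrier ?F" "\<forall>s\<in>S 0. u s \<in> \<mm>"
        using u ideal_mult_free[OF mm_ideal, of u "S 0"] by blast+
      have "u s \<in> mpow (n - 1)" for s
      proof (cases "s \<in> S 0")
        case True then show ?thesis using u'(2) mm_pow by (simp add: n2)
      next
        case False
        then have "u s = \<zero>" using u'(1) by (simp add: free_module_on_carrier)
        then show ?thesis by (simp add: mpow_def cf_zero)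
      qed
      then obtain c where c: "\<eta> u = ?s c" using soc[OF u'(1)] by blast
      note ct = F.smult_closed[OF const_in t(1), of c]
      have "\<eta> (u \<ominus>\<^bsub>?F\<^esub> const c \<odot>\<^bsub>?F\<^esub> t) = ?s c \<ominus>\<^bsub>W\<^esub> ?s c"
        unfolding hom_minus[OF F.module_axioms W \<eta>(1) u'(1) ct] module_hom_smult[OF \<eta>(1) const_in t(1)] t(2) c s_smult ..
      then have "u \<ominus>\<^bsub>?F\<^esub> const c \<odot>\<^bsub>?F\<^esub> t \<in> ?P"
        unfolding P using F.minus_closed[OF u'(1) ct] minus_eq_zero_iff[OF W.abelian_group_axioms s_in s_in, of c c]
        by simp
      then show "\<exists>c. u \<ominus>\<^bsub>?F\<^esub> const c \<odot>\<^bsub>?F\<^esub> t \<in> ?P" by blast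
    qed
    then have bound: "d * card (S 0) \<le> card (S (Suc 0)) + 1" by (simp split: if_splits del: free_module_on_simps)
    \<comment> \<open>On a cyclic module with \<open>\<mm>\<^sup>2 = 0\<close> the pairs \<open>(X 0 \<odot> w, X 1 \<odot> w)\<close> are proportional to each
      other, but \<open>(\<sigma> 1, 0)\<close> and \<open>(0, \<sigma> 1)\<close> both occur.\<close>
    have two: "2 \<le> card (S 0)"
    proof (rule ccontr)
      assume "\<not> 2 \<le> card (S 0)"
      moreover have "card (S 0) \<noteq> 0" using ne r(1)[of 0] by simp
      ultimately have "card (S 0) = 1" by linarith
      then obtain s where s: "S 0 = {s}" by (rule card_1_singletonE)
      define e where "e = \<eta> (free_gen R s)"
      have e: "e \<in> carrier W" unfolding e_def by (rule hom_in[OF \<eta>(1) free_gen_in]) (simp add: s)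
      \<comment> \<open>\<open>X i\<close> acts on a cyclic module through the constant term.\<close>
      have cyc: "\<exists>c. \<forall>i<d. X i \<odot>\<^bsub>W\<^esub> w = const c \<odot>\<^bsub>W\<^esub> (X i \<odot>\<^bsub>W\<^esub> e)" if w: "w \<in> carrier W" for w
      proof -
        obtain x where x: "x \<in> carrier ?F" "\<eta> x = w" using nonzero[OF w] by blast
        have xs: "x s \<in> carrier R" by (rule free_module_on_in[OF x(1)])
        have eF: "free_gen R s \<in> carrier ?F" by (rule free_gen_in) (simp add: s)
        have "x = x s \<odot>\<^bsub>?F\<^esub> free_gen R s"
          using x(1) xs by (auto simp: fun_eq_iff free_gen_def free_module_on_carrier s)
        then have we: "w = x s \<odot>\<^bsub>W\<^esub> e"
          using module_hom_smult[OF \<eta>(1) xs eF] x(2) unfolding e_def by simp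
        obtain r1 where r1: "r1 \<in> \<mm>" "x s = const (cf (x s) 0) \<oplus> r1" using split_const[OF xs] by blast
        let ?c = "const (cf (x s) 0)"
        have "X i \<odot>\<^bsub>W\<^esub> w = ?c \<odot>\<^bsub>W\<^esub> (X i \<odot>\<^bsub>W\<^esub> e)" if i: "i < d" for i
        proof -
          have "r1 \<in> mpow (n - 1)" using r1(1) mm_pow by (simp add: n2)
          then have "X i \<otimes> r1 = \<zero>" by (rule soc_killed[OF X_mm[OF i]])
          then have "X i \<otimes> x s = X i \<otimes> ?c"
            using r_distr[OF const_in Icarr[OF r1(1)] X_in[OF i], of "cf (x s) 0"] X_in[OF i] const_in
            unfolding r1(2)[symmetric] by simp
          then have "X i \<otimes> x s = ?c \<otimes> X i" using m_comm[OF X_in[OF i] const_in] by simp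
          then show ?thesis
            unfolding we W.smult_assoc1[OF X_in[OF i] xs e, symmetric]
            using W.smult_assoc1[OF const_in X_in[OF i] e] by simp
        qed
        then show ?thesis by blast
      qed
      obtain c0 where c0: "\<forall>i<d. X i \<odot>\<^bsub>W\<^esub> coeff_elem W (unit_mon 0) = const c0 \<odot>\<^bsub>W\<^esub> (X i \<odot>\<^bsub>W\<^esub> e)"
        using cyc[OF coeff_elem_in] by blast
      obtain c1 where c1: "\<forall>i<d. X i \<odot>\<^bsub>W\<^esub> coeff_elem W (unit_mon 1) = const c1 \<odot>\<^bsub>W\<^esub> (X i \<odot>\<^bsub>W\<^esub> e)"
        using cyc[OF coeff_elem_in] by blast
      have Xe: "X 0 \<odot>\<^bsub>W\<^esub> e \<in> carrier W" "X 1 \<odot>\<^bsub>W\<^esub> e \<in> carrier W"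
        using W.smult_closed[OF X_in e] i by blast+
      have "?s 1 = const c0 \<odot>\<^bsub>W\<^esub> (X 0 \<odot>\<^bsub>W\<^esub> e)" using c0 i(1) X_coeff_elem'[OF i(1) i(1)] by simp
      then have "c0 \<noteq> 0" using s_nz[of 1] Xe(1) by (auto simp: const_zero)
      have "const c0 \<odot>\<^bsub>W\<^esub> (X 1 \<odot>\<^bsub>W\<^esub> e) = \<zero>\<^bsub>W\<^esub>" using c0 i(2) X_coeff_elem'[OF i(2) i(1)] by simp
      then have "const (1 / c0) \<odot>\<^bsub>W\<^esub> (const c0 \<odot>\<^bsub>W\<^esub> (X 1 \<odot>\<^bsub>W\<^esub> e)) = \<zero>\<^bsub>W\<^esub>"
        using W.smult_r_null[OF const_in] by simp
      then have "X 1 \<odot>\<^bsub>W\<^esub> e = \<zero>\<^bsub>W\<^esub>"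
        unfolding W.smult_assoc1[OF const_in const_in Xe(2), symmetric] const_mult
        using \<open>c0 \<noteq> 0\<close> Xe(2) by (simp add: const_one)
      then have "?s 1 = \<zero>\<^bsub>W\<^esub>" using c1 i(2) X_coeff_elem'[OF i(2) i(2)] W.smult_r_null[OF const_in] by simp
      then show False using s_nz[of 1] by simp
    qed
    obtain s' where s': "card (S 0) = Suc (Suc s')" using two that[of "card (S 0) - 2"] by simp
    obtain d' where d': "d = Suc (Suc d')" using dn(1) that[of "d - 2"] by simp
    show ?thesis using bound unfolding s' d' by (simp add: algebra_simps)
  qed
  then have "S 1 \<noteq> {}" using dn(1) by auto
  then show ?thesis
    using first betti_increase[OF dn W r, of i] betti_minimal[OF W r] by (cases i) simp_all
qed

end

section \<open>The truncated polynomial ring\<close>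

lemma mpoly_ring_simps [simp]:
  "monoid.mult (mpoly_ring d) = (*)" "one (mpoly_ring d) = 1" "ring.zero (mpoly_ring d) = 0"
  "add (mpoly_ring d) = (+)"
  by (simp_all add: mpoly_ring_def)

lemma mpoly_carrier:
  "p \<in> carrier (mpoly_ring d) \<longleftrightarrow> (\<forall>m\<in>Poly_Mapping.keys p. Poly_Mapping.keys m \<subseteq> {..<d})"
  by (simp add: mpoly_ring_def)

lemma mpoly_closed:
  assumes "p \<in> carrier (mpoly_ring d)" "q \<in> carrier (mpoly_ring d)"
  shows "p + q \<in> carrier (mpoly_ring d)" "p * q \<in> carrier (mpoly_ring d)" "- p \<in> carrier (mpoly_ring d)"
    "p - q \<in> carrier (mpoly_ring d)"
proof -
  show "p + q \<in> carrier (mpoly_ring d)"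
    using assms Poly_Mapping.keys_add[of p q] unfolding mpoly_carrier by blast
  show "- p \<in> carrier (mpoly_ring d)" using assms unfolding mpoly_carrier by simp
  show "p - q \<in> carrier (mpoly_ring d)"
    using assms keys_diff[of p q] unfolding mpoly_carrier by blast
  show "p * q \<in> carrier (mpoly_ring d)"
    unfolding mpoly_carrier
  proof
    fix m assume "m \<in> Poly_Mapping.keys (p * q)"
    then obtain a b where ab: "a \<in> Poly_Mapping.keys p" "b \<in> Poly_Mapping.keys q" "m = a + b"
      using keys_mult[of p q] by blast
    then show "Poly_Mapping.keys m \<subseteq> {..<d}" using assms Poly_Mapping.keys_add[of a b] unfolding mpoly_carrier by blast
  qed
qed

lemma mpoly_cring: "cring (mpoly_ring d :: ((nat \<Rightarrow>\<^sub>0 nat) \<Rightarrow>\<^sub>0 'k::field) ring)"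
proof (rule cringI)
  show "abelian_group (mpoly_ring d :: ((nat \<Rightarrow>\<^sub>0 nat) \<Rightarrow>\<^sub>0 'k) ring)"
  proof (rule abelian_groupI)
    fix x :: "(nat \<Rightarrow>\<^sub>0 nat) \<Rightarrow>\<^sub>0 'k" assume x: "x \<in> carrier (mpoly_ring d)"
    then show "\<exists>y\<in>carrier (mpoly_ring d). y \<oplus>\<^bsub>mpoly_ring d\<^esub> x = \<zero>\<^bsub>mpoly_ring d\<^esub>"
      by (intro bexI[of _ "- x"]) (simp_all add: mpoly_closed[OF x x])
  qed (simp_all add: mpoly_closed algebra_simps, simp add: mpoly_carrier)
  show "Group.comm_monoid (mpoly_ring d :: ((nat \<Rightarrow>\<^sub>0 nat) \<Rightarrow>\<^sub>0 'k) ring)"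
    by (rule comm_monoidI) (simp_all add: mpoly_closed algebra_simps, simp add: mpoly_carrier)
qed (simp add: algebra_simps)

lemma mpoly_minus:
  fixes p q :: "(nat \<Rightarrow>\<^sub>0 nat) \<Rightarrow>\<^sub>0 'k::field"
  assumes "p \<in> carrier (mpoly_ring d)" "q \<in> carrier (mpoly_ring d)"
  shows "p \<ominus>\<^bsub>mpoly_ring d\<^esub> q = p - q"
proof -
  interpret A: cring "mpoly_ring d :: ((nat \<Rightarrow>\<^sub>0 nat) \<Rightarrow>\<^sub>0 'k) ring" by (rule mpoly_cring)
  have "\<ominus>\<^bsub>mpoly_ring d\<^esub> q = - q"
    by (rule A.minus_equality) (use assms mpoly_closed in simp_all)
  then show ?thesis by (simp add: a_minus_def)
qed

text \<open>The \<open>n\<close>-th power of the ideal generated by the variables, in terms of monomials.\<close>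
definition mdeg_ideal :: "nat \<Rightarrow> nat \<Rightarrow> ((nat \<Rightarrow>\<^sub>0 nat) \<Rightarrow>\<^sub>0 'k::field) set" where
  "mdeg_ideal d n = {p \<in> carrier (mpoly_ring d). \<forall>m\<in>Poly_Mapping.keys p. n \<le> mdeg d m}"

lemma mdeg_idealI:
  "p \<in> carrier (mpoly_ring d) \<Longrightarrow> (\<And>m. m \<in> Poly_Mapping.keys p \<Longrightarrow> n \<le> mdeg d m) \<Longrightarrow> p \<in> mdeg_ideal d n"
  by (simp add: mdeg_ideal_def)

lemma mdeg_idealD:
  "p \<in> mdeg_ideal d n \<Longrightarrow> p \<in> carrier (mpoly_ring d)"
  "p \<in> mdeg_ideal d n \<Longrightarrow> m \<in> Poly_Mapping.keys p \<Longrightarrow> n \<le> mdeg d m"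
  by (simp_all add: mdeg_ideal_def)

lemma mdeg_ideal_ideal: "ideal (mdeg_ideal d n :: ((nat \<Rightarrow>\<^sub>0 nat) \<Rightarrow>\<^sub>0 'k::field) set) (mpoly_ring d)"
proof (rule idealI)
  interpret A: cring "mpoly_ring d :: ((nat \<Rightarrow>\<^sub>0 nat) \<Rightarrow>\<^sub>0 'k) ring" by (rule mpoly_cring)
  let ?J = "mdeg_ideal d n :: ((nat \<Rightarrow>\<^sub>0 nat) \<Rightarrow>\<^sub>0 'k) set"
  show "ring (mpoly_ring d :: ((nat \<Rightarrow>\<^sub>0 nat) \<Rightarrow>\<^sub>0 'k) ring)" by (rule A.ring_axioms)
  show "subgroup ?J (add_monoid (mpoly_ring d))"
  proof (rule A.add.subgroupI)
    show "?J \<subseteq> carrier (mpoly_ring d)" unfolding mdeg_ideal_def by blast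
    have "0 \<in> ?J" by (simp add: mdeg_ideal_def mpoly_carrier)
    then show "?J \<noteq> {}" by blast
    fix a assume a: "a \<in> ?J"
    then have ac: "a \<in> carrier (mpoly_ring d)" by (simp add: mdeg_ideal_def)
    have "\<ominus>\<^bsub>mpoly_ring d\<^esub> a = - a"
      using mpoly_minus[OF A.zero_closed ac] ac by (simp add: a_minus_def)
    then show "\<ominus>\<^bsub>mpoly_ring d\<^esub> a \<in> ?J" using a mpoly_closed(3)[OF ac ac] by (simp add: mdeg_ideal_def)
    fix b assume b: "b \<in> ?J"
    then have bc: "b \<in> carrier (mpoly_ring d)" by (simp add: mdeg_ideal_def)
    have "\<forall>m\<in>Poly_Mapping.keys (a + b). n \<le> mdeg d m"
      using a b Poly_Mapping.keys_add[of a b] unfolding mdeg_ideal_def by blast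
    then show "a \<oplus>\<^bsub>mpoly_ring d\<^esub> b \<in> ?J" using mpoly_closed(1)[OF ac bc] by (simp add: mdeg_ideal_def)
  qed
  have mult: "x * a \<in> ?J" if a: "a \<in> ?J" and x: "x \<in> carrier (mpoly_ring d)" for a x
  proof -
    have ac: "a \<in> carrier (mpoly_ring d)" using a by (simp add: mdeg_ideal_def)
    have "n \<le> mdeg d m" if m: "m \<in> Poly_Mapping.keys (x * a)" for m
    proof -
      obtain u v where uv: "v \<in> Poly_Mapping.keys a" "m = u + v" using keys_mult[of x a] m by blast
      then have "n \<le> mdeg d v" using a by (simp add: mdeg_ideal_def)
      then show ?thesis unfolding uv(2) mdeg_add by simp
    qed
    then show ?thesis using mpoly_closed(2)[OF x ac] by (simp add: mdeg_ideal_def)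
  qed
  show "x \<otimes>\<^bsub>mpoly_ring d\<^esub> a \<in> ?J" if "a \<in> ?J" "x \<in> carrier (mpoly_ring d)" for a x
    using mult[OF that] by simp
  show "a \<otimes>\<^bsub>mpoly_ring d\<^esub> x \<in> ?J" if "a \<in> ?J" "x \<in> carrier (mpoly_ring d)" for a x
    using mult[OF that] by (simp add: mult.commute)
qed

lemma sum_single_lookup:
  "(\<Sum>m\<in>Poly_Mapping.keys p. Poly_Mapping.single m (Poly_Mapping.lookup p m)) = p"
proof (rule poly_mapping_eqI)
  fix k
  have "Poly_Mapping.lookup (\<Sum>m\<in>Poly_Mapping.keys p. Poly_Mapping.single m (Poly_Mapping.lookup p m)) k =
      (\<Sum>m\<in>Poly_Mapping.keys p. if m = k then Poly_Mapping.lookup p m else 0)"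
    by (simp only: lookup_sum lookup_single when_def)
  also have "\<dots> = Poly_Mapping.lookup p k"
    by (simp add: sum.delta in_keys_iff)
  finally show "Poly_Mapping.lookup (\<Sum>m\<in>Poly_Mapping.keys p. Poly_Mapping.single m (Poly_Mapping.lookup p m)) k =
      Poly_Mapping.lookup p k" .
qed

lemma mem_if_terms:
  fixes p :: "(nat \<Rightarrow>\<^sub>0 nat) \<Rightarrow>\<^sub>0 'k::field"
  assumes "0 \<in> I" "\<And>a b. a \<in> I \<Longrightarrow> b \<in> I \<Longrightarrow> a + b \<in> I"
    and "\<And>m. m \<in> Poly_Mapping.keys p \<Longrightarrow> Poly_Mapping.single m (Poly_Mapping.lookup p m) \<in> I"
  shows "p \<in> I"
proof -
  have "(\<Sum>m\<in>T. Poly_Mapping.single m (Poly_Mapping.lookup p m)) \<in> I"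
    if "finite T" "T \<subseteq> Poly_Mapping.keys p" for T
    using that by (induction T rule: finite_induct) (use assms in auto)
  from this[OF finite_keys order_refl] show ?thesis by (simp add: sum_single_lookup)
qed

text \<open>A term of degree at least \<open>n + 1\<close> splits off a variable; this is the only step in which a power
  of the ideal is built up.\<close>
lemma mdeg_ideal_term:
  assumes p: "p \<in> mdeg_ideal d (Suc n)" and m: "m \<in> Poly_Mapping.keys p"
  shows "\<exists>i<d. \<exists>q\<in>mdeg_ideal d n. Poly_Mapping.single m c = mpoly_var i * q"
proof -
  have mk: "Poly_Mapping.keys m \<subseteq> {..<d}" "Suc n \<le> mdeg d m"
    using p m by (auto simp: mdeg_ideal_def mpoly_carrier)
  have "m \<noteq> 0" using mk(2) by auto
  then obtain i where i: "i < d" "Poly_Mapping.lookup m i > 0"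
    using mons_nonzero[of m d "Suc (mdeg d m)"] mk(1) by (auto simp: mons_def)
  obtain \<nu> where \<nu>: "m = \<nu> + unit_mon i" using mon_split[OF i(2)] by blast
  have "n \<le> mdeg d \<nu>" using mk(2) i(1) by (simp add: \<nu> mdeg_add mdeg_unit)
  moreover have "Poly_Mapping.keys \<nu> \<subseteq> {..<d}" using mk(1) unfolding \<nu> keys_add_unit by blast
  ultimately have "Poly_Mapping.single \<nu> c \<in> mdeg_ideal d n"
    by (auto simp: mdeg_ideal_def mpoly_carrier)
  moreover have "Poly_Mapping.single m c = mpoly_var i * Poly_Mapping.single \<nu> c"
    by (simp add: mpoly_var_def mult_single \<nu> add.commute)
  ultimately show ?thesis using i(1) by blast
qed

lemma mpoly_var_in: "i < d \<Longrightarrow> mpoly_var i \<in> carrier (mpoly_ring d)"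
  by (simp add: mpoly_carrier mpoly_var_def)

lemma mpoly_var_mdeg: "i < d \<Longrightarrow> mpoly_var i \<in> mdeg_ideal d 1"
  by (simp add: mdeg_ideal_def mpoly_var_in) (simp add: mpoly_var_def mdeg_unit)

lemma genideal_vars:
  "genideal (mpoly_ring d) (mpoly_var ` {..<d}) = (mdeg_ideal d 1 :: ((nat \<Rightarrow>\<^sub>0 nat) \<Rightarrow>\<^sub>0 'k::field) set)"
proof -
  interpret A: cring "mpoly_ring d :: ((nat \<Rightarrow>\<^sub>0 nat) \<Rightarrow>\<^sub>0 'k) ring" by (rule mpoly_cring)
  let ?V = "mpoly_var ` {..<d} :: ((nat \<Rightarrow>\<^sub>0 nat) \<Rightarrow>\<^sub>0 'k) set"
  have V: "?V \<subseteq> carrier (mpoly_ring d)" using mpoly_var_in by blast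
  interpret I: ideal "genideal (mpoly_ring d) ?V" "mpoly_ring d" by (rule A.genideal_ideal[OF V])
  show ?thesis
  proof
    have "?V \<subseteq> mdeg_ideal d 1" using mpoly_var_mdeg by blast
    then show "genideal (mpoly_ring d) ?V \<subseteq> mdeg_ideal d 1"
      by (rule A.genideal_minimal[OF mdeg_ideal_ideal])
    show "mdeg_ideal d 1 \<subseteq> genideal (mpoly_ring d) ?V"
    proof
      fix p :: "(nat \<Rightarrow>\<^sub>0 nat) \<Rightarrow>\<^sub>0 'k" assume p: "p \<in> mdeg_ideal d 1"
      show "p \<in> genideal (mpoly_ring d) ?V"
      proof (rule mem_if_terms)
        show "0 \<in> genideal (mpoly_ring d) ?V" using I.zero_closed by simp
        show "a + b \<in> genideal (mpoly_ring d) ?V"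
          if "a \<in> genideal (mpoly_ring d) ?V" "b \<in> genideal (mpoly_ring d) ?V" for a b
          using I.a_closed[OF that] by simp
        fix m assume m: "m \<in> Poly_Mapping.keys p"
        obtain i q where iq: "i < d" "q \<in> mdeg_ideal d 0"
            "Poly_Mapping.single m (Poly_Mapping.lookup p m) = mpoly_var i * q"
          using mdeg_ideal_term[OF p[unfolded One_nat_def] m] by blast
        have "mpoly_var i \<in> genideal (mpoly_ring d) ?V"
          using A.genideal_self[OF V] iq(1) by blast
        moreover have "q \<in> carrier (mpoly_ring d)" using iq(2) by (simp add: mdeg_ideal_def)
        ultimately have "mpoly_var i \<otimes>\<^bsub>mpoly_ring d\<^esub> q \<in> genideal (mpoly_ring d) ?V" by (rule I.I_r_closed)
        then show "Poly_Mapping.single m (Poly_Mapping.lookup p m) \<in> genideal (mpoly_ring d) ?V"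
          unfolding iq(3) by simp
      qed
    qed
  qed
qed

lemma ideal_power_vars:
  "ideal_power (mpoly_ring d) (genideal (mpoly_ring d) (mpoly_var ` {..<d})) n =
    (mdeg_ideal d n :: ((nat \<Rightarrow>\<^sub>0 nat) \<Rightarrow>\<^sub>0 'k::field) set)"
  unfolding ideal_power_def genideal_vars
proof (induction n)
  case 0 then show ?case by (simp add: mdeg_ideal_def)
next
  case (Suc n)
  let ?A = "mpoly_ring d :: ((nat \<Rightarrow>\<^sub>0 nat) \<Rightarrow>\<^sub>0 'k) ring"
  let ?J = "\<lambda>n. mdeg_ideal d n :: ((nat \<Rightarrow>\<^sub>0 nat) \<Rightarrow>\<^sub>0 'k) set"
  have "ideal_prod ?A (?J 1) (?J n) = ?J (Suc n)"
  proof
    interpret J: ideal "?J (Suc n)" ?A by (rule mdeg_ideal_ideal)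
    show "ideal_prod ?A (?J 1) (?J n) \<subseteq> ?J (Suc n)"
    proof
      fix p assume "p \<in> ideal_prod ?A (?J 1) (?J n)"
      then show "p \<in> ?J (Suc n)"
      proof induct
        case (prod a b)
        have "Suc n \<le> mdeg d m" if m: "m \<in> Poly_Mapping.keys (a * b)" for m
        proof -
          obtain u v where uv: "u \<in> Poly_Mapping.keys a" "v \<in> Poly_Mapping.keys b" "m = u + v"
            using keys_mult[of a b] m by blast
          have "1 \<le> mdeg d u" "n \<le> mdeg d v"
            by (rule mdeg_idealD(2)[OF prod(1) uv(1)], rule mdeg_idealD(2)[OF prod(2) uv(2)])
          then show ?thesis unfolding uv(3) mdeg_add by simp
        qed
        then show ?case
          using mpoly_closed(2)[OF mdeg_idealD(1)[OF prod(1)] mdeg_idealD(1)[OF prod(2)]] unfolding mpoly_ring_simps(1)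
          by (rule mdeg_idealI[rotated])
      next
        case (sum a b)
        show ?case by (rule additive_subgroup.a_closed[OF J.additive_subgroup_axioms sum(2,4)])
      qed
    qed
    show "?J (Suc n) \<subseteq> ideal_prod ?A (?J 1) (?J n)"
    proof
      fix p assume p: "p \<in> ?J (Suc n)"
      show "p \<in> ideal_prod ?A (?J 1) (?J n)"
      proof (rule mem_if_terms)
        have "0 \<otimes>\<^bsub>?A\<^esub> 0 \<in> ideal_prod ?A (?J 1) (?J n)"
          by (intro ideal_prod.prod mdeg_idealI) (simp_all add: mpoly_carrier)
        then show "0 \<in> ideal_prod ?A (?J 1) (?J n)" by simp
        show "a + b \<in> ideal_prod ?A (?J 1) (?J n)"
          if "a \<in> ideal_prod ?A (?J 1) (?J n)" "b \<in> ideal_prod ?A (?J 1) (?J n)" for a b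
          using ideal_prod.sum[OF that] by simp
        fix m assume m: "m \<in> Poly_Mapping.keys p"
        obtain i q where iq: "i < d" "q \<in> ?J n"
            "Poly_Mapping.single m (Poly_Mapping.lookup p m) = mpoly_var i * q"
          using mdeg_ideal_term[OF p m] by blast
        have "mpoly_var i \<in> ?J 1"
          by (rule mpoly_var_mdeg[OF iq(1)])
        then have "mpoly_var i \<otimes>\<^bsub>?A\<^esub> q \<in> ideal_prod ?A (?J 1) (?J n)" using iq(2) by (rule ideal_prod.prod)
        then show "Poly_Mapping.single m (Poly_Mapping.lookup p m) \<in> ideal_prod ?A (?J 1) (?J n)"
          unfolding iq(3) by simp
      qed
    qed
  qed
  then show ?case using Suc by simp
qed

lemma lookup_single_times:
  fixes p :: "(nat \<Rightarrow>\<^sub>0 nat) \<Rightarrow>\<^sub>0 'k::field"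
  shows "Poly_Mapping.lookup (Poly_Mapping.single a c * p) (\<nu> + a) = c * Poly_Mapping.lookup p \<nu>"
proof -
  have "Poly_Mapping.single a c * p =
      (\<Sum>m\<in>Poly_Mapping.keys p. Poly_Mapping.single (a + m) (c * Poly_Mapping.lookup p m))"
    by (subst (1) sum_single_lookup[of p, symmetric]) (simp add: sum_distrib_left mult_single)
  then have "Poly_Mapping.lookup (Poly_Mapping.single a c * p) (\<nu> + a) =
      (\<Sum>m\<in>Poly_Mapping.keys p. if m = \<nu> then c * Poly_Mapping.lookup p m else 0)"
    by (simp add: lookup_sum lookup_single when_def add.commute)
  also have "\<dots> = c * Poly_Mapping.lookup p \<nu>"
    by (simp add: sum.delta in_keys_iff)
  finally show ?thesis .
qed

text \<open>The choice of the representative does not matter below degree \<open>n\<close>; coefficients beyond are set to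
  \<open>0\<close>.\<close>
definition coset_coeff :: "nat \<Rightarrow> nat \<Rightarrow> ((nat \<Rightarrow>\<^sub>0 nat) \<Rightarrow>\<^sub>0 'k::field) set \<Rightarrow> (nat \<Rightarrow>\<^sub>0 nat) \<Rightarrow> 'k" where
  "coset_coeff d n A \<mu> = (if \<mu> \<in> mons d n then Poly_Mapping.lookup (SOME p. p \<in> A) \<mu> else 0)"

theorem trunc_poly_ring_truncated_algebra:
  fixes d n :: nat
  assumes n: "n > 1"
  defines "J \<equiv> mdeg_ideal d n :: ((nat \<Rightarrow>\<^sub>0 nat) \<Rightarrow>\<^sub>0 'k::field) set"
  shows "truncated_algebra (trunc_poly_ring d n :: ((nat \<Rightarrow>\<^sub>0 nat) \<Rightarrow>\<^sub>0 'k) set ring) d n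
    (coset_coeff d n) (\<lambda>c. J +>\<^bsub>mpoly_ring d\<^esub> Poly_Mapping.single 0 c) (\<lambda>i. J +>\<^bsub>mpoly_ring d\<^esub> mpoly_var i)"
proof -
  let ?A = "mpoly_ring d :: ((nat \<Rightarrow>\<^sub>0 nat) \<Rightarrow>\<^sub>0 'k) ring"
  let ?R = "trunc_poly_ring d n :: ((nat \<Rightarrow>\<^sub>0 nat) \<Rightarrow>\<^sub>0 'k) set ring"
  let ?c = "\<lambda>p. J +>\<^bsub>?A\<^esub> p"
  interpret A: cring ?A by (rule mpoly_cring)
  interpret J: ideal J ?A unfolding J_def by (rule mdeg_ideal_ideal)
  have R: "?R = ?A Quot J" unfolding trunc_poly_ring_def ideal_power_vars J_def ..
  have hom: "?c \<in> ring_hom ?A ?R" unfolding R by (rule J.rcos_ring_hom)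
  have surj: "\<exists>p\<in>carrier ?A. r = ?c p" if "r \<in> carrier ?R" for r
    using that unfolding R by (auto simp: FactRing_def A_RCOSETS_def')
  have c_in: "?c p \<in> carrier ?R" if "p \<in> carrier ?A" for p using ring_hom_closed[OF hom that] .
  have c_add: "?c p \<oplus>\<^bsub>?R\<^esub> ?c q = ?c (p + q)" if "p \<in> carrier ?A" "q \<in> carrier ?A" for p q
    using ring_hom_add[OF hom that] by simp
  have c_mult: "?c p \<otimes>\<^bsub>?R\<^esub> ?c q = ?c (p * q)" if "p \<in> carrier ?A" "q \<in> carrier ?A" for p q
    using ring_hom_mult[OF hom that] by simp
  have c_one: "\<one>\<^bsub>?R\<^esub> = ?c 1" using ring_hom_one[OF hom] by simp
  have J_low: "Poly_Mapping.lookup h \<mu> = 0" if "h \<in> J" "\<mu> \<in> mons d n" for h \<mu>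
    
  proof (rule ccontr)
    assume "Poly_Mapping.lookup h \<mu> \<noteq> 0"
    then have "\<mu> \<in> Poly_Mapping.keys h" by (simp add: in_keys_iff)
    with that(1) have "n \<le> mdeg d \<mu>" unfolding J_def by (rule mdeg_idealD(2))
    then show False using that(2) by (simp add: mons_def)
  qed
  have coeff: "coset_coeff d n (?c p) \<mu> = Poly_Mapping.lookup p \<mu>"
    if p: "p \<in> carrier ?A" and \<mu>: "\<mu> \<in> mons d n" for p \<mu>
  proof -
    define q where "q = (SOME q. q \<in> ?c p)"
    have "q \<in> ?c p" unfolding q_def by (rule someI[of _ p]) (rule J.a_rcos_self[OF p])
    then obtain h where h: "h \<in> J" "q = h + p" by (auto simp: a_r_coset_def')
    have "Poly_Mapping.lookup q \<mu> = Poly_Mapping.lookup p \<mu>" unfolding h(2) lookup_add using J_low[OF h(1) \<mu>] by simp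
    then show ?thesis using \<mu> by (simp add: coset_coeff_def q_def)
  qed
  have supp: "coset_coeff d n r \<mu> = 0" if "\<mu> \<notin> mons d n" for r :: "((nat \<Rightarrow>\<^sub>0 nat) \<Rightarrow>\<^sub>0 'k) set" and \<mu>
    using that by (simp add: coset_coeff_def)
  have const_in: "Poly_Mapping.single 0 c \<in> carrier ?A" for c by (simp add: mpoly_carrier)
  note closed = mpoly_closed[of _ d]
  have n0: "0 \<in> mons d n" using n by (intro zero_in_mons) simp
  show ?thesis
  proof (intro truncated_algebra.intro comm_base.intro truncated_algebra_axioms.intro)
    show "cring ?R" unfolding R by (rule J.quotient_is_cring[OF A.is_cring])
    show "1 < n" by (rule n)
    show "r = s" if rs: "r \<in> carrier ?R" "s \<in> carrier ?R" "coset_coeff d n r = coset_coeff d n s" for r s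
    proof -
      obtain p q where pq: "p \<in> carrier ?A" "q \<in> carrier ?A" "r = ?c p" "s = ?c q"
        using surj[OF rs(1)] surj[OF rs(2)] by blast
      have pm: "p - q \<in> carrier ?A" by (rule closed(4)[OF pq(1,2)])
      have "n \<le> mdeg d m" if m: "m \<in> Poly_Mapping.keys (p - q)" for m
      proof (rule ccontr)
        assume "\<not> n \<le> mdeg d m"
        then have mm: "m \<in> mons d n" using pm m by (auto simp: mons_def mpoly_carrier)
        have "Poly_Mapping.lookup p m = Poly_Mapping.lookup q m"
          using fun_cong[OF rs(3), of m] coeff[OF pq(1) mm] coeff[OF pq(2) mm] pq(3,4) by simp
        then show False using m by (simp add: in_keys_iff lookup_minus)
      qed
      then have "p - q \<in> J" unfolding J_def by (rule mdeg_idealI[OF pm])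
      then have "p \<ominus>\<^bsub>?A\<^esub> q \<in> J" unfolding mpoly_minus[OF pq(1,2)] .
      then have "?c p = ?c q"
        by (rule A.quotient_eq_iff_same_a_r_cos[OF J.ideal_axioms pq(1,2), THEN iffD1])
      then show "r = s" unfolding pq(3,4) .
    qed
    show "\<exists>r\<in>carrier ?R. coset_coeff d n r = f" if f: "f \<in> fun_space (mons d n)" for f :: "(nat \<Rightarrow>\<^sub>0 nat) \<Rightarrow> 'k"
    proof -
      let ?p = "\<Sum>m\<in>mons d n. Poly_Mapping.single m (f m)"
      have lp: "Poly_Mapping.lookup ?p \<mu> = (if \<mu> \<in> mons d n then f \<mu> else 0)" for \<mu>
        using finite_mons[of d n] by (simp add: lookup_sum lookup_single when_def sum.delta)
      have p: "?p \<in> carrier ?A"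
        unfolding mpoly_carrier
      proof
        fix m assume "m \<in> Poly_Mapping.keys ?p"
        then have "m \<in> mons d n" using lp[of m] by (auto simp: in_keys_iff split: if_splits)
        then show "Poly_Mapping.keys m \<subseteq> {..<d}" by (simp add: mons_def)
      qed
      have "coset_coeff d n (?c ?p) \<mu> = f \<mu>" for \<mu>
        using coeff[OF p, of \<mu>] lp[of \<mu>] supp[of \<mu>] f by (cases "\<mu> \<in> mons d n") (simp_all add: fun_space_def)
      then show ?thesis using c_in[OF p] by blast
    qed
    show "coset_coeff d n r \<mu> = 0" if "r \<in> carrier ?R" "\<mu> \<notin> mons d n" for r \<mu> using supp[OF that(2)] .
    show "coset_coeff d n (r \<oplus>\<^bsub>?R\<^esub> s) = (\<lambda>\<mu>. coset_coeff d n r \<mu> + coset_coeff d n s \<mu>)"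
      if rs: "r \<in> carrier ?R" "s \<in> carrier ?R" for r s
    proof
      fix \<mu>
      obtain p q where pq: "p \<in> carrier ?A" "q \<in> carrier ?A" "r = ?c p" "s = ?c q"
        using surj[OF rs(1)] surj[OF rs(2)] by blast
      show "coset_coeff d n (r \<oplus>\<^bsub>?R\<^esub> s) \<mu> = coset_coeff d n r \<mu> + coset_coeff d n s \<mu>"
        unfolding pq(3,4) c_add[OF pq(1,2)]
        using coeff[OF pq(1), of \<mu>] coeff[OF pq(2), of \<mu>] coeff[OF closed(1)[OF pq(1,2)], of \<mu>] supp[of \<mu>]
        by (cases "\<mu> \<in> mons d n") (simp_all add: lookup_add)
    qed
    show "?c (Poly_Mapping.single 0 c) \<in> carrier ?R" for c by (rule c_in[OF const_in])
    show "coset_coeff d n (?c (Poly_Mapping.single 0 c) \<otimes>\<^bsub>?R\<^esub> r) = (\<lambda>\<mu>. c * coset_coeff d n r \<mu>)"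
      if r: "r \<in> carrier ?R" for c r
    proof
      fix \<mu>
      obtain p where p: "p \<in> carrier ?A" "r = ?c p" using surj[OF r] by blast
      show "coset_coeff d n (?c (Poly_Mapping.single 0 c) \<otimes>\<^bsub>?R\<^esub> r) \<mu> = c * coset_coeff d n r \<mu>"
        unfolding p(2) c_mult[OF const_in p(1)]
        using coeff[OF p(1), of \<mu>] coeff[OF closed(2)[OF const_in p(1)], of \<mu> c] supp[of \<mu>]
          lookup_single_times[of 0 c p \<mu>]
        by (cases "\<mu> \<in> mons d n") simp_all
    qed
    have "1 \<in> carrier ?A" using A.one_closed by simp
    then show "coset_coeff d n \<one>\<^bsub>?R\<^esub> 0 = 1" unfolding c_one by (simp add: coeff[OF _ n0] lookup_one)
    show "?c (mpoly_var i) \<in> carrier ?R" if "i < d" for i by (rule c_in[OF mpoly_var_in[OF that]])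
    show "coset_coeff d n (?c (mpoly_var i) \<otimes>\<^bsub>?R\<^esub> r) (\<nu> + unit_mon i) = coset_coeff d n r \<nu>"
      if i: "i < d" and r: "r \<in> carrier ?R" and \<nu>: "\<nu> + unit_mon i \<in> mons d n" for i r \<nu>
    proof -
      obtain p where p: "p \<in> carrier ?A" "r = ?c p" using surj[OF r] by blast
      have \<nu>': "\<nu> \<in> mons d n" using \<nu> mons_add_unit[OF i] mons_mono[of "n - 1" n d] by auto
      show ?thesis
        unfolding p(2) c_mult[OF mpoly_var_in[OF i] p(1)] coeff[OF closed(2)[OF mpoly_var_in[OF i] p(1)] \<nu>]
          coeff[OF p(1) \<nu>']
        using lookup_single_times[of "unit_mon i" 1 p \<nu>] by (simp add: mpoly_var_def)
    qed
    show "coset_coeff d n (?c (mpoly_var i) \<otimes>\<^bsub>?R\<^esub> r) \<mu> = 0"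
      if i: "i < d" and r: "r \<in> carrier ?R" and \<mu>: "Poly_Mapping.lookup \<mu> i = 0" for i r \<mu>
    proof -
      obtain p where p: "p \<in> carrier ?A" "r = ?c p" using surj[OF r] by blast
      have "\<mu> \<notin> Poly_Mapping.keys (mpoly_var i * p)"
      proof
        assume "\<mu> \<in> Poly_Mapping.keys (mpoly_var i * p)"
        then obtain u v where "u \<in> Poly_Mapping.keys (mpoly_var i :: (nat \<Rightarrow>\<^sub>0 nat) \<Rightarrow>\<^sub>0 'k)" "\<mu> = u + v"
          using keys_mult[of "mpoly_var i" p] by blast
        then show False using \<mu> by (simp add: mpoly_var_def lookup_add)
      qed
      then show ?thesis
        unfolding p(2) c_mult[OF mpoly_var_in[OF i] p(1)]
        using coeff[OF closed(2)[OF mpoly_var_in[OF i] p(1)], of \<mu>] supp[of \<mu>]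
        by (cases "\<mu> \<in> mons d n") (simp_all add: in_keys_iff)
    qed
  qed
qed

theorem mainTheorem11:
  fixes d :: nat
    and R :: "((nat \<Rightarrow>\<^sub>0 nat) \<Rightarrow>\<^sub>0 'k::field) set ring"
    and M :: "(((nat \<Rightarrow>\<^sub>0 nat) \<Rightarrow>\<^sub>0 'k) set, 'm) module"
    and \<omega> :: "(((nat \<Rightarrow>\<^sub>0 nat) \<Rightarrow>\<^sub>0 'k) set, 'w) module"
  assumes "(d > 1 \<and> R = trunc_poly_ring d 2) \<or>
           (d = 2 \<and> (\<exists>n>1. R = trunc_poly_ring 2 n))"
  shows "(module R M \<and> finitely_generated R M \<and> \<not> free_module R M \<longrightarrow>
            (\<forall>i\<ge>1. int (betti R M (i + 1)) - int (betti R M i) \<ge> int d - 1)) \<and>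
         (canonical_module R \<omega> \<longrightarrow>
            (\<forall>i. int (betti R \<omega> (i + 1)) - int (betti R \<omega> i) \<ge> int d - 1))"
proof -
  obtain n where n: "n > 1" "R = trunc_poly_ring d n" "d > 1" "d = 2 \<or> n = 2"
    using assms
  proof (elim disjE conjE exE)
    assume "d > 1" "R = trunc_poly_ring d 2"
    then show thesis by (intro that[of 2]) simp_all
  next
    fix n :: nat assume "d = 2" "n > 1" "R = trunc_poly_ring 2 n"
    then show thesis by (intro that[of n]) simp_all
  qed
  note R = trunc_poly_ring_truncated_algebra[OF n(1), where d = d and 'k = 'k, folded n(2)]
  have step: "int b - int a \<ge> int d - 1" if "a + (d - 1) \<le> b" for a b :: nat
    using that n(3) by linarith
  show ?thesis
  proof (intro conjI impI allI)
    fix i :: nat assume M: "module R M \<and> finitely_generated R M \<and> \<not> free_module R M" and i: "i \<ge> 1"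
    show "int (betti R M (i + 1)) - int (betti R M i) \<ge> int d - 1"
      using truncated_algebra.betti_nonfree[OF R n(3,4) M[THEN conjunct1]
        M[THEN conjunct2, THEN conjunct1] M[THEN conjunct2, THEN conjunct2] i]
      unfolding Suc_eq_plus1 by (rule step)
  next
    fix i :: nat assume \<omega>: "canonical_module R \<omega>"
    show "int (betti R \<omega> (i + 1)) - int (betti R \<omega> i) \<ge> int d - 1"
      using truncated_algebra.betti_canonical[OF R n(3,4) \<omega>] unfolding Suc_eq_plus1 by (rule step)
  qed
qed

end
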